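(* Let $n\ge 3$ and $d\ge 1$ be integers and let $\overline{\sigma}=\{\sigma_1,\ldots,\sigma_n\}$ be a list of $n$ integer partitions of $d$. Give the polyhedral complex $\mathcal{H}(\overline{\sigma})$ the weights $w$ defined in the context, and let $\phi:\mathcal{H}(\overline{\sigma})\to\tilde{M}=\phi(\mathcal{H}(\overline{\sigma}))$ be the morphism of polyhedral complexes given by the double ratios. Then the degree of $\phi$ is well defined and $$\deg(\phi)=\frac{1}{d!}\,\mathrm{tr}(K_{\sigma_1}\cdots K_{\sigma_n}).$$
   Context: **Graphs.** A graph is a pair $(V,E)$ with $V$ a finite set and $E$ a set of unordered pairs of elements of $V$. A tree is a connected graph without circuits. A leaf is a vertex of degree $1$; other vertices are internal. $L(G)$ is the set of leaves. An edge containing a leaf is unbounded; other edges are bounded. A graph is trivalent if all vertices have degree $1$ or $3$. A trivalent tree with $n\ge 3$ leaves has $m=n-3$ bounded edges. An isomorphism of graphs is a bijection $F_V$ of vertices inducing a bijection $F_E$ of edges. The degeneration of $G$ by a bounded edge $e$ is the graph obtained by contracting $e$ to a point. **Class algebra.** For an integer partition $\mu$ of $d$, $K_\mu\in Z(\mathbb{R}[S_d])$ is the sum of all permutations in $S_d$ of cycle-type $\mu$, and $|K_\mu|$ is the number of such permutations. $\mathrm{tr}:Z(\mathbb{R}[S_d])\to\mathbb{R}$ is $\mathrm{tr}(\sum_g c_g g)=c_e$, the coefficient of the identity. **Labelled trees.** Let $G$ be (an isomorphism class of) a trivalent tree with $n$ leaves, with its unbounded edges (equivalently leaves) labelled bijectively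 by $\overline{\lambda}=\{\lambda_1,\ldots,\lambda_n\}$ and its bounded edges labelled bijectively by $\overline{E}=\{e_1,\ldots,e_m\}$. Assign $\sigma_i$ to $\lambda_i$, and let $\overline{\nu}=\{\nu_1,\ldots,\nu_m\}$ be a choice of integer partition $\nu_i$ of $d$ for each $e_i$. This data is denoted $G(\overline{\sigma},\overline{\nu})$. For an internal vertex $v$ put $I(v)=\mathrm{tr}(K_{\mu_1}K_{\mu_2}K_{\mu_3})$, where $\mu_1,\mu_2,\mu_3$ are the partitions assigned to the three edges at $v$. The data is acceptable if $I(v)\neq 0$ for every internal $v$. For $p=(p_1,\ldots,p_m)\in\mathbb{R}^m_{\ge 0}$, $G(\overline{\lambda},\overline{E})(p)$ is the metric graph obtained from $G$ by degenerating every $e_i$ with $p_i=0$ and giving length $p_i$ to each $e_i$ with $p_i>0$; the labels of surviving edges are kept. **The space.** $D(\overline{\sigma})$ is the disjoint union of copies $D(\overline{\sigma})_{G(\overline{\sigma},\overline{\nu})}$ of $\mathbb{R}^m_{\ge 0}$, one for each acceptable $G(\overline{\sigma},\overline{\nu})$ ($\overline\sigma$ fixed; the labelled trivalent tree and $\overline{\nu}$ vary). $\mathcal{H}(\overline{\sigma})$ is the quotient space of $D(\overline{\sigma})$ in which $p\in D(\overline{\sigma})_{G(\overline{\sigma},\overline{\nu})}$ and $q\in D(\overline{\sigma})_{G'(\overline{\sigma},\overline{\nu}')}$ are identified exactly when there is an isomorphism of metric graphs (a graph isomorphism preserving lengths of bounded edges) $F:G(\overline{\lambda},\overline{E})(p)\to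 G'(\overline{\lambda},\overline{E})(q)$ with $F_E(\lambda_i)=\lambda_i$ for all $i$, and such that $F_E(e_i)=e_j$ implies $\nu_i=\nu'_j$. For each face $Y$ of a cone $D(\overline{\sigma})_{G(\overline{\sigma},\overline{\nu})}$ (including the cone itself), $c_{\hat{Y}}:Y\to\hat Y$ is the restriction of the quotient map, with image $\hat{Y}$. These $\hat Y$ (collection $\overline{P}$) and $c_{\hat Y}$ (collection $\overline{c}$) are the cells and charts of the polyhedral complex $\mathcal{H}(\overline{\sigma})$. **Weights.** The top-dimensional cell that is the image of the whole cone $D(\overline{\sigma})_{G(\overline{\sigma},\overline{\nu})}$, $G=(V,E)$, has weight $$w=\frac{1}{d!}\Big(\prod_{e_i\in\overline{E}}\frac{1}{|K_{\nu_i}|}\Big)\Big(\prod_{v\in V\setminus L(G)}I(v)\Big).$$ For $p$ in the interior of a top-dimensional cell, $w(p)$ is the weight of that cell. **The map $\phi$.** For distinct $w,x,y,z\in\overline{\lambda}$ (viewed as leaves) and $p\in D(\overline{\sigma})_{G(\overline{\sigma},\overline{\nu})}$, the double ratio $d_{(w,x),(y,z)}(p)$ is $\pm$ the length, in $G(\overline{\lambda},\overline{E})(p)$, of the intersection of the oriented path from leaf $w$ to leaf $x$ with the oriented path from leaf $y$ to leaf $z$; the sign is $+$ if the orientations agree on the intersection and $-$ if they disagree (the value is $0$ if the intersection has no edge). It depends only on the labelled metric graph, so is a function on $\mathcal{H}(\overline{\sigma})$. Two double ratios are equivalent if they differ by swapping $w,x$, swapping $y,z$, or swapping the pairs $(w,x),(y,z)$;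 there are $N=3\binom{n}{4}$ classes. Choose one representative of each class, ordered $d_1,\ldots,d_N$, and set $\phi(p)=(d_1(p),\ldots,d_N(p))\in\mathbb{R}^N$. $\tilde{M}=\phi(\mathcal{H}(\overline{\sigma}))$ is a polyhedral complex with cells $\{\phi(P)\mid P\in\overline{P}\}$ and charts $\{\phi\circ c\mid c\in\overline{c}\}$. **Polyhedral complexes and degree.** A polyhedral complex is a topological space $C$ with closed cells $P_i$ covering $C$ and, for each cell, a lattice-equivalence class of charts $c_i:X_i\to P_i$ (homeomorphisms from closed lattice polyhedra; two charts are lattice-equivalent if they differ by an affine isomorphism of the affine spans of the polyhedra which carries one polyhedron to the other and integer points to integer points), such that intersections of two cells are cells, images of faces are cells, and charts with equal images are lattice-equivalent. It has dimension $k$ if $k$ is the largest dimension of a cell and every cell is a face of a $k$-dimensional one. A morphism $\phi:C\to C'$ is a continuous map sending each cell $P_i$ into some cell $P'_j$ with $c_j'^{-1}\circ\phi\circ c_i$ affine and integral. If $C,C'$ have the same dimension $k$ and $p$ lies in the interior of a $k$-dimensional cell $P_i$ mapping into $P'_j$, then $\mathrm{ind}(\phi)_p=0$ if $\dim P'_j\ne k$, and otherwise $\mathrm{ind}(\phi)_p$ is the index in the lattice $\Lambda'_j$ of $X'_j$ of the image of the lattice $\Lambda_i$ of $X_i$ under $c_j'^{-1}\circ\phi\circ c_i$. If $C$ is weighted (each $k$-dimensional cell carries a rational weight), then for $q$ in the interior of a top-dimensional cell of $C'$, $\deg(\phi)_q=\sum_{p\in C,\ \phi(p)=q}w(p)\,\mathrm{ind}(\phi)_p$;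 if this is independent of $q$, its value is $\deg(\phi)$. *)

theory Defs
  imports
    "HOL-Analysis.Analysis"
    "HOL-Algebra.Sym_Groups"
    "HOL-Combinatorics.Orbits"
    "HOL-Library.Multiset"
    "HOL-Library.Function_Algebras"
begin

section \<open>The class algebra of the symmetric group\<close>

definition integer_partition :: "nat \<Rightarrow> nat multiset \<Rightarrow> bool" where
  "integer_partition d \<mu> \<longleftrightarrow> sum_mset \<mu> = d \<and> 0 \<notin># \<mu>"

text \<open>Fixed points contribute parts equal to 1.\<close>

definition cycle_type :: "nat \<Rightarrow> (nat \<Rightarrow> nat) \<Rightarrow> nat multiset" where
  "cycle_type d g = image_mset card (mset_set (orbit g ` {1..d}))"

text \<open>An element of the real group algebra of a finite group is its coefficient function,
  which vanishes outside the carrier; the product is convolution.\<close>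

definition galg_mult :: "('g, 'z) monoid_scheme \<Rightarrow> ('g \<Rightarrow> real) \<Rightarrow> ('g \<Rightarrow> real) \<Rightarrow> 'g \<Rightarrow> real" where
  "galg_mult G a b x =
     (\<Sum>(g, h) \<in> {(g, h). g \<in> carrier G \<and> h \<in> carrier G \<and> g \<otimes>\<^bsub>G\<^esub> h = x}. a g * b h)"

definition galg_one :: "('g, 'z) monoid_scheme \<Rightarrow> 'g \<Rightarrow> real" where
  "galg_one G x = (if x = \<one>\<^bsub>G\<^esub> then 1 else 0)"

definition galg_prod :: "('g, 'z) monoid_scheme \<Rightarrow> ('g \<Rightarrow> real) list \<Rightarrow> 'g \<Rightarrow> real" where
  "galg_prod G as = foldr (galg_mult G) as (galg_one G)"

definition galg_tr :: "('g, 'z) monoid_scheme \<Rightarrow> ('g \<Rightarrow> real) \<Rightarrow> real" where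
  "galg_tr G a = a \<one>\<^bsub>G\<^esub>"

definition conj_class :: "nat \<Rightarrow> nat multiset \<Rightarrow> (nat \<Rightarrow> nat) set" where
  "conj_class d \<mu> = {g \<in> carrier (sym_group d). cycle_type d g = \<mu>}"

definition class_sum :: "nat \<Rightarrow> nat multiset \<Rightarrow> (nat \<Rightarrow> nat) \<Rightarrow> real" where
  "class_sum d \<mu> g = (if g \<in> conj_class d \<mu> then 1 else 0)"


section \<open>Graphs and trees\<close>

record 'v ugraph =
  verts :: "'v set"
  edges :: "'v set set"

text \<open>Loops are excluded from the outset; a loop is a circuit, so trees have none.\<close>

definition wf_graph :: "'v ugraph \<Rightarrow> bool" where
  "wf_graph G \<longleftrightarrow> finite (verts G) \<and>
     (\<forall>e \<in> edges G. \<exists>u \<in> verts G. \<exists>v \<in> verts G. u \<noteq> v \<and> e = {u, v})"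

definition edges_at :: "'v ugraph \<Rightarrow> 'v \<Rightarrow> 'v set set" where
  "edges_at G v = {e \<in> edges G. v \<in> e}"

definition leaves :: "'v ugraph \<Rightarrow> 'v set" where
  "leaves G = {v \<in> verts G. card (edges_at G v) = 1}"

definition unbounded_edges :: "'v ugraph \<Rightarrow> 'v set set" where
  "unbounded_edges G = {e \<in> edges G. e \<inter> leaves G \<noteq> {}}"

definition bounded_edges :: "'v ugraph \<Rightarrow> 'v set set" where
  "bounded_edges G = edges G - unbounded_edges G"

definition is_path :: "'v ugraph \<Rightarrow> 'v \<Rightarrow> 'v list \<Rightarrow> 'v \<Rightarrow> bool" where
  "is_path G u xs v \<longleftrightarrow> xs \<noteq> [] \<and> hd xs = u \<and> last xs = v \<and> set xs \<subseteq> verts G \<and> distinct xs \<and>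
     successively (\<lambda>a b. {a, b} \<in> edges G) xs"

definition is_circuit :: "'v ugraph \<Rightarrow> 'v list \<Rightarrow> bool" where
  "is_circuit G xs \<longleftrightarrow> 3 \<le> length xs \<and> set xs \<subseteq> verts G \<and> distinct xs \<and>
     successively (\<lambda>a b. {a, b} \<in> edges G) xs \<and> {last xs, hd xs} \<in> edges G"

definition connected_graph :: "'v ugraph \<Rightarrow> bool" where
  "connected_graph G \<longleftrightarrow> verts G \<noteq> {} \<and>
     (\<forall>u \<in> verts G. \<forall>v \<in> verts G. \<exists>xs. is_path G u xs v)"

definition is_tree :: "'v ugraph \<Rightarrow> bool" where
  "is_tree G \<longleftrightarrow> wf_graph G \<and> connected_graph G \<and> (\<nexists>xs. is_circuit G xs)"

definition trivalent :: "'v ugraph \<Rightarrow> bool" where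
  "trivalent G \<longleftrightarrow> (\<forall>v \<in> verts G. card (edges_at G v) \<in> {1, 3})"

definition graph_iso :: "'v ugraph \<Rightarrow> 'w ugraph \<Rightarrow> ('v \<Rightarrow> 'w) \<Rightarrow> bool" where
  "graph_iso G H F \<longleftrightarrow> bij_betw F (verts G) (verts H) \<and> bij_betw (\<lambda>e. F ` e) (edges G) (edges H)"

text \<open>Contraction of a set \<open>S\<close> of edges: a vertex of the new graph is the set of all old
  vertices that can be joined to each other inside \<open>S\<close>.\<close>

definition collapse :: "'v ugraph \<Rightarrow> 'v set set \<Rightarrow> 'v \<Rightarrow> 'v set" where
  "collapse G S u = {v. \<exists>xs. is_path \<lparr>verts = verts G, edges = S\<rparr> u xs v}"

definition degenerate :: "'v ugraph \<Rightarrow> 'v set set \<Rightarrow> 'v set ugraph" where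
  "degenerate G S = \<lparr>verts = collapse G S ` verts G,
                     edges = (\<lambda>e. collapse G S ` e) ` (edges G - S)\<rparr>"


section \<open>Labelled trees\<close>

text \<open>The data \<open>G(\<sigma>, \<nu>)\<close>: labels are numbered from 0, so \<open>ulab T i\<close> is the unbounded edge
  labelled \<open>\<lambda>\<^sub>i\<close> for \<open>i < n\<close>, \<open>blab T i\<close> is the bounded edge labelled \<open>e\<^sub>i\<close> and \<open>part T i\<close>
  is \<open>\<nu>\<^sub>i\<close> for \<open>i < n - 3\<close>. Values outside these ranges are irrelevant.  Vertices are
  natural numbers, which is no loss since only isomorphism classes are used below.\<close>

record ltree =
  gr :: "nat ugraph"
  ulab :: "nat \<Rightarrow> nat set"
  blab :: "nat \<Rightarrow> nat set"
  part :: "nat \<Rightarrow> nat multiset"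

definition labelled_trivalent_tree :: "nat \<Rightarrow> ltree \<Rightarrow> bool" where
  "labelled_trivalent_tree n T \<longleftrightarrow> is_tree (gr T) \<and> trivalent (gr T) \<and> card (leaves (gr T)) = n \<and>
     bij_betw (ulab T) {..<n} (unbounded_edges (gr T)) \<and>
     bij_betw (blab T) {..<n - 3} (bounded_edges (gr T))"

definition edge_partition :: "nat \<Rightarrow> nat multiset list \<Rightarrow> ltree \<Rightarrow> nat set \<Rightarrow> nat multiset" where
  "edge_partition n \<sigma> T e =
     (if e \<in> unbounded_edges (gr T) then \<sigma> ! inv_into {..<n} (ulab T) e
      else part T (inv_into {..<n - 3} (blab T) e))"

text \<open>The order in which the edges at \<open>v\<close> are listed does not matter, as class sums commute.\<close>

definition vertex_mult :: "nat \<Rightarrow> nat \<Rightarrow> nat multiset list \<Rightarrow> ltree \<Rightarrow> nat \<Rightarrow> real" where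
  "vertex_mult n d \<sigma> T v =
     (let es = (SOME es. distinct es \<and> set es = edges_at (gr T) v)
      in galg_tr (sym_group d)
           (galg_prod (sym_group d) (map (\<lambda>e. class_sum d (edge_partition n \<sigma> T e)) es)))"

definition acceptable :: "nat \<Rightarrow> nat \<Rightarrow> nat multiset list \<Rightarrow> ltree \<Rightarrow> bool" where
  "acceptable n d \<sigma> T \<longleftrightarrow> labelled_trivalent_tree n T \<and>
     (\<forall>i < n - 3. integer_partition d (part T i)) \<and>
     (\<forall>v \<in> verts (gr T) - leaves (gr T). vertex_mult n d \<sigma> T v \<noteq> 0)"

definition ltree_iso :: "nat \<Rightarrow> ltree \<Rightarrow> ltree \<Rightarrow> bool" where
  "ltree_iso n T T' \<longleftrightarrow> (\<exists>F. graph_iso (gr T) (gr T') F \<and>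
     (\<forall>i < n. F ` ulab T i = ulab T' i) \<and>
     (\<forall>i < n - 3. F ` blab T i = blab T' i \<and> part T i = part T' i))"

definition acceptable_classes :: "nat \<Rightarrow> nat \<Rightarrow> nat multiset list \<Rightarrow> ltree set set" where
  "acceptable_classes n d \<sigma> =
     {T. acceptable n d \<sigma> T} //
       {(T, T'). acceptable n d \<sigma> T \<and> acceptable n d \<sigma> T' \<and> ltree_iso n T T'}"

definition class_rep :: "ltree set \<Rightarrow> ltree" where
  "class_rep c = (SOME T. T \<in> c)"

definition cone_weight :: "nat \<Rightarrow> nat \<Rightarrow> nat multiset list \<Rightarrow> ltree \<Rightarrow> real" where
  "cone_weight n d \<sigma> T = 1 / fact d
     * (\<Prod>i < n - 3. 1 / real (card (conj_class d (part T i))))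
     * (\<Prod>v \<in> verts (gr T) - leaves (gr T). vertex_mult n d \<sigma> T v)"


section \<open>Metric graphs and double ratios\<close>

text \<open>\<open>mblab M i\<close> is \<open>None\<close> when the edge labelled \<open>e\<^sub>i\<close> has been contracted.  Only the
  lengths of bounded edges are meaningful.\<close>

record 'v mgraph =
  mgr :: "'v ugraph"
  mlen :: "'v set \<Rightarrow> real"
  mulab :: "nat \<Rightarrow> 'v set"
  mblab :: "nat \<Rightarrow> 'v set option"

definition metric_tree :: "nat \<Rightarrow> ltree \<Rightarrow> (nat \<Rightarrow> real) \<Rightarrow> nat set mgraph" where
  "metric_tree n T p =
     (let S = blab T ` {i. i < n - 3 \<and> p i = 0};
          \<pi> = collapse (gr T) S;
          lab = (\<lambda>i. if i < n - 3 \<and> p i > 0 then Some (\<pi> ` blab T i) else None)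
      in \<lparr>mgr = degenerate (gr T) S,
          mlen = (\<lambda>e. if \<exists>i. lab i = Some e then p (THE i. lab i = Some e) else 0),
          mulab = (\<lambda>i. \<pi> ` ulab T i),
          mblab = lab\<rparr>)"

definition metric_iso :: "'v mgraph \<Rightarrow> 'w mgraph \<Rightarrow> ('v \<Rightarrow> 'w) \<Rightarrow> bool" where
  "metric_iso M M' F \<longleftrightarrow> graph_iso (mgr M) (mgr M') F \<and>
     (\<forall>e \<in> bounded_edges (mgr M). mlen M' (F ` e) = mlen M e)"

definition leaf_vertex :: "'v mgraph \<Rightarrow> nat \<Rightarrow> 'v" where
  "leaf_vertex M i = (THE v. v \<in> leaves (mgr M) \<and> v \<in> mulab M i)"

text \<open>The oriented edges of the path from the leaf \<open>\<lambda>\<^sub>i\<close> to the leaf \<open>\<lambda>\<^sub>j\<close>.\<close>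

definition path_arcs :: "'v mgraph \<Rightarrow> nat \<Rightarrow> nat \<Rightarrow> ('v \<times> 'v) set" where
  "path_arcs M i j =
     (let xs = (THE xs. is_path (mgr M) (leaf_vertex M i) xs (leaf_vertex M j))
      in set (zip xs (tl xs)))"

type_synonym quad = "(nat \<times> nat) \<times> (nat \<times> nat)"

text \<open>On a tree the two paths either agree or disagree in direction on their whole
  intersection, so a single common edge traversed in opposite directions decides the sign.\<close>

definition double_ratio :: "'v mgraph \<Rightarrow> quad \<Rightarrow> real" where
  "double_ratio M = (\<lambda>((w, x), (y, z)).
     let A = path_arcs M w x; B = path_arcs M y z
     in (if A\<inverse> \<inter> B = {} then 1 else - 1) *
        (\<Sum>e \<in> (\<lambda>(u, v). {u, v}) ` A \<inter> (\<lambda>(u, v). {u, v}) ` B. mlen M e))"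

definition quads :: "nat \<Rightarrow> quad set" where
  "quads n = {((w, x), (y, z)) | w x y z. distinct [w, x, y, z] \<and> {w, x, y, z} \<subseteq> {..<n}}"

inductive quad_swap :: "quad \<Rightarrow> quad \<Rightarrow> bool" where
  "quad_swap ((w, x), (y, z)) ((x, w), (y, z))"
| "quad_swap ((w, x), (y, z)) ((w, x), (z, y))"
| "quad_swap ((w, x), (y, z)) ((y, z), (w, x))"

text \<open>The swaps are involutions, so the reflexive-transitive closure is the equivalence
  relation that they generate.\<close>

definition quad_representatives :: "nat \<Rightarrow> quad list \<Rightarrow> bool" where
  "quad_representatives n reps \<longleftrightarrow> set reps \<subseteq> quads n \<and>
     (\<forall>q \<in> quads n. \<exists>!k. k < length reps \<and> quad_swap\<^sup>*\<^sup>* (reps ! k) q)"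


section \<open>Polyhedral complexes\<close>

text \<open>\<open>\<real>\<^sup>m\<close> is the space of sequences vanishing from position \<open>m\<close> on, as in
  \<^const>\<open>Euclidean_space\<close>.  Pointwise scalar multiplication gives access to the library notions
  of affine and convex geometry that do not need a norm; the topology on sequences is the
  product topology, which restricts to the usual one on each \<open>\<real>\<^sup>m\<close>.\<close>

instantiation "fun" :: (type, real_vector) real_vector
begin

definition scaleR_fun_def: "scaleR r f = (\<lambda>x. r *\<^sub>R f x)"

instance
  by standard (simp_all add: scaleR_fun_def plus_fun_def scaleR_add_right scaleR_add_left)

end

definition int_points :: "(nat \<Rightarrow> real) set" where
  "int_points = {x. \<forall>i. x i \<in> \<int>}"

text \<open>A lattice polyhedron is the sum of a lattice polytope and a finitely generated rational cone.\<close>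

definition lattice_polyhedron :: "(nat \<Rightarrow> real) set \<Rightarrow> bool" where
  "lattice_polyhedron X \<longleftrightarrow> (\<exists>m A B. finite A \<and> A \<noteq> {} \<and> finite B \<and>
     A \<union> B \<subseteq> int_points \<inter> topspace (Euclidean_space m) \<and>
     X = {x + (\<Sum>b\<in>B. t b *\<^sub>R b) | x t. x \<in> convex hull A \<and> (\<forall>b\<in>B. 0 \<le> t b)})"

definition direction_space :: "(nat \<Rightarrow> real) set \<Rightarrow> (nat \<Rightarrow> real) set" where
  "direction_space X = span {x - y | x y. x \<in> X \<and> y \<in> X}"

definition direction_lattice :: "(nat \<Rightarrow> real) set \<Rightarrow> (nat \<Rightarrow> real) set" where
  "direction_lattice X = direction_space X \<inter> int_points"

definition poly_dim :: "(nat \<Rightarrow> real) set \<Rightarrow> nat" where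
  "poly_dim X = dim (direction_space X)"

type_synonym 'a chart = "(nat \<Rightarrow> real) set \<times> ((nat \<Rightarrow> real) \<Rightarrow> 'a)"

text \<open>The chart classes are given by a collection of representatives; the cells are the
  images of the charts.\<close>

record 'a pcomplex =
  pspace :: "'a topology"
  pcharts :: "'a chart set"

definition cells :: "'a pcomplex \<Rightarrow> 'a set set" where
  "cells C = (\<lambda>(X, c). c ` X) ` pcharts C"

definition lattice_equivalent :: "'a chart \<Rightarrow> 'a chart \<Rightarrow> bool" where
  "lattice_equivalent = (\<lambda>(X, c) (Y, c').
     \<exists>L b. let f = (\<lambda>x. L x + b) in
       linear L \<and> bij_betw f (affine hull X) (affine hull Y) \<and> f ` X = Y \<and>
       f ` (affine hull X \<inter> int_points) = affine hull Y \<inter> int_points \<and>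
       (\<forall>x\<in>X. c' (f x) = c x))"

text \<open>Faces are nonempty, and disjoint cells are allowed.\<close>

definition polyhedral_complex :: "'a pcomplex \<Rightarrow> bool" where
  "polyhedral_complex C \<longleftrightarrow>
     (\<forall>(X, c) \<in> pcharts C. lattice_polyhedron X \<and> closedin (pspace C) (c ` X) \<and>
        homeomorphic_map (top_of_set X) (subtopology (pspace C) (c ` X)) c) \<and>
     \<Union> (cells C) = topspace (pspace C) \<and>
     (\<forall>P \<in> cells C. \<forall>Q \<in> cells C. P \<inter> Q \<noteq> {} \<longrightarrow> P \<inter> Q \<in> cells C) \<and>
     (\<forall>(X, c) \<in> pcharts C. \<forall>Y. Y face_of X \<and> Y \<noteq> {} \<longrightarrow> c ` Y \<in> cells C) \<and>
     (\<forall>(X, c) \<in> pcharts C. \<forall>(Y, c') \<in> pcharts C. c ` X = c' ` Y \<longrightarrow>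
        lattice_equivalent (X, c) (Y, c'))"

text \<open>The empty complex is regarded as having every dimension.\<close>

definition has_dimension :: "'a pcomplex \<Rightarrow> nat \<Rightarrow> bool" where
  "has_dimension C k \<longleftrightarrow> (\<forall>(X, c) \<in> pcharts C. poly_dim X \<le> k) \<and>
     (\<forall>P \<in> cells C. \<exists>(X, c) \<in> pcharts C. poly_dim X = k \<and> (\<exists>Y. Y face_of X \<and> P = c ` Y))"

text \<open>\<open>L\<close> is a linear part of the affine map \<open>f\<close> on \<open>X\<close>; it is determined on
  \<^term>\<open>direction_space X\<close>.\<close>

definition linear_part :: "(nat \<Rightarrow> real) set \<Rightarrow> ((nat \<Rightarrow> real) \<Rightarrow> nat \<Rightarrow> real) \<Rightarrow>
    ((nat \<Rightarrow> real) \<Rightarrow> nat \<Rightarrow> real) \<Rightarrow> bool" where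
  "linear_part X f L \<longleftrightarrow> linear L \<and> (\<forall>x\<in>X. \<forall>y\<in>X. f x - f y = L (x - y))"

definition in_charts :: "'a chart \<Rightarrow> 'b chart \<Rightarrow> ('a \<Rightarrow> 'b) \<Rightarrow> (nat \<Rightarrow> real) \<Rightarrow> nat \<Rightarrow> real" where
  "in_charts = (\<lambda>(X, c) (X', c') f. inv_into X' c' \<circ> f \<circ> c)"

definition pc_morphism :: "'a pcomplex \<Rightarrow> 'b pcomplex \<Rightarrow> ('a \<Rightarrow> 'b) \<Rightarrow> bool" where
  "pc_morphism C C' f \<longleftrightarrow> continuous_map (pspace C) (pspace C') f \<and>
     (\<forall>(X, c) \<in> pcharts C. \<exists>(X', c') \<in> pcharts C'. f ` c ` X \<subseteq> c' ` X' \<and>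
        (\<exists>L. linear_part X (in_charts (X, c) (X', c') f) L \<and>
             L ` direction_lattice X \<subseteq> direction_lattice X'))"

text \<open>The charts whose cell is \<open>k\<close>-dimensional and contains \<open>p\<close> in its interior.\<close>

definition charts_around :: "nat \<Rightarrow> 'a pcomplex \<Rightarrow> 'a \<Rightarrow> 'a chart set" where
  "charts_around k C p = {(X, c) \<in> pcharts C. poly_dim X = k \<and> p \<in> c ` rel_interior X}"

definition top_interior :: "nat \<Rightarrow> 'a pcomplex \<Rightarrow> 'a set" where
  "top_interior k C = {p. charts_around k C p \<noteq> {}}"

text \<open>The index of \<open>\<Lambda>\<close> in \<open>\<Lambda>'\<close> is the number of cosets (and 0 if there are infinitely many).\<close>

definition lattice_index :: "(nat \<Rightarrow> real) set \<Rightarrow> (nat \<Rightarrow> real) set \<Rightarrow> nat" where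
  "lattice_index \<Lambda> \<Lambda>' = card ((\<lambda>u. (\<lambda>v. u + v) ` \<Lambda>) ` \<Lambda>')"

text \<open>Points outside the interiors of the \<open>k\<close>-dimensional cells, where index and weight are
  not defined, are given index 0.\<close>

definition index_at :: "nat \<Rightarrow> 'a pcomplex \<Rightarrow> 'b pcomplex \<Rightarrow> ('a \<Rightarrow> 'b) \<Rightarrow> 'a \<Rightarrow> nat" where
  "index_at k C C' f p =
     (if p \<in> top_interior k C then
        let (X, c) = (SOME \<gamma>. \<gamma> \<in> charts_around k C p);
            (X', c') = (SOME \<gamma>'. \<gamma>' \<in> pcharts C' \<and> f ` c ` X \<subseteq> snd \<gamma>' ` fst \<gamma>');
            L = (SOME L. linear_part X (in_charts (X, c) (X', c') f) L)
        in if poly_dim X' = k then lattice_index (L ` direction_lattice X) (direction_lattice X')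
           else 0
      else 0)"

definition weighted :: "nat \<Rightarrow> 'a pcomplex \<Rightarrow> ('a set \<Rightarrow> real) \<Rightarrow> bool" where
  "weighted k C w \<longleftrightarrow> (\<forall>(X, c) \<in> pcharts C. poly_dim X = k \<longrightarrow> w (c ` X) \<in> \<rat>)"

definition weight_at :: "nat \<Rightarrow> 'a pcomplex \<Rightarrow> ('a set \<Rightarrow> real) \<Rightarrow> 'a \<Rightarrow> real" where
  "weight_at k C w p = (let (X, c) = (SOME \<gamma>. \<gamma> \<in> charts_around k C p) in w (c ` X))"

definition fibre :: "'a pcomplex \<Rightarrow> ('a \<Rightarrow> 'b) \<Rightarrow> 'b \<Rightarrow> 'a set" where
  "fibre C f q = {p \<in> topspace (pspace C). f p = q}"

definition degree_at :: "nat \<Rightarrow> 'a pcomplex \<Rightarrow> ('a set \<Rightarrow> real) \<Rightarrow> 'b pcomplex \<Rightarrow> ('a \<Rightarrow> 'b) \<Rightarrow>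
    'b \<Rightarrow> real" where
  "degree_at k C w C' f q = (\<Sum>p \<in> fibre C f q. weight_at k C w p * real (index_at k C C' f p))"

definition degree_well_defined :: "nat \<Rightarrow> 'a pcomplex \<Rightarrow> ('a set \<Rightarrow> real) \<Rightarrow> 'b pcomplex \<Rightarrow>
    ('a \<Rightarrow> 'b) \<Rightarrow> bool" where
  "degree_well_defined k C w C' f \<longleftrightarrow>
     (\<forall>q \<in> top_interior k C'. finite (fibre C f q)) \<and>
     (\<forall>q \<in> top_interior k C'. \<forall>q' \<in> top_interior k C'.
        degree_at k C w C' f q = degree_at k C w C' f q')"

text \<open>A morphism to the empty complex has degree 0.\<close>

definition morphism_degree :: "nat \<Rightarrow> 'a pcomplex \<Rightarrow> ('a set \<Rightarrow> real) \<Rightarrow> 'b pcomplex \<Rightarrow>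
    ('a \<Rightarrow> 'b) \<Rightarrow> real" where
  "morphism_degree k C w C' f =
     (if top_interior k C' = {} then 0
      else degree_at k C w C' f (SOME q. q \<in> top_interior k C'))"


section \<open>The complexes and the morphism\<close>

definition orthant :: "nat \<Rightarrow> (nat \<Rightarrow> real) set" where
  "orthant m = {x \<in> topspace (Euclidean_space m). \<forall>i < m. 0 \<le> x i}"

type_synonym dpoint = "ltree set \<times> (nat \<Rightarrow> real)"

definition D_space :: "nat \<Rightarrow> nat \<Rightarrow> nat multiset list \<Rightarrow> dpoint topology" where
  "D_space n d \<sigma> =
     sum_topology (\<lambda>_. subtopology (Euclidean_space (n - 3)) (orthant (n - 3)))
       (acceptable_classes n d \<sigma>)"

definition dtree :: "nat \<Rightarrow> dpoint \<Rightarrow> nat set mgraph" where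
  "dtree n = (\<lambda>(c, p). metric_tree n (class_rep c) p)"

definition gluing :: "nat \<Rightarrow> nat \<Rightarrow> nat multiset list \<Rightarrow> (dpoint \<times> dpoint) set" where
  "gluing n d \<sigma> = {(a, b). a \<in> topspace (D_space n d \<sigma>) \<and> b \<in> topspace (D_space n d \<sigma>) \<and>
     (\<exists>F. metric_iso (dtree n a) (dtree n b) F \<and>
        (\<forall>i < n. F ` mulab (dtree n a) i = mulab (dtree n b) i) \<and>
        (\<forall>i j e e'. mblab (dtree n a) i = Some e \<and> mblab (dtree n b) j = Some e' \<and> F ` e = e' \<longrightarrow>
           part (class_rep (fst a)) i = part (class_rep (fst b)) j))}"

definition quotient_topology :: "'a topology \<Rightarrow> ('a \<times> 'a) set \<Rightarrow> 'a set topology" where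
  "quotient_topology T R = topology (\<lambda>U. U \<subseteq> topspace T // R \<and> openin T (\<Union> U))"

lemma istopology_quotient:
  assumes "equiv (topspace T) R"
  shows "istopology (\<lambda>U. U \<subseteq> topspace T // R \<and> openin T (\<Union> U))"
proof -
  have "openin T (\<Union> (U \<inter> V))"
    if "U \<subseteq> topspace T // R" "openin T (\<Union> U)" "V \<subseteq> topspace T // R" "openin T (\<Union> V)" for U V
  proof -
    have "\<Union> (U \<inter> V) = \<Union> U \<inter> \<Union> V"
      using that quotient_disj[OF assms] by blast
    then show ?thesis
      using that by auto
  qed
  moreover have "openin T (\<Union> (\<Union> \<U>))" if "\<forall>U\<in>\<U>. openin T (\<Union> U)" for \<U>
  proof -
    have "\<Union> (\<Union> \<U>) = (\<Union>U\<in>\<U>. \<Union> U)"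
      by blast
    then show ?thesis
      using that by (metis (mono_tags, lifting) openin_Union imageE)
  qed
  ultimately show ?thesis
    unfolding istopology_def by blast
qed

definition H_point :: "nat \<Rightarrow> nat \<Rightarrow> nat multiset list \<Rightarrow> ltree set \<Rightarrow> (nat \<Rightarrow> real) \<Rightarrow> dpoint set" where
  "H_point n d \<sigma> c p = gluing n d \<sigma> `` {(c, p)}"

definition H_complex :: "nat \<Rightarrow> nat \<Rightarrow> nat multiset list \<Rightarrow> dpoint set pcomplex" where
  "H_complex n d \<sigma> =
     \<lparr>pspace = quotient_topology (D_space n d \<sigma>) (gluing n d \<sigma>),
      pcharts = {(Y, H_point n d \<sigma> c) | Y c. c \<in> acceptable_classes n d \<sigma> \<and>
                   Y face_of orthant (n - 3) \<and> Y \<noteq> {}}\<rparr>"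

text \<open>Cones that differ only in the numbering of the bounded edges have the same image;
  they also have the same weight.\<close>

definition H_weight :: "nat \<Rightarrow> nat \<Rightarrow> nat multiset list \<Rightarrow> dpoint set set \<Rightarrow> real" where
  "H_weight n d \<sigma> P = cone_weight n d \<sigma>
     (class_rep (SOME c. c \<in> acceptable_classes n d \<sigma> \<and> P = H_point n d \<sigma> c ` orthant (n - 3)))"

definition double_ratio_map :: "nat \<Rightarrow> quad list \<Rightarrow> dpoint set \<Rightarrow> nat \<Rightarrow> real" where
  "double_ratio_map n reps h k =
     (if k < length reps then double_ratio (dtree n (SOME a. a \<in> h)) (reps ! k) else 0)"

definition M_complex :: "nat \<Rightarrow> nat \<Rightarrow> nat multiset list \<Rightarrow> quad list \<Rightarrow> (nat \<Rightarrow> real) pcomplex" where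
  "M_complex n d \<sigma> reps =
     \<lparr>pspace = subtopology (Euclidean_space (length reps))
                 (double_ratio_map n reps ` topspace (pspace (H_complex n d \<sigma>))),
      pcharts = (\<lambda>(X, c). (X, double_ratio_map n reps \<circ> c)) ` pcharts (H_complex n d \<sigma>)\<rparr>"

end

theory Submission
  imports Defs
begin

text \<open>Root every tree at the leaf labelled 0.  An edge is then given by its cluster, the set of
  labels that it separates from 0.  The clusters of a tree are pairwise nested or disjoint, they
  determine the tree up to isomorphism, and contracting edges just deletes clusters.  Hence a
  point of \<open>H(\<sigma>)\<close> is a length function on pairs (cluster, partition), and \<open>\<phi>\<close> forgets the
  partitions.  A double ratio is the signed sum of the lengths of the clusters that separate its
  two pairs; every cluster of a tree is isolated by some double ratio, and two families of
  clusters that cross are told apart by a sign, so the double ratios recover the lengths.  Both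
  complexes are therefore glued from orthants along coordinate faces, and all indices are 1.

  The fibre of \<open>\<phi>\<close> over an interior point of the cone of a tree consists of the colourings of its
  bounded edges by partitions.  Summing the weights over the colours of one edge merges its two
  end vertices, because the class sums are an orthogonal basis of the class functions; after all
  bounded edges the trace of the product of all \<open>K\<close> remains, whatever the tree.\<close>

section \<open>Class functions on the symmetric group, up to the orthogonality of class sums\<close>

section \<open>Conjugacy and cycle types\<close>

text \<open>The definitions choose by \<open>SOME\<close>: a representative of a class, a chart
  around a point, a class with a given cell, a target chart, a linear part. Moreover, classes that
  differ in the numbering of the bounded edges share one cell. Every quantity is therefore first
  expressed by data that no choice affects, the coloured clusters: \<open>len\<close> for points,
  \<open>same_keys\<close> for weights, \<open>index_one\<close> for indices.

  Contraction destroys trivalence, so clusters are studied in the weaker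
  \<open>labelled_tree\<close>, whose axiom \<open>branching\<close> survives contraction. Rooting
  selects one of the two sides of every edge and turns the order of the tree into inclusion.

  The fibre contains only the acceptable colourings, whereas the merging argument sums over all of
  them. The two sums agree because a colouring is unacceptable exactly when its weight is 0. If
  there is no top cell at all, the degree is 0 by convention, and the formula then requires some
  trivalent tree to exist: a nonzero trace would give it an acceptable colouring.\<close>

lemma permutes_orbit_facts:
  assumes "f permutes S" "finite S"
  shows "x \<in> orbit f x" "y \<in> orbit f x \<Longrightarrow> orbit f y = orbit f x" "finite (orbit f x)"
    "(f ^^ k) x \<in> orbit f x" "y \<in> orbit f x \<Longrightarrow> \<exists>k. (f ^^ k) x = y"
    "(f ^^ s) x = (f ^^ t) x \<longleftrightarrow> s mod card (orbit f x) = t mod card (orbit f x)"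
proof -
  have perm: "permutation f" using assms permutation_permutes by blast
  show self: "x \<in> orbit f x" by (rule permutation_self_in_orbit[OF perm])
  show "y \<in> orbit f x \<Longrightarrow> orbit f y = orbit f x"
    using orbit_cyclic_eq3[OF cyclic_on_orbit[OF assms]] .
  show "finite (orbit f x)" by (rule finite_orbit[OF self])
  show "(f ^^ k) x \<in> orbit f x" by (rule funpow_in_orbit[OF self])
  show "y \<in> orbit f x \<Longrightarrow> \<exists>k. (f ^^ k) x = y" by (auto simp: orbit_altdef)
  let ?N = "funpow_dist1 f x x"
  have inj: "inj_on (\<lambda>n. (f ^^ n) x) {0..<?N}" by (rule inj_on_funpow_dist1[OF self])
  have "card (orbit f x) = ?N"
    unfolding orbit_conv_funpow_dist1[OF self] card_image[OF inj] by simp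
  moreover have "(f ^^ ?N) x = x" by (rule funpow_dist1_prop[OF self])
  then have "(f ^^ (n mod ?N)) x = (f ^^ n) x" for n by (rule funpow_mod_eq)
  moreover have "(f ^^ (s mod ?N)) x = (f ^^ (t mod ?N)) x \<longleftrightarrow> s mod ?N = t mod ?N"
    using inj_on_eq_iff[OF inj, of "s mod ?N" "t mod ?N"] by simp
  ultimately show "(f ^^ s) x = (f ^^ t) x \<longleftrightarrow> s mod card (orbit f x) = t mod card (orbit f x)"
    by simp
qed

text \<open>Choose a base point in every orbit and let \<open>k\<close> carry \<open>g^t\<close> of
  a base point to \<open>h^t\<close> of the base point of the matching orbit. Because matching
  orbits have equal size, exponents are determined modulo the same number on both sides, so
  \<open>k\<close> is well defined and injective.\<close>

lemma conjugate_of_orbit_bij: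
  assumes g: "g permutes S" and h: "h permutes S" and fin: "finite S"
    and \<beta>: "bij_betw \<beta> (orbit g ` S) (orbit h ` S)" "\<And>Q. Q \<in> orbit g ` S \<Longrightarrow> card (\<beta> Q) = card Q"
  shows "\<exists>k. k permutes S \<and> h \<circ> k = k \<circ> g"
proof -
  note G = permutes_orbit_facts[OF g fin] and H = permutes_orbit_facts[OF h fin]
  define base where "base Q = (SOME x. x \<in> Q)" for Q :: "'a set"
  have base: "orbit g (base Q) = Q" if Q: "Q \<in> orbit g ` S" for Q
  proof -
    obtain x where x: "Q = orbit g x" using Q by blast
    then have "base Q \<in> Q" unfolding base_def using G(1) by (metis someI)
    then show ?thesis using G(2) x by blast
  qed
  have base': "orbit h (base Q) = Q" if Q: "Q \<in> orbit h ` S" for Q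
  proof -
    obtain x where x: "Q = orbit h x" using Q by blast
    then have "base Q \<in> Q" unfolding base_def using H(1) by (metis someI)
    then show ?thesis using H(2) x by blast
  qed
  define t where "t z = (SOME t. (g ^^ t) (base (orbit g z)) = z)" for z
  have t: "(g ^^ t z) (base (orbit g z)) = z" if "z \<in> S" for z
  proof -
    have "z \<in> orbit g (base (orbit g z))" using base[of "orbit g z"] that G(1) by simp
    then have "\<exists>t. (g ^^ t) (base (orbit g z)) = z" by (rule G(5))
    then show ?thesis unfolding t_def by (rule someI_ex)
  qed
  define K where "K z = (if z \<in> S then (h ^^ t z) (base (\<beta> (orbit g z))) else z)" for z
  have \<beta>': "\<beta> (orbit g z) \<in> orbit h ` S" if "z \<in> S" for z
    using bij_betw_apply[OF \<beta>(1)] that by blast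
  \<comment> \<open>Both sides say that \<open>s\<close> and \<open>s'\<close> agree modulo the
    common orbit size; hence the arbitrary exponent \<open>t z\<close> does no harm.\<close>
  have key: "(h ^^ s) (base (\<beta> Q)) = (h ^^ s') (base (\<beta> Q)) \<longleftrightarrow> (g ^^ s) (base Q) = (g ^^ s') (base Q)"
    if Q: "Q \<in> orbit g ` S" for Q s s'
    unfolding G(6) H(6) base[OF Q] using base'[of "\<beta> Q"] bij_betw_apply[OF \<beta>(1) Q] \<beta>(2)[OF Q] by simp
  have Korb: "K z \<in> \<beta> (orbit g z)" if "z \<in> S" for z
    using H(4)[of "t z" "base (\<beta> (orbit g z))"] base'[OF \<beta>'[OF that]] that by (simp add: K_def)
  have orbS: "orbit h x \<subseteq> S" if "x \<in> S" for x by (rule permutes_orbit_subset[OF h that])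
  have KS: "K z \<in> S" if z: "z \<in> S" for z
    using Korb[OF z] \<beta>'[OF z] orbS by auto
  have gS: "g z \<in> S" if "z \<in> S" for z using g that by (simp add: permutes_in_image)
  have comm: "h (K z) = K (g z)" if z: "z \<in> S" for z
  proof -
    have orb: "orbit g (g z) = orbit g z" using G(2)[OF orbit.base[of g z]] .
    have "(g ^^ Suc (t z)) (base (orbit g z)) = g z" using t[OF z] by simp
    also have "\<dots> = (g ^^ t (g z)) (base (orbit g z))" using t[OF gS[OF z]] orb by simp
    finally have "(h ^^ Suc (t z)) (base (\<beta> (orbit g z))) = (h ^^ t (g z)) (base (\<beta> (orbit g z)))"
      using key[of "orbit g z"] z by blast
    then show ?thesis using z gS[OF z] orb by (simp add: K_def)
  qed
  have "inj_on K S"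
  proof (rule inj_onI)
    fix z z' assume z: "z \<in> S" "z' \<in> S" "K z = K z'"
    have "orbit h (K z) = \<beta> (orbit g z)" "orbit h (K z') = \<beta> (orbit g z')"
      using Korb \<beta>' z(1,2) H(2) by (metis imageE)+
    then have "\<beta> (orbit g z) = \<beta> (orbit g z')" using z(3) by simp
    then have orb: "orbit g z = orbit g z'"
      using \<beta>(1) z by (auto simp: bij_betw_def inj_on_def)
    then have "(h ^^ t z) (base (\<beta> (orbit g z))) = (h ^^ t z') (base (\<beta> (orbit g z)))"
      using z by (simp add: K_def)
    then have "(g ^^ t z) (base (orbit g z)) = (g ^^ t z') (base (orbit g z))"
      using key[of "orbit g z"] z(1) by blast
    then have "z = (g ^^ t z') (base (orbit g z))" unfolding t[OF z(1)] .
    also have "\<dots> = z'" unfolding orb by (rule t[OF z(2)])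
    finally show "z = z'" .
  qed
  moreover have "K ` S \<subseteq> S" using KS by blast
  ultimately have "bij_betw K S S"
    unfolding bij_betw_def using endo_inj_surj[OF fin] by blast
  then have "K permutes S" by (rule bij_imp_permutes) (simp add: K_def)
  moreover have "h \<circ> K = K \<circ> g"
  proof
    fix z
    show "(h \<circ> K) z = (K \<circ> g) z"
    proof (cases "z \<in> S")
      case True
      then show ?thesis using comm by simp
    next
      case False
      then have "g z = z" "h z = z" using g h by (simp_all add: permutes_not_in)
      then show ?thesis using False by (simp add: K_def)
    qed
  qed
  ultimately show ?thesis by blast
qed

text \<open>Listing both sets turns the equality of multisets into a permutation that aligns the two
  lists of sizes; entries at equal positions are then matched.\<close>

lemma bij_of_card_mset_eq:
  assumes "finite A" "finite B" "image_mset card (mset_set A) = image_mset card (mset_set B)"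
  shows "\<exists>\<beta>. bij_betw \<beta> A B \<and> (\<forall>Q\<in>A. card (\<beta> Q) = card Q)"
proof -
  obtain xs ys where xs: "set xs = A" "distinct xs" and ys: "set ys = B" "distinct ys"
    using assms finite_distinct_list by meson
  have "mset (map card xs) = mset (map card ys)"
    using assms(3) xs ys by (simp add: mset_set_set[symmetric])
  then obtain p where p: "p permutes {..<length (map card ys)}" "permute_list p (map card ys) = map card xs"
    by (rule mset_eq_permutation)
  let ?ys = "permute_list p ys"
  have p': "p permutes {..<length ys}" using p(1) by simp
  have map: "map card ?ys = map card xs" using p(2) p' by (simp add: permute_list_map)
  have len: "length ?ys = length xs" using map map_eq_imp_length_eq by blast
  have ys': "set ?ys = B" "distinct ?ys" using p' ys by simp_all
  let ?\<beta> = "\<lambda>Q. ?ys ! (inv_into {..<length xs} ((!) xs) Q)"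
  have b1: "bij_betw ((!) xs) {..<length xs} A" using xs bij_betw_nth by blast
  have b2: "bij_betw ((!) ?ys) {..<length xs} B" using ys' len bij_betw_nth by metis
  have "bij_betw (((!) ?ys) \<circ> inv_into {..<length xs} ((!) xs)) A B"
    by (rule bij_betw_trans[OF bij_betw_inv_into[OF b1] b2])
  moreover have "card (?\<beta> Q) = card Q" if Q: "Q \<in> A" for Q
  proof -
    let ?i = "inv_into {..<length xs} ((!) xs) Q"
    have i: "?i < length xs" "xs ! ?i = Q"
      using bij_betw_apply[OF bij_betw_inv_into[OF b1] Q] bij_betw_inv_into_right[OF b1 Q] by auto
    then have "map card ?ys ! ?i = map card xs ! ?i" using map by simp
    then show ?thesis using i len by simp
  qed
  ultimately show ?thesis by (intro exI[of _ "((!) ?ys) \<circ> inv_into {..<length xs} ((!) xs)"]) auto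
qed

lemma cycle_type_conjugate:
  assumes g: "g permutes {1..d}" and h: "h permutes {1..d}" and eq: "cycle_type d g = cycle_type d h"
  shows "\<exists>k. k permutes {1..d} \<and> h = k \<circ> g \<circ> inv_into UNIV k"
proof -
  obtain \<beta> where "bij_betw \<beta> (orbit g ` {1..d}) (orbit h ` {1..d})" "\<forall>Q\<in>orbit g ` {1..d}. card (\<beta> Q) = card Q"
    using bij_of_card_mset_eq[of "orbit g ` {1..d}" "orbit h ` {1..d}"] eq unfolding cycle_type_def by auto
  then obtain k where k: "k permutes {1..d}" "h \<circ> k = k \<circ> g"
    using conjugate_of_orbit_bij[OF g h, of \<beta>] by auto
  have "h = h \<circ> (k \<circ> inv_into UNIV k)" using permutes_inv_o(1)[OF k(1)] by simp
  also have "\<dots> = k \<circ> g \<circ> inv_into UNIV k" using k(2) by (simp flip: comp_assoc)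
  finally show ?thesis using k(1) by blast
qed

lemma cycle_type_conj:
  assumes g: "g permutes {1..d}" and k: "k permutes {1..d}"
  shows "cycle_type d (k \<circ> g \<circ> inv_into UNIV k) = cycle_type d g"
proof -
  let ?h = "k \<circ> g \<circ> inv_into UNIV k"
  have fin: "finite {1..d}" by simp
  have inj: "inj k" using k by (rule permutes_inj)
  have "?h (k y) = k (g y)" for y using inj by (simp add: inv_f_f)
  then have orb: "k ` orbit g x = orbit ?h (k x)" for x
    using orbit_inverse[OF permutes_orbit_facts(1)[OF g fin], where g' = ?h and f = k] by simp
  have "orbit ?h ` {1..d} = orbit ?h ` k ` {1..d}" using permutes_image[OF k] by simp
  also have "\<dots> = (`) k ` orbit g ` {1..d}" using orb by (simp add: image_image)
  finally have eq: "orbit ?h ` {1..d} = (`) k ` orbit g ` {1..d}" .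
  have "inj_on ((`) k) (orbit g ` {1..d})" using inj by (simp add: inj_on_def inj_image_eq_iff)
  then have "mset_set (orbit ?h ` {1..d}) = image_mset ((`) k) (mset_set (orbit g ` {1..d}))"
    unfolding eq by (rule image_mset_mset_set[symmetric])
  moreover have "card (k ` Q) = card Q" for Q using card_image[of k Q] inj inj_on_subset by blast
  ultimately show ?thesis by (simp add: cycle_type_def image_mset.compositionality comp_def)
qed

lemma cycle_type_inv: "g permutes {1..d} \<Longrightarrow> cycle_type d (inv_into UNIV g) = cycle_type d g"
  unfolding cycle_type_def using orbit_inv_eq[of g] permutation_permutes by (metis finite_atLeastAtMost image_cong)

lemma integer_partition_cycle_type:
  assumes g: "g permutes {1..d}"
  shows "integer_partition d (cycle_type d g)"
proof -
  have fin: "finite {1..d}" by simp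
  note G = permutes_orbit_facts[OF g fin]
  have "sum_mset (cycle_type d g) = (\<Sum>Q\<in>orbit g ` {1..d}. card Q)"
    by (simp add: cycle_type_def sum_unfold_sum_mset)
  also have "\<dots> = card (\<Union> (orbit g ` {1..d}))"
  proof (rule card_Union_disjoint[symmetric])
    show "pairwise disjnt (orbit g ` {1..d})"
      unfolding pairwise_def disjnt_def using G(2) by (metis disjoint_iff imageE)
    show "finite Q" if "Q \<in> orbit g ` {1..d}" for Q using that G(3) by blast
  qed
  also have "\<Union> (orbit g ` {1..d}) = {1..d}"
    using permutes_orbit_subset[OF g] G(1) by blast
  finally have "sum_mset (cycle_type d g) = d" by simp
  moreover have "0 \<notin># cycle_type d g"
    using G(1,3) by (fastforce simp: cycle_type_def)
  ultimately show ?thesis by (simp add: integer_partition_def)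
qed

text \<open>Parts are positive, so there are at most \<open>d\<close> of them, each at most
  \<open>d\<close>.\<close>

lemma finite_integer_partitions: "finite {\<mu>. integer_partition d \<mu>}"
proof -
  have "{\<mu>. integer_partition d \<mu>} \<subseteq> (\<Union>k\<le>d. {\<mu>. set_mset \<mu> \<subseteq> {..d} \<and> size \<mu> = k})"
  proof
    fix \<mu> assume "\<mu> \<in> {\<mu>. integer_partition d \<mu>}"
    then have \<mu>: "sum_mset \<mu> = d" "0 \<notin># \<mu>" by (auto simp: integer_partition_def)
    have "size \<nu> \<le> sum_mset \<nu>" if "0 \<notin># \<nu>" for \<nu> :: "nat multiset"
      using that by (induction \<nu>) auto
    then have "size \<mu> \<le> d" using \<mu> by blast
    moreover have "set_mset \<mu> \<subseteq> {..d}" using \<mu>(1) by (auto dest!: multi_member_split)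
    ultimately show "\<mu> \<in> (\<Union>k\<le>d. {\<mu>. set_mset \<mu> \<subseteq> {..d} \<and> size \<mu> = k})" by blast
  qed
  moreover have "finite {\<mu> :: nat multiset. set_mset \<mu> \<subseteq> {..d} \<and> size \<mu> = k}" for k
    using finite_multisets_of_size[of "{..d}" k] by (simp add: multisets_of_size_def)
  ultimately show ?thesis by (meson finite_UN_I finite_atMost finite_subset)
qed

section \<open>Class functions\<close>

context group
begin

text \<open>Vanishing off the carrier is included so that the unit law \<open>galg_mult_one\<close>
  is an equality of functions on the whole type.\<close>

definition class_fun :: "('a \<Rightarrow> real) \<Rightarrow> bool" where
  "class_fun a \<longleftrightarrow> (\<forall>g. g \<notin> carrier G \<longrightarrow> a g = 0) \<and>
     (\<forall>g\<in>carrier G. \<forall>k\<in>carrier G. a (k \<otimes> g \<otimes> inv k) = a g)"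

lemma galg_mult_eq:
  assumes "x \<in> carrier G"
  shows "galg_mult G a b x = (\<Sum>g\<in>carrier G. a g * b (inv g \<otimes> x))"
proof -
  have "{(g, h). g \<in> carrier G \<and> h \<in> carrier G \<and> g \<otimes> h = x} = (\<lambda>g. (g, inv g \<otimes> x)) ` carrier G"
    using assms by (auto simp: m_assoc[symmetric] image_iff)
  moreover have "inj_on (\<lambda>g. (g, inv g \<otimes> x)) (carrier G)" by (simp add: inj_on_def)
  ultimately show ?thesis by (simp add: galg_mult_def sum.reindex)
qed

lemma galg_mult_outside: "x \<notin> carrier G \<Longrightarrow> galg_mult G a b x = 0"
proof -
  assume "x \<notin> carrier G"
  then have "{(g, h). g \<in> carrier G \<and> h \<in> carrier G \<and> g \<otimes> h = x} = {}" by auto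
  then show ?thesis by (simp only: galg_mult_def sum.empty)
qed

lemma class_fun_one: "class_fun (galg_one G)"
proof -
  have "k \<otimes> g \<otimes> inv k = \<one> \<longleftrightarrow> g = \<one>" if "g \<in> carrier G" "k \<in> carrier G" for g k
    using that by (metis inv_closed inv_inv l_inv m_assoc m_closed r_inv r_one l_one)
  then show ?thesis by (auto simp: class_fun_def galg_one_def)
qed

lemma class_fun_comm:
  assumes "class_fun a" "g \<in> carrier G" "h \<in> carrier G"
  shows "a (g \<otimes> h) = a (h \<otimes> g)"
proof -
  have "a (h \<otimes> (g \<otimes> h) \<otimes> inv h) = a (g \<otimes> h)"
    using assms by (auto simp: class_fun_def)
  moreover have "h \<otimes> (g \<otimes> h) \<otimes> inv h = h \<otimes> g"
    using assms(2,3) by (simp add: m_assoc)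
  ultimately show ?thesis by simp
qed

lemma class_fun_mult:
  assumes "class_fun a" "class_fun b"
  shows "class_fun (galg_mult G a b)"
  unfolding class_fun_def
proof (intro conjI allI ballI impI)
  show "galg_mult G a b g = 0" if "g \<notin> carrier G" for g using galg_mult_outside that .
  fix x k assume x: "x \<in> carrier G" and k: "k \<in> carrier G"
  have bij: "bij_betw (\<lambda>g. k \<otimes> g \<otimes> inv k) (carrier G) (carrier G)"
    by (rule bij_betw_byWitness[where f' = "\<lambda>g. inv k \<otimes> g \<otimes> k"])
      (use k in \<open>auto simp: m_assoc\<close>, use k in \<open>simp_all add: m_assoc[symmetric]\<close>)
  have "galg_mult G a b (k \<otimes> x \<otimes> inv k) = (\<Sum>g\<in>carrier G. a g * b (inv g \<otimes> (k \<otimes> x \<otimes> inv k)))"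
    by (rule galg_mult_eq) (use x k in simp)
  also have "\<dots> = (\<Sum>g\<in>carrier G. a (k \<otimes> g \<otimes> inv k) * b (inv (k \<otimes> g \<otimes> inv k) \<otimes> (k \<otimes> x \<otimes> inv k)))"
    by (rule sum.reindex_bij_betw[OF bij, symmetric])
  also have "\<dots> = (\<Sum>g\<in>carrier G. a g * b (inv g \<otimes> x))"
  proof (rule sum.cong)
    fix g assume g: "g \<in> carrier G"
    have "inv (k \<otimes> g \<otimes> inv k) \<otimes> (k \<otimes> x \<otimes> inv k) = k \<otimes> (inv g \<otimes> x) \<otimes> inv k"
      using g k x by (simp add: inv_mult_group m_assoc) (simp flip: m_assoc)
    then show "a (k \<otimes> g \<otimes> inv k) * b (inv (k \<otimes> g \<otimes> inv k) \<otimes> (k \<otimes> x \<otimes> inv k)) = a g * b (inv g \<otimes> x)"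
      using assms g k x by (simp add: class_fun_def)
  qed simp
  also have "\<dots> = galg_mult G a b x" by (rule galg_mult_eq[OF x, symmetric])
  finally show "galg_mult G a b (k \<otimes> x \<otimes> inv k) = galg_mult G a b x" .
qed

text \<open>Substituting \<open>x \<otimes> inv g\<close> for \<open>g\<close> exchanges the factors
  up to the order of a product inside the argument of \<open>b\<close>, and a class function takes
  the same value on both orders (\<open>class_fun_comm\<close>).\<close>

lemma galg_mult_commute:
  assumes "class_fun b"
  shows "galg_mult G a b = galg_mult G b a"
proof
  fix x
  show "galg_mult G a b x = galg_mult G b a x"
  proof (cases "x \<in> carrier G")
    case True
    have bij: "bij_betw (\<lambda>g. x \<otimes> inv g) (carrier G) (carrier G)"
      by (rule bij_betw_byWitness[where f' = "\<lambda>g. inv g \<otimes> x"])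
        (use True in \<open>auto simp: inv_mult_group m_assoc\<close>, use True in \<open>simp_all add: m_assoc[symmetric]\<close>)
    have "galg_mult G b a x = (\<Sum>g\<in>carrier G. b g * a (inv g \<otimes> x))"
      by (rule galg_mult_eq[OF True])
    also have "\<dots> = (\<Sum>g\<in>carrier G. b (x \<otimes> inv g) * a (inv (x \<otimes> inv g) \<otimes> x))"
      by (rule sum.reindex_bij_betw[OF bij, symmetric])
    also have "\<dots> = (\<Sum>g\<in>carrier G. a g * b (inv g \<otimes> x))"
    proof (rule sum.cong)
      fix g assume g: "g \<in> carrier G"
      have "inv (x \<otimes> inv g) \<otimes> x = g" using g True by (simp add: inv_mult_group m_assoc)
      then show "b (x \<otimes> inv g) * a (inv (x \<otimes> inv g) \<otimes> x) = a g * b (inv g \<otimes> x)"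
        using class_fun_comm[OF assms, of x "inv g"] g True by simp
    qed simp
    also have "\<dots> = galg_mult G a b x" by (rule galg_mult_eq[OF True, symmetric])
    finally show ?thesis by simp
  qed (simp add: galg_mult_outside)
qed

lemma galg_mult_assoc: "galg_mult G (galg_mult G a b) c = galg_mult G a (galg_mult G b c)"
proof
  fix x
  show "galg_mult G (galg_mult G a b) c x = galg_mult G a (galg_mult G b c) x"
  proof (cases "x \<in> carrier G")
    case True
    have "galg_mult G (galg_mult G a b) c x = (\<Sum>g\<in>carrier G. \<Sum>h\<in>carrier G. a h * b (inv h \<otimes> g) * c (inv g \<otimes> x))"
      unfolding galg_mult_eq[OF True] by (rule sum.cong) (auto simp: galg_mult_eq sum_distrib_right)
    also have "\<dots> = (\<Sum>h\<in>carrier G. \<Sum>g\<in>carrier G. a h * b (inv h \<otimes> g) * c (inv g \<otimes> x))"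
      by (rule sum.swap)
    also have "\<dots> = (\<Sum>h\<in>carrier G. a h * galg_mult G b c (inv h \<otimes> x))"
    proof (rule sum.cong)
      fix h assume h: "h \<in> carrier G"
      have bij: "bij_betw (\<lambda>g. h \<otimes> g) (carrier G) (carrier G)"
        by (rule bij_betw_byWitness[where f' = "\<lambda>g. inv h \<otimes> g"])
          (use h in \<open>auto simp: m_assoc[symmetric]\<close>)
      have "(\<Sum>g\<in>carrier G. a h * b (inv h \<otimes> g) * c (inv g \<otimes> x)) =
          (\<Sum>g\<in>carrier G. a h * b (inv h \<otimes> (h \<otimes> g)) * c (inv (h \<otimes> g) \<otimes> x))"
        by (rule sum.reindex_bij_betw[OF bij, symmetric])
      also have "\<dots> = (\<Sum>g\<in>carrier G. a h * (b g * c (inv g \<otimes> (inv h \<otimes> x))))"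
        by (rule sum.cong) (use h True in \<open>auto simp: inv_mult_group m_assoc simp flip: m_assoc[of "inv h" h]\<close>)
      also have "\<dots> = a h * galg_mult G b c (inv h \<otimes> x)"
        using h True by (simp add: galg_mult_eq sum_distrib_left)
      finally show "(\<Sum>g\<in>carrier G. a h * b (inv h \<otimes> g) * c (inv g \<otimes> x)) = a h * galg_mult G b c (inv h \<otimes> x)" .
    qed simp
    also have "\<dots> = galg_mult G a (galg_mult G b c) x" by (rule galg_mult_eq[OF True, symmetric])
    finally show ?thesis .
  qed (simp add: galg_mult_outside)
qed

lemma galg_mult_one:
  assumes "finite (carrier G)" "class_fun b"
  shows "galg_mult G (galg_one G) b = b"
proof
  fix x
  show "galg_mult G (galg_one G) b x = b x"
  proof (cases "x \<in> carrier G")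
    case True
    have "galg_mult G (galg_one G) b x = (\<Sum>g\<in>carrier G. if g = \<one> then b (inv g \<otimes> x) else 0)"
      unfolding galg_mult_eq[OF True] by (rule sum.cong) (auto simp: galg_one_def)
    also have "\<dots> = b x" using assms(1) True by simp
    finally show ?thesis .
  next
    case False
    then show ?thesis using assms(2) by (simp add: galg_mult_outside class_fun_def)
  qed
qed

lemma class_fun_prod: "\<forall>a\<in>set as. class_fun a \<Longrightarrow> class_fun (galg_prod G as)"
  unfolding galg_prod_def by (induction as) (auto intro: class_fun_one class_fun_mult)

lemma galg_prod_Cons: "galg_prod G (a # as) = galg_mult G a (galg_prod G as)"
  by (simp add: galg_prod_def)

lemma galg_prod_append:
  assumes "finite (carrier G)" "\<forall>a\<in>set (as @ bs). class_fun a"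
  shows "galg_prod G (as @ bs) = galg_mult G (galg_prod G as) (galg_prod G bs)"
  using assms(2)
proof (induction as)
  case Nil
  then show ?case using galg_mult_one[OF assms(1) class_fun_prod[of bs]] by (simp add: galg_prod_def)
next
  case (Cons a as)
  then show ?case by (simp add: galg_prod_Cons galg_mult_assoc)
qed

text \<open>Class functions commute, so the head can be moved past any prefix. This makes the
  arbitrary listing of the edges in \<open>vertex_mult\<close> harmless.\<close>

lemma galg_prod_perm:
  assumes "mset as = mset bs" "\<forall>a\<in>set as. class_fun a"
  shows "galg_prod G as = galg_prod G bs"
  using assms
proof (induction as arbitrary: bs)
  case (Cons a as)
  have "a \<in> set bs" using Cons.prems(1) by (metis list.set_intros(1) set_mset_mset)
  then obtain us vs where bs: "bs = us @ a # vs" by (meson split_list)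
  have "mset as = mset (us @ vs)" using Cons.prems(1) bs by simp
  then have IH: "galg_prod G as = galg_prod G (us @ vs)" using Cons by simp
  have cls: "\<forall>b\<in>set us. class_fun b"
    using Cons.prems bs by (metis Un_iff set_append set_mset_mset)
  have a: "class_fun a" using Cons.prems(2) by simp
  have "galg_prod G (us @ a # vs) = galg_mult G a (galg_prod G (us @ vs))"
    using cls
  proof (induction us)
    case (Cons u us)
    have "galg_prod G ((u # us) @ a # vs) = galg_mult G u (galg_mult G a (galg_prod G (us @ vs)))"
      using Cons by (simp add: galg_prod_Cons)
    also have "\<dots> = galg_mult G (galg_mult G u a) (galg_prod G (us @ vs))"
      by (simp only: galg_mult_assoc)
    also have "galg_mult G u a = galg_mult G a u"
      by (rule galg_mult_commute[OF a])
    also have "galg_mult G (galg_mult G a u) (galg_prod G (us @ vs)) = galg_mult G a (galg_prod G ((u # us) @ vs))"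
      by (simp add: galg_mult_assoc galg_prod_Cons)
    finally show ?case .
  qed (simp add: galg_prod_Cons)
  then show ?case using IH bs by (simp add: galg_prod_Cons)
qed simp

end

section \<open>Class sums\<close>

lemma finite_sym_group: "finite (carrier (sym_group d))"
  using finite_permutations[of "{1..d}"] by (simp add: sym_group_def)

lemma class_fun_class_sum: "group.class_fun (sym_group d) (class_sum d \<mu>)"
proof -
  interpret group "sym_group d" by (rule sym_group_is_group)
  have "cycle_type d (k \<circ> g \<circ> inv_into UNIV k) = cycle_type d g \<and> k \<circ> g \<circ> inv_into UNIV k \<in> carrier (sym_group d)"
    if "g \<in> carrier (sym_group d)" "k \<in> carrier (sym_group d)" for g k
    using that cycle_type_conj by (auto simp: sym_group_carrier intro: permutes_compose permutes_inv)
  then show ?thesis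
    unfolding class_fun_def by (auto simp: class_sum_def conj_class_def sym_group_mult)
qed

lemma class_fun_cycle_type:
  assumes "group.class_fun (sym_group d) a" "g \<in> carrier (sym_group d)" "h \<in> carrier (sym_group d)"
    "cycle_type d g = cycle_type d h"
  shows "a g = a h"
proof -
  interpret group "sym_group d" by (rule sym_group_is_group)
  obtain k where k: "k permutes {1..d}" "h = k \<circ> g \<circ> inv_into UNIV k"
    using cycle_type_conjugate[of g d h] assms by (auto simp: sym_group_carrier)
  then have kc: "k \<in> carrier (sym_group d)" by (simp add: sym_group_carrier)
  then have "h = k \<otimes>\<^bsub>sym_group d\<^esub> g \<otimes>\<^bsub>sym_group d\<^esub> inv\<^bsub>sym_group d\<^esub> k"
    using k by (simp add: sym_group_mult)
  then show ?thesis using assms(1,2) kc by (simp add: class_fun_def)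
qed

text \<open>The coefficient of the identity pairs \<open>g\<close> with its inverse, which has the
  same cycle type. The trace form thereby becomes the standard inner product on class
  functions.\<close>

lemma galg_tr_mult:
  assumes "group.class_fun (sym_group d) a" "group.class_fun (sym_group d) b"
  shows "galg_tr (sym_group d) (galg_mult (sym_group d) a b) = (\<Sum>g\<in>carrier (sym_group d). a g * b g)"
proof -
  interpret group "sym_group d" by (rule sym_group_is_group)
  have "b (inv_into UNIV g) = b g" if g: "g \<in> carrier (sym_group d)" for g
    using class_fun_cycle_type[OF assms(2) sym_group_inv_closed[OF g] g] cycle_type_inv g
    by (simp add: sym_group_carrier)
  then have "b (inv\<^bsub>sym_group d\<^esub> g \<otimes>\<^bsub>sym_group d\<^esub> \<one>\<^bsub>sym_group d\<^esub>) = b g"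
    if "g \<in> carrier (sym_group d)" for g
    using that sym_group_inv_closed[OF that] by simp
  then show ?thesis
    unfolding galg_tr_def galg_mult_eq[OF one_closed] by (intro sum.cong) auto
qed

text \<open>Cutting at an edge: the class sums form an orthogonal basis of the class functions.\<close>

lemma class_sum_gluing:
  assumes a: "group.class_fun (sym_group d) a" and b: "group.class_fun (sym_group d) b"
  shows "(\<Sum>\<nu> | integer_partition d \<nu>. 1 / real (card (conj_class d \<nu>)) *
      (galg_tr (sym_group d) (galg_mult (sym_group d) (class_sum d \<nu>) a) *
       galg_tr (sym_group d) (galg_mult (sym_group d) (class_sum d \<nu>) b)))
    = galg_tr (sym_group d) (galg_mult (sym_group d) a b)"
proof -
  let ?G = "carrier (sym_group d)" and ?K = "conj_class d"
  have finK: "finite (?K \<nu>)" for \<nu> using finite_sym_group by (simp add: conj_class_def)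
  have KG: "?K \<nu> \<subseteq> ?G" for \<nu> by (auto simp: conj_class_def)
  have tr: "galg_tr (sym_group d) (galg_mult (sym_group d) (class_sum d \<nu>) f) = (\<Sum>g\<in>?K \<nu>. f g)"
    if "group.class_fun (sym_group d) f" for \<nu> f
  proof -
    have "(\<Sum>g\<in>?G. class_sum d \<nu> g * f g) = (\<Sum>g\<in>?K \<nu>. class_sum d \<nu> g * f g)"
      by (rule sum.mono_neutral_right) (use finite_sym_group KG in \<open>auto simp: class_sum_def\<close>)
    also have "\<dots> = (\<Sum>g\<in>?K \<nu>. f g)" by (rule sum.cong) (auto simp: class_sum_def)
    finally show ?thesis using galg_tr_mult[OF class_fun_class_sum that] by simp
  qed
  \<comment> \<open>On a single class both functions are constant, so the product of the two sums is
    the class size times the sum of the products. For an empty class all sums are 0.\<close>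
  have "1 / real (card (?K \<nu>)) * ((\<Sum>g\<in>?K \<nu>. a g) * (\<Sum>g\<in>?K \<nu>. b g)) = (\<Sum>g\<in>?K \<nu>. a g * b g)" for \<nu>
  proof (cases "?K \<nu> = {}")
    case False
    then obtain x where x: "x \<in> ?K \<nu>" by blast
    have const: "f g = f x" if "group.class_fun (sym_group d) f" "g \<in> ?K \<nu>" for f g
      using class_fun_cycle_type[OF that(1)] that(2) x by (auto simp: conj_class_def)
    have "(\<Sum>g\<in>?K \<nu>. a g) = real (card (?K \<nu>)) * a x" "(\<Sum>g\<in>?K \<nu>. b g) = real (card (?K \<nu>)) * b x"
        "(\<Sum>g\<in>?K \<nu>. a g * b g) = real (card (?K \<nu>)) * (a x * b x)"
      using const[OF a] const[OF b] by (simp_all cong: sum.cong)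
    moreover have "card (?K \<nu>) \<noteq> 0" using False finK by simp
    ultimately show ?thesis by simp
  qed simp
  then have "(\<Sum>\<nu> | integer_partition d \<nu>. 1 / real (card (?K \<nu>)) *
      (galg_tr (sym_group d) (galg_mult (sym_group d) (class_sum d \<nu>) a) *
       galg_tr (sym_group d) (galg_mult (sym_group d) (class_sum d \<nu>) b)))
    = (\<Sum>\<nu> | integer_partition d \<nu>. \<Sum>g\<in>?K \<nu>. a g * b g)"
    unfolding tr[OF a] tr[OF b] by simp
  also have "\<dots> = (\<Sum>\<nu> | integer_partition d \<nu>. \<Sum>g | g \<in> ?G \<and> cycle_type d g = \<nu>. a g * b g)"
    by (simp add: conj_class_def)
  \<comment> \<open>The cycle type of a permutation of \<open>d\<close> points is an integer
    partition of \<open>d\<close>, so the classes exhaust the group.\<close>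
  also have "\<dots> = (\<Sum>g\<in>?G. a g * b g)"
    by (rule sum.group)
      (use finite_sym_group finite_integer_partitions integer_partition_cycle_type in \<open>auto simp: sym_group_carrier\<close>)
  finally show ?thesis using galg_tr_mult[OF a b] by simp
qed

section \<open>Trees as laminar families of clusters\<close>

section \<open>Connectivity, paths and bridges\<close>

text \<open>Connection by walks ignores vertex sets and distinctness, so it composes freely and is
  monotone in the edge set; \<open>is_path\<close> appears only at the interface to the graph
  definitions.\<close>

definition conn :: "'v set set \<Rightarrow> ('v \<times> 'v) set" where
  "conn E = {(u, v). {u, v} \<in> E}\<^sup>*"

lemma conn_refl [simp, intro]: "(u, u) \<in> conn E"
  by (simp add: conn_def)

lemma conn_trans: "(u, v) \<in> conn E \<Longrightarrow> (v, w) \<in> conn E \<Longrightarrow> (u, w) \<in> conn E"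
  by (simp add: conn_def)

lemma conn_sym: "(u, v) \<in> conn E \<Longrightarrow> (v, u) \<in> conn E"
proof -
  have "sym {(u, v). {u, v} \<in> E}"
    by (auto simp: sym_def insert_commute)
  then show "(u, v) \<in> conn E \<Longrightarrow> (v, u) \<in> conn E"
    unfolding conn_def using sym_rtrancl symD by metis
qed

lemma conn_edge: "{u, v} \<in> E \<Longrightarrow> (u, v) \<in> conn E"
  by (simp add: conn_def r_into_rtrancl)

lemma conn_mono: "E \<subseteq> E' \<Longrightarrow> conn E \<subseteq> conn E'"
  unfolding conn_def by (rule rtrancl_mono) auto

lemma conn_step: "(u, v) \<in> conn E \<Longrightarrow> {v, w} \<in> E \<Longrightarrow> (u, w) \<in> conn E"
  using conn_edge conn_trans by metis

lemma conn_induct [consumes 1, case_names refl step]: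
  assumes "(u, v) \<in> conn E" "P u" "\<And>y z. (u, y) \<in> conn E \<Longrightarrow> {y, z} \<in> E \<Longrightarrow> P y \<Longrightarrow> P z"
  shows "P v"
  using assms(1) unfolding conn_def
proof (induction rule: rtrancl_induct)
  case base
  show ?case by (fact assms(2))
next
  case (step y z)
  then show ?case using assms(3)[of y z] by (simp add: conn_def)
qed

lemma conn_closed: "(u, v) \<in> conn E \<Longrightarrow> u \<in> W \<Longrightarrow> (\<And>y z. {y, z} \<in> E \<Longrightarrow> y \<in> W \<Longrightarrow> z \<in> W) \<Longrightarrow> v \<in> W"
  by (induction rule: conn_induct) auto

text \<open>Stop the walk just before its first edge from \<open>R\<close>. With
  \<open>E - {e'}\<close> in place of \<open>E\<close> and \<open>{e}\<close> in place of
  \<open>R\<close> this controls two deleted edges at once, which is how the cluster arguments use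
  it.\<close>

lemma conn_first_exit:
  assumes "(x, y) \<in> conn E"
  shows "(x, y) \<in> conn (E - R) \<or> (\<exists>e\<in>R \<inter> E. \<exists>a\<in>e. (x, a) \<in> conn (E - R))"
  using assms
proof (induction rule: conn_induct)
  case (step y z)
  then show ?case
    by (metis DiffI IntI conn_step insertI1)
qed simp

text \<open>Cut the walk at its last visit to \<open>x\<close>: what follows the next edge uses no
  edge at \<open>x\<close> at all, in particular not that one again. The induction carries this
  stronger form.\<close>

lemma conn_first_edge:
  assumes "(x, y) \<in> conn E" "x \<noteq> y"
  shows "\<exists>z. {x, z} \<in> E \<and> x \<noteq> z \<and> (z, y) \<in> conn (E - {{x, z}})"
proof -
  have "x = y \<or> (\<exists>z. {x, z} \<in> E \<and> x \<noteq> z \<and> (z, y) \<in> conn {e \<in> E. x \<notin> e})"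
    using assms(1)
  proof (induction rule: conn_induct)
    case (step y z)
    show ?case
    proof (cases "x = z \<or> x = y")
      case False
      then obtain w where w: "{x, w} \<in> E" "x \<noteq> w" "(w, y) \<in> conn {e \<in> E. x \<notin> e}"
        using step by blast
      have "{y, z} \<in> {e \<in> E. x \<notin> e}"
        using step False by auto
      then have "(w, z) \<in> conn {e \<in> E. x \<notin> e}"
        by (rule conn_step[OF w(3)])
      then show ?thesis
        using w(1,2) by blast
    qed (use step in auto)
  qed simp
  then obtain z where z: "{x, z} \<in> E" "x \<noteq> z" "(z, y) \<in> conn {e \<in> E. x \<notin> e}"
    using assms by blast
  moreover have "{e \<in> E. x \<notin> e} \<subseteq> E - {{x, z}}"
    by auto
  ultimately show ?thesis
    using conn_mono by blast
qed

lemma is_path_conn: "is_path G u xs v \<Longrightarrow> (u, v) \<in> conn (edges G)"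
proof -
  have "successively (\<lambda>a b. {a, b} \<in> E) xs \<Longrightarrow> xs \<noteq> [] \<Longrightarrow> (hd xs, last xs) \<in> conn E" for E :: "'a set set" and xs
  proof (induction xs rule: induct_list012)
    case (3 x y zs)
    then show ?case
      using conn_edge[of x y E] conn_trans[of x y E] by auto
  qed auto
  then show "is_path G u xs v \<Longrightarrow> (u, v) \<in> conn (edges G)"
    by (auto simp: is_path_def)
qed

lemma conn_is_path:
  assumes "(u, v) \<in> conn (edges G)" "u \<in> verts G" "edges G \<subseteq> Pow (verts G)"
  shows "\<exists>xs. is_path G u xs v"
  using assms(1)
proof (induction rule: conn_induct)
  case refl
  have "is_path G u [u] u"
    using assms(2) by (simp add: is_path_def)
  then show ?case by blast
next
  case (step y z)
  then obtain xs where xs: "is_path G u xs y" by blast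
  \<comment> \<open>If \<open>z\<close> already lies on the path, the path is cut there instead of
    extended, which keeps it distinct.\<close>
  show ?case
  proof (cases "z \<in> set xs")
    case True
    then obtain ys zs where "xs = ys @ z # zs"
      by (meson split_list)
    then have "is_path G u (ys @ [z]) z"
      using xs by (cases ys) (auto simp: is_path_def successively_append_iff successively_Cons hd_append split: if_splits)
    then show ?thesis by blast
  next
    case False
    have "z \<in> verts G" using step assms(3) by blast
    then have "is_path G u (xs @ [z]) z"
      using xs False step by (auto simp: is_path_def successively_append_iff)
    then show ?thesis by blast
  qed
qed

lemma tree_bridge:
  assumes "is_tree G" "{a, b} \<in> edges G"
  shows "(a, b) \<notin> conn (edges G - {{a, b}})"
proof
  assume *: "(a, b) \<in> conn (edges G - {{a, b}})"
  have wf: "wf_graph G" using assms by (simp add: is_tree_def)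
  have sub: "edges G \<subseteq> Pow (verts G)" using wf by (auto simp: wf_graph_def)
  have "a \<noteq> b" using wf assms(2) by (fastforce simp: wf_graph_def doubleton_eq_iff)
  let ?G = "\<lparr>verts = verts G, edges = edges G - {{a, b}}\<rparr>"
  have "\<exists>xs. is_path ?G a xs b"
    using * sub assms(2) by (intro conn_is_path) auto
  then obtain xs where xs: "is_path ?G a xs b" by blast
  obtain x y ys where ys: "xs = x # y # ys"
    using xs \<open>a \<noteq> b\<close> by (cases xs rule: list.exhaust[case_product list.exhaust])
      (auto simp: is_path_def neq_Nil_conv, metis last.simps list.exhaust_sel list.sel(1))
  \<comment> \<open>A path on two vertices would use the deleted edge, so the closed path has at
    least three vertices and is a genuine circuit.\<close>
  have "ys \<noteq> []"
    using xs by (auto simp: is_path_def ys)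
  have "successively (\<lambda>a b. {a, b} \<in> edges G) xs"
    using xs by (auto simp: is_path_def intro: successively_mono)
  then have "is_circuit G xs"
    using xs assms(2) \<open>ys \<noteq> []\<close> unfolding is_circuit_def is_path_def
    by (auto simp: ys insert_commute Suc_le_eq)
  then show False using assms(1) by (auto simp: is_tree_def)
qed

lemma collapse_eq:
  assumes "u \<in> verts G" "S \<subseteq> Pow (verts G)"
  shows "collapse G S u = {v \<in> verts G. (u, v) \<in> conn S}"
proof (intro Set.set_eqI iffI)
  fix v assume "v \<in> collapse G S u"
  then obtain xs where xs: "is_path \<lparr>verts = verts G, edges = S\<rparr> u xs v"
    by (auto simp: collapse_def)
  then have "v \<in> verts G"
    by (auto simp: is_path_def)
  then show "v \<in> {v \<in> verts G. (u, v) \<in> conn S}"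
    using is_path_conn[OF xs] by simp
next
  fix v assume "v \<in> {v \<in> verts G. (u, v) \<in> conn S}"
  then show "v \<in> collapse G S u"
    using conn_is_path[of u v "\<lparr>verts = verts G, edges = S\<rparr>"] assms by (simp add: collapse_def)
qed

text \<open>\<open>{a, b}\<close> is the only edge between \<open>D\<close> and its complement. A
  distinct path crosses it at most once, since a second crossing would revisit \<open>a\<close> and
  \<open>b\<close>; so the two ends of the path decide whether, and in which direction, it is
  crossed.\<close>

lemma path_crossing:
  assumes "\<And>y z. R y z \<Longrightarrow> (y \<in> D) \<noteq> (z \<in> D) \<Longrightarrow> {y, z} = {a, b}" "a \<in> D" "b \<notin> D"
    and "successively R xs" "distinct xs" "xs \<noteq> []"
  shows "((a, b) \<in> set (zip xs (tl xs)) \<longleftrightarrow> hd xs \<in> D \<and> last xs \<notin> D) \<and>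
         ((b, a) \<in> set (zip xs (tl xs)) \<longleftrightarrow> hd xs \<notin> D \<and> last xs \<in> D)"
  using assms(4-6)
proof (induction xs rule: induct_list012)
  case (3 x y zs)
  let ?A = "set (zip (y # zs) (tl (y # zs)))"
  have IH: "((a, b) \<in> ?A \<longleftrightarrow> y \<in> D \<and> last (y # zs) \<notin> D) \<and>
         ((b, a) \<in> ?A \<longleftrightarrow> y \<notin> D \<and> last (y # zs) \<in> D)"
    using 3 by simp
  have sub: "fst ` ?A \<subseteq> set (y # zs)" "snd ` ?A \<subseteq> set (y # zs)"
    by (auto dest: set_zip_leftD set_zip_rightD)
  have x: "x \<notin> set (y # zs)" using 3 by simp
  show ?case
  proof (cases "(x \<in> D) = (y \<in> D)")
    case True
    then have "(x, y) \<noteq> (a, b)" "(x, y) \<noteq> (b, a)"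
      using assms(2,3) by auto
    then show ?thesis using IH True by auto
  next
    case False
    then have "{x, y} = {a, b}"
      using 3 assms(1)[of x y] by simp
    then consider "x = a" "y = b" | "x = b" "y = a"
      by (auto simp: doubleton_eq_iff)
    then show ?thesis
    proof cases
      case 1
      have "(b, a) \<notin> ?A" using sub x 1 by force
      then show ?thesis using IH 1 assms(2,3) by auto
    next
      case 2
      have "(a, b) \<notin> ?A" using sub x 2 by force
      then show ?thesis using IH 2 assms(2,3) by auto
    qed
  qed
qed auto

text \<open>In a distinct list the arc leaving the head is unique. This supplies uniqueness of the
  path named by \<open>THE\<close> in \<open>path_arcs\<close>.\<close>

lemma path_determined_by_arcs:
  assumes "distinct xs" "distinct ys" "xs \<noteq> []" "ys \<noteq> []" "hd xs = hd ys"
    "set (zip xs (tl xs)) = set (zip ys (tl ys))"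
  shows "xs = ys"
  using assms
proof (induction xs arbitrary: ys)
  case (Cons x xs)
  obtain ys' where ys: "ys = x # ys'" using Cons.prems by (cases ys) auto
  show ?case
  proof (cases "xs = [] \<or> ys' = []")
    case True
    then show ?thesis using Cons.prems ys by (cases xs; cases ys') auto
  next
    case False
    then obtain x2 xs2 y2 ys2 where e: "xs = x2 # xs2" "ys' = y2 # ys2"
      by (meson list.exhaust)
    let ?X = "set (zip xs (tl xs))" and ?Y = "set (zip ys' (tl ys'))"
    have eq: "insert (x, x2) ?X = insert (x, y2) ?Y"
      using Cons.prems(6) by (simp add: ys e)
    have nx: "(x, b) \<notin> ?X" "(x, b) \<notin> ?Y" for b
      using Cons.prems(1,2) ys by (auto dest: set_zip_leftD)
    have "(x, x2) \<in> insert (x, y2) ?Y" using eq by (metis insertI1)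
    then have "x2 = y2" using nx(2) by auto
    have "?X = insert (x, x2) ?X - {(x, x2)}" using nx(1)[of x2] by simp
    also have "\<dots> = ?Y" unfolding eq using nx(2)[of x2] \<open>x2 = y2\<close> by simp
    finally have XY: "?X = ?Y" .
    have "xs = ys'"
    proof (rule Cons.IH)
      show "hd xs = hd ys'" using \<open>x2 = y2\<close> e by simp
      show "distinct xs" "distinct ys'" using Cons.prems(1,2) ys by simp_all
      show "xs \<noteq> []" "ys' \<noteq> []" using e by simp_all
    qed (fact XY)
    then show ?thesis using ys by simp
  qed
qed simp

section \<open>Leaf-labelled trees and their clusters\<close>

text \<open>An axiomatisation that is stable under contraction of bounded edges, unlike trivalence.
  The axiom \<open>branching\<close> replaces the degree condition: beyond any edge, even with one
  further edge \<open>e'\<close> deleted, a label can still be reached. It excludes unlabelled dead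
  ends and vertices of degree 2.\<close>

locale labelled_tree =
  fixes V :: "'v set" and E :: "'v set set" and L :: "nat \<Rightarrow> 'v" and n :: nat
  assumes n3: "n \<ge> 3" and finE: "finite E"
    and edge_ends: "e \<in> E \<Longrightarrow> \<exists>a\<in>V. \<exists>b\<in>V. a \<noteq> b \<and> e = {a, b}"
    and connected: "u \<in> V \<Longrightarrow> v \<in> V \<Longrightarrow> (u, v) \<in> conn E"
    and bridge: "{a, b} \<in> E \<Longrightarrow> (a, b) \<notin> conn (E - {{a, b}})"
    and label_in: "i < n \<Longrightarrow> L i \<in> V"
    and label_inj: "inj_on L {..<n}"
    and label_edge: "i < n \<Longrightarrow> \<exists>e. {e' \<in> E. L i \<in> e'} = {e}"
    and branching: "{b, c} \<in> E \<Longrightarrow> \<exists>i<n. (c, L i) \<in> conn (E - {{b, c}, e'})"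
begin

text \<open>The labels on the far side of \<open>e\<close>, seen from the leaf labelled 0.\<close>

definition cluster :: "'v set \<Rightarrow> nat set" where
  "cluster e = {i. i < n \<and> (L 0, L i) \<notin> conn (E - {e})}"

text \<open>The edges on the path from the leaf labelled 0 to \<open>v\<close>.\<close>

definition ancestors :: "'v \<Rightarrow> 'v set set" where
  "ancestors v = {e \<in> E. (L 0, v) \<notin> conn (E - {e})}"

definition lower :: "'v set \<Rightarrow> 'v" where
  "lower e = (SOME v. v \<in> e \<and> (L 0, v) \<notin> conn (E - {e}))"

definition upper :: "'v set \<Rightarrow> 'v" where
  "upper e = (SOME u. e = {u, lower e})"

lemma root_in [simp]: "L 0 \<in> V"
  using label_in n3 by simp

lemma two_sides:
  assumes "{a, b} \<in> E" "v \<in> V"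
  shows "(v, a) \<in> conn (E - {{a, b}}) \<longleftrightarrow> (v, b) \<notin> conn (E - {{a, b}})"
proof -
  have "a \<in> V" using edge_ends[OF assms(1)] by (auto simp: doubleton_eq_iff)
  then have "(v, a) \<in> conn E" using connected assms by blast
  then have "(v, a) \<in> conn (E - {{a, b}}) \<or> (v, b) \<in> conn (E - {{a, b}})"
    using conn_first_exit[of v a E "{{a, b}}"] by auto
  moreover have "\<not> ((v, a) \<in> conn (E - {{a, b}}) \<and> (v, b) \<in> conn (E - {{a, b}}))"
    using bridge[OF assms(1)] conn_trans conn_sym by metis
  ultimately show ?thesis by blast
qed

lemma ends:
  assumes "e \<in> E"
  shows "e = {upper e, lower e}" "upper e \<noteq> lower e" "upper e \<in> V" "lower e \<in> V"
    "(L 0, upper e) \<in> conn (E - {e})" "(L 0, lower e) \<notin> conn (E - {e})"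
proof -
  obtain a b where ab: "a \<in> V" "b \<in> V" "a \<noteq> b" "e = {a, b}"
    using edge_ends[OF assms] by blast
  have "(L 0, a) \<in> conn (E - {e}) \<longleftrightarrow> (L 0, b) \<notin> conn (E - {e})"
    using two_sides[of a b "L 0"] ab assms by simp
  then have "\<exists>v. v \<in> e \<and> (L 0, v) \<notin> conn (E - {e})"
    using ab by blast
  then have lo: "lower e \<in> e" "(L 0, lower e) \<notin> conn (E - {e})"
    unfolding lower_def by (metis (mono_tags, lifting) someI_ex)+
  then have "\<exists>u. e = {u, lower e}"
    using ab by auto
  then show up: "e = {upper e, lower e}"
    unfolding upper_def by (rule someI_ex)
  show "upper e \<noteq> lower e"
    using up ab by (metis doubleton_eq_iff)
  have "upper e \<in> e" "lower e \<in> e"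
    by (subst up, simp)+
  then show "upper e \<in> V" "lower e \<in> V"
    using ab by auto
  show "(L 0, lower e) \<notin> conn (E - {e})" by fact
  have "{upper e, lower e} \<in> E"
    by (subst up[symmetric]) (rule assms)
  note two_sides[OF this root_in]
  then show "(L 0, upper e) \<in> conn (E - {e})"
    using lo(2) by (simp only: up[symmetric] not_True_eq_False not_False_eq_True simp_thms)
qed

lemma mem_ends: "e \<in> E \<Longrightarrow> a \<in> e \<Longrightarrow> a = upper e \<or> a = lower e"
  using ends(1)[of e] by blast

lemma conn_ends:
  assumes "e \<in> E" "e \<noteq> e'"
  shows "(upper e, lower e) \<in> conn (E - {e'})"
proof -
  have "{upper e, lower e} \<in> E - {e'}"
    using ends(1)[OF assms(1)] assms by simp
  then show ?thesis by (rule conn_edge)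
qed

text \<open>Deleting \<open>e\<close> leaves two sides, and membership of \<open>e\<close> in
  \<open>ancestors v\<close> records the side of \<open>v\<close>. Questions of separation become
  comparisons of ancestor sets.\<close>

lemma separated_iff:
  assumes "x \<in> V" "y \<in> V" "e \<in> E"
  shows "(x, y) \<in> conn (E - {e}) \<longleftrightarrow> (e \<in> ancestors x \<longleftrightarrow> e \<in> ancestors y)"
proof -
  have "(v, lower e) \<in> conn (E - {e}) \<longleftrightarrow> e \<in> ancestors v"
       "(L 0, v) \<in> conn (E - {e}) \<longleftrightarrow> e \<notin> ancestors v" if "v \<in> V" for v
  proof -
    have e: "{upper e, lower e} = e" "{upper e, lower e} \<in> E"
      using ends(1)[OF assms(3)] assms(3) by simp_all
    have *: "(v, lower e) \<in> conn (E - {e}) \<longleftrightarrow> (v, upper e) \<notin> conn (E - {e})"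
      using two_sides[OF e(2) that] unfolding e(1) by blast
    have "(v, upper e) \<in> conn (E - {e}) \<longleftrightarrow> (L 0, v) \<in> conn (E - {e})"
      using ends(5)[OF assms(3)] conn_trans conn_sym by metis
    then show "(v, lower e) \<in> conn (E - {e}) \<longleftrightarrow> e \<in> ancestors v"
       "(L 0, v) \<in> conn (E - {e}) \<longleftrightarrow> e \<notin> ancestors v"
      using * assms(3) by (auto simp: ancestors_def)
  qed
  then show ?thesis
    using assms conn_trans conn_sym by metis
qed

lemma ancestors_sub: "ancestors v \<subseteq> E"
  by (auto simp: ancestors_def)

lemma ancestors_root [simp]: "ancestors (L 0) = {}"
  by (simp add: ancestors_def)

lemma lower_ancestor: "e \<in> E \<Longrightarrow> e \<in> ancestors (lower e)"
  using ends(6) by (simp add: ancestors_def)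

lemma upper_ancestor: "e \<in> E \<Longrightarrow> e \<notin> ancestors (upper e)"
  using ends(5) by (simp add: ancestors_def)

lemma ancestors_lower:
  assumes "e \<in> E"
  shows "ancestors (lower e) = insert e (ancestors (upper e))"
proof (intro Set.set_eqI)
  fix e'
  show "e' \<in> ancestors (lower e) \<longleftrightarrow> e' \<in> insert e (ancestors (upper e))"
  proof (cases "e' = e \<or> e' \<notin> E")
    case True
    then show ?thesis using lower_ancestor[OF assms] ancestors_sub[of "lower e"] ancestors_sub[of "upper e"] assms by blast
  next
    case False
    then have "(upper e, lower e) \<in> conn (E - {e'})"
      using conn_ends[of e e'] assms by blast
    then show ?thesis
      using separated_iff[of "upper e" "lower e" e'] ends(3,4)[OF assms] False by blast
  qed
qed

lemma mem_cluster_iff: "i < n \<Longrightarrow> e \<in> E \<Longrightarrow> i \<in> cluster e \<longleftrightarrow> e \<in> ancestors (L i)"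
  by (auto simp: cluster_def ancestors_def)

lemma cluster_less: "i \<in> cluster e \<Longrightarrow> i < n"
  by (simp add: cluster_def)

lemma cluster_0 [simp]: "0 \<notin> cluster e"
  by (simp add: cluster_def)

text \<open>The first edge of a walk between two distinct vertices separates them, because it is a
  bridge; so it lies in exactly one of the two ancestor sets.\<close>

lemma ancestors_inj: "inj_on ancestors V"
proof (rule inj_onI, rule ccontr)
  fix x y assume xy: "x \<in> V" "y \<in> V" "ancestors x = ancestors y" "x \<noteq> y"
  then obtain z where z: "{x, z} \<in> E" "x \<noteq> z" "(z, y) \<in> conn (E - {{x, z}})"
    using conn_first_edge[OF connected] by blast
  have "(x, y) \<in> conn (E - {{x, z}})"
    using separated_iff[of x y "{x, z}"] xy z by blast
  then have "(x, z) \<in> conn (E - {{x, z}})"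
    using z conn_trans conn_sym by metis
  then show False using bridge z by blast
qed

text \<open>Edges are recognised by ancestor sets alone, which allows them to be transported between
  trees. By \<open>separated_iff\<close> only the deletion of \<open>e\<close> parts
  \<open>x\<close> from \<open>y\<close>. A walk from \<open>x\<close> to \<open>y\<close> that
  avoids another edge \<open>e'\<close> must therefore use \<open>e\<close>, so \<open>x\<close> and
  \<open>upper e\<close> lie on the same side of \<open>e'\<close>.\<close>

lemma adjacent:
  assumes "x \<in> V" "y \<in> V" "ancestors y = insert e (ancestors x)" "e \<notin> ancestors x"
  shows "x = upper e" "y = lower e"
proof -
  have e: "e \<in> E" using assms(3) ancestors_sub by blast
  have sep: "(x, y) \<notin> conn (E - {e})"
    using separated_iff[OF assms(1,2) e] assms by simp
  have "ancestors x = ancestors (upper e)"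
  proof (intro Set.set_eqI)
    fix e'
    show "e' \<in> ancestors x \<longleftrightarrow> e' \<in> ancestors (upper e)"
    proof (cases "e' = e \<or> e' \<notin> E")
      case True
      then show ?thesis using assms upper_ancestor[OF e] ancestors_sub by blast
    next
      case False
      then have "(x, y) \<in> conn (E - {e'})"
        using separated_iff[OF assms(1,2), of e'] assms by auto
      then have "(x, y) \<in> conn (E - {e'} - {e}) \<or> (\<exists>a\<in>e. (x, a) \<in> conn (E - {e'} - {e}))"
        using conn_first_exit[of x y "E - {e'}" "{e}"] by auto
      moreover have "conn (E - {e'} - {e}) \<subseteq> conn (E - {e})" "conn (E - {e'} - {e}) \<subseteq> conn (E - {e'})"
        by (intro conn_mono; blast)+
      ultimately obtain a where a: "a \<in> e" "(x, a) \<in> conn (E - {e'})"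
        using sep by blast
      have "a = upper e \<or> a = lower e"
        using a(1) mem_ends[OF e] by blast
      then have "(x, upper e) \<in> conn (E - {e'})"
        using a conn_ends[of e e'] e False conn_trans conn_sym by metis
      then show ?thesis
        using separated_iff[of x "upper e" e'] assms(1) ends(3)[OF e] False by blast
    qed
  qed
  then show "x = upper e"
    using ancestors_inj assms(1) ends(3)[OF e] by (simp add: inj_on_eq_iff)
  then have "ancestors y = ancestors (lower e)"
    using ancestors_lower[OF e] assms(3) by simp
  then show "y = lower e"
    using ancestors_inj assms(2) ends(4)[OF e] by (simp add: inj_on_eq_iff)
qed

lemma nonroot_lower:
  assumes "x \<in> V" "x \<noteq> L 0"
  shows "\<exists>e\<in>E. x = lower e"
proof -
  obtain z where z: "{x, z} \<in> E" "x \<noteq> z" "(z, L 0) \<in> conn (E - {{x, z}})"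
    using conn_first_edge[OF connected] assms root_in by blast
  let ?e = "{x, z}"
  have e: "?e = {upper ?e, lower ?e}" "(L 0, lower ?e) \<notin> conn (E - {?e})"
    using ends(1,6)[OF z(1)] by blast+
  then have "z \<noteq> lower ?e"
    using z(3) conn_sym by metis
  then have "x = lower ?e"
    using e(1) z(2) by (auto simp: doubleton_eq_iff)
  then show ?thesis using z(1) by blast
qed

text \<open>Turns the order of the tree into inclusion of clusters. If a label below
  \<open>e\<close> were not below \<open>e'\<close>, a walk from the root to it avoiding
  \<open>e'\<close> would put \<open>lower e\<close> on the root side of \<open>e'\<close>.
  Conversely, \<open>branching\<close> provides a label below \<open>e\<close> that is joined to
  \<open>lower e\<close> without using \<open>e'\<close>.\<close>

lemma ancestor_lower_iff:
  assumes "e \<in> E" "e' \<in> E"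
  shows "e' \<in> ancestors (lower e) \<longleftrightarrow> cluster e \<subseteq> cluster e'"
proof
  assume *: "e' \<in> ancestors (lower e)"
  show "cluster e \<subseteq> cluster e'"
  proof (cases "e = e'")
    case False
    show ?thesis
    proof (rule subsetI, rule ccontr)
      fix i assume i: "i \<in> cluster e" "i \<notin> cluster e'"
      then have n: "i < n" by (simp add: cluster_less)
      then have "(L 0, L i) \<in> conn (E - {e'})"
        using i by (simp add: cluster_def)
      then have "(L 0, L i) \<in> conn (E - {e'} - {e}) \<or> (\<exists>a\<in>e. (L 0, a) \<in> conn (E - {e'} - {e}))"
        using conn_first_exit[of "L 0" "L i" "E - {e'}" "{e}"] by auto
      moreover have "conn (E - {e'} - {e}) \<subseteq> conn (E - {e})" "conn (E - {e'} - {e}) \<subseteq> conn (E - {e'})"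
        by (intro conn_mono; blast)+
      ultimately obtain a where a: "a \<in> e" "(L 0, a) \<in> conn (E - {e'})"
        using i by (auto simp: cluster_def)
      have "a = upper e \<or> a = lower e"
        using a(1) mem_ends[OF assms(1)] by blast
      then have "(L 0, lower e) \<in> conn (E - {e'})"
        using a conn_ends[of e e'] assms False conn_trans by metis
      then show False using * by (simp add: ancestors_def)
    qed
  qed simp
next
  assume *: "cluster e \<subseteq> cluster e'"
  have e: "{upper e, lower e} = e" "{upper e, lower e} \<in> E"
    using ends(1)[OF assms(1)] assms(1) by simp_all
  obtain i where i: "i < n" "(lower e, L i) \<in> conn (E - {e, e'})"
    using branching[OF e(2), of e'] unfolding e(1) by blast
  moreover have "conn (E - {e, e'}) \<subseteq> conn (E - {e})" "conn (E - {e, e'}) \<subseteq> conn (E - {e'})"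
    by (intro conn_mono; blast)+
  ultimately have c: "(lower e, L i) \<in> conn (E - {e})" "(lower e, L i) \<in> conn (E - {e'})"
    by blast+
  have "e \<in> ancestors (L i)"
    using c(1) separated_iff[of "lower e" "L i" e] lower_ancestor assms ends(4) label_in i by blast
  then have "i \<in> cluster e'"
    using * mem_cluster_iff i assms by blast
  then show "e' \<in> ancestors (lower e)"
    using c(2) separated_iff[of "lower e" "L i" e'] mem_cluster_iff assms ends(4) label_in i by blast
qed

text \<open>Edges with equal clusters would each lie above the lower end of the other. A walk from
  the root to \<open>upper e\<close> that avoids \<open>e\<close> either avoids \<open>e'\<close> as
  well or reaches \<open>e'\<close> without \<open>e\<close>; each case contradicts one of these two
  relations.\<close>

lemma cluster_inj: "inj_on cluster E"
proof (rule inj_onI, rule ccontr)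
  fix e e' assume e: "e \<in> E" "e' \<in> E" "cluster e = cluster e'" "e \<noteq> e'"
  have anc: "e' \<in> ancestors (lower e)" "e \<in> ancestors (lower e')"
    using ancestor_lower_iff e by blast+
  have "(L 0, upper e) \<in> conn (E - {e} - {e'}) \<or> (\<exists>a\<in>e'. (L 0, a) \<in> conn (E - {e} - {e'}))"
    using conn_first_exit[of "L 0" "upper e" "E - {e}" "{e'}"] ends(5)[OF e(1)] by auto
  moreover have "conn (E - {e} - {e'}) \<subseteq> conn (E - {e})" "conn (E - {e} - {e'}) \<subseteq> conn (E - {e'})"
    by (intro conn_mono; blast)+
  ultimately have "(L 0, upper e) \<in> conn (E - {e'}) \<or> (\<exists>a\<in>e'. (L 0, a) \<in> conn (E - {e}))"
    by blast
  moreover have "(L 0, upper e) \<notin> conn (E - {e'})"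
    using anc(1) conn_ends[of e e'] e conn_trans[of "L 0" "upper e" "E - {e'}" "lower e"]
    by (auto simp: ancestors_def)
  moreover have "(L 0, lower e') \<notin> conn (E - {e})"
    using anc(2) by (auto simp: ancestors_def)
  moreover have "(L 0, upper e') \<notin> conn (E - {e})"
    using anc(2) conn_ends[of e' e] e conn_trans[of "L 0" "upper e'" "E - {e}" "lower e'"]
    by (auto simp: ancestors_def)
  ultimately show False
    using mem_ends[OF e(2)] by metis
qed

text \<open>Walk from a common label \<open>L i\<close> to \<open>lower e\<close> without crossing
  \<open>e\<close>. If \<open>e'\<close> is not met, then \<open>lower e\<close> lies below
  \<open>e'\<close>; if it is met, the end reached first must be \<open>lower e'\<close>, which
  therefore lies below \<open>e\<close>.\<close>

lemma cluster_laminar: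
  assumes "e \<in> E" "e' \<in> E" "cluster e \<inter> cluster e' \<noteq> {}"
  shows "cluster e \<subseteq> cluster e' \<or> cluster e' \<subseteq> cluster e"
proof -
  obtain i where i: "i \<in> cluster e" "i \<in> cluster e'" "i < n"
    using assms(3) cluster_less by blast
  then have anc: "e \<in> ancestors (L i)" "e' \<in> ancestors (L i)"
    using mem_cluster_iff assms by blast+
  have "(L i, lower e) \<in> conn (E - {e})"
    using separated_iff[of "L i" "lower e" e] anc lower_ancestor assms ends(4) label_in i by blast
  then have "(L i, lower e) \<in> conn (E - {e} - {e'}) \<or> (\<exists>a\<in>e'. (L i, a) \<in> conn (E - {e} - {e'}))"
    using conn_first_exit[of "L i" "lower e" "E - {e}" "{e'}"] by auto
  moreover have "conn (E - {e} - {e'}) \<subseteq> conn (E - {e})" "conn (E - {e} - {e'}) \<subseteq> conn (E - {e'})"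
    by (intro conn_mono; blast)+
  ultimately consider "(L i, lower e) \<in> conn (E - {e'})"
    | a where "a \<in> e'" "(L i, a) \<in> conn (E - {e})" "(L i, a) \<in> conn (E - {e'})"
    by blast
  then show ?thesis
  proof cases
    case 1
    then have "e' \<in> ancestors (lower e)"
      using separated_iff[OF label_in[OF i(3)] ends(4)[OF assms(1)] assms(2)] anc by blast
    then show ?thesis
      using ancestor_lower_iff[OF assms(1,2)] by blast
  next
    case 2
    have "a \<noteq> upper e'"
      using separated_iff[OF label_in[OF i(3)] ends(3)[OF assms(2)] assms(2)] anc
        upper_ancestor[OF assms(2)] 2(3) by blast
    then have "(L i, lower e') \<in> conn (E - {e})"
      using mem_ends[OF assms(2) 2(1)] 2(2) by blast
    then have "e \<in> ancestors (lower e')"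
      using separated_iff[OF label_in[OF i(3)] ends(4)[OF assms(2)] assms(1)] anc by blast
    then show ?thesis
      using ancestor_lower_iff[OF assms(2,1)] by blast
  qed
qed

lemma cluster_nonempty: "e \<in> E \<Longrightarrow> cluster e \<noteq> {}"
proof
  assume e: "e \<in> E" "cluster e = {}"
  have e': "{upper e, lower e} = e" "{upper e, lower e} \<in> E"
    using ends(1)[OF e(1)] e(1) by simp_all
  obtain i where i: "i < n" "(lower e, L i) \<in> conn (E - {e, e})"
    using branching[OF e'(2), of e] unfolding e'(1) by blast
  then have "e \<in> ancestors (L i)"
    using separated_iff[of "lower e" "L i" e] lower_ancestor e ends(4) label_in by simp
  then show False using mem_cluster_iff i e by blast
qed

text \<open>Ancestor sets written as families of label sets, so that vertices of different trees can
  be compared.\<close>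

definition code :: "'v \<Rightarrow> nat set set" where
  "code v = cluster ` ancestors v"

lemma code_inj: "inj_on code V"
proof (rule inj_onI)
  fix x y assume "x \<in> V" "y \<in> V" "code x = code y"
  then show "x = y"
    using inj_on_image_eq_iff[OF cluster_inj ancestors_sub ancestors_sub] ancestors_inj
    by (simp add: code_def inj_on_eq_iff)
qed

lemma code_lower:
  assumes "e \<in> E"
  shows "code (lower e) = {C \<in> cluster ` E. cluster e \<subseteq> C}"
  using ancestor_lower_iff[OF assms] ancestors_sub[of "lower e"] unfolding code_def by blast

text \<open>Every vertex other than the root is \<open>lower e\<close> for some edge
  \<open>e\<close>, so the set of codes is a function of the cluster family alone.\<close>

lemma codes: "code ` V = insert {} ((\<lambda>D. {C \<in> cluster ` E. D \<subseteq> C}) ` cluster ` E)"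
proof -
  have "V = insert (L 0) (lower ` E)"
    using nonroot_lower ends(4) root_in by blast
  then have "code ` V = insert (code (L 0)) ((\<lambda>e. code (lower e)) ` E)"
    by (simp add: image_image)
  also have "\<dots> = insert {} ((\<lambda>e. {C \<in> cluster ` E. cluster e \<subseteq> C}) ` E)"
    using code_lower by (simp add: code_def[of "L 0"])
  finally show ?thesis by (simp add: image_image)
qed

end

text \<open>\<open>F\<close> matches vertices with the same code. It respects labels by
  \<open>mem_cluster_iff\<close>, and edges by \<open>adjacent\<close>, since the ends of an edge
  are characterised by their ancestor sets.\<close>

lemma labelled_tree_iso:
  assumes T: "labelled_tree V E L n" and T': "labelled_tree V' E' L' n"
    and eq: "labelled_tree.cluster E L n ` E = labelled_tree.cluster E' L' n ` E'"
  shows "\<exists>F. bij_betw F V V' \<and> bij_betw ((`) F) E E' \<and> (\<forall>i<n. F (L i) = L' i) \<and>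
    (\<forall>e\<in>E. labelled_tree.cluster E' L' n (F ` e) = labelled_tree.cluster E L n e)"
proof -
  interpret T: labelled_tree V E L n by fact
  interpret T': labelled_tree V' E' L' n by fact
  define F where "F = inv_into V' T'.code \<circ> T.code"
  have codes: "T.code ` V = T'.code ` V'"
    unfolding T.codes T'.codes eq ..
  have "bij_betw T.code V (T.code ` V)" "bij_betw T'.code V' (T.code ` V)"
    unfolding bij_betw_def using T.code_inj T'.code_inj codes by auto
  then have bij: "bij_betw F V V'"
    unfolding F_def by (intro bij_betw_trans bij_betw_inv_into)
  have FV: "F v \<in> V'" if "v \<in> V" for v
    using bij that by (auto simp: bij_betw_def)
  have code_F: "T'.code (F v) = T.code v" if "v \<in> V" for v
    using that codes by (auto simp: F_def intro!: f_inv_into_f)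
  have anc: "e' \<in> T'.ancestors (F v) \<longleftrightarrow> e \<in> T.ancestors v"
    if "v \<in> V" "e \<in> E" "e' \<in> E'" "T'.cluster e' = T.cluster e" for v e e'
  proof -
    have "e \<in> T.ancestors v \<longleftrightarrow> T.cluster e \<in> T.code v"
      using inj_on_image_mem_iff[OF T.cluster_inj that(2) T.ancestors_sub[of v]] unfolding T.code_def by blast
    moreover have "e' \<in> T'.ancestors (F v) \<longleftrightarrow> T'.cluster e' \<in> T'.code (F v)"
      using inj_on_image_mem_iff[OF T'.cluster_inj that(3) T'.ancestors_sub[of "F v"]] unfolding T'.code_def by blast
    ultimately show ?thesis
      by (simp only: code_F[OF that(1)] that(4))
  qed
  have corr: "\<exists>e\<in>E. T'.cluster e' = T.cluster e" if "e' \<in> E'" for e'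
    using eq that by (metis imageE imageI)
  have corr': "\<exists>e'\<in>E'. T'.cluster e' = T.cluster e" if "e \<in> E" for e
    using eq that by (metis imageE imageI)
  have leaf: "F (L i) = L' i" if i: "i < n" for i
  proof -
    have "e' \<in> T'.ancestors (F (L i)) \<longleftrightarrow> e' \<in> T'.ancestors (L' i)" if e': "e' \<in> E'" for e'
    proof -
      obtain e where e: "e \<in> E" "T'.cluster e' = T.cluster e" using corr e' by blast
      then show ?thesis
        using anc[OF T.label_in[OF i] e(1) e' e(2)] T.mem_cluster_iff[OF i e(1)] T'.mem_cluster_iff[OF i e'] by simp
    qed
    then have "T'.ancestors (F (L i)) = T'.ancestors (L' i)"
      using T'.ancestors_sub by blast
    then show ?thesis
      using T'.ancestors_inj FV[OF T.label_in[OF i]] T'.label_in[OF i] by (simp add: inj_on_eq_iff)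
  qed
  have edge: "F ` e = e'" if e: "e \<in> E" "e' \<in> E'" "T'.cluster e' = T.cluster e" for e e'
  proof -
    have up: "T.upper e \<in> V" "T.lower e \<in> V" "e = {T.upper e, T.lower e}"
      using T.ends[OF e(1)] by blast+
    have "f' \<in> T'.ancestors (F (T.lower e)) \<longleftrightarrow> f' \<in> insert e' (T'.ancestors (F (T.upper e)))"
      if f': "f' \<in> E'" for f'
    proof -
      obtain f where f: "f \<in> E" "T'.cluster f' = T.cluster f" using corr f' by blast
      have "f = e \<longleftrightarrow> f' = e'"
        using f f' e T.cluster_inj T'.cluster_inj by (metis inj_onD)
      then show ?thesis
        using anc[OF up(1) f(1) f' f(2)] anc[OF up(2) f(1) f' f(2)] T.ancestors_lower[OF e(1)] by simp
    qed
    then have "T'.ancestors (F (T.lower e)) = insert e' (T'.ancestors (F (T.upper e)))"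
      using T'.ancestors_sub e(2) by blast
    moreover have "e' \<notin> T'.ancestors (F (T.upper e))"
      using anc[OF up(1) e] T.upper_ancestor[OF e(1)] by simp
    ultimately have "F (T.upper e) = T'.upper e'" "F (T.lower e) = T'.lower e'"
      using T'.adjacent[OF FV[OF up(1)] FV[OF up(2)]] by blast+
    then have "F ` {T.upper e, T.lower e} = {T'.upper e', T'.lower e'}"
      by simp
    then show ?thesis
      unfolding up(3)[symmetric] T'.ends(1)[OF e(2), symmetric] .
  qed
  have cl: "F ` e \<in> E'" "T'.cluster (F ` e) = T.cluster e" if "e \<in> E" for e
    using corr'[OF that] edge[OF that] by metis+
  have "bij_betw ((`) F) E E'"
    unfolding bij_betw_def
  proof
    show "inj_on ((`) F) E"
      using cl(2) T.cluster_inj by (metis inj_on_def)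
    show "(`) F ` E = E'"
    proof
      show "(`) F ` E \<subseteq> E'" using cl(1) by blast
      show "E' \<subseteq> (`) F ` E" using corr edge by (metis image_eqI subsetI)
    qed
  qed
  then show ?thesis using bij leaf cl by blast
qed

section \<open>Double ratios in terms of clusters\<close>

text \<open>The contribution of an edge of length 1 with cluster \<open>C\<close> to a double ratio.\<close>

definition quad_sign :: "nat set \<Rightarrow> quad \<Rightarrow> real" where
  "quad_sign C = (\<lambda>((w, x), (y, z)).
     (of_bool (w \<in> C) - of_bool (x \<in> C)) * (of_bool (y \<in> C) - of_bool (z \<in> C)))"

lemma quad_sign_range: "quad_sign C q \<in> {-1, 0, 1}"
  by (cases q) (auto simp: quad_sign_def split: prod.splits)

text \<open>A finite check on four labels. It is the reason why the two paths of a double ratio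
  agree or disagree along their entire intersection, and later it excludes cancellation between
  edges of one tree.\<close>

lemma quad_sign_compatible:
  assumes "C \<inter> D = {} \<or> C \<subseteq> D \<or> D \<subseteq> C" "quad_sign C q = 1"
  shows "quad_sign D q \<noteq> -1"
proof -
  obtain w x y z where q: "q = ((w, x), (y, z))"
    by (metis surj_pair)
  have "\<not> (quad_sign C q = 1 \<and> quad_sign D q = -1)"
    using assms(1) unfolding q quad_sign_def
    by (auto simp: of_bool_def split: if_splits)
  then show ?thesis using assms(2) by blast
qed

lemma successively_zip: "successively R xs \<Longrightarrow> (y, z) \<in> set (zip xs (tl xs)) \<Longrightarrow> R y z"
  by (induction xs rule: induct_list012) auto

context labelled_tree
begin

text \<open>The arcs expected on the path from \<open>w\<close> to \<open>x\<close>: it climbs the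
  edges above \<open>w\<close> only and descends those above \<open>x\<close> only.\<close>

definition leaf_arcs :: "nat \<Rightarrow> nat \<Rightarrow> ('v \<times> 'v) set" where
  "leaf_arcs w x = {(lower e, upper e) | e. e \<in> E \<and> w \<in> cluster e \<and> x \<notin> cluster e} \<union>
                   {(upper e, lower e) | e. e \<in> E \<and> x \<in> cluster e \<and> w \<notin> cluster e}"

lemma edge_in_V: "{y, z} \<in> E \<Longrightarrow> y \<in> V \<and> z \<in> V"
  using edge_ends[of "{y, z}"] by (auto simp: doubleton_eq_iff)

text \<open>The vertices below an edge \<open>e\<close> are joined to the other vertices by
  \<open>e\<close> alone, so \<open>path_crossing\<close> applies to each edge separately.\<close>

lemma path_arcs_eq:
  assumes G: "verts G = V" "edges G = E" and xs: "is_path G (L w) xs (L x)" and wx: "w < n" "x < n"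
  shows "set (zip xs (tl xs)) = leaf_arcs w x"
proof -
  let ?A = "set (zip xs (tl xs))"
  have succ: "successively (\<lambda>a b. {a, b} \<in> E) xs" and xs': "distinct xs" "xs \<noteq> []"
      "hd xs = L w" "last xs = L x"
    using xs G by (auto simp: is_path_def)
  have cross: "((lower e, upper e) \<in> ?A \<longleftrightarrow> w \<in> cluster e \<and> x \<notin> cluster e) \<and>
      ((upper e, lower e) \<in> ?A \<longleftrightarrow> w \<notin> cluster e \<and> x \<in> cluster e)" if e: "e \<in> E" for e
  proof -
    have *: "{y, z} = {lower e, upper e}"
      if "{y, z} \<in> E" "(y \<in> {y. e \<in> ancestors y}) \<noteq> (z \<in> {y. e \<in> ancestors y})" for y z
    proof (rule ccontr)
      assume "{y, z} \<noteq> {lower e, upper e}"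
      then have "{y, z} \<noteq> e" using ends(1)[OF e] by (metis insert_commute)
      then have "(y, z) \<in> conn (E - {e})" using that by (intro conn_edge) auto
      then show False
        using separated_iff[of y z e] edge_in_V[OF that(1)] e that by auto
    qed
    show ?thesis
      using path_crossing[where R="\<lambda>a b. {a, b} \<in> E" and D="{y. e \<in> ancestors y}", OF * _ _ succ xs'(1,2)]
        lower_ancestor[OF e] upper_ancestor[OF e] mem_cluster_iff[OF _ e] wx xs'(3,4) by simp
  qed
  show ?thesis
  proof (rule subset_antisym; rule subrelI)
    fix y z assume yz: "(y, z) \<in> ?A"
    then obtain e where e: "e \<in> E" "{y, z} = e"
      using successively_zip[OF succ] by blast
    have "{y, z} = {upper e, lower e}"
      by (rule trans[OF e(2) ends(1)[OF e(1)]])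
    then have "y = lower e \<and> z = upper e \<or> y = upper e \<and> z = lower e"
      by (auto simp: doubleton_eq_iff)
    then show "(y, z) \<in> leaf_arcs w x"
      using cross[OF e(1)] yz e(1) unfolding leaf_arcs_def by blast
  next
    fix y z assume "(y, z) \<in> leaf_arcs w x"
    then show "(y, z) \<in> ?A"
      unfolding leaf_arcs_def using cross by blast
  qed
qed

lemma path_arcs_mgraph:
  assumes G: "verts (mgr M) = V" "edges (mgr M) = E"
    and L: "leaf_vertex M w = L w" "leaf_vertex M x = L x" and wx: "w < n" "x < n"
  shows "path_arcs M w x = leaf_arcs w x"
proof -
  have "\<exists>xs. is_path (mgr M) (L w) xs (L x)"
    using conn_is_path[of "L w" "L x" "mgr M"] connected[of "L w" "L x"] label_in wx G edge_ends
    by (metis Pow_iff empty_subsetI insert_subset subsetI)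
  then obtain xs where xs: "is_path (mgr M) (L w) xs (L x)" by blast
  moreover have "ys = xs" if "is_path (mgr M) (L w) ys (L x)" for ys
    using path_determined_by_arcs[of ys xs] path_arcs_eq[OF G _ wx] xs that
    by (auto simp: is_path_def)
  ultimately have "(THE xs. is_path (mgr M) (L w) xs (L x)) = xs"
    by (intro the_equality)
  then show ?thesis
    using path_arcs_eq[OF G xs wx] by (simp add: path_arcs_def L)
qed

lemma leaf_arcs_edges:
  "(\<lambda>(u, v). {u, v}) ` leaf_arcs w x = {e \<in> E. (w \<in> cluster e) \<noteq> (x \<in> cluster e)}" (is "?l = ?r")
proof
  show "?l \<subseteq> ?r"
  proof
    fix f assume "f \<in> ?l"
    then obtain e where e: "e \<in> E" "f = {lower e, upper e}" "(w \<in> cluster e) \<noteq> (x \<in> cluster e)"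
      by (auto simp: leaf_arcs_def)
    then have "f = e" using ends(1)[OF e(1)] by (metis insert_commute)
    then show "f \<in> ?r" using e by simp
  qed
  show "?r \<subseteq> ?l"
  proof
    fix e assume e: "e \<in> ?r"
    then have "(lower e, upper e) \<in> leaf_arcs w x \<or> (upper e, lower e) \<in> leaf_arcs w x"
      unfolding leaf_arcs_def by blast
    moreover have "{lower e, upper e} = e" "{upper e, lower e} = e"
      using ends(1)[of e] e by (auto simp: insert_commute)
    ultimately show "e \<in> ?l"
      by (metis (mono_tags, lifting) case_prod_conv image_eqI)
  qed
qed

lemma arcs_disagree:
  "(leaf_arcs w x)\<inverse> \<inter> leaf_arcs y z = {} \<longleftrightarrow> (\<forall>e\<in>E. quad_sign (cluster e) ((w, x), (y, z)) \<noteq> -1)"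
proof -
  have or: "e = e'" if "e \<in> E" "e' \<in> E" "{lower e, upper e} = {lower e', upper e'}" for e e'
    using ends(1) that by (metis insert_commute)
  have sg: "quad_sign C ((w, x), (y, z)) = -1 \<longleftrightarrow>
      (w \<in> C \<and> x \<notin> C \<and> z \<in> C \<and> y \<notin> C) \<or> (x \<in> C \<and> w \<notin> C \<and> y \<in> C \<and> z \<notin> C)" for C
    by (auto simp: quad_sign_def of_bool_def)
  show ?thesis
  proof
    assume l: "(leaf_arcs w x)\<inverse> \<inter> leaf_arcs y z = {}"
    show "\<forall>e\<in>E. quad_sign (cluster e) ((w, x), (y, z)) \<noteq> -1"
    proof
      fix e assume e: "e \<in> E"
      have "(upper e, lower e) \<notin> (leaf_arcs w x)\<inverse> \<inter> leaf_arcs y z" "(lower e, upper e) \<notin> (leaf_arcs w x)\<inverse> \<inter> leaf_arcs y z"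
        using l by auto
      then show "quad_sign (cluster e) ((w, x), (y, z)) \<noteq> -1"
        unfolding sg leaf_arcs_def using e by blast
    qed
  next
    assume r: "\<forall>e\<in>E. quad_sign (cluster e) ((w, x), (y, z)) \<noteq> -1"
    show "(leaf_arcs w x)\<inverse> \<inter> leaf_arcs y z = {}"
    proof (rule ccontr)
      assume "(leaf_arcs w x)\<inverse> \<inter> leaf_arcs y z \<noteq> {}"
      then obtain a b where ab: "(b, a) \<in> leaf_arcs w x" "(a, b) \<in> leaf_arcs y z"
        by auto
      obtain e where e: "e \<in> E" "b = lower e \<and> a = upper e \<and> w \<in> cluster e \<and> x \<notin> cluster e \<or>
          b = upper e \<and> a = lower e \<and> x \<in> cluster e \<and> w \<notin> cluster e"
        using ab(1) unfolding leaf_arcs_def by blast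
      obtain e' where e': "e' \<in> E" "a = lower e' \<and> b = upper e' \<and> y \<in> cluster e' \<and> z \<notin> cluster e' \<or>
          a = upper e' \<and> b = lower e' \<and> z \<in> cluster e' \<and> y \<notin> cluster e'"
        using ab(2) unfolding leaf_arcs_def by blast
      have "{lower e, upper e} = {lower e', upper e'}"
        using e(2) e'(2) by auto
      then have "e = e'" using or[of e e'] e e' by blast
      then have "quad_sign (cluster e) ((w, x), (y, z)) = -1"
        unfolding sg using e e' ends(2)[OF e(1)] by auto
      then show False using r e by blast
    qed
  qed
qed

lemma double_ratio_eq:
  assumes G: "verts (mgr M) = V" "edges (mgr M) = E"
    and L: "\<And>i. i < n \<Longrightarrow> leaf_vertex M i = L i" and q: "q \<in> quads n"
  shows "double_ratio M q = (\<Sum>e\<in>E. mlen M e * quad_sign (cluster e) q)"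
proof -
  obtain w x y z where wxyz: "q = ((w, x), (y, z))" and lt: "w < n" "x < n" "y < n" "z < n"
    using q by (auto simp: quads_def)
  let ?s = "\<lambda>e. quad_sign (cluster e) q"
  let ?B = "{e \<in> E. (w \<in> cluster e) \<noteq> (x \<in> cluster e)} \<inter> {e \<in> E. (y \<in> cluster e) \<noteq> (z \<in> cluster e)}"
  let ?c = "if \<forall>e\<in>E. ?s e \<noteq> -1 then 1 else - 1 :: real"
  have "double_ratio M q = ?c * (\<Sum>e\<in>?B. mlen M e)"
    unfolding wxyz double_ratio_def Let_def split
      path_arcs_mgraph[OF G L[OF lt(1)] L[OF lt(2)] lt(1,2)]
      path_arcs_mgraph[OF G L[OF lt(3)] L[OF lt(4)] lt(3,4)] leaf_arcs_edges arcs_disagree ..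
  also have "\<dots> = (\<Sum>e\<in>?B. mlen M e * ?s e)"
  proof -
    \<comment> \<open>One edge with sign -1 forces, by laminarity, every common edge of the two
      paths to have sign -1. The global sign of the definition can therefore be taken inside the
      sum.\<close>
    have "?s e = ?c" if e: "e \<in> ?B" for e
    proof -
      have pm: "?s e = 1 \<or> ?s e = -1"
        using e by (auto simp: quad_sign_def wxyz)
      show ?thesis
      proof (cases "\<forall>e\<in>E. ?s e \<noteq> -1")
        case True
        then show ?thesis using pm e by auto
      next
        case False
        then obtain e' where e': "e' \<in> E" "?s e' = -1" by blast
        then have "?s e \<noteq> 1"
          using quad_sign_compatible[of "cluster e" "cluster e'" q] cluster_laminar[of e e'] e by blast
        then show ?thesis using False pm by auto
      qed
    qed
    then show ?thesis
      unfolding sum_distrib_left by (intro sum.cong) auto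
  qed
  also have "\<dots> = (\<Sum>e\<in>E. mlen M e * ?s e)"
    by (rule sum.mono_neutral_left) (auto simp: finE quad_sign_def wxyz)
  finally show ?thesis .
qed

text \<open>An edge joining two labels would be a whole component, since each label lies on one edge
  only; but there are at least three labels.\<close>

lemma not_label_edge:
  assumes "i < n" "j < n" "i \<noteq> j"
  shows "{L i, L j} \<notin> E"
proof
  assume e: "{L i, L j} \<in> E"
  obtain e1 e2 where e12: "{e' \<in> E. L i \<in> e'} = {e1}" "{e' \<in> E. L j \<in> e'} = {e2}"
    using label_edge[OF assms(1)] label_edge[OF assms(2)] by metis
  have "{L i, L j} \<in> {e' \<in> E. L i \<in> e'}" "{L i, L j} \<in> {e' \<in> E. L j \<in> e'}"
    using e by simp_all
  then have e12': "e1 = {L i, L j}" "e2 = {L i, L j}"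
    unfolding e12 by simp_all
  have only: "f = {L i, L j}" if f: "f \<in> E" "L i \<in> f \<or> L j \<in> f" for f
  proof -
    have "f \<in> {e' \<in> E. L i \<in> e'} \<or> f \<in> {e' \<in> E. L j \<in> e'}"
      using f by blast
    then show ?thesis unfolding e12 e12' by blast
  qed
  have "\<exists>k<n. k \<noteq> i \<and> k \<noteq> j"
    using n3 by presburger
  then obtain k where k: "k < n" "k \<noteq> i" "k \<noteq> j" by blast
  have "(L i, L k) \<in> conn E" using connected label_in assms k by blast
  then have "L k \<in> {L i, L j}"
  proof (rule conn_closed)
    fix y z assume yz: "{y, z} \<in> E" "y \<in> {L i, L j}"
    then have "{y, z} = {L i, L j}" using only[OF yz(1)] by blast
    then show "z \<in> {L i, L j}" by blast
  qed simp
  then show False using label_inj k assms by (auto simp: inj_on_def)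
qed

lemma leaves_eq:
  assumes G: "verts G = V" "edges G = E"
  shows "leaves G = L ` {..<n}"
proof -
  have "card {e \<in> E. L i \<in> e} = 1" if "i < n" for i
    using label_edge[OF that] by (simp add: card_1_singleton_iff)
  moreover have "v \<in> L ` {..<n}" if v: "v \<in> V" "card {e \<in> E. v \<in> e} = 1" for v
  proof -
    obtain e where e: "{e \<in> E. v \<in> e} = {e}"
      using v(2) by (auto simp: card_1_singleton_iff)
    have "e \<in> {e \<in> E. v \<in> e}" unfolding e by simp
    then have ev: "e \<in> E" "v \<in> e" by simp_all
    obtain a c where ac: "e = {a, c}"
      using edge_ends[OF ev(1)] by blast
    define b where "b = (if v = a then c else a)"
    have b: "e = {b, v}" "e \<in> E"
      using ev ac by (auto simp: b_def)
    \<comment> \<open>\<open>branching\<close> with \<open>e' = e\<close>: after deletion of its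
      only edge, \<open>v\<close> reaches nothing but itself, so the label reached is
      \<open>v\<close>.\<close>
    obtain i where i: "i < n" "(v, L i) \<in> conn (E - {e, e})"
      using branching[of b v e] b by blast
    have "L i \<in> {v}"
      using i(2)
    proof (rule conn_closed)
      fix y z assume yz: "{y, z} \<in> E - {e, e}" "y \<in> {v}"
      then have "{y, z} \<in> {e \<in> E. v \<in> e}" by auto
      then have "{y, z} \<in> {e}" unfolding e .
      then show "z \<in> {v}" using yz(1) by simp
    qed simp
    then show ?thesis using i by auto
  qed
  ultimately show ?thesis
    using label_in G by (auto simp: leaves_def edges_at_def)
qed

lemma leaf_vertex_eq:
  assumes G: "verts (mgr M) = V" "edges (mgr M) = E"
    and i: "i < n" "mulab M i \<in> E" "L i \<in> mulab M i"
  shows "leaf_vertex M i = L i"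
  unfolding leaf_vertex_def leaves_eq[OF G]
proof (rule the_equality)
  show "L i \<in> L ` {..<n} \<and> L i \<in> mulab M i" using i by blast
  fix v assume v: "v \<in> L ` {..<n} \<and> v \<in> mulab M i"
  then obtain j where j: "j < n" "v = L j" by blast
  show "v = L i"
  proof (rule ccontr)
    assume ne: "v \<noteq> L i"
    then have "mulab M i = {L i, L j}"
      using edge_ends[OF i(2)] v j i(3) by auto
    then show False
      using not_label_edge[of i j] i j ne by auto
  qed
qed

lemma unbounded_edges_eq:
  assumes G: "verts G = V" "edges G = E"
  shows "unbounded_edges G = {e \<in> E. \<exists>i<n. L i \<in> e}"
  by (auto simp: unbounded_edges_def leaves_eq[OF G] G(2))

end

section \<open>Contraction\<close>

text \<open>Edges at labels are never contracted, so labelled vertices stay blocks on their own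
  (\<open>block_label\<close>).\<close>

locale contraction = labelled_tree +
  fixes S :: "'a set set"
  assumes S: "S \<subseteq> E" and S_label: "i < n \<Longrightarrow> e \<in> S \<Longrightarrow> L i \<notin> e"
begin

definition block :: "'a \<Rightarrow> 'a set" where
  "block u = {v \<in> V. (u, v) \<in> conn S}"

lemma block_eq_iff:
  assumes "u \<in> V" "v \<in> V"
  shows "block u = block v \<longleftrightarrow> (u, v) \<in> conn S"
proof
  assume "block u = block v"
  moreover have "v \<in> block v" using assms by (simp add: block_def)
  ultimately have "v \<in> block u" by simp
  then show "(u, v) \<in> conn S" by (simp add: block_def)
next
  assume "(u, v) \<in> conn S"
  then show "block u = block v"
    using conn_trans[of u v S] conn_trans[of v u S] conn_sym[of u v S] by (auto simp: block_def)
qed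

lemma block_label:
  assumes "u \<in> V" "i < n" "block u = block (L i)"
  shows "u = L i"
proof -
  have "(L i, u) \<in> conn S"
    using assms block_eq_iff[of "L i" u] label_in by auto
  then have "u \<in> {L i}"
  proof (rule conn_closed)
    fix y z assume "{y, z} \<in> S" "y \<in> {L i}"
    then show "z \<in> {L i}" using S_label[OF assms(2)] by blast
  qed simp
  then show ?thesis by simp
qed

lemma edge_obtain:
  assumes "{A, B} \<in> (`) block ` F" "F \<subseteq> E"
  obtains a b where "{a, b} \<in> F" "A = block a" "B = block b" "a \<in> V" "b \<in> V"
proof -
  obtain e where e: "e \<in> F" "{A, B} = block ` e" using assms by blast
  obtain a b where ab: "e = {a, b}" "a \<in> V" "b \<in> V"
    using edge_ends[OF subsetD[OF assms(2) e(1)]] by blast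
  have "{A, B} = {block a, block b}" using e(2) unfolding ab(1) by simp
  then consider "A = block a" "B = block b" | "A = block b" "B = block a"
    by (auto simp: doubleton_eq_iff)
  then show ?thesis
  proof cases
    case 1
    then show ?thesis using that[of a b] e(1) ab by simp
  next
    case 2
    then show ?thesis using that[of b a] e(1) ab by (simp add: insert_commute)
  qed
qed

text \<open>If two remaining edges had the same image, one could be bypassed through the other and
  through \<open>S\<close>, although it is a bridge. So contraction merges no edges, even though
  edges are mere vertex sets.\<close>

lemma block_edge_inj: "inj_on ((`) block) (E - S)"
proof (rule inj_onI, rule ccontr)
  fix e e' assume e: "e \<in> E - S" "e' \<in> E - S" "block ` e = block ` e'" "e \<noteq> e'"
  obtain a b where ab: "e = {a, b}" "a \<in> V" "b \<in> V"
    using edge_ends[of e] e(1) by blast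
  have "{block a, block b} \<in> (`) block ` {e'}" using e(3) unfolding ab(1) by simp
  moreover have "{e'} \<subseteq> E" using e(2) by simp
  ultimately obtain a' b' where ab': "{a', b'} \<in> {e'}" "block a = block a'" "block b = block b'" "a' \<in> V" "b' \<in> V"
    by (rule edge_obtain)
  have sub: "conn S \<subseteq> conn (E - {e})"
    using S e(1) by (intro conn_mono) auto
  have "(a, a') \<in> conn (E - {e})"
    using sub block_eq_iff[OF ab(2) ab'(4)] ab'(2) by blast
  moreover have "(a', b') \<in> conn (E - {e})"
    using ab'(1) e by (intro conn_edge) auto
  moreover have "(b', b) \<in> conn (E - {e})"
    using sub block_eq_iff[OF ab'(5) ab(3)] ab'(3) by auto
  ultimately have "(a, b) \<in> conn (E - {e})"
    by (blast intro: conn_trans)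
  then show False using bridge[of a b] ab(1) e(1) by simp
qed

text \<open>A walk between blocks lifts by inserting walks in \<open>S\<close> inside each block,
  and these avoid \<open>R\<close> because \<open>R\<close> is disjoint from \<open>S\<close>. In
  the other direction an edge of \<open>S\<close> becomes a pause.\<close>

lemma block_conn:
  assumes R: "R \<subseteq> E - S" and uv: "u \<in> V" "v \<in> V"
  shows "(block u, block v) \<in> conn ((`) block ` (E - S) - (`) block ` R) \<longleftrightarrow> (u, v) \<in> conn (E - R)"
proof
  have S': "conn S \<subseteq> conn (E - R)"
    using S R by (intro conn_mono) auto
  have eq: "(`) block ` (E - S) - (`) block ` R = (`) block ` (E - S - R)"
    using inj_on_image_set_diff[OF block_edge_inj, of "E - S" R] R by auto
  {
    assume "(block u, block v) \<in> conn ((`) block ` (E - S) - (`) block ` R)"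
    then have "\<forall>w\<in>V. block v = block w \<longrightarrow> (u, w) \<in> conn (E - R)"
      unfolding eq
    proof (induction rule: conn_induct)
      case refl
      then show ?case using uv block_eq_iff S' by blast
    next
      case (step Y Z)
      then obtain a b where ab: "{a, b} \<in> E - S - R" "Y = block a" "Z = block b" "a \<in> V" "b \<in> V"
        by (elim edge_obtain) auto
      then have "(u, a) \<in> conn (E - R)" using step by blast
      then have ub: "(u, b) \<in> conn (E - R)" by (rule conn_step) (use ab(1) in blast)
      show ?case
      proof (intro ballI impI)
        fix w assume "w \<in> V" "Z = block w"
        then have "(b, w) \<in> conn (E - R)"
          using block_eq_iff[of b w] ab(3,5) S' by auto
        then show "(u, w) \<in> conn (E - R)" using ub conn_trans by fast
      qed
    qed
    then show "(u, v) \<in> conn (E - R)" using uv by simp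
  next
    assume "(u, v) \<in> conn (E - R)"
    then have "v \<in> V \<and> (block u, block v) \<in> conn ((`) block ` (E - S - R))"
    proof (induction rule: conn_induct)
      case (step y z)
      then have V: "y \<in> V" "z \<in> V" using edge_in_V[of y z] by auto
      show ?case
      proof (cases "{y, z} \<in> S")
        case True
        then have "block y = block z" using V block_eq_iff[of y z] conn_edge[of y z S] by simp
        then show ?thesis using step V by simp
      next
        case False
        then have "block ` {y, z} \<in> (`) block ` (E - S - R)" using step by blast
        then have "{block y, block z} \<in> (`) block ` (E - S - R)" by simp
        then show ?thesis using V step conn_step[of "block u" "block y"] by blast
      qed
    qed (use uv in auto)
    then show "(block u, block v) \<in> conn ((`) block ` (E - S) - (`) block ` R)" unfolding eq by simp
  }
qed

lemma labelled_tree_contraction: "labelled_tree (block ` V) ((`) block ` (E - S)) (\<lambda>i. block (L i)) n"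
proof
  let ?E = "(`) block ` (E - S)"
  show "n \<ge> 3" by (rule n3)
  show "finite ?E" using finE by blast
  show "\<exists>a\<in>block ` V. \<exists>b\<in>block ` V. a \<noteq> b \<and> e = {a, b}" if e: "e \<in> ?E" for e
  proof -
    obtain f where f: "f \<in> E - S" "e = block ` f" using e by blast
    obtain a b where ab: "f = {a, b}" "a \<in> V" "b \<in> V" using edge_ends[of f] f(1) by blast
    have "block a \<noteq> block b"
      using bridge[of a b] ab f block_eq_iff[of a b] conn_mono[of S "E - {{a, b}}"] S by blast
    then show ?thesis using f ab by auto
  qed
  show "(u, v) \<in> conn ?E" if "u \<in> block ` V" "v \<in> block ` V" for u v
    using that block_conn[of "{}"] connected by auto
  show "(A, B) \<notin> conn (?E - {{A, B}})" if AB: "{A, B} \<in> ?E" for A B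
  proof -
    obtain a b where ab: "{a, b} \<in> E - S" "A = block a" "B = block b" "a \<in> V" "b \<in> V"
      using AB by (elim edge_obtain) auto
    show ?thesis
      using block_conn[of "{{a, b}}" a b] bridge[of a b] ab by auto
  qed
  show "block (L i) \<in> block ` V" if "i < n" for i
    using that label_in by blast
  show "inj_on (\<lambda>i. block (L i)) {..<n}"
  proof (rule inj_onI)
    fix i j assume ij: "i \<in> {..<n}" "j \<in> {..<n}" "block (L i) = block (L j)"
    then have "L i = L j" using block_label[of "L i" j] label_in by simp
    then show "i = j" using inj_onD[OF label_inj] ij by blast
  qed
  show "\<exists>e. {e' \<in> ?E. block (L i) \<in> e'} = {e}" if i: "i < n" for i
  proof -
    obtain e where e: "{e' \<in> E. L i \<in> e'} = {e}" using label_edge[OF i] by blast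
    have "e \<in> {e' \<in> E. L i \<in> e'}" unfolding e by simp
    then have eS: "e \<in> E - S" "L i \<in> e" using S_label[OF i] by blast+
    have "f = e" if ff: "f \<in> E - S" "block (L i) \<in> block ` f" for f
    proof -
      obtain a where a: "a \<in> f" "block a = block (L i)" using ff(2) by auto
      have "a \<in> V" using ff(1) edge_ends[of f] a(1) by blast
      then have "L i \<in> f" using block_label[OF _ i a(2)] a(1) by simp
      then have "f \<in> {e' \<in> E. L i \<in> e'}" using ff(1) by simp
      then show ?thesis unfolding e by simp
    qed
    then have "{e' \<in> ?E. block (L i) \<in> e'} = {block ` e}"
      using eS by blast
    then show ?thesis by blast
  qed
  show "\<exists>i<n. (C, block (L i)) \<in> conn (?E - {{B, C}, e'})" if BC: "{B, C} \<in> ?E" for B C e'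
  proof -
    obtain b c where bc: "{b, c} \<in> E - S" "B = block b" "C = block c" "b \<in> V" "c \<in> V"
      using BC by (elim edge_obtain) auto
    \<comment> \<open>An \<open>e'\<close> that is no edge of the quotient deletes nothing, so
      \<open>{b, c}\<close> itself can stand in for its preimage.\<close>
    obtain f where f: "f \<in> E - S" "?E - {{B, C}, e'} = ?E - (`) block ` {{b, c}, f}"
    proof (cases "e' \<in> ?E")
      case True
      then obtain f where "f \<in> E - S" "e' = block ` f" by blast
      then show ?thesis using that[of f] bc(2,3) by simp
    next
      case False
      then have "?E - {{B, C}, e'} = ?E - (`) block ` {{b, c}, {b, c}}" using bc(2,3) by auto
      then show ?thesis by (rule that[OF bc(1)])
    qed
    obtain i where i: "i < n" "(c, L i) \<in> conn (E - {{b, c}, f})"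
      using branching[of b c f] bc(1) by blast
    have R: "{{b, c}, f} \<subseteq> E - S" using bc(1) f(1) by blast
    have "(block c, block (L i)) \<in> conn (?E - (`) block ` {{b, c}, f})"
      using block_conn[OF R bc(5) label_in[OF i(1)]] i(2) by blast
    then have "(C, block (L i)) \<in> conn (?E - {{B, C}, e'})"
      unfolding f(2) by (simp only: bc(3))
    then show ?thesis using i(1) by blast
  qed
qed

lemma cluster_contraction:
  assumes "e \<in> E - S"
  shows "labelled_tree.cluster ((`) block ` (E - S)) (\<lambda>i. block (L i)) n (block ` e) = cluster e"
proof -
  interpret Q: labelled_tree "block ` V" "(`) block ` (E - S)" "\<lambda>i. block (L i)" n
    by (rule labelled_tree_contraction)
  show ?thesis
    unfolding Q.cluster_def cluster_def
    using block_conn[of "{e}" "L 0"] assms label_in by auto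
qed

end

section \<open>Labelled trivalent trees and their metric graphs\<close>

definition leaf_of :: "ltree \<Rightarrow> nat \<Rightarrow> nat" where
  "leaf_of T i = (THE v. v \<in> leaves (gr T) \<and> v \<in> ulab T i)"

text \<open>A walk that starts at \<open>d\<close> and avoids the bridge \<open>{c, d}\<close> never
  reaches \<open>c\<close>, so it uses no other edge at \<open>c\<close> either.\<close>

lemma conn_avoid:
  assumes "(d, x) \<in> conn F" "F \<subseteq> E - {{c, d}}" "(c, d) \<notin> conn (E - {{c, d}})" "{b, c} \<in> E" "{b, c} \<noteq> {c, d}"
  shows "(d, x) \<in> conn (F - {{b, c}})"
proof (rule ccontr)
  assume "\<not> ?thesis"
  then obtain a where a: "a \<in> {b, c}" "(d, a) \<in> conn (F - {{b, c}})"
    using conn_first_exit[OF assms(1), of "{{b, c}}"] by auto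
  have "conn (F - {{b, c}}) \<subseteq> conn (E - {{c, d}})"
    using assms(2) by (intro conn_mono) auto
  then have da: "(d, a) \<in> conn (E - {{c, d}})" using a by blast
  have "{b, c} \<in> E - {{c, d}}" using assms(4,5) by simp
  then have "(d, c) \<in> conn (E - {{c, d}})"
    using da a(1) conn_step[of d b "E - {{c, d}}" c] by blast
  then show False using assms(3) conn_sym by metis
qed

locale trivalent_tree =
  fixes n :: nat and T :: ltree
  assumes n3: "n \<ge> 3" and lt: "labelled_trivalent_tree n T"
begin

abbreviation "V \<equiv> verts (gr T)"
abbreviation "E \<equiv> edges (gr T)"

lemma facts: "is_tree (gr T)" "trivalent (gr T)" "card (leaves (gr T)) = n"
    "bij_betw (ulab T) {..<n} (unbounded_edges (gr T))"
    "bij_betw (blab T) {..<n - 3} (bounded_edges (gr T))"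
  using lt by (auto simp: labelled_trivalent_tree_def)

lemma ends_in: "e \<in> E \<Longrightarrow> \<exists>a\<in>V. \<exists>b\<in>V. a \<noteq> b \<and> e = {a, b}"
  using facts(1) by (auto simp: is_tree_def wf_graph_def)

lemma finite_V: "finite V"
  using facts(1) by (auto simp: is_tree_def wf_graph_def)

lemma finite_E: "finite E"
proof -
  have "E \<subseteq> Pow V" using ends_in by blast
  then show ?thesis using finite_V by (meson finite_Pow_iff finite_subset)
qed

lemma conn_V: "u \<in> V \<Longrightarrow> v \<in> V \<Longrightarrow> (u, v) \<in> conn E"
  using facts(1) is_path_conn by (fastforce simp: is_tree_def connected_graph_def)

lemma bridge_E: "{a, b} \<in> E \<Longrightarrow> (a, b) \<notin> conn (E - {{a, b}})"
  using tree_bridge[OF facts(1)] by blast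

lemma leaf_edge: "v \<in> leaves (gr T) \<Longrightarrow> \<exists>e. {e' \<in> E. v \<in> e'} = {e}"
  by (auto simp: leaves_def edges_at_def card_1_singleton_iff)

lemma leaf_V: "v \<in> leaves (gr T) \<Longrightarrow> v \<in> V"
  by (simp add: leaves_def)

lemma leaf_edge_unique:
  assumes "v \<in> leaves (gr T)" "e \<in> E" "v \<in> e" "e' \<in> E" "v \<in> e'"
  shows "e = e'"
proof -
  obtain f where f: "{e' \<in> E. v \<in> e'} = {f}" using leaf_edge[OF assms(1)] by blast
  have "e \<in> {e' \<in> E. v \<in> e'}" "e' \<in> {e' \<in> E. v \<in> e'}" using assms by simp_all
  then show ?thesis unfolding f by simp
qed

text \<open>An edge between two leaves would be the entire tree, which has at least three
  leaves.\<close>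

lemma one_leaf:
  assumes "e \<in> E" "u \<in> e" "v \<in> e" "u \<in> leaves (gr T)" "v \<in> leaves (gr T)"
  shows "u = v"
proof (rule ccontr)
  assume ne: "u \<noteq> v"
  then have e: "e = {u, v}" using ends_in[OF assms(1)] assms(2,3) by auto
  have "x \<in> {u, v}" if "x \<in> V" for x
  proof -
    have "(u, x) \<in> conn E" using conn_V that assms leaf_V by blast
    then show ?thesis
    proof (rule conn_closed)
      fix y z assume yz: "{y, z} \<in> E" "y \<in> {u, v}"
      then have "{y, z} = e"
        using leaf_edge_unique[of y "{y, z}" e] assms by blast
      then show "z \<in> {u, v}" using e by blast
    qed simp
  qed
  then have "leaves (gr T) \<subseteq> {u, v}" using leaf_V by blast
  then have "card (leaves (gr T)) \<le> card {u, v}" by (intro card_mono) auto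
  also have "\<dots> \<le> 2" by (simp add: card_insert_if)
  finally show False using facts(3) n3 by simp
qed

lemma ulab_E: "i < n \<Longrightarrow> ulab T i \<in> E"
  using facts(4) by (auto simp: bij_betw_def unbounded_edges_def)

lemma leaf_of:
  assumes "i < n"
  shows "leaf_of T i \<in> leaves (gr T)" "leaf_of T i \<in> ulab T i"
proof -
  have "ulab T i \<in> unbounded_edges (gr T)"
    using facts(4) assms by (auto simp: bij_betw_def)
  then obtain v where v: "v \<in> leaves (gr T)" "v \<in> ulab T i" "ulab T i \<in> E"
    by (auto simp: unbounded_edges_def)
  have "leaf_of T i = v"
    unfolding leaf_of_def
  proof (rule the_equality)
    show "v \<in> leaves (gr T) \<and> v \<in> ulab T i" using v by blast
    show "w = v" if "w \<in> leaves (gr T) \<and> w \<in> ulab T i" for w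
      using one_leaf[OF v(3)] v that by blast
  qed
  then show "leaf_of T i \<in> leaves (gr T)" "leaf_of T i \<in> ulab T i" using v by auto
qed

lemma leaf_of_surj:
  assumes "v \<in> leaves (gr T)"
  shows "\<exists>i<n. v = leaf_of T i"
proof -
  obtain f where f: "{e' \<in> E. v \<in> e'} = {f}" using leaf_edge[OF assms] by blast
  have "f \<in> {e' \<in> E. v \<in> e'}" unfolding f by simp
  then have "f \<in> E" "v \<in> f" by simp_all
  then have "f \<in> unbounded_edges (gr T)" using assms by (auto simp: unbounded_edges_def)
  then obtain i where i: "i < n" "f = ulab T i"
    using facts(4) by (auto simp: bij_betw_def)
  then show ?thesis
    using one_leaf[OF \<open>f \<in> E\<close> \<open>v \<in> f\<close> _ assms] leaf_of[OF i(1)] by auto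
qed

text \<open>Induction on the number of vertices beyond the edge. An internal vertex \<open>c\<close>
  has three edges, so one of them is neither \<open>{b, c}\<close> nor \<open>e'\<close>; the part
  beyond that edge is strictly smaller, and by \<open>conn_avoid\<close> walks inside it stay clear
  of \<open>{b, c}\<close>.\<close>

lemma branching_E:
  assumes "{b, c} \<in> E"
  shows "\<exists>i<n. (c, leaf_of T i) \<in> conn (E - {{b, c}, e'})"
  using assms
proof (induction "card {x \<in> V. (c, x) \<in> conn (E - {{b, c}})}" arbitrary: b c rule: less_induct)
  case less
  have c: "c \<in> V" using ends_in[OF less.prems] by (auto simp: doubleton_eq_iff)
  show ?case
  proof (cases "c \<in> leaves (gr T)")
    case True
    then show ?thesis using leaf_of_surj by fastforce
  next
    case False
    then have c3: "card (edges_at (gr T) c) = 3"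
      using facts(2) c by (auto simp: trivalent_def leaves_def)
    have "\<not> edges_at (gr T) c \<subseteq> {{b, c}, e'}"
    proof
      assume "edges_at (gr T) c \<subseteq> {{b, c}, e'}"
      then have "card (edges_at (gr T) c) \<le> card {{b, c}, e'}" by (intro card_mono) auto
      also have "\<dots> \<le> 2" by (simp add: card_insert_if)
      finally show False using c3 by simp
    qed
    then obtain g where g: "g \<in> E" "c \<in> g" "g \<noteq> {b, c}" "g \<noteq> e'"
      by (auto simp: edges_at_def)
    obtain d where d: "g = {c, d}"
      using ends_in[OF g(1)] g(2) by blast
    have gE: "{c, d} \<in> E" using g(1) d by simp
    have ne: "{b, c} \<noteq> {c, d}" using g d by simp
    note br = bridge_E[OF gE]
    let ?W = "\<lambda>b c. {x \<in> V. (c, x) \<in> conn (E - {{b, c}})}"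
    have cd: "(c, d) \<in> conn (E - {{b, c}})"
      using gE ne by (intro conn_edge) auto
    have "?W c d \<subset> ?W b c"
    proof
      show "?W c d \<subseteq> ?W b c"
      proof
        fix x assume x: "x \<in> ?W c d"
        then have "(d, x) \<in> conn (E - {{c, d}} - {{b, c}})"
          using conn_avoid[OF _ _ br less.prems ne, of x] by simp
        moreover have "conn (E - {{c, d}} - {{b, c}}) \<subseteq> conn (E - {{b, c}})"
          by (intro conn_mono) auto
        ultimately have "(d, x) \<in> conn (E - {{b, c}})" by blast
        then show "x \<in> ?W b c" using x cd conn_trans[OF cd] by simp
      qed
      have "c \<in> ?W b c" using c by simp
      moreover have "c \<notin> ?W c d" using br conn_sym by fastforce
      ultimately show "?W c d \<noteq> ?W b c" by metis
    qed
    then have "card (?W c d) < card (?W b c)"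
      using finite_V by (intro psubset_card_mono) auto
    then obtain i where i: "i < n" "(d, leaf_of T i) \<in> conn (E - {{c, d}, e'})"
      using less.hyps[of d c] gE by blast
    have "E - {{c, d}, e'} \<subseteq> E - {{c, d}}" by blast
    then have "(d, leaf_of T i) \<in> conn (E - {{c, d}, e'} - {{b, c}})"
      using conn_avoid[OF i(2) _ br less.prems ne] by simp
    moreover have "conn (E - {{c, d}, e'} - {{b, c}}) \<subseteq> conn (E - {{b, c}, e'})"
      by (intro conn_mono) auto
    ultimately have di: "(d, leaf_of T i) \<in> conn (E - {{b, c}, e'})" by blast
    have "(c, d) \<in> conn (E - {{b, c}, e'})"
      using gE ne g d by (intro conn_edge) auto
    then show ?thesis using conn_trans[OF _ di] i(1) by blast
  qed
qed

sublocale labelled_tree V E "leaf_of T" n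
proof
  show "n \<ge> 3" by (rule n3)
  show "finite E" by (rule finite_E)
  show "\<exists>a\<in>V. \<exists>b\<in>V. a \<noteq> b \<and> e = {a, b}" if "e \<in> E" for e
    using ends_in that by blast
  show "(u, v) \<in> conn E" if "u \<in> V" "v \<in> V" for u v
    using conn_V that by blast
  show "(a, b) \<notin> conn (E - {{a, b}})" if "{a, b} \<in> E" for a b
    using bridge_E that by blast
  show "leaf_of T i \<in> V" if "i < n" for i
    using leaf_of leaf_V that by blast
  show "inj_on (leaf_of T) {..<n}"
  proof (rule inj_onI)
    fix i j assume ij: "i \<in> {..<n}" "j \<in> {..<n}" "leaf_of T i = leaf_of T j"
    then have lt: "i < n" "j < n" by simp_all
    have "leaf_of T i \<in> ulab T j" using leaf_of(2)[OF lt(2)] ij(3) by simp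
    then have "ulab T i = ulab T j"
      using leaf_edge_unique[OF leaf_of(1)[OF lt(1)] ulab_E[OF lt(1)] leaf_of(2)[OF lt(1)] ulab_E[OF lt(2)]] by simp
    moreover have "inj_on (ulab T) {..<n}" using facts(4) by (simp add: bij_betw_def)
    ultimately show "i = j" using ij inj_onD by metis
  qed
  show "\<exists>e. {e' \<in> E. leaf_of T i \<in> e'} = {e}" if "i < n" for i
    using leaf_edge[OF leaf_of(1)[OF that]] .
  show "\<exists>i<n. (c, leaf_of T i) \<in> conn (E - {{b, c}, e'})" if "{b, c} \<in> E" for b c e'
    using branching_E[OF that] .
qed

definition key :: "nat \<Rightarrow> nat set" where
  "key i = cluster (blab T i)"

lemma blab_bounded: "i < n - 3 \<Longrightarrow> blab T i \<in> bounded_edges (gr T)"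
  using facts(5) by (auto simp: bij_betw_def)

lemma bounded_E: "e \<in> bounded_edges (gr T) \<Longrightarrow> e \<in> E"
  by (simp add: bounded_edges_def)

lemma bounded_no_leaf: "e \<in> bounded_edges (gr T) \<Longrightarrow> i < n \<Longrightarrow> leaf_of T i \<notin> e"
  using leaf_of by (auto simp: bounded_edges_def unbounded_edges_def)

lemma key_inj: "inj_on key {..<n - 3}"
proof (rule inj_onI)
  fix i j assume ij: "i \<in> {..<n - 3}" "j \<in> {..<n - 3}" "key i = key j"
  then have "blab T i = blab T j"
    using inj_onD[OF cluster_inj] blab_bounded bounded_E by (simp add: key_def)
  then show "i = j" using facts(5) ij by (auto simp: bij_betw_def inj_on_def)
qed

end

context labelled_tree
begin

text \<open>An edge at a label isolates that label. Hence the unbounded edges have the same clusters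
  in every tree, and trees are distinguished by their bounded edges.\<close>

lemma cluster_label_edge:
  assumes "i < n" "e \<in> E" "L i \<in> e"
  shows "cluster e = (if i = 0 then {1..<n} else {i})"
proof -
  obtain f where f: "{e' \<in> E. L i \<in> e'} = {f}" using label_edge[OF assms(1)] by blast
  have "e \<in> {e' \<in> E. L i \<in> e'}" using assms by simp
  then have ef: "{e' \<in> E. L i \<in> e'} = {e}" unfolding f by simp
  have iso: "x = L i" if "(L i, x) \<in> conn (E - {e})" for x
  proof -
    have "x \<in> {L i}"
      using that
    proof (rule conn_closed)
      fix y z assume yz: "{y, z} \<in> E - {e}" "y \<in> {L i}"
      then have "{y, z} \<in> {e' \<in> E. L i \<in> e'}" by simp
      then show "z \<in> {L i}" unfolding ef using yz(1) by simp
    qed simp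
    then show ?thesis by simp
  qed
  have inj: "j = k" if "j < n" "k < n" "L j = L k" for j k
    using inj_onD[OF label_inj] that by simp
  show ?thesis
  proof (cases "i = 0")
    case True
    have "j \<in> cluster e \<longleftrightarrow> j \<in> {1..<n}" for j
    proof
      assume j: "j \<in> {1..<n}"
      then have "(L 0, L j) \<notin> conn (E - {e})" using iso[of "L j"] inj[of j 0] True by auto
      then show "j \<in> cluster e" using j by (simp add: cluster_def)
    next
      assume j: "j \<in> cluster e"
      then have "j \<noteq> 0" by (metis cluster_0)
      then show "j \<in> {1..<n}" using j cluster_less by simp
    qed
    then have "cluster e = {1..<n}" by (rule Set.set_eqI)
    then show ?thesis using True by simp
  next
    case False
    have i: "i \<in> cluster e"
    proof (rule ccontr)
      assume "i \<notin> cluster e"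
      then have "(L 0, L i) \<in> conn (E - {e})" using assms(1) by (simp add: cluster_def)
      then have "L 0 = L i" by (rule iso[OF conn_sym])
      then show False using inj[of 0 i] False assms(1) n3 by simp
    qed
    have "j = i" if j: "j \<in> cluster e" for j
    proof -
      have jn: "j < n" using j cluster_less by blast
      have "(L i, L j) \<in> conn (E - {e})"
        using separated_iff[OF label_in[OF assms(1)] label_in[OF jn] assms(2)]
          mem_cluster_iff[OF assms(1,2)] mem_cluster_iff[OF jn assms(2)] i j by blast
      then show ?thesis using iso inj jn assms(1) by metis
    qed
    then have "cluster e = {i}" using i by blast
    then show ?thesis using False by simp
  qed
qed

end

context trivalent_tree
begin

text \<open>\<open>{1..<n}\<close> and the singletons \<open>{j}\<close> with
  \<open>j \<noteq> 0\<close> are the clusters of the unbounded edges, from which a bounded edge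
  differs by \<open>cluster_inj\<close>.\<close>

lemma key_proper:
  assumes "i < n - 3"
  shows "key i \<subseteq> {..<n}" "0 \<notin> key i" "key i \<noteq> {}" "key i \<noteq> {j}" "key i \<noteq> {1..<n}"
proof -
  have e: "blab T i \<in> E" using blab_bounded bounded_E assms by blast
  show "key i \<subseteq> {..<n}" "0 \<notin> key i" by (auto simp: key_def cluster_less)
  show "key i \<noteq> {}" unfolding key_def by (rule cluster_nonempty[OF e])
  have ne: "key i \<noteq> cluster (ulab T j)" if j: "j < n" for j
  proof
    assume "key i = cluster (ulab T j)"
    then have "blab T i = ulab T j"
      using inj_onD[OF cluster_inj _ e ulab_E[OF j]] by (simp add: key_def)
    then show False using bounded_no_leaf[OF blab_bounded[OF assms] j] leaf_of[OF j] by simp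
  qed
  show "key i \<noteq> {1..<n}"
    using ne[of 0] cluster_label_edge[of 0 "ulab T 0"] ulab_E[of 0] leaf_of[of 0] n3 by simp
  show "key i \<noteq> {j}"
  proof
    assume k: "key i = {j}"
    then have "j \<in> key i" by simp
    then have "j < n" "j \<noteq> 0" using \<open>key i \<subseteq> {..<n}\<close> \<open>0 \<notin> key i\<close> by (auto intro!: gr0I)
    then show False
      using ne[of j] cluster_label_edge[of j "ulab T j"] ulab_E[of j] leaf_of[of j] k by simp
  qed
qed

lemma key_laminar:
  assumes "i < n - 3" "j < n - 3"
  shows "key i \<inter> key j = {} \<or> key i \<subseteq> key j \<or> key j \<subseteq> key i"
  using cluster_laminar[of "blab T i" "blab T j"] blab_bounded bounded_E assms unfolding key_def by blast

end

section \<open>Length functions and their recovery from double ratios\<close>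

section \<open>Length functions on keys\<close>

text \<open>A point of a cone as a function of keys instead of indices. With injective keys the sum
  has at most one term, and its value is 0 at absent keys, so neither the numbering nor a contracted
  edge leaves a trace.\<close>

definition len :: "nat \<Rightarrow> (nat \<Rightarrow> 'k) \<Rightarrow> (nat \<Rightarrow> real) \<Rightarrow> 'k \<Rightarrow> real" where
  "len m K p k = (\<Sum>i | i < m \<and> K i = k. p i)"

lemma len_key:
  assumes "inj_on K {..<m}" "i < m"
  shows "len m K p (K i) = p i"
proof -
  have "{j. j < m \<and> K j = K i} = {i}"
    using assms by (auto simp: inj_on_def)
  then show ?thesis by (simp add: len_def)
qed

lemma len_outside: "(\<And>i. i < m \<Longrightarrow> p i \<noteq> 0 \<Longrightarrow> K i \<noteq> k) \<Longrightarrow> len m K p k = 0"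
  unfolding len_def by (rule sum.neutral) auto

lemma len_nonzero: "len m K p k \<noteq> 0 \<Longrightarrow> \<exists>i<m. K i = k \<and> p i \<noteq> 0"
  using len_outside by metis

lemma len_eqI:
  assumes "inj_on K {..<m}" "inj_on K' {..<m}"
    and "\<And>i. i < m \<Longrightarrow> p i \<noteq> 0 \<Longrightarrow> \<exists>j<m. K' j = K i \<and> p' j = p i"
    and "\<And>j. j < m \<Longrightarrow> p' j \<noteq> 0 \<Longrightarrow> \<exists>i<m. K i = K' j \<and> p i = p' j"
  shows "len m K p k = len m K' p' k"
proof (cases "len m K p k = 0 \<and> len m K' p' k = 0")
  case False
  then consider i where "i < m" "K i = k" "p i \<noteq> 0" | j where "j < m" "K' j = k" "p' j \<noteq> 0"
    using len_nonzero by metis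
  then show ?thesis
  proof cases
    case 1
    then obtain j where "j < m" "K' j = K i" "p' j = p i" using assms(3) by blast
    then show ?thesis using 1 len_key[OF assms(1), of i p] len_key[OF assms(2), of j p'] by simp
  next
    case 2
    then obtain i where "i < m" "K i = K' j" "p i = p' j" using assms(4) by blast
    then show ?thesis using 2 len_key[OF assms(1), of i p] len_key[OF assms(2), of j p'] by simp
  qed
qed simp

lemma len_eqD:
  assumes "inj_on K {..<m}" "inj_on K' {..<m}" "\<And>k. len m K p k = len m K' p' k" "i < m" "p i \<noteq> 0"
  shows "\<exists>j<m. K' j = K i \<and> p' j = p i"
proof -
  have *: "len m K' p' (K i) = p i"
    using assms(3)[of "K i"] len_key[OF assms(1,4), of p] by simp
  then obtain j where j: "j < m" "K' j = K i"
    using len_nonzero[of m K' p' "K i"] assms(5) by auto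
  then show ?thesis
    using * len_key[OF assms(2) j(1), of p'] by auto
qed

section \<open>Graph isomorphisms\<close>

lemma graph_iso_edges_at:
  assumes "graph_iso G H F" "edges G \<subseteq> Pow (verts G)" "v \<in> verts G"
  shows "edges_at H (F v) = (`) F ` edges_at G v" "card (edges_at H (F v)) = card (edges_at G v)"
proof -
  have inj: "inj_on F (verts G)" and E: "edges H = (`) F ` edges G" and injE: "inj_on ((`) F) (edges G)"
    using assms(1) by (auto simp: graph_iso_def bij_betw_def)
  have "F v \<in> F ` e \<longleftrightarrow> v \<in> e" if "e \<in> edges G" for e
    using inj_on_image_mem_iff[OF inj assms(3), of e] that assms(2) by blast
  then show *: "edges_at H (F v) = (`) F ` edges_at G v"
    unfolding edges_at_def E by auto
  have "inj_on ((`) F) (edges_at G v)"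
    by (rule inj_on_subset[OF injE]) (auto simp: edges_at_def)
  then show "card (edges_at H (F v)) = card (edges_at G v)"
    unfolding * by (rule card_image)
qed

lemma graph_iso_leaves:
  assumes "graph_iso G H F" "edges G \<subseteq> Pow (verts G)"
  shows "leaves H = F ` leaves G"
proof -
  have "verts H = F ` verts G" using assms(1) by (auto simp: graph_iso_def bij_betw_def)
  then show ?thesis
    using graph_iso_edges_at(2)[OF assms] by (auto simp: leaves_def)
qed

lemma graph_iso_leaf_iff:
  assumes "graph_iso G H F" "edges G \<subseteq> Pow (verts G)" "v \<in> verts G"
  shows "F v \<in> leaves H \<longleftrightarrow> v \<in> leaves G"
proof -
  have "F v \<in> verts H" using assms(1,3) by (auto simp: graph_iso_def bij_betw_def)
  then show ?thesis using graph_iso_edges_at(2)[OF assms] assms(3) by (simp add: leaves_def)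
qed

lemma graph_iso_bounded:
  assumes "graph_iso G H F" "edges G \<subseteq> Pow (verts G)" "e \<in> edges G"
  shows "F ` e \<in> bounded_edges H \<longleftrightarrow> e \<in> bounded_edges G"
proof -
  have "F ` e \<in> edges H" using assms by (auto simp: graph_iso_def bij_betw_def)
  moreover have "F ` e \<inter> leaves H = {} \<longleftrightarrow> e \<inter> leaves G = {}"
    using graph_iso_leaf_iff[OF assms(1,2)] assms(2,3) by blast
  ultimately show ?thesis using assms(3) by (auto simp: bounded_edges_def unbounded_edges_def)
qed

lemma conn_image: "(u, v) \<in> conn A \<Longrightarrow> (F u, F v) \<in> conn ((`) F ` A)"
proof (induction rule: conn_induct)
  case (step y z)
  then have "F ` {y, z} \<in> (`) F ` A" by blast
  then have "{F y, F z} \<in> (`) F ` A" by simp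
  with step(3) show ?case by (rule conn_step)
qed simp

lemma conn_image_iff:
  assumes "inj_on F V" "A \<subseteq> Pow V" "u \<in> V" "v \<in> V"
  shows "(F u, F v) \<in> conn ((`) F ` A) \<longleftrightarrow> (u, v) \<in> conn A"
proof
  let ?G = "inv_into V F"
  assume "(F u, F v) \<in> conn ((`) F ` A)"
  then have "(?G (F u), ?G (F v)) \<in> conn ((`) ?G ` (`) F ` A)" by (rule conn_image)
  moreover have "?G ` F ` e = e" if "e \<in> A" for e
    using that assms(1,2) by (metis PowD inv_into_image_cancel subsetD)
  then have "(`) ?G ` (`) F ` A = A" by (simp add: image_image)
  ultimately show "(u, v) \<in> conn A" using assms by simp
qed (rule conn_image)

context labelled_tree
begin

lemma E_sub: "E \<subseteq> Pow V"
  using edge_ends by blast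

end

lemma cluster_iso:
  assumes T: "labelled_tree (verts G) (edges G) L n" and T': "labelled_tree (verts H) (edges H) L' n"
    and F: "graph_iso G H F" and L: "\<And>i. i < n \<Longrightarrow> F (L i) = L' i" and e: "e \<in> edges G"
  shows "labelled_tree.cluster (edges H) L' n (F ` e) = labelled_tree.cluster (edges G) L n e"
proof -
  interpret T: labelled_tree "verts G" "edges G" L n by fact
  interpret T': labelled_tree "verts H" "edges H" L' n by fact
  have inj: "inj_on F (verts G)" and E: "edges H = (`) F ` edges G" and injE: "inj_on ((`) F) (edges G)"
    using F by (auto simp: graph_iso_def bij_betw_def)
  have "(`) F ` (edges G - {e}) = (`) F ` edges G - (`) F ` {e}"
    by (rule inj_on_image_set_diff[OF injE]) (use e in auto)
  then have *: "edges H - {F ` e} = (`) F ` (edges G - {e})"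
    unfolding E by simp
  have sub: "edges G - {e} \<subseteq> Pow (verts G)" using T.E_sub by blast
  have "(L' 0, L' i) \<in> conn (edges H - {F ` e}) \<longleftrightarrow> (L 0, L i) \<in> conn (edges G - {e})" if "i < n" for i
    unfolding * using conn_image_iff[OF inj sub T.root_in T.label_in[OF that]] L[of 0] L[OF that] that by simp
  then show ?thesis
    unfolding T.cluster_def T'.cluster_def by auto
qed

section \<open>Metric graphs with known clusters\<close>

text \<open>The properties of a metric graph obtained by contraction, detached from its
  construction: \<open>b i\<close> is the surviving edge of index \<open>i\<close> and
  \<open>K i\<close> its cluster. \<open>K\<close> is given at all indices, also where
  \<open>p i = 0\<close> and the edge is gone.\<close>

locale metric_view = labelled_tree "verts (mgr M)" "edges (mgr M)" L n
  for M :: "'v mgraph" and L :: "nat \<Rightarrow> 'v" and n :: nat +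
  fixes b :: "nat \<Rightarrow> 'v set" and p :: "nat \<Rightarrow> real" and K :: "nat \<Rightarrow> nat set"
  assumes mulab: "i < n \<Longrightarrow> mulab M i \<in> edges (mgr M)" "i < n \<Longrightarrow> L i \<in> mulab M i"
    and mblab: "mblab M = (\<lambda>i. if i < n - 3 \<and> 0 < p i then Some (b i) else None)"
    and b_bij: "bij_betw b {i. i < n - 3 \<and> 0 < p i} (bounded_edges (mgr M))"
    and mlen_b: "i < n - 3 \<Longrightarrow> 0 < p i \<Longrightarrow> mlen M (b i) = p i"
    and cluster_b: "i < n - 3 \<Longrightarrow> 0 < p i \<Longrightarrow> cluster (b i) = K i"
    and mlen_0: "e \<notin> bounded_edges (mgr M) \<Longrightarrow> mlen M e = 0"
    and nonneg: "i < n - 3 \<Longrightarrow> 0 \<le> p i"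
    and K_inj: "inj_on K {..<n - 3}"
begin

lemma bounded_sub: "bounded_edges (mgr M) \<subseteq> edges (mgr M)"
  by (auto simp: bounded_edges_def)

lemma bounded_obtain:
  assumes "e \<in> bounded_edges (mgr M)"
  obtains i where "i < n - 3" "0 < p i" "b i = e"
proof -
  have "e \<in> b ` {i. i < n - 3 \<and> 0 < p i}" using assms b_bij by (simp add: bij_betw_def)
  then show ?thesis using that by blast
qed

lemma b_bounded: "i < n - 3 \<Longrightarrow> 0 < p i \<Longrightarrow> b i \<in> bounded_edges (mgr M)"
  using b_bij by (auto simp: bij_betw_def)

lemma leaf_vertex: "i < n \<Longrightarrow> leaf_vertex M i = L i"
  using leaf_vertex_eq[OF refl refl] mulab by blast

lemma double_ratio_keys:
  assumes "q \<in> quads n"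
  shows "double_ratio M q = (\<Sum>i<n - 3. p i * quad_sign (K i) q)"
proof -
  have "double_ratio M q = (\<Sum>e\<in>edges (mgr M). mlen M e * quad_sign (cluster e) q)"
    using double_ratio_eq[OF refl refl _ assms] leaf_vertex by blast
  also have "\<dots> = (\<Sum>e\<in>bounded_edges (mgr M). mlen M e * quad_sign (cluster e) q)"
    by (rule sum.mono_neutral_right) (use bounded_sub finE mlen_0 in auto)
  also have "\<dots> = (\<Sum>i | i < n - 3 \<and> 0 < p i. mlen M (b i) * quad_sign (cluster (b i)) q)"
    by (rule sum.reindex_bij_betw[OF b_bij, symmetric])
  also have "\<dots> = (\<Sum>i | i < n - 3 \<and> 0 < p i. p i * quad_sign (K i) q)"
    by (rule sum.cong) (auto simp: mlen_b cluster_b)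
  also have "\<dots> = (\<Sum>i<n - 3. p i * quad_sign (K i) q)"
    by (rule sum.mono_neutral_left) (use nonneg in \<open>auto simp: order_less_le\<close>)
  finally show ?thesis .
qed

text \<open>The clusters of unbounded edges are fixed, so the keys of positive length determine the
  whole family and with it the graph.\<close>

lemma clusters_eq: "cluster ` edges (mgr M) =
    K ` {i. i < n - 3 \<and> 0 < p i} \<union> insert {1..<n} ((\<lambda>i. {i}) ` {1..<n})" (is "_ = ?R")
proof -
  have lab: "cluster (mulab M i) = (if i = 0 then {1..<n} else {i})" if "i < n" for i
    using cluster_label_edge[OF that] mulab[OF that] by blast
  have 1: "cluster e \<in> ?R" if e: "e \<in> edges (mgr M)" for e
  proof (cases "e \<in> bounded_edges (mgr M)")
    case True
    then obtain i where "i < n - 3" "0 < p i" "b i = e" by (rule bounded_obtain)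
    then show ?thesis using cluster_b by auto
  next
    case False
    then obtain i where i: "i < n" "L i \<in> e"
      using e unbounded_edges_eq[OF refl refl] by (auto simp: bounded_edges_def)
    then show ?thesis using cluster_label_edge[OF i(1) e i(2)] by auto
  qed
  have 2: "K i \<in> cluster ` edges (mgr M)" if "i < n - 3" "0 < p i" for i
    using cluster_b[OF that] b_bounded[OF that] bounded_sub by (metis image_eqI subsetD)
  have 3: "{1..<n} \<in> cluster ` edges (mgr M)"
    using lab[of 0] mulab(1)[of 0] n3 by (metis (full_types) image_eqI less_le_trans zero_less_numeral)
  have 4: "{i} \<in> cluster ` edges (mgr M)" if "i \<in> {1..<n}" for i
    using lab[of i] mulab(1)[of i] that by (intro image_eqI[of _ _ "mulab M i"]) auto
  show ?thesis
  proof (rule subset_antisym)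
    show "cluster ` edges (mgr M) \<subseteq> ?R" by (rule image_subsetI) (rule 1)
    show "?R \<subseteq> cluster ` edges (mgr M)"
    proof (rule Un_least)
      show "K ` {i. i < n - 3 \<and> 0 < p i} \<subseteq> cluster ` edges (mgr M)"
        by (rule image_subsetI) (use 2 in simp)
      have "(\<lambda>i. {i}) ` {1..<n} \<subseteq> cluster ` edges (mgr M)"
        by (rule image_subsetI) (rule 4)
      with 3 show "insert {1..<n} ((\<lambda>i. {i}) ` {1..<n}) \<subseteq> cluster ` edges (mgr M)"
        by (rule insert_subsetI)
    qed
  qed
qed

end

lemma metric_view_iso_imp:
  assumes 1: "metric_view M L n b p K" and 2: "metric_view M' L' n b' p' K'"
    and F: "metric_iso M M' F" "\<And>i. i < n \<Longrightarrow> F ` mulab M i = mulab M' i"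
    and part: "\<And>i j e e'. mblab M i = Some e \<Longrightarrow> mblab M' j = Some e' \<Longrightarrow> F ` e = e' \<Longrightarrow> \<nu> i = \<nu>' j"
  shows "len (n - 3) (\<lambda>i. (K i, \<nu> i)) p k = len (n - 3) (\<lambda>i. (K' i, \<nu>' i)) p' k"
proof -
  interpret A: metric_view M L n b p K by fact
  interpret B: metric_view M' L' n b' p' K' by fact
  have iso: "graph_iso (mgr M) (mgr M') F" and ml: "\<And>e. e \<in> bounded_edges (mgr M) \<Longrightarrow> mlen M' (F ` e) = mlen M e"
    using F(1) by (auto simp: metric_iso_def)
  \<comment> \<open>\<open>F\<close> is only known to map each labelled edge onto the edge with the
    same label. It cannot turn it around, because \<open>F (L i)\<close> is again a leaf and an edge
    has at most one leaf.\<close>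
  have FL: "F (L i) = L' i" if i: "i < n" for i
  proof -
    have "L i \<in> leaves (mgr M)" using A.leaves_eq[OF refl refl] i by blast
    then have "F (L i) \<in> leaves (mgr M')"
      using graph_iso_leaf_iff[OF iso A.E_sub A.label_in[OF i]] by blast
    then obtain j where j: "j < n" "F (L i) = L' j" using B.leaves_eq[OF refl refl] by auto
    have "F (L i) \<in> mulab M' i" using F(2)[OF i] A.mulab(2)[OF i] by blast
    then have mem: "L' j \<in> mulab M' i" "L' i \<in> mulab M' i" using j B.mulab(2)[OF i] by simp_all
    have "L' i = L' j"
    proof (rule ccontr)
      assume ne: "L' i \<noteq> L' j"
      obtain x y where "mulab M' i = {x, y}" using B.edge_ends[OF B.mulab(1)[OF i]] by blast
      then have "mulab M' i = {L' i, L' j}" using mem ne by auto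
      then have "{L' i, L' j} \<in> edges (mgr M')" using B.mulab(1)[OF i] by simp
      then show False using B.not_label_edge[OF i j(1)] ne by blast
    qed
    then show ?thesis using j by simp
  qed
  have key: "K i = K' j \<and> p i = p' j \<and> \<nu> i = \<nu>' j"
    if "i < n - 3" "0 < p i" "j < n - 3" "0 < p' j" "F ` b i = b' j" for i j
  proof -
    have be: "b i \<in> bounded_edges (mgr M)" using A.b_bounded that by blast
    have "A.cluster (b i) = B.cluster (b' j)"
      using cluster_iso[OF A.labelled_tree_axioms B.labelled_tree_axioms iso FL, of "b i"] that(5) be A.bounded_sub by auto
    then have "K i = K' j" using A.cluster_b B.cluster_b that by simp
    moreover have "p i = p' j"
      using ml[OF be] A.mlen_b B.mlen_b that by simp
    moreover have "\<nu> i = \<nu>' j"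
      using part[of i "b i" j "b' j"] that A.mblab B.mblab by simp
    ultimately show ?thesis by simp
  qed
  show ?thesis
  proof (rule len_eqI)
    show "inj_on (\<lambda>i. (K i, \<nu> i)) {..<n - 3}" "inj_on (\<lambda>i. (K' i, \<nu>' i)) {..<n - 3}"
      using A.K_inj B.K_inj by (auto simp: inj_on_def)
    show "\<exists>j<n - 3. (K' j, \<nu>' j) = (K i, \<nu> i) \<and> p' j = p i" if "i < n - 3" "p i \<noteq> 0" for i
    proof -
      have i: "0 < p i" using that A.nonneg[of i] by simp
      have be: "b i \<in> bounded_edges (mgr M)" using A.b_bounded that i by blast
      then have "F ` b i \<in> bounded_edges (mgr M')"
        using graph_iso_bounded[OF iso A.E_sub] A.bounded_sub by blast
      then obtain j where "j < n - 3" "0 < p' j" "b' j = F ` b i" by (rule B.bounded_obtain)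
      then show ?thesis using key[of i j] that i by auto
    qed
    show "\<exists>i<n - 3. (K i, \<nu> i) = (K' j, \<nu>' j) \<and> p i = p' j" if "j < n - 3" "p' j \<noteq> 0" for j
    proof -
      have j: "0 < p' j" using that B.nonneg[of j] by simp
      have be: "b' j \<in> bounded_edges (mgr M')" using B.b_bounded that j by blast
      then have "b' j \<in> (`) F ` edges (mgr M)"
        using B.bounded_sub iso by (auto simp: graph_iso_def bij_betw_def)
      then obtain e where e: "e \<in> edges (mgr M)" "F ` e = b' j" by auto
      then have "e \<in> bounded_edges (mgr M)"
        using graph_iso_bounded[OF iso A.E_sub e(1)] be e(2) by simp
      then obtain i where "i < n - 3" "0 < p i" "b i = e" by (rule A.bounded_obtain)
      then show ?thesis using key[of i j] that j e by auto
    qed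
  qed
qed

text \<open>Equal length functions give equal sets of positive keys, hence equal cluster families,
  and \<open>labelled_tree_iso\<close> supplies \<open>F\<close>. Lengths and partitions match
  because \<open>F\<close> preserves clusters and keys are injective.\<close>

lemma metric_view_iso_exists:
  assumes 1: "metric_view M L n b p K" and 2: "metric_view M' L' n b' p' K'"
    and len: "\<And>k. len (n - 3) (\<lambda>i. (K i, \<nu> i)) p k = len (n - 3) (\<lambda>i. (K' i, \<nu>' i)) p' k"
  shows "\<exists>F. metric_iso M M' F \<and> (\<forall>i<n. F ` mulab M i = mulab M' i) \<and>
    (\<forall>i j e e'. mblab M i = Some e \<and> mblab M' j = Some e' \<and> F ` e = e' \<longrightarrow> \<nu> i = \<nu>' j)"
proof -
  interpret A: metric_view M L n b p K by fact
  interpret B: metric_view M' L' n b' p' K' by fact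
  have inj: "inj_on (\<lambda>i. (K i, \<nu> i)) {..<n - 3}" "inj_on (\<lambda>i. (K' i, \<nu>' i)) {..<n - 3}"
    using A.K_inj B.K_inj by (auto simp: inj_on_def)
  have AB: "\<exists>j<n - 3. K' j = K i \<and> \<nu>' j = \<nu> i \<and> p' j = p i" if "i < n - 3" "0 < p i" for i
    using len_eqD[OF inj len that(1)] that by auto
  have BA: "\<exists>i<n - 3. K i = K' j \<and> \<nu> i = \<nu>' j \<and> p i = p' j" if "j < n - 3" "0 < p' j" for j
    using len_eqD[OF inj(2,1) len[symmetric] that(1)] that by auto
  have "K ` {i. i < n - 3 \<and> 0 < p i} = K' ` {i. i < n - 3 \<and> 0 < p' i}"
  proof
    show "K ` {i. i < n - 3 \<and> 0 < p i} \<subseteq> K' ` {i. i < n - 3 \<and> 0 < p' i}"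
    proof
      fix C assume "C \<in> K ` {i. i < n - 3 \<and> 0 < p i}"
      then obtain i where i: "i < n - 3" "0 < p i" "C = K i" by auto
      then show "C \<in> K' ` {i. i < n - 3 \<and> 0 < p' i}" using AB[OF i(1,2)] by fastforce
    qed
    show "K' ` {i. i < n - 3 \<and> 0 < p' i} \<subseteq> K ` {i. i < n - 3 \<and> 0 < p i}"
    proof
      fix C assume "C \<in> K' ` {i. i < n - 3 \<and> 0 < p' i}"
      then obtain i where i: "i < n - 3" "0 < p' i" "C = K' i" by auto
      then show "C \<in> K ` {i. i < n - 3 \<and> 0 < p i}" using BA[OF i(1,2)] by fastforce
    qed
  qed
  then have "A.cluster ` edges (mgr M) = B.cluster ` edges (mgr M')"
    unfolding A.clusters_eq B.clusters_eq by simp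
  then obtain F where F: "bij_betw F (verts (mgr M)) (verts (mgr M'))" "bij_betw ((`) F) (edges (mgr M)) (edges (mgr M'))"
      "\<And>e. e \<in> edges (mgr M) \<Longrightarrow> B.cluster (F ` e) = A.cluster e"
    using labelled_tree_iso[OF A.labelled_tree_axioms B.labelled_tree_axioms] by blast
  have iso: "graph_iso (mgr M) (mgr M') F" using F by (simp add: graph_iso_def)
  have FE: "F ` e \<in> edges (mgr M')" if "e \<in> edges (mgr M)" for e
    using F(2) that by (auto simp: bij_betw_def)
  have mul: "F ` mulab M i = mulab M' i" if i: "i < n" for i
  proof (rule inj_onD[OF B.cluster_inj])
    show "B.cluster (F ` mulab M i) = B.cluster (mulab M' i)"
      using F(3)[OF A.mulab(1)[OF i]] A.cluster_label_edge[OF i A.mulab[OF i]]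
        B.cluster_label_edge[OF i B.mulab[OF i]] by simp
  qed (use FE A.mulab B.mulab i in auto)
  have Fb: "F ` b i = b' j" if "i < n - 3" "0 < p i" "j < n - 3" "K' j = K i" "p' j = p i" for i j
  proof (rule inj_onD[OF B.cluster_inj])
    have e: "b i \<in> edges (mgr M)" using A.b_bounded that A.bounded_sub by blast
    show "F ` b i \<in> edges (mgr M')" using FE[OF e] .
    show "b' j \<in> edges (mgr M')" using B.b_bounded[of j] that B.bounded_sub by auto
    show "B.cluster (F ` b i) = B.cluster (b' j)"
      using F(3)[OF e] A.cluster_b[of i] B.cluster_b[of j] that by simp
  qed
  have "mlen M' (F ` e) = mlen M e" if e: "e \<in> bounded_edges (mgr M)" for e
  proof -
    obtain i where i: "i < n - 3" "0 < p i" "b i = e" using A.bounded_obtain[OF e] .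
    then obtain j where j: "j < n - 3" "K' j = K i" "p' j = p i" using AB by blast
    then show ?thesis using Fb[OF i(1,2) j] A.mlen_b[OF i(1,2)] B.mlen_b[of j] i by simp
  qed
  then have "metric_iso M M' F" using iso by (simp add: metric_iso_def)
  moreover have "\<nu> i = \<nu>' j" if "mblab M i = Some e" "mblab M' j = Some e'" "F ` e = e'" for i j e e'
  proof -
    have i: "i < n - 3" "0 < p i" "b i = e" using that(1) A.mblab by (auto split: if_splits)
    have j: "j < n - 3" "0 < p' j" "b' j = e'" using that(2) B.mblab by (auto split: if_splits)
    have "e \<in> edges (mgr M)" using A.b_bounded i A.bounded_sub by blast
    then have "K' j = K i"
      using F(3)[of e] A.cluster_b[OF i(1,2)] B.cluster_b[OF j(1,2)] i j that(3) by simp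
    moreover obtain j' where "j' < n - 3" "K' j' = K i" "\<nu>' j' = \<nu> i" using AB[OF i(1,2)] by blast
    ultimately show ?thesis using inj_onD[OF B.K_inj, of j j'] j by auto
  qed
  ultimately show ?thesis using mul by blast
qed

section \<open>Double ratios determine the lengths\<close>

text \<open>The sets that can occur for a bounded edge: \<open>{1..<n}\<close> and the singletons
  belong to unbounded edges.\<close>

definition proper_cluster :: "nat \<Rightarrow> nat set \<Rightarrow> bool" where
  "proper_cluster n C \<longleftrightarrow> C \<subseteq> {..<n} \<and> 0 \<notin> C \<and> C \<noteq> {} \<and> (\<forall>j. C \<noteq> {j}) \<and> C \<noteq> {1..<n}"

definition nested_or_disjoint :: "nat set \<Rightarrow> nat set \<Rightarrow> bool" where
  "nested_or_disjoint C D \<longleftrightarrow> C \<inter> D = {} \<or> C \<subseteq> D \<or> D \<subseteq> C"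

text \<open>The quad separates \<open>a\<close>, \<open>a'\<close> from 0, \<open>b\<close>, where \<open>a'\<close> avoids the largest member of \<open>\<Sigma>\<close>
  strictly inside \<open>A\<close> that contains \<open>a\<close>, and \<open>b\<close> lies in the smallest one strictly containing \<open>A\<close>.\<close>

lemma isolating_quad:
  assumes fin: "finite \<Sigma>" and pcl: "\<And>C. C \<in> \<Sigma> \<Longrightarrow> proper_cluster n C"
    and nested: "\<And>C D. C \<in> \<Sigma> \<Longrightarrow> D \<in> \<Sigma> \<Longrightarrow> nested_or_disjoint C D"
    and A: "proper_cluster n A" "A \<notin> \<Sigma>" "\<And>C. C \<in> \<Sigma> \<Longrightarrow> nested_or_disjoint C A"
  shows "\<exists>q\<in>quads n. quad_sign A q = 1 \<and> (\<forall>C\<in>\<Sigma>. quad_sign C q = 0)"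
proof -
  have A': "A \<subseteq> {..<n}" "0 \<notin> A" "A \<noteq> {}" "A \<noteq> {1..<n}" "\<And>j. A \<noteq> {j}"
    using A(1) by (auto simp: proper_cluster_def)
  obtain a where a: "a \<in> A" using A'(3) by blast
  let ?S1 = "{C \<in> \<Sigma>. C \<subset> A \<and> a \<in> C}"
  obtain a' where a': "a' \<in> A" "a' \<noteq> a" "\<And>C. C \<in> ?S1 \<Longrightarrow> a' \<notin> C"
  proof (cases "?S1 = {}")
    case True
    obtain a' where "a' \<in> A" "a' \<noteq> a" using A'(5)[of a] a by blast
    then show ?thesis using that True by blast
  next
    case False
    have fin1: "finite ?S1" using fin by simp
    obtain M where M: "M \<in> ?S1" "\<forall>C\<in>?S1. M \<subseteq> C \<longrightarrow> M = C"
      by (rule bexE[OF finite_has_maximal[OF fin1 False]]) (rule that)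
    \<comment> \<open>The members of \<open>?S1\<close> share \<open>a\<close>, so they form a
      chain, and a maximal one is the largest.\<close>
    have sub: "C \<subseteq> M" if C: "C \<in> ?S1" for C
    proof -
      have "C \<in> \<Sigma>" "a \<in> C" "M \<in> \<Sigma>" "a \<in> M" using C M(1) by simp_all
      then have "C \<subseteq> M \<or> M \<subseteq> C" using nested[of C M] unfolding nested_or_disjoint_def by blast
      then show ?thesis using bspec[OF M(2) C] by auto
    qed
    have "M \<subset> A" using M(1) by simp
    then obtain a' where a': "a' \<in> A" "a' \<notin> M" by blast
    have "a \<in> M" using M(1) by simp
    then have "a' \<noteq> a" using a'(2) by blast
    show ?thesis
      by (rule that[OF a'(1) \<open>a' \<noteq> a\<close>]) (use sub a'(2) in blast)
  qed
  let ?S2 = "{C \<in> \<Sigma>. A \<subset> C}"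
  obtain b where b: "b \<notin> A" "b \<noteq> 0" "b < n" "\<And>C. C \<in> ?S2 \<Longrightarrow> b \<in> C"
  proof (cases "?S2 = {}")
    case True
    have "A \<subseteq> {1..<n}" using A'(1,2) by (auto simp: Suc_le_eq intro!: gr0I)
    \<comment> \<open>With no cluster above \<open>A\<close>, any nonzero label outside
      \<open>A\<close> will do; one exists because \<open>A\<close> is not
      \<open>{1..<n}\<close>.\<close>
    then obtain b where "b \<in> {1..<n}" "b \<notin> A" using A'(4) by blast
    then show ?thesis using that[of b] True by auto
  next
    case False
    have fin2: "finite ?S2" using fin by simp
    obtain N where N: "N \<in> ?S2" "\<forall>C\<in>?S2. C \<subseteq> N \<longrightarrow> N = C"
      by (rule bexE[OF finite_has_minimal[OF fin2 False]]) (rule that)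
    have sub: "N \<subseteq> C" if C: "C \<in> ?S2" for C
    proof -
      have "C \<in> \<Sigma>" "a \<in> C" "N \<in> \<Sigma>" "a \<in> N" using C N(1) a by auto
      then have "C \<subseteq> N \<or> N \<subseteq> C" using nested[of C N] unfolding nested_or_disjoint_def by blast
      then show ?thesis using bspec[OF N(2) C] by auto
    qed
    have "A \<subset> N" using N(1) by simp
    then obtain b where b: "b \<in> N" "b \<notin> A" by blast
    have "N \<subseteq> {..<n}" "0 \<notin> N" using pcl[of N] N(1) by (auto simp: proper_cluster_def)
    then have "b \<noteq> 0" "b < n" using b(1) by (metis, blast)
    then show ?thesis by (rule that[OF b(2)]) (use sub b(1) in blast)
  qed
  have n: "a < n" "a' < n" "0 < n" using a a'(1) A'(1) by auto
  have ne: "a \<noteq> 0" "a' \<noteq> 0" "b \<noteq> a" "b \<noteq> a'" using a a'(1) A'(2) b(1) by (metis, metis, metis, metis)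
  let ?q = "((a, 0), (a', b))"
  have "?q \<in> quads n"
    using n ne a'(2) b(2,3) by (auto simp: quads_def)
  moreover have "quad_sign A ?q = 1"
    using a a'(1) b(1) A'(2) by (simp add: quad_sign_def)
  moreover have "quad_sign C ?q = 0" if C: "C \<in> \<Sigma>" for C
  proof -
    have C0: "0 \<notin> C" using pcl[OF C] by (simp add: proper_cluster_def)
    consider "C \<inter> A = {}" | "C \<subset> A" | "A \<subset> C"
      using A(2) A(3)[OF C] C unfolding nested_or_disjoint_def by blast
    then show ?thesis
    proof cases
      case 1
      then have "a \<notin> C" using a by blast
      then show ?thesis using C0 by (simp add: quad_sign_def)
    next
      case 2
      show ?thesis
      proof (cases "a \<in> C")
        case True
        then have "a' \<notin> C" "b \<notin> C" using a'(3) b(1) 2 C by blast+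
        then show ?thesis by (simp add: quad_sign_def)
      qed (use C0 in \<open>simp add: quad_sign_def\<close>)
    next
      case 3
      then have "a' \<in> C" "b \<in> C" using a'(1) b(4) C by blast+
      then show ?thesis by (simp add: quad_sign_def)
    qed
  qed
  ultimately show ?thesis by blast
qed

text \<open>Take \<open>a\<close> in both sets, \<open>a'\<close> in \<open>A\<close> only,
  \<open>b\<close> in \<open>C\<close> only, and 0 in neither; the quad is
  \<open>((a, 0), (a', b))\<close>.\<close>

lemma crossing_quad:
  assumes "proper_cluster n A" "proper_cluster n C" "\<not> nested_or_disjoint C A"
  shows "\<exists>q\<in>quads n. quad_sign A q = 1 \<and> quad_sign C q = -1"
proof -
  obtain a a' b where ab: "a \<in> A" "a \<in> C" "a' \<in> A" "a' \<notin> C" "b \<in> C" "b \<notin> A"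
    using assms(3) unfolding nested_or_disjoint_def by blast
  have n: "a < n" "a' < n" "b < n" "0 < n" and C0: "0 \<notin> A" "0 \<notin> C"
    using ab assms(1,2) by (auto simp: proper_cluster_def)
  have ne: "a \<noteq> 0" "a' \<noteq> 0" "b \<noteq> 0" "a \<noteq> a'" "b \<noteq> a" "b \<noteq> a'"
    using ab C0 by (metis, metis, metis, metis, metis, metis)
  then have "((a, 0), (a', b)) \<in> quads n"
    using n by (auto simp: quads_def)
  moreover have "quad_sign A ((a, 0), (a', b)) = 1" "quad_sign C ((a, 0), (a', b)) = -1"
    using ab C0 by (auto simp: quad_sign_def)
  ultimately show ?thesis by blast
qed

definition tree_keys :: "nat \<Rightarrow> nat \<Rightarrow> (nat \<Rightarrow> nat set) \<Rightarrow> bool" where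
  "tree_keys n m K \<longleftrightarrow> inj_on K {..<m} \<and> (\<forall>i<m. proper_cluster n (K i)) \<and>
     (\<forall>i<m. \<forall>j<m. nested_or_disjoint (K i) (K j))"

text \<open>On actual trees this linear form is the double ratio \<open>q\<close>, by
  \<open>double_ratio_keys\<close>.\<close>

definition drsum :: "nat \<Rightarrow> (nat \<Rightarrow> nat set) \<Rightarrow> (nat \<Rightarrow> real) \<Rightarrow> quad \<Rightarrow> real" where
  "drsum m K p q = (\<Sum>i<m. p i * quad_sign (K i) q)"

text \<open>Positivity shows that no key of \<open>K'\<close> with positive length crosses
  \<open>K i\<close>. Then a quad isolating \<open>K i\<close> from the other such keys reads off
  the length of \<open>K i\<close> in the second tree, while its value in the first tree is at least
  \<open>p i\<close>.\<close>

lemma drsum_key_le: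
  assumes K: "tree_keys n m K" and K': "tree_keys n m K'"
    and p: "\<And>i. i < m \<Longrightarrow> 0 \<le> p i" and p': "\<And>i. i < m \<Longrightarrow> 0 \<le> p' i"
    and eq: "\<And>q. q \<in> quads n \<Longrightarrow> drsum m K p q = drsum m K' p' q"
    and i: "i < m" "0 < p i"
  shows "\<exists>j<m. K' j = K i \<and> p i \<le> p' j"
proof -
  \<comment> \<open>If \<open>q\<close> is positive on \<open>K i\<close>, it is negative on no
    other key of the same tree, so nothing is subtracted.\<close>
  have lower: "p i \<le> drsum m K p q" if q: "quad_sign (K i) q = 1" for q
  proof -
    have "0 \<le> p j * quad_sign (K j) q" if "j < m" for j
    proof -
      have "quad_sign (K j) q \<noteq> -1"
        using quad_sign_compatible[OF _ q] K i(1) that by (auto simp: tree_keys_def nested_or_disjoint_def)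
      then have "0 \<le> quad_sign (K j) q" using quad_sign_range[of "K j" q] by auto
      then show ?thesis using p[OF that] by simp
    qed
    then have "p i * quad_sign (K i) q \<le> drsum m K p q"
      unfolding drsum_def using i(1) by (intro member_le_sum) auto
    then show ?thesis using q by simp
  qed
  \<comment> \<open>A crossing key would give a quad whose value is at least \<open>p i > 0\<close>
    in the first tree and at most 0 in the second.\<close>
  have nested: "nested_or_disjoint (K' j) (K i)" if j: "j < m" "0 < p' j" for j
  proof (rule ccontr)
    assume "\<not> nested_or_disjoint (K' j) (K i)"
    then obtain q where q: "q \<in> quads n" "quad_sign (K i) q = 1" "quad_sign (K' j) q = -1"
      using crossing_quad[of n "K i" "K' j"] K K' i(1) j(1) by (auto simp: tree_keys_def)
    have "p' k * quad_sign (K' k) q \<le> 0" if "k < m" for k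
    proof -
      have "quad_sign (K' k) q \<noteq> 1"
        using quad_sign_compatible[of "K' k" "K' j" q] q(3) K' j(1) that
        by (auto simp: tree_keys_def nested_or_disjoint_def)
      then have "quad_sign (K' k) q \<le> 0" using quad_sign_range[of "K' k" q] by auto
      then show ?thesis using p'[OF that] by (simp add: mult_nonneg_nonpos)
    qed
    then have "drsum m K' p' q \<le> 0"
      unfolding drsum_def by (intro sum_nonpos) auto
    then show False using lower[OF q(2)] eq[OF q(1)] i(2) by simp
  qed
  \<comment> \<open>Only keys of positive length are taken; those of length 0 may cross
    \<open>K i\<close>, but they contribute 0 to the sum.\<close>
  let ?S = "K' ` {j. j < m \<and> 0 < p' j} - {K i}"
  have "\<exists>q\<in>quads n. quad_sign (K i) q = 1 \<and> (\<forall>C\<in>?S. quad_sign C q = 0)"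
  proof (rule isolating_quad)
    show "finite ?S" by simp
    show "proper_cluster n C" if "C \<in> ?S" for C using that K' by (auto simp: tree_keys_def)
    show "nested_or_disjoint C D" if "C \<in> ?S" "D \<in> ?S" for C D using that K' by (auto simp: tree_keys_def)
    show "proper_cluster n (K i)" using K i by (simp add: tree_keys_def)
    show "nested_or_disjoint C (K i)" if "C \<in> ?S" for C using that nested by auto
  qed simp
  then obtain q where q: "q \<in> quads n" "quad_sign (K i) q = 1" "\<And>C. C \<in> ?S \<Longrightarrow> quad_sign C q = 0" by blast
  have "drsum m K' p' q = len m K' p' (K i)"
  proof -
    have "drsum m K' p' q = (\<Sum>j | j < m \<and> K' j = K i. p' j * quad_sign (K' j) q)"
      unfolding drsum_def
    proof (rule sum.mono_neutral_right; (intro ballI)?)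
      fix j assume j: "j \<in> {..<m} - {j. j < m \<and> K' j = K i}"
      show "p' j * quad_sign (K' j) q = 0"
      proof (cases "p' j = 0")
        case False
        then have "K' j \<in> ?S" using j p'[of j] by auto
        then show ?thesis using q(3) by simp
      qed simp
    qed auto
    also have "\<dots> = len m K' p' (K i)"
      unfolding len_def by (rule sum.cong) (auto simp: q(2))
    finally show ?thesis .
  qed
  then have le: "p i \<le> len m K' p' (K i)"
    using lower[OF q(2)] eq[OF q(1)] by simp
  then obtain j where j: "j < m" "K' j = K i"
    using len_nonzero[of m K' p' "K i"] i(2) by auto
  then show ?thesis
    using le len_key[of K' m j p'] K' by (auto simp: tree_keys_def)
qed

text \<open>The inequality of \<open>drsum_key_le\<close>, used in both directions, closes into an
  equality because keys are injective within each tree.\<close>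

lemma drsum_determines:
  assumes K: "tree_keys n m K" and K': "tree_keys n m K'"
    and p: "\<And>i. i < m \<Longrightarrow> 0 \<le> p i" and p': "\<And>i. i < m \<Longrightarrow> 0 \<le> p' i"
    and eq: "\<And>q. q \<in> quads n \<Longrightarrow> drsum m K p q = drsum m K' p' q"
  shows "len m K p k = len m K' p' k"
proof (rule len_eqI)
  show inj: "inj_on K {..<m}" "inj_on K' {..<m}" using K K' by (auto simp: tree_keys_def)
  show "\<exists>j<m. K' j = K i \<and> p' j = p i" if i: "i < m" "p i \<noteq> 0" for i
  proof -
    have "0 < p i" using p[OF i(1)] i(2) by simp
    then obtain j where j: "j < m" "K' j = K i" "p i \<le> p' j"
      using drsum_key_le[OF K K' p p' eq i(1)] by blast
    then have "0 < p' j" using \<open>0 < p i\<close> by simp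
    then obtain l where l: "l < m" "K l = K' j" "p' j \<le> p l"
      using drsum_key_le[OF K' K p' p eq[symmetric] j(1)] by blast
    have "l = i" using inj_onD[OF inj(1), of l i] l j i by simp
    then show ?thesis using j l by auto
  qed
  show "\<exists>i<m. K i = K' j \<and> p i = p' j" if j: "j < m" "p' j \<noteq> 0" for j
  proof -
    have "0 < p' j" using p'[OF j(1)] j(2) by simp
    then obtain i where i: "i < m" "K i = K' j" "p' j \<le> p i"
      using drsum_key_le[OF K' K p' p eq[symmetric] j(1)] by blast
    then have "0 < p i" using \<open>0 < p' j\<close> by simp
    then obtain l where l: "l < m" "K' l = K i" "p i \<le> p' l"
      using drsum_key_le[OF K K' p p' eq i(1)] by blast
    have "l = j" using inj_onD[OF inj(2), of l j] l j i by simp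
    then show ?thesis using i l by auto
  qed
qed

text \<open>Each coordinate of a cone is itself a double ratio. This yields a continuous inverse of
  the double ratio map on every cone.\<close>

lemma isolating_key_quad:
  assumes K: "tree_keys n m K" and i: "i < m"
  shows "\<exists>q\<in>quads n. \<forall>p. drsum m K p q = p i"
proof -
  let ?S = "K ` {..<m} - {K i}"
  have "\<exists>q\<in>quads n. quad_sign (K i) q = 1 \<and> (\<forall>C\<in>?S. quad_sign C q = 0)"
    by (rule isolating_quad) (use K i in \<open>auto simp: tree_keys_def\<close>)
  then obtain q where q: "q \<in> quads n" "quad_sign (K i) q = 1" "\<And>C. C \<in> ?S \<Longrightarrow> quad_sign C q = 0" by blast
  have sign: "quad_sign (K j) q = of_bool (j = i)" if "j < m" for j
  proof (cases "j = i")
    case False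
    then have "K j \<noteq> K i" using inj_onD[of K "{..<m}" j i] K that i by (auto simp: tree_keys_def)
    then show ?thesis using q(3)[of "K j"] that False by simp
  qed (use q in simp)
  have "drsum m K p q = p i" for p
  proof -
    have "drsum m K p q = (\<Sum>j<m. if j = i then p j else 0)"
      unfolding drsum_def by (rule sum.cong) (auto simp: sign)
    then show ?thesis using i by simp
  qed
  then show ?thesis using q(1) by blast
qed

text \<open>A swap within a pair changes the sign and an exchange of the pairs does not. So the
  chosen representatives determine all double ratios, up to a sign that does not depend on the
  tree.\<close>

lemma quad_swap_sign:
  assumes "quad_swap\<^sup>*\<^sup>* q q'"
  shows "\<exists>s\<in>{1, -1}. \<forall>m K p. drsum m K p q' = s * drsum m K p q"
  using assms
proof (induction rule: rtranclp_induct)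
  case (step y z)
  have "\<exists>t\<in>{1, -1}. \<forall>C. quad_sign C z = t * quad_sign C y"
    using step(2)
  proof cases
    case (1 w x u v)
    then show ?thesis by (intro bexI[of _ "-1"]) (auto simp: quad_sign_def)
  next
    case (2 w x u v)
    then show ?thesis by (intro bexI[of _ "-1"]) (auto simp: quad_sign_def)
  next
    case (3 w x u v)
    then show ?thesis by (intro bexI[of _ 1]) (auto simp: quad_sign_def)
  qed
  then obtain t where t: "t \<in> {1, -1}" "\<And>C. quad_sign C z = t * quad_sign C y" by blast
  have t': "drsum m K p z = t * drsum m K p y" for m K p
    unfolding drsum_def t(2) sum_distrib_left by (rule sum.cong) (auto simp: algebra_simps)
  obtain s where s: "s \<in> {1, -1}" "\<forall>m K p. drsum m K p y = s * drsum m K p q"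
    using step(3) by blast
  have "t * s \<in> {1, -1}" using s(1) t(1) by auto
  then show ?case using t' s(2) by (intro bexI[of _ "t * s"]) auto
qed (intro bexI[of _ 1]; simp)

section \<open>The metric graph of a labelled tree\<close>

locale metric_trivalent_tree = trivalent_tree +
  fixes p :: "nat \<Rightarrow> real"
  assumes p_nonneg: "i < n - 3 \<Longrightarrow> 0 \<le> p i"
begin

definition zero_edges :: "nat set set" where
  "zero_edges = blab T ` {i. i < n - 3 \<and> p i = 0}"

lemma zero_edges_bounded: "zero_edges \<subseteq> bounded_edges (gr T)"
  using blab_bounded by (auto simp: zero_edges_def)

sublocale contraction V E "leaf_of T" n zero_edges
proof
  show "zero_edges \<subseteq> E" using zero_edges_bounded bounded_E by blast
  show "leaf_of T i \<notin> e" if "i < n" "e \<in> zero_edges" for i e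
    using that zero_edges_bounded bounded_no_leaf by blast
qed

abbreviation "M \<equiv> metric_tree n T p"

lemma collapse_block: "u \<in> V \<Longrightarrow> collapse (gr T) zero_edges u = block u"
  using collapse_eq[of u "gr T" zero_edges] S E_sub by (simp add: block_def subset_trans)

lemma collapse_block_image: "e \<in> E \<Longrightarrow> collapse (gr T) zero_edges ` e = block ` e"
  using collapse_block E_sub by (intro image_cong) auto

lemma blab_E: "i < n - 3 \<Longrightarrow> blab T i \<in> E"
  using blab_bounded bounded_E by blast

lemma blab_inj: "inj_on (blab T) {..<n - 3}"
  using facts(5) by (simp add: bij_betw_def)

lemma positive_edge:
  assumes "i < n - 3" "0 < p i"
  shows "blab T i \<in> E - zero_edges"
proof -
  have "blab T i \<notin> zero_edges"
    using assms inj_onD[OF blab_inj, of i] by (auto simp: zero_edges_def)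
  then show ?thesis using blab_E assms by blast
qed

lemma M_verts: "verts (mgr M) = block ` V"
  and M_edges: "edges (mgr M) = (`) block ` (E - zero_edges)"
  and M_mulab: "i < n \<Longrightarrow> mulab M i = block ` ulab T i"
  and M_mblab: "mblab M = (\<lambda>i. if i < n - 3 \<and> 0 < p i then Some (block ` blab T i) else None)"
proof -
  show "verts (mgr M) = block ` V"
    using collapse_block by (simp add: metric_tree_def Let_def degenerate_def flip: zero_edges_def)
  show "edges (mgr M) = (`) block ` (E - zero_edges)"
    using collapse_block_image by (simp add: metric_tree_def Let_def degenerate_def flip: zero_edges_def)
  show "i < n \<Longrightarrow> mulab M i = block ` ulab T i"
    using collapse_block_image[OF ulab_E] by (simp add: metric_tree_def Let_def flip: zero_edges_def)
  show "mblab M = (\<lambda>i. if i < n - 3 \<and> 0 < p i then Some (block ` blab T i) else None)"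
    using collapse_block_image[OF blab_E] by (auto simp: metric_tree_def Let_def simp flip: zero_edges_def)
qed

lemma M_mlen: "mlen M e =
    (if \<exists>i. mblab M i = Some e then p (THE i. mblab M i = Some e) else 0)"
  by (simp add: metric_tree_def Let_def)

lemma M_labelled: "labelled_tree (verts (mgr M)) (edges (mgr M)) (\<lambda>i. block (leaf_of T i)) n"
  unfolding M_verts M_edges by (rule labelled_tree_contraction)

text \<open>Contraction does not change which labels lie on an edge, and an edge is unbounded when
  it contains a label.\<close>

lemma block_bounded:
  assumes "e \<in> E - zero_edges"
  shows "block ` e \<in> bounded_edges (mgr M) \<longleftrightarrow> e \<in> bounded_edges (gr T)"
proof -
  interpret Q: labelled_tree "verts (mgr M)" "edges (mgr M)" "\<lambda>i. block (leaf_of T i)" n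
    by (rule M_labelled)
  have "block (leaf_of T i) \<in> block ` e \<longleftrightarrow> leaf_of T i \<in> e" if i: "i < n" for i
  proof
    assume "block (leaf_of T i) \<in> block ` e"
    then obtain a where a: "a \<in> e" "block a = block (leaf_of T i)" by auto
    then have "a \<in> V" using assms E_sub by blast
    then show "leaf_of T i \<in> e" using block_label[OF _ i a(2)] a(1) by simp
  qed blast
  moreover have "block ` e \<in> edges (mgr M)" unfolding M_edges using assms by blast
  ultimately show ?thesis
    using assms unfolding bounded_edges_def Q.unbounded_edges_eq[OF refl refl] unbounded_edges_eq[OF refl refl]
    by blast
qed

text \<open>Gives the \<open>THE\<close> in the definition of \<open>mlen\<close> its value.\<close>

lemma mblab_unique: "mblab M i = Some e \<Longrightarrow> mblab M j = Some e \<Longrightarrow> i = j"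
proof -
  assume "mblab M i = Some e" "mblab M j = Some e"
  then have ij: "i < n - 3" "0 < p i" "j < n - 3" "0 < p j" "block ` blab T i = block ` blab T j"
    by (auto simp: M_mblab split: if_splits)
  then have "blab T i = blab T j"
    using inj_onD[OF block_edge_inj ij(5)] positive_edge by blast
  then show "i = j" using inj_onD[OF blab_inj] ij by blast
qed

lemma metric_view: "metric_view M (\<lambda>i. block (leaf_of T i)) n (\<lambda>i. block ` blab T i) p key"
proof -
  interpret Q: labelled_tree "verts (mgr M)" "edges (mgr M)" "\<lambda>i. block (leaf_of T i)" n
    by (rule M_labelled)
  have cl: "Q.cluster (block ` e) = cluster e" if "e \<in> E - zero_edges" for e
    using cluster_contraction[OF that] unfolding M_edges .
  have bij: "bij_betw (\<lambda>i. block ` blab T i) {i. i < n - 3 \<and> 0 < p i} (bounded_edges (mgr M))"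
    unfolding bij_betw_def
  proof
    show "inj_on (\<lambda>i. block ` blab T i) {i. i < n - 3 \<and> 0 < p i}"
    proof (rule inj_onI)
      fix i j assume "i \<in> {i. i < n - 3 \<and> 0 < p i}" "j \<in> {i. i < n - 3 \<and> 0 < p i}" "block ` blab T i = block ` blab T j"
      then show "i = j" using mblab_unique[of i "block ` blab T i" j] by (simp add: M_mblab)
    qed
    show "(\<lambda>i. block ` blab T i) ` {i. i < n - 3 \<and> 0 < p i} = bounded_edges (mgr M)"
    proof (rule subset_antisym; rule subsetI)
      fix f assume "f \<in> (\<lambda>i. block ` blab T i) ` {i. i < n - 3 \<and> 0 < p i}"
      then show "f \<in> bounded_edges (mgr M)" using block_bounded positive_edge blab_bounded by auto
    next
      fix f assume f: "f \<in> bounded_edges (mgr M)"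
      then have "f \<in> edges (mgr M)" by (simp add: bounded_edges_def)
      then obtain e where e: "e \<in> E - zero_edges" "f = block ` e" unfolding M_edges by blast
      then have "e \<in> bounded_edges (gr T)" using block_bounded f by blast
      then obtain i where i: "i < n - 3" "e = blab T i"
        using facts(5) by (auto simp: bij_betw_def)
      then have "p i \<noteq> 0" using e(1) by (auto simp: zero_edges_def)
      then show "f \<in> (\<lambda>i. block ` blab T i) ` {i. i < n - 3 \<and> 0 < p i}"
        using p_nonneg[OF i(1)] i e(2) by auto
    qed
  qed
  show ?thesis
  proof (unfold_locales)
    show "mulab M i \<in> edges (mgr M)" "block (leaf_of T i) \<in> mulab M i" if "i < n" for i
    proof -
      have "ulab T i \<in> E - zero_edges"
        using ulab_E[OF that] leaf_of[OF that] S_label[OF that] by blast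
      then show "mulab M i \<in> edges (mgr M)" "block (leaf_of T i) \<in> mulab M i"
        unfolding M_mulab[OF that] M_edges using leaf_of[OF that] by auto
    qed
    show "mblab M = (\<lambda>i. if i < n - 3 \<and> 0 < p i then Some (block ` blab T i) else None)"
      by (rule M_mblab)
    show "bij_betw (\<lambda>i. block ` blab T i) {i. i < n - 3 \<and> 0 < p i} (bounded_edges (mgr M))"
      by (rule bij)
    show "mlen M (block ` blab T i) = p i" if "i < n - 3" "0 < p i" for i
    proof -
      have i: "mblab M i = Some (block ` blab T i)" using that by (simp add: M_mblab)
      then have "(THE j. mblab M j = Some (block ` blab T i)) = i"
        using mblab_unique by (intro the_equality) auto
      then show ?thesis unfolding M_mlen using i by auto
    qed
    show "Q.cluster (block ` blab T i) = key i" if "i < n - 3" "0 < p i" for i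
      using cl[OF positive_edge[OF that]] by (simp add: key_def)
    show "mlen M e = 0" if "e \<notin> bounded_edges (mgr M)" for e
    proof -
      have "mblab M i \<noteq> Some e" for i
        using that bij by (auto simp: M_mblab bij_betw_def split: if_splits)
      then show ?thesis by (simp add: M_mlen)
    qed
    show "0 \<le> p i" if "i < n - 3" for i by (rule p_nonneg[OF that])
    show "inj_on key {..<n - 3}" by (rule key_inj)
  qed
qed

end

section \<open>Orthants, their faces, and complexes glued from them\<close>

section \<open>Faces of orthants\<close>

definition unit_seq :: "nat \<Rightarrow> nat \<Rightarrow> real" where
  "unit_seq i = (\<lambda>j. if j = i then 1 else 0)"

definition coord_space :: "nat set \<Rightarrow> (nat \<Rightarrow> real) set" where
  "coord_space J = {x. \<forall>i. i \<notin> J \<longrightarrow> x i = 0}"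

definition coord_face :: "nat set \<Rightarrow> (nat \<Rightarrow> real) set" where
  "coord_face J = {x. (\<forall>i. 0 \<le> x i) \<and> (\<forall>i. i \<notin> J \<longrightarrow> x i = 0)}"

lemma orthant_coord_face: "orthant m = coord_face {..<m}"
proof -
  have "(\<forall>i\<ge>m. x i = 0) \<and> (\<forall>i<m. 0 \<le> x i) \<longleftrightarrow> (\<forall>i. 0 \<le> x i) \<and> (\<forall>i. \<not> i < m \<longrightarrow> x i = 0)" for x :: "nat \<Rightarrow> real"
    by (metis linorder_not_less order_refl)
  then show ?thesis
    by (auto simp: orthant_def topspace_Euclidean_space coord_face_def)
qed

lemma coord_face_sub_space: "coord_face J \<subseteq> coord_space J"
  by (auto simp: coord_face_def coord_space_def)

lemma coord_face_mono: "J \<subseteq> J' \<Longrightarrow> coord_face J \<subseteq> coord_face J'"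
  by (auto simp: coord_face_def)

lemma zero_coord_face [simp]: "0 \<in> coord_face J"
  by (simp add: coord_face_def)

lemma unit_seq_face: "i \<in> J \<Longrightarrow> unit_seq i \<in> coord_face J"
  by (auto simp: coord_face_def unit_seq_def)

lemma subspace_coord_space: "subspace (coord_space J)"
  by (auto simp: subspace_def coord_space_def scaleR_fun_def)

lemma sum_fun_apply: "(\<Sum>b\<in>A. f b) x = (\<Sum>b\<in>A. (f b x :: real))" for f :: "'b \<Rightarrow> 'c \<Rightarrow> real"
  by (induction A rule: infinite_finite_induct) auto

lemma coord_space_expand:
  assumes "finite J" "x \<in> coord_space J"
  shows "x = (\<Sum>i\<in>J. x i *\<^sub>R unit_seq i)"
proof
  fix j
  have "(\<Sum>i\<in>J. x i *\<^sub>R unit_seq i) j = (\<Sum>i\<in>J. if j = i then x i else 0)"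
    unfolding sum_fun_apply by (rule sum.cong) (auto simp: scaleR_fun_def unit_seq_def)
  also have "\<dots> = x j"
    using assms by (auto simp: coord_space_def)
  finally show "x j = (\<Sum>i\<in>J. x i *\<^sub>R unit_seq i) j" by simp
qed

lemma span_unit_seq:
  assumes "finite J"
  shows "span (unit_seq ` J) = coord_space J"
proof
  show "span (unit_seq ` J) \<subseteq> coord_space J"
    by (rule span_minimal[OF _ subspace_coord_space]) (auto simp: unit_seq_def coord_space_def)
  show "coord_space J \<subseteq> span (unit_seq ` J)"
  proof
    fix x assume "x \<in> coord_space J"
    then have "x = (\<Sum>i\<in>J. x i *\<^sub>R unit_seq i)" by (rule coord_space_expand[OF assms])
    also have "\<dots> \<in> span (unit_seq ` J)"
      by (intro span_sum span_scale span_base) auto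
    finally show "x \<in> span (unit_seq ` J)" .
  qed
qed

lemma unit_seq_inj: "inj unit_seq"
proof (rule injI)
  fix i j assume "unit_seq i = unit_seq j"
  then have "unit_seq i i = unit_seq j i" by simp
  then show "i = j" by (auto simp: unit_seq_def split: if_splits)
qed

lemma independent_unit_seq:
  assumes "finite J"
  shows "independent (unit_seq ` J)"
  using assms
proof (induction J rule: finite_induct)
  case (insert i J)
  have "unit_seq i \<notin> coord_space J"
    using insert(2) by (auto simp: coord_space_def unit_seq_def)
  then have "unit_seq i \<notin> span (unit_seq ` J)"
    unfolding span_unit_seq[OF insert(1)] .
  then show ?case using insert by (simp add: independent_insertI)
qed (simp add: independent_empty)

lemma dim_coord_space: "finite J \<Longrightarrow> dim (coord_space J) = card J"
  using dim_eq_card[of "unit_seq ` J" "coord_space J"] independent_unit_seq[of J] span_unit_seq[of J]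
    card_image[of unit_seq J] unit_seq_inj span_span
  by (metis inj_on_subset subset_UNIV)

lemma span_coord_face:
  assumes "finite J"
  shows "span (coord_face J) = coord_space J"
proof
  show "span (coord_face J) \<subseteq> coord_space J"
    by (rule span_minimal[OF coord_face_sub_space subspace_coord_space])
  show "coord_space J \<subseteq> span (coord_face J)"
    unfolding span_unit_seq[OF assms, symmetric] by (rule span_mono) (auto intro: unit_seq_face)
qed

lemma affine_hull_coord_face: "finite J \<Longrightarrow> affine hull (coord_face J) = coord_space J"
  using affine_hull_span_0[of "coord_face J"] hull_inc[of 0 "coord_face J"] span_coord_face by simp

lemma direction_space_coord_face:
  assumes "finite J"
  shows "direction_space (coord_face J) = coord_space J"
proof
  show "direction_space (coord_face J) \<subseteq> coord_space J"
    unfolding direction_space_def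
    by (rule span_minimal[OF _ subspace_coord_space]) (auto simp: coord_space_def coord_face_def)
  have "unit_seq ` J \<subseteq> {x - y | x y. x \<in> coord_face J \<and> y \<in> coord_face J}"
  proof
    fix u assume "u \<in> unit_seq ` J"
    then have "u \<in> coord_face J" by (auto intro: unit_seq_face)
    then have "u = u - 0 \<and> u \<in> coord_face J \<and> 0 \<in> coord_face J" by simp
    then show "u \<in> {x - y | x y. x \<in> coord_face J \<and> y \<in> coord_face J}" by blast
  qed
  then show "coord_space J \<subseteq> direction_space (coord_face J)"
    unfolding direction_space_def span_unit_seq[OF assms, symmetric] by (rule span_mono)
qed

lemma poly_dim_coord_face: "finite J \<Longrightarrow> poly_dim (coord_face J) = card J"
  by (simp add: poly_dim_def direction_space_coord_face dim_coord_space)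

text \<open>The polytope is the point 0, and the cone is generated by the unit vectors of
  \<open>J\<close>.\<close>

lemma lattice_polyhedron_coord_face:
  assumes "J \<subseteq> {..<m}"
  shows "lattice_polyhedron (coord_face J)"
proof -
  have fin: "finite J" using assms finite_subset by blast
  have inj: "inj_on unit_seq J" using unit_seq_inj inj_on_subset by blast
  have sum: "(\<Sum>b\<in>unit_seq ` J. t b *\<^sub>R b) = (\<Sum>i\<in>J. t (unit_seq i) *\<^sub>R unit_seq i)" for t
    by (simp add: sum.reindex[OF inj])
  have val: "(\<Sum>i\<in>J. t i *\<^sub>R unit_seq i) j = (if j \<in> J then t j else 0)" for t j
  proof -
    have "(\<Sum>i\<in>J. t i *\<^sub>R unit_seq i) j = (\<Sum>i\<in>J. if j = i then t i else 0)"
      unfolding sum_fun_apply by (rule sum.cong) (auto simp: scaleR_fun_def unit_seq_def)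
    then show ?thesis using fin by simp
  qed
  have "coord_face J = {x + (\<Sum>b\<in>unit_seq ` J. t b *\<^sub>R b) | x t. x \<in> convex hull {0} \<and> (\<forall>b\<in>unit_seq ` J. 0 \<le> t b)}"
  proof (intro subset_antisym subsetI)
    fix x assume x: "x \<in> coord_face J"
    define t where "t b = x (inv_into J unit_seq b)" for b
    have "x = 0 + (\<Sum>b\<in>unit_seq ` J. t b *\<^sub>R b)"
    proof -
      have "(\<Sum>i\<in>J. t (unit_seq i) *\<^sub>R unit_seq i) = (\<Sum>i\<in>J. x i *\<^sub>R unit_seq i)"
        by (rule sum.cong) (auto simp: t_def inv_into_f_f[OF inj])
      then show ?thesis
        using coord_space_expand[OF fin, of x] x coord_face_sub_space unfolding sum by auto
    qed
    moreover have "\<forall>b\<in>unit_seq ` J. 0 \<le> t b"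
      using x by (auto simp: t_def coord_face_def)
    ultimately show "x \<in> {x + (\<Sum>b\<in>unit_seq ` J. t b *\<^sub>R b) | x t. x \<in> convex hull {0} \<and> (\<forall>b\<in>unit_seq ` J. 0 \<le> t b)}"
      by (intro CollectI exI[of _ 0] exI[of _ t]) auto
  next
    fix x assume "x \<in> {x + (\<Sum>b\<in>unit_seq ` J. t b *\<^sub>R b) | x t. x \<in> convex hull {0} \<and> (\<forall>b\<in>unit_seq ` J. 0 \<le> t b)}"
    then obtain t where t: "x = (\<Sum>i\<in>J. t (unit_seq i) *\<^sub>R unit_seq i)" "\<forall>b\<in>unit_seq ` J. 0 \<le> t b"
      unfolding sum by auto
    then show "x \<in> coord_face J" using val[of "\<lambda>i. t (unit_seq i)"] by (auto simp: coord_face_def)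
  qed
  moreover have "{0} \<union> unit_seq ` J \<subseteq> int_points \<inter> topspace (Euclidean_space m)"
    using assms by (auto simp: int_points_def topspace_Euclidean_space unit_seq_def)
  ultimately show ?thesis
    unfolding lattice_polyhedron_def using fin by (intro exI[of _ m] exI[of _ "{0}"] exI[of _ "unit_seq ` J"]) auto
qed

lemma convex_coord_face: "convex (coord_face J)"
  by (auto simp: convex_def coord_face_def scaleR_fun_def)

lemma open_segment_fun: "x \<in> open_segment a b \<longleftrightarrow> a \<noteq> b \<and> (\<exists>u. 0 < u \<and> u < 1 \<and> x = (\<lambda>i. (1 - u) * a i + u * b i))"
  for a b x :: "nat \<Rightarrow> real"
  by (auto simp: in_segment scaleR_fun_def plus_fun_def)

lemma coord_face_face:
  assumes "J \<subseteq> J'"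
  shows "coord_face J face_of coord_face J'"
  unfolding face_of_def
proof (intro conjI ballI impI)
  show "coord_face J \<subseteq> coord_face J'" by (rule coord_face_mono[OF assms])
  show "convex (coord_face J)" by (rule convex_coord_face)
  fix a b x assume ab: "a \<in> coord_face J'" "b \<in> coord_face J'" "x \<in> coord_face J" "x \<in> open_segment a b"
  then obtain u where u: "0 < u" "u < 1" "\<And>i. x i = (1 - u) * a i + u * b i"
    by (auto simp: open_segment_fun)
  have "a i = 0 \<and> b i = 0" if "i \<notin> J" for i
  proof -
    have "(1 - u) * a i + u * b i = 0" using ab(3) that u(3)[of i] by (simp add: coord_face_def)
    moreover have "0 \<le> (1 - u) * a i" "0 \<le> u * b i" using ab u by (auto simp: coord_face_def)
    ultimately have "(1 - u) * a i = 0" "u * b i = 0" by linarith+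
    then show ?thesis using u by auto
  qed
  then show "a \<in> coord_face J" "b \<in> coord_face J" using ab by (auto simp: coord_face_def)
qed

text \<open>Averaging produces a point \<open>z\<close> of \<open>F\<close> that is positive on the
  whole support \<open>J\<close> of \<open>F\<close>. For any other \<open>x\<close> in
  \<open>coord_face J\<close> the segment from \<open>x\<close> to \<open>z\<close> can be prolonged
  a little beyond \<open>z\<close> inside the orthant. So \<open>z\<close> is an inner point of a
  segment starting at \<open>x\<close>, and the face property puts \<open>x\<close> into
  \<open>F\<close>.\<close>

lemma face_of_coord_face:
  assumes fin: "finite I" and F: "F face_of coord_face I" "F \<noteq> {}"
  shows "\<exists>J\<subseteq>I. F = coord_face J"
proof -
  define J where "J = {i. \<exists>x\<in>F. x i \<noteq> 0}"
  have sub: "F \<subseteq> coord_face I" and conv: "convex F" using F(1) by (auto simp: face_of_def)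
  have JI: "J \<subseteq> I" using sub by (fastforce simp: J_def coord_face_def)
  have "finite J" using fin JI finite_subset by blast
  have "\<exists>z\<in>F. \<forall>i\<in>H. 0 < z i" if "finite H" "H \<subseteq> J" for H
    using that
  proof (induction H rule: finite_induct)
    case empty
    then show ?case using F(2) by blast
  next
    case (insert i H)
    then obtain z where z: "z \<in> F" "\<forall>i\<in>H. 0 < z i" by blast
    obtain x where x: "x \<in> F" "x i \<noteq> 0" using insert by (auto simp: J_def)
    let ?y = "(1/2) *\<^sub>R z + (1/2) *\<^sub>R x"
    have "?y \<in> F" using convexD[OF conv z(1) x(1), of "1/2" "1/2"] by simp
    moreover have "0 < ?y j" if "j \<in> insert i H" for j
    proof -
      have "0 \<le> z j" "0 \<le> x j" using z(1) x(1) sub by (auto simp: coord_face_def)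
      moreover have "0 < z j \<or> x j \<noteq> 0" using that z(2) x(2) by blast
      ultimately show ?thesis by (auto simp: scaleR_fun_def)
    qed
    ultimately show ?case by blast
  qed
  then obtain z where z: "z \<in> F" "\<forall>i\<in>J. 0 < z i" using \<open>finite J\<close> by blast
  have "coord_face J \<subseteq> F"
  proof
    fix x assume x: "x \<in> coord_face J"
    show "x \<in> F"
    proof (cases "x = z")
      case False
      have "\<exists>e>0. \<forall>i\<in>J. e * x i \<le> z i"
      proof -
        \<comment> \<open>Small enough that \<open>z - e x\<close> stays nonnegative on
          \<open>J\<close>; the \<open>+ 1\<close> in the denominator allows \<open>x i = 0\<close>,
          and the inserted 1 allows an empty \<open>J\<close>.\<close>
        define e where "e = Min (insert 1 ((\<lambda>i. z i / (x i + 1)) ` J))"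
        have xn: "0 \<le> x i" for i using x by (simp add: coord_face_def)
        have "0 < e" unfolding e_def using \<open>finite J\<close> z(2) xn
          by (subst Min_gr_iff) (auto intro!: divide_pos_pos add_nonneg_pos)
        moreover have "e * x i \<le> z i" if i: "i \<in> J" for i
        proof -
          have "e \<le> z i / (x i + 1)" unfolding e_def using \<open>finite J\<close> i by (intro Min_le) auto
          then have "e * (x i + 1) \<le> z i" using xn[of i] by (simp add: pos_le_divide_eq add_nonneg_pos)
          moreover have "e * x i \<le> e * (x i + 1)" using \<open>0 < e\<close> by (simp add: algebra_simps)
          ultimately show ?thesis by linarith
        qed
        ultimately show ?thesis by blast
      qed
      then obtain e where e: "0 < e" "\<forall>i\<in>J. e * x i \<le> z i" by blast
      \<comment> \<open>The point \<open>z + e (z - x)\<close> beyond \<open>z\<close> on the line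
        from \<open>x\<close>.\<close>
      define w where "w = (\<lambda>i. (1 + e) * z i - e * x i)"
      have w: "w \<in> coord_face I"
      proof -
        have "0 \<le> w i" for i
        proof (cases "i \<in> J")
          case True
          have "0 \<le> e * z i" using e(1) z(2) True by (simp add: less_imp_le)
          then show ?thesis using e(2) True by (simp add: w_def algebra_simps) (smt (verit))
        next
          case False
          then have "z i = 0" using z(1) by (auto simp: J_def)
          moreover have "x i = 0" using x False by (simp add: coord_face_def)
          ultimately show ?thesis by (simp add: w_def)
        qed
        moreover have "w i = 0" if "i \<notin> I" for i
        proof -
          have "x i = 0" "z i = 0" using that x z(1) JI sub by (auto simp: coord_face_def)
          then show ?thesis by (simp add: w_def)
        qed
        ultimately show ?thesis by (auto simp: coord_face_def)
      qed
      have "z \<in> open_segment x w"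
        unfolding open_segment_fun
      proof (intro conjI exI[of _ "1 / (1 + e)"])
        show "x \<noteq> w"
        proof
          assume "x = w"
          have "x i = z i" for i
          proof -
            have "x i = (1 + e) * z i - e * x i" using fun_cong[OF \<open>x = w\<close>, of i] by (simp add: w_def)
            then have "(1 + e) * x i = (1 + e) * z i" by (simp add: algebra_simps)
            then show ?thesis using e(1) by simp
          qed
          then show False using False by blast
        qed
        show "z = (\<lambda>i. (1 - 1 / (1 + e)) * x i + 1 / (1 + e) * w i)"
        proof
          fix i
          have ne: "1 + e \<noteq> 0" using e(1) by simp
          then have "1 - 1 / (1 + e) = e / (1 + e)" by (simp add: field_simps)
          then have "(1 - 1 / (1 + e)) * x i + 1 / (1 + e) * w i = (e * x i + w i) / (1 + e)"
            by (simp add: add_divide_distrib)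
          also have "e * x i + w i = (1 + e) * z i" by (simp add: w_def)
          also have "(1 + e) * z i / (1 + e) = z i" using ne by simp
          finally show "z i = (1 - 1 / (1 + e)) * x i + 1 / (1 + e) * w i" by simp
        qed
      qed (use e(1) in auto)
      moreover have "x \<in> coord_face I" using x coord_face_mono[OF JI] by blast
      ultimately show ?thesis using F(1) w z(1) unfolding face_of_def by blast
    qed (use z in simp)
  qed
  moreover have "F \<subseteq> coord_face J" using sub by (auto simp: coord_face_def J_def)
  ultimately show ?thesis using JI by blast
qed

lemma orthant_faces: "Y face_of orthant m \<and> Y \<noteq> {} \<longleftrightarrow> (\<exists>J\<subseteq>{..<m}. Y = coord_face J)"
  unfolding orthant_coord_face
  using face_of_coord_face[of "{..<m}" Y] coord_face_face[of _ "{..<m}"] zero_coord_face by blast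

lemma closed_coord_face: "closed (coord_face J)"
proof -
  have "coord_face J = (\<Inter>i. {x. 0 \<le> x i}) \<inter> (\<Inter>i\<in>-J. {x. x i = 0})"
    by (auto simp: coord_face_def)
  moreover have "closed {x :: nat \<Rightarrow> real. 0 \<le> x i}" "closed {x :: nat \<Rightarrow> real. x i = 0}" for i
    by (intro closed_Collect_le closed_Collect_eq continuous_on_product_coordinates continuous_on_const)+
  ultimately show ?thesis by (auto intro!: closed_INT closed_Int)
qed

lemma rel_interior_coord_face:
  assumes "finite J"
  shows "rel_interior (coord_face J) = {x \<in> coord_face J. \<forall>i\<in>J. 0 < x i}"
proof (intro subset_antisym subsetI)
  fix x assume "x \<in> rel_interior (coord_face J)"
  then obtain T where T: "openin (top_of_set (coord_space J)) T" "x \<in> T" "T \<subseteq> coord_face J"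
    by (auto simp: rel_interior_def affine_hull_coord_face[OF assms])
  have xJ: "x \<in> coord_face J" using T by blast
  moreover have "0 < x i" if i: "i \<in> J" for i
  proof (rule ccontr)
    assume "\<not> 0 < x i"
    then have x0: "x i = 0" using xJ by (auto simp: coord_face_def order.antisym)
    obtain U where U: "open U" "T = coord_space J \<inter> U" using T(1) by (auto simp: openin_open)
    \<comment> \<open>Moving from \<open>x\<close> against the \<open>i\<close>-th axis stays in the
      affine hull and, by openness, in the face for small steps, although the \<open>i\<close>-th
      coordinate becomes negative.\<close>
    let ?f = "\<lambda>t::real. \<lambda>j. x j - t * unit_seq i j"
    have "continuous_on UNIV ?f"
      by (intro continuous_on_coordinatewise_then_product continuous_intros)
    then have "open (?f -` U)" using U(1) by (simp add: open_vimage)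
    moreover have "0 \<in> ?f -` U" using T(2) U(2) by simp
    ultimately obtain e where e: "0 < e" "ball 0 e \<subseteq> ?f -` U" using open_contains_ball by blast
    have "e/2 \<in> ball 0 e" using e(1) by (simp add: dist_real_def)
    then have "?f (e/2) \<in> U" using e(2) by blast
    moreover have "?f (e/2) \<in> coord_space J"
      using xJ i by (auto simp: coord_space_def coord_face_def unit_seq_def)
    ultimately have "?f (e/2) \<in> coord_face J" using T(3) U(2) by blast
    then have "0 \<le> ?f (e/2) i" by (simp add: coord_face_def)
    then show False using x0 e(1) by (simp add: unit_seq_def)
  qed
  ultimately show "x \<in> {x \<in> coord_face J. \<forall>i\<in>J. 0 < x i}" by blast
next
  fix x assume x: "x \<in> {x \<in> coord_face J. \<forall>i\<in>J. 0 < x i}"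
  let ?U = "\<Inter>i\<in>J. {x :: nat \<Rightarrow> real. 0 < x i}"
  have "open {x :: nat \<Rightarrow> real. 0 < x i}" for i
    by (intro open_Collect_less continuous_on_product_coordinates continuous_on_const)
  then have "open ?U" using assms by (intro open_INT) auto
  then have "openin (top_of_set (coord_space J)) (coord_space J \<inter> ?U)" by (rule openin_open_Int)
  moreover have "coord_space J \<inter> ?U \<subseteq> coord_face J"
  proof
    fix y assume y: "y \<in> coord_space J \<inter> ?U"
    then have "0 \<le> y i" for i by (cases "i \<in> J") (auto simp: coord_space_def less_imp_le)
    then show "y \<in> coord_face J" using y by (auto simp: coord_space_def coord_face_def)
  qed
  moreover have "x \<in> coord_space J \<inter> ?U" using x coord_face_sub_space by auto
  ultimately show "x \<in> rel_interior (coord_face J)"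
    unfolding rel_interior_def affine_hull_coord_face[OF assms] by blast
qed

section \<open>Complexes glued from orthants\<close>

text \<open>The change of coordinates between two numberings of the same keys; \<tau> sends new
  indices to old ones.\<close>

definition reindex :: "(nat \<Rightarrow> nat) \<Rightarrow> nat set \<Rightarrow> (nat \<Rightarrow> real) \<Rightarrow> nat \<Rightarrow> real" where
  "reindex \<tau> J x = (\<lambda>j. if j \<in> J then x (\<tau> j) else 0)"

lemma linear_reindex: "linear (reindex \<tau> J)"
  by (rule linearI) (auto simp: reindex_def scaleR_fun_def)

lemma reindex_zero [simp]: "reindex \<tau> J 0 = 0"
  by (auto simp: reindex_def)

lemma reindex_in:
  "reindex \<tau> J x \<in> coord_space J"
  "x \<in> coord_face J' \<Longrightarrow> reindex \<tau> J x \<in> coord_face J"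
  "x \<in> int_points \<Longrightarrow> reindex \<tau> J x \<in> int_points"
  by (auto simp: reindex_def coord_space_def coord_face_def int_points_def)

lemma reindex_inverse:
  assumes "bij_betw \<tau> J' J" "x \<in> coord_space J"
  shows "reindex (inv_into J' \<tau>) J (reindex \<tau> J' x) = x"
proof
  fix i
  show "reindex (inv_into J' \<tau>) J (reindex \<tau> J' x) i = x i"
    using assms bij_betw_inv_into_right[OF assms(1), of i] bij_betw_apply[OF bij_betw_inv_into[OF assms(1)], of i]
    by (auto simp: reindex_def coord_space_def)
qed

lemma reindex_inverse':
  assumes "bij_betw \<tau> J' J" "y \<in> coord_space J'"
  shows "reindex \<tau> J' (reindex (inv_into J' \<tau>) J y) = y"
proof
  fix i
  show "reindex \<tau> J' (reindex (inv_into J' \<tau>) J y) i = y i"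
    using assms bij_betw_inv_into_left[OF assms(1), of i] bij_betw_apply[OF assms(1), of i]
    by (auto simp: reindex_def coord_space_def)
qed

lemma reindex_image:
  assumes "bij_betw \<tau> J' J"
  shows "bij_betw (reindex \<tau> J') (coord_space J) (coord_space J')"
    "reindex \<tau> J' ` coord_face J = coord_face J'"
    "reindex \<tau> J' ` (coord_space J \<inter> int_points) = coord_space J' \<inter> int_points"
proof -
  let ?f = "reindex \<tau> J'" and ?g = "reindex (inv_into J' \<tau>) J"
  note inv = reindex_inverse[OF assms] reindex_inverse'[OF assms]
  show "bij_betw ?f (coord_space J) (coord_space J')"
    by (rule bij_betw_byWitness[where f' = ?g]) (auto simp: inv reindex_in)
  show "?f ` coord_face J = coord_face J'"
  proof (intro subset_antisym subsetI)
    fix y assume y: "y \<in> coord_face J'"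
    have yJ: "y \<in> coord_space J'" using y coord_face_sub_space by blast
    show "y \<in> ?f ` coord_face J"
      by (rule image_eqI[where x = "?g y" and f = "?f" and b = y, OF inv(2)[OF yJ, symmetric] reindex_in(2)[OF y]])
  qed (auto intro: reindex_in)
  show "?f ` (coord_space J \<inter> int_points) = coord_space J' \<inter> int_points"
  proof (intro subset_antisym subsetI)
    fix y assume y: "y \<in> coord_space J' \<inter> int_points"
    then have yJ: "y \<in> coord_space J'" "y \<in> int_points" by simp_all
    have "?g y \<in> coord_space J \<inter> int_points"
      using reindex_in(1) reindex_in(3)[OF yJ(2)] by (rule IntI)
    then show "y \<in> ?f ` (coord_space J \<inter> int_points)"
      by (rule image_eqI[where x = "?g y" and f = "?f" and b = y, OF inv(2)[OF yJ(1), symmetric]])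
  qed (auto intro: reindex_in)
qed

text \<open>Common form of \<open>H_complex\<close>, where keys are clusters with partitions, and
  \<open>M_complex\<close>, where they are clusters alone. By \<open>glue\<close> a point is
  determined by its length function, so intersections, faces and chart changes become statements
  about sets of keys; \<open>cont\<close> and \<open>closed\<close> make each chart an
  embedding.\<close>

locale cone_complex =
  fixes m :: nat and C :: "'a pcomplex" and I :: "'i set" and ch :: "'i \<Rightarrow> (nat \<Rightarrow> real) \<Rightarrow> 'a"
    and K :: "'i \<Rightarrow> nat \<Rightarrow> 'k"
  assumes charts: "pcharts C = {(Y, ch c) | Y c. c \<in> I \<and> Y face_of orthant m \<and> Y \<noteq> {}}"
    and K_inj: "c \<in> I \<Longrightarrow> inj_on (K c) {..<m}"
    and glue: "c \<in> I \<Longrightarrow> c' \<in> I \<Longrightarrow> p \<in> orthant m \<Longrightarrow> p' \<in> orthant m \<Longrightarrow>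
      ch c p = ch c' p' \<longleftrightarrow> (\<forall>k. len m (K c) p k = len m (K c') p' k)"
    and cover: "topspace (pspace C) = (\<Union>c\<in>I. ch c ` orthant m)"
    and cont: "c \<in> I \<Longrightarrow> continuous_map (top_of_set (orthant m)) (pspace C) (ch c)"
    and closed: "c \<in> I \<Longrightarrow> closed_map (top_of_set (orthant m)) (pspace C) (ch c)"
begin

lemma chart_iff: "(X, h) \<in> pcharts C \<longleftrightarrow> (\<exists>c\<in>I. \<exists>J\<subseteq>{..<m}. X = coord_face J \<and> h = ch c)"
  unfolding charts using orthant_faces[of X m] by auto

lemma face_orthant: "J \<subseteq> {..<m} \<Longrightarrow> p \<in> coord_face J \<Longrightarrow> p \<in> orthant m"
  unfolding orthant_coord_face using coord_face_mono by blast

lemma ch_inj: "c \<in> I \<Longrightarrow> inj_on (ch c) (orthant m)"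
proof (rule inj_onI, rule ext)
  fix p p' i assume c: "c \<in> I" and p: "p \<in> orthant m" "p' \<in> orthant m" "ch c p = ch c p'"
  have "len m (K c) p k = len m (K c) p' k" for k
    using glue[OF c c p(1,2)] p(3) by blast
  then have "p i = p' i" if "i < m"
    using len_key[OF K_inj[OF c] that] by metis
  moreover have "p i = p' i" if "\<not> i < m"
    using p(1,2) that by (simp add: orthant_coord_face coord_face_def)
  ultimately show "p i = p' i" by blast
qed

text \<open>Reads the lengths of a point of cone \<open>c\<close> at the keys of cone
  \<open>c'\<close>. The result names the same point when \<open>c'\<close> has every key that
  carries length.\<close>

definition push :: "'i \<Rightarrow> 'i \<Rightarrow> (nat \<Rightarrow> real) \<Rightarrow> nat \<Rightarrow> real" where
  "push c c' p j = (if j < m then len m (K c) p (K c' j) else 0)"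

lemma push:
  assumes c: "c \<in> I" "c' \<in> I" and J: "J \<subseteq> {..<m}" "J' \<subseteq> {..<m}" and p: "p \<in> coord_face J"
    and K: "K c ` J \<subseteq> K c' ` J'"
  shows "push c c' p \<in> coord_face J'" "ch c' (push c c' p) = ch c p"
proof -
  have pJ: "p i \<noteq> 0 \<Longrightarrow> i \<in> J" for i using p by (auto simp: coord_face_def)
  show push: "push c c' p \<in> coord_face J'"
  proof -
    have "0 \<le> push c c' p j" for j
      using p by (auto simp: push_def len_def coord_face_def intro!: sum_nonneg)
    moreover have "push c c' p j = 0" if "j \<notin> J'" for j
    proof (rule ccontr)
      assume ne: "push c c' p j \<noteq> 0"
      then have j: "j < m" by (auto simp: push_def split: if_splits)
      then obtain i where i: "i < m" "K c i = K c' j" "p i \<noteq> 0"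
        using ne len_nonzero[of m "K c" p] by (auto simp: push_def)
      then obtain j' where "j' \<in> J'" "K c' j = K c' j'" using K pJ by (metis imageE image_subset_iff)
      then have "j = j'" using inj_onD[OF K_inj[OF c(2)], of j j'] j J(2) by auto
      then show False using that \<open>j' \<in> J'\<close> by blast
    qed
    ultimately show ?thesis by (auto simp: coord_face_def)
  qed
  have "len m (K c') (push c c' p) k = len m (K c) p k" for k
  proof (rule len_eqI)
    show "inj_on (K c') {..<m}" "inj_on (K c) {..<m}" using K_inj c by auto
    show "\<exists>i<m. K c i = K c' j \<and> p i = push c c' p j" if j: "j < m" "push c c' p j \<noteq> 0" for j
    proof -
      obtain i where i: "i < m" "K c i = K c' j"
        using j len_nonzero[of m "K c" p "K c' j"] by (auto simp: push_def)
      then show ?thesis using len_key[OF K_inj[OF c(1)] i(1), of p] j by (auto simp: push_def)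
    qed
    show "\<exists>j<m. K c' j = K c i \<and> push c c' p j = p i" if i: "i < m" "p i \<noteq> 0" for i
    proof -
      obtain j where j: "j \<in> J'" "K c' j = K c i" using K pJ[OF i(2)] by (metis imageE image_subset_iff)
      then show ?thesis using len_key[OF K_inj[OF c(1)] i(1), of p] J(2) by (auto simp: push_def)
    qed
  qed
  then show "ch c' (push c c' p) = ch c p"
    using glue[OF c(2,1) face_orthant[OF J(2) push] face_orthant[OF J(1) p]] by blast
qed

text \<open>The unit vector at \<open>i\<close> tests whether the key of \<open>i\<close> occurs in
  the other cell; conversely, \<open>push\<close> moves points there.\<close>

lemma image_subset_iff:
  assumes c: "c \<in> I" "c' \<in> I" and J: "J \<subseteq> {..<m}" "J' \<subseteq> {..<m}"
  shows "ch c ` coord_face J \<subseteq> ch c' ` coord_face J' \<longleftrightarrow> K c ` J \<subseteq> K c' ` J'"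
proof
  assume *: "ch c ` coord_face J \<subseteq> ch c' ` coord_face J'"
  show "K c ` J \<subseteq> K c' ` J'"
  proof
    fix k assume "k \<in> K c ` J"
    then obtain i where i: "i \<in> J" "k = K c i" by blast
    then have u: "unit_seq i \<in> coord_face J" by (simp add: unit_seq_face)
    then obtain p' where p': "p' \<in> coord_face J'" "ch c (unit_seq i) = ch c' p'" using * by blast
    have "len m (K c) (unit_seq i) k = len m (K c') p' k"
      using glue[OF c face_orthant[OF J(1) u] face_orthant[OF J(2) p'(1)]] p'(2) by blast
    moreover have "len m (K c) (unit_seq i) k = 1"
      using len_key[OF K_inj[OF c(1)], of i "unit_seq i"] i J(1) by (auto simp: unit_seq_def)
    ultimately obtain j where "j < m" "K c' j = k" "p' j \<noteq> 0"
      using len_nonzero[of m "K c'" p' k] by auto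
    then show "k \<in> K c' ` J'" using p'(1) by (auto simp: coord_face_def)
  qed
next
  assume "K c ` J \<subseteq> K c' ` J'"
  then show "ch c ` coord_face J \<subseteq> ch c' ` coord_face J'"
    using push[OF c J] by (metis (no_types, lifting) image_eqI image_subsetI)
qed

lemma image_eq_iff:
  assumes c: "c \<in> I" "c' \<in> I" and J: "J \<subseteq> {..<m}" "J' \<subseteq> {..<m}"
  shows "ch c ` coord_face J = ch c' ` coord_face J' \<longleftrightarrow> K c ` J = K c' ` J'"
  using image_subset_iff[OF c J] image_subset_iff[OF c(2,1) J(2,1)] by auto

text \<open>A common point has positive length at common keys only, so two cells meet in a
  coordinate face, possibly in the apex alone.\<close>

lemma image_inter:
  assumes c: "c \<in> I" "c' \<in> I" and J: "J \<subseteq> {..<m}" "J' \<subseteq> {..<m}"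
  shows "ch c ` coord_face J \<inter> ch c' ` coord_face J' = ch c ` coord_face {i \<in> J. K c i \<in> K c' ` J'}"
    (is "?l = ch c ` coord_face ?J")
proof (intro subset_antisym subsetI)
  fix h assume "h \<in> ?l"
  then obtain p p' where p: "p \<in> coord_face J" "h = ch c p" "p' \<in> coord_face J'" "h = ch c' p'" by blast
  have eq: "len m (K c) p k = len m (K c') p' k" for k
    using glue[OF c face_orthant[OF J(1) p(1)] face_orthant[OF J(2) p(3)]] p by simp
  have "p i = 0" if i: "i \<notin> ?J" for i
  proof (rule ccontr)
    assume ne: "p i \<noteq> 0"
    then have iJ: "i \<in> J" using p(1) by (auto simp: coord_face_def)
    then have "len m (K c) p (K c i) = p i" using len_key[OF K_inj[OF c(1)]] J(1) by auto
    then obtain j where "j < m" "K c' j = K c i" "p' j \<noteq> 0"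
      using eq[of "K c i"] ne len_nonzero[of m "K c'" p' "K c i"] by auto
    then have "K c i \<in> K c' ` J'" using p(3) by (auto simp: coord_face_def) (metis image_eqI)
    then show False using i iJ by blast
  qed
  then have "p \<in> coord_face ?J" using p(1) by (auto simp: coord_face_def)
  then show "h \<in> ch c ` coord_face ?J" using p(2) by blast
next
  fix h assume "h \<in> ch c ` coord_face ?J"
  moreover have "ch c ` coord_face ?J \<subseteq> ch c ` coord_face J"
    by (intro image_mono coord_face_mono) auto
  moreover have "ch c ` coord_face ?J \<subseteq> ch c' ` coord_face J'"
    using image_subset_iff[OF c, of ?J J'] J by auto
  ultimately show "h \<in> ?l" by blast
qed

text \<open>Between cells with the same keys \<open>push\<close> permutes coordinates, so it is
  linear and preserves integer points. The lattice equivalences of the complex are of this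
  kind.\<close>

lemma reindex_push:
  assumes c: "c \<in> I" "c' \<in> I" and J: "J \<subseteq> {..<m}" "J' \<subseteq> {..<m}" and K: "K c ` J = K c' ` J'"
  obtains \<tau> where "bij_betw \<tau> J' J" "\<And>p. p \<in> coord_face J \<Longrightarrow> reindex \<tau> J' p = push c c' p"
proof -
  define \<tau> where "\<tau> = inv_into J (K c) \<circ> K c'"
  have injs: "inj_on (K c) J" "inj_on (K c') J'"
    using K_inj c J inj_on_subset by blast+
  have "bij_betw (inv_into J (K c)) (K c ` J) J"
    by (rule bij_betw_inv_into) (use injs in \<open>simp add: bij_betw_def\<close>)
  moreover have "bij_betw (K c') J' (K c ` J)"
    unfolding K using injs by (simp add: bij_betw_def)
  ultimately have bij: "bij_betw \<tau> J' J" unfolding \<tau>_def by (rule bij_betw_trans[rotated])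
  have "reindex \<tau> J' p = push c c' p" if p: "p \<in> coord_face J" for p
  proof
    fix j
    show "reindex \<tau> J' p j = push c c' p j"
    proof (cases "j \<in> J'")
      case True
      then have "K c (\<tau> j) = K c' j" "\<tau> j \<in> J"
        using K by (auto simp: \<tau>_def f_inv_into_f inv_into_into)
      then show ?thesis
        using True J len_key[OF K_inj[OF c(1)], of "\<tau> j" p] by (auto simp: reindex_def push_def)
    next
      case False
      then show ?thesis using push(1)[OF c J p] K by (auto simp: reindex_def coord_face_def)
    qed
  qed
  then show ?thesis using that bij by blast
qed

text \<open>A continuous, injective and closed map is an embedding, and embeddings restrict to
  faces.\<close>

lemma chart_homeomorphic:
  assumes c: "c \<in> I" and J: "J \<subseteq> {..<m}"
  shows "closedin (pspace C) (ch c ` coord_face J)"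
    "homeomorphic_map (top_of_set (coord_face J)) (subtopology (pspace C) (ch c ` coord_face J)) (ch c)"
proof -
  have sub: "coord_face J \<subseteq> orthant m" using face_orthant[OF J] by blast
  have "closedin (top_of_set (orthant m)) (coord_face J)"
    using closed_subset[OF sub closed_coord_face] .
  then show "closedin (pspace C) (ch c ` coord_face J)"
    using closed[OF c] by (simp add: closed_map_def)
  have "embedding_map (top_of_set (orthant m)) (pspace C) (ch c)"
    using injective_closed_imp_embedding_map[OF cont[OF c] closed[OF c]] ch_inj[OF c] by simp
  then have "homeomorphic_map (top_of_set (orthant m)) (subtopology (pspace C) (ch c ` orthant m)) (ch c)"
    by (simp add: embedding_map_def)
  moreover have "ch c ` orthant m \<subseteq> topspace (pspace C)" unfolding cover using c by blast
  then have "ch c ` (topspace (top_of_set (orthant m)) \<inter> coord_face J) =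
      topspace (subtopology (pspace C) (ch c ` orthant m)) \<inter> ch c ` coord_face J"
    using sub by (simp add: Int_absorb1) blast
  ultimately have "homeomorphic_map (subtopology (top_of_set (orthant m)) (coord_face J))
      (subtopology (subtopology (pspace C) (ch c ` orthant m)) (ch c ` coord_face J)) (ch c)"
    by (rule homeomorphic_map_subtopologies)
  moreover have "subtopology (top_of_set (orthant m)) (coord_face J) = top_of_set (coord_face J)"
    using sub by (simp add: subtopology_subtopology Int_absorb1)
  moreover have "subtopology (subtopology (pspace C) (ch c ` orthant m)) (ch c ` coord_face J) =
      subtopology (pspace C) (ch c ` coord_face J)"
    using image_mono[OF sub, of "ch c"] by (simp add: subtopology_subtopology Int_absorb1)
  ultimately show "homeomorphic_map (top_of_set (coord_face J)) (subtopology (pspace C) (ch c ` coord_face J)) (ch c)"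
    by simp
qed

lemma cells_iff: "P \<in> cells C \<longleftrightarrow> (\<exists>c\<in>I. \<exists>J\<subseteq>{..<m}. P = ch c ` coord_face J)"
proof -
  have "P \<in> cells C \<longleftrightarrow> (\<exists>X h. (X, h) \<in> pcharts C \<and> P = h ` X)"
    by (auto simp: cells_def image_iff Bex_def)
  then show ?thesis unfolding chart_iff by blast
qed

theorem polyhedral_complex: "polyhedral_complex C"
  unfolding polyhedral_complex_def
proof (intro conjI ballI impI)
  fix \<gamma> assume "\<gamma> \<in> pcharts C"
  moreover obtain X h where \<gamma>: "\<gamma> = (X, h)" by fastforce
  ultimately obtain c J where cJ: "c \<in> I" "J \<subseteq> {..<m}" "X = coord_face J" "h = ch c"
    using chart_iff by blast
  show "case \<gamma> of (X, c) \<Rightarrow> lattice_polyhedron X \<and> closedin (pspace C) (c ` X) \<and>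
      homeomorphic_map (top_of_set X) (subtopology (pspace C) (c ` X)) c"
    unfolding \<gamma> cJ(3,4) using lattice_polyhedron_coord_face[OF cJ(2)] chart_homeomorphic[OF cJ(1,2)] by simp
  show "case \<gamma> of (X, c) \<Rightarrow> \<forall>Y. Y face_of X \<and> Y \<noteq> {} \<longrightarrow> c ` Y \<in> cells C"
    unfolding \<gamma> cJ(3,4) case_prod_conv
  proof (intro allI impI)
    fix Y assume Y: "Y face_of coord_face J \<and> Y \<noteq> {}"
    have "finite J" using cJ(2) finite_subset by blast
    then obtain J' where "J' \<subseteq> J" "Y = coord_face J'" using face_of_coord_face Y by blast
    then show "ch c ` Y \<in> cells C" unfolding cells_iff using cJ by blast
  qed
  show "case \<gamma> of (X, c) \<Rightarrow> \<forall>(Y, c') \<in> pcharts C. c ` X = c' ` Y \<longrightarrow> lattice_equivalent (X, c) (Y, c')"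
    unfolding \<gamma> cJ(3,4) case_prod_conv
  proof (rule ballI)
    fix \<delta> assume "\<delta> \<in> pcharts C"
    moreover obtain Y h' where \<delta>: "\<delta> = (Y, h')" by fastforce
    ultimately obtain c' J' where cJ': "c' \<in> I" "J' \<subseteq> {..<m}" "Y = coord_face J'" "h' = ch c'"
      using chart_iff by blast
    have "lattice_equivalent (coord_face J, ch c) (coord_face J', ch c')"
      if eq: "ch c ` coord_face J = ch c' ` coord_face J'"
    proof -
      have K: "K c ` J = K c' ` J'" using image_eq_iff[OF cJ(1) cJ'(1) cJ(2) cJ'(2)] eq by blast
      obtain \<tau> where \<tau>: "bij_betw \<tau> J' J" "\<And>p. p \<in> coord_face J \<Longrightarrow> reindex \<tau> J' p = push c c' p"
        using reindex_push[OF cJ(1) cJ'(1) cJ(2) cJ'(2) K] by blast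
      have fin: "finite J" "finite J'" using cJ(2) cJ'(2) finite_subset by blast+
      have "ch c' (reindex \<tau> J' x) = ch c x" if x: "x \<in> coord_face J" for x
        using push(2)[OF cJ(1) cJ'(1) cJ(2) cJ'(2) x] K \<tau>(2)[OF x] by simp
      then show ?thesis
        unfolding lattice_equivalent_def case_prod_conv Let_def
        using reindex_image[OF \<tau>(1)] linear_reindex
        by (intro exI[of _ "reindex \<tau> J'"] exI[of _ 0]) (auto simp: affine_hull_coord_face fin)
    qed
    then show "case \<delta> of (Y, c') \<Rightarrow> ch c ` coord_face J = c' ` Y \<longrightarrow> lattice_equivalent (coord_face J, ch c) (Y, c')"
      unfolding \<delta> cJ'(3,4) by simp
  qed
next
  show "\<Union> (cells C) = topspace (pspace C)"
  proof (intro subset_antisym subsetI)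
    fix h assume "h \<in> \<Union> (cells C)"
    then obtain P where P: "P \<in> cells C" "h \<in> P" by blast
    then obtain c J where cJ: "c \<in> I" "J \<subseteq> {..<m}" "P = ch c ` coord_face J" using cells_iff[of P] by blast
    then obtain p where p: "p \<in> coord_face J" "h = ch c p" using P(2) by blast
    then have "p \<in> orthant m" using face_orthant cJ(2) by blast
    then show "h \<in> topspace (pspace C)" unfolding cover using cJ(1) p(2) by blast
  next
    fix h assume "h \<in> topspace (pspace C)"
    then obtain c where c: "c \<in> I" "h \<in> ch c ` coord_face {..<m}" unfolding cover orthant_coord_face by blast
    have "ch c ` coord_face {..<m} \<in> cells C"
      using cells_iff[of "ch c ` coord_face {..<m}"] c(1) by blast
    then show "h \<in> \<Union> (cells C)" using c(2) by blast
  qed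
next
  fix P Q assume "P \<in> cells C" "Q \<in> cells C"
  then obtain c J c' J' where "c \<in> I" "J \<subseteq> {..<m}" "P = ch c ` coord_face J"
      "c' \<in> I" "J' \<subseteq> {..<m}" "Q = ch c' ` coord_face J'" unfolding cells_iff by blast
  then have PQ: "P \<inter> Q = ch c ` coord_face {i \<in> J. K c i \<in> K c' ` J'}" "{i \<in> J. K c i \<in> K c' ` J'} \<subseteq> {..<m}" "c \<in> I"
    using image_inter[of c c' J J'] by auto
  show "P \<inter> Q \<in> cells C"
    unfolding cells_iff PQ(1) using PQ(2,3) by blast
qed

theorem has_dimension: "has_dimension C m"
  unfolding has_dimension_def
proof (intro conjI ballI)
  fix \<gamma> assume "\<gamma> \<in> pcharts C"
  moreover obtain X h where \<gamma>: "\<gamma> = (X, h)" by fastforce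
  ultimately obtain c J where cJ: "c \<in> I" "J \<subseteq> {..<m}" "X = coord_face J" using chart_iff by blast
  have "finite J" "card J \<le> m"
    using cJ(2) finite_subset card_mono[of "{..<m}" J] by auto
  then show "case \<gamma> of (X, c) \<Rightarrow> poly_dim X \<le> m"
    unfolding \<gamma> cJ(3) by (simp add: poly_dim_coord_face)
next
  fix P assume "P \<in> cells C"
  then obtain c J where cJ: "c \<in> I" "J \<subseteq> {..<m}" "P = ch c ` coord_face J" using cells_iff by blast
  have "(coord_face {..<m}, ch c) \<in> pcharts C" using chart_iff cJ(1) by blast
  moreover have "poly_dim (coord_face {..<m}) = m" by (simp add: poly_dim_coord_face)
  moreover have "coord_face J face_of coord_face {..<m}" by (rule coord_face_face[OF cJ(2)])
  ultimately show "\<exists>(X, c)\<in>pcharts C. poly_dim X = m \<and> (\<exists>Y. Y face_of X \<and> P = c ` Y)"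
    using cJ(3) by blast
qed

definition open_orthant :: "(nat \<Rightarrow> real) set" where
  "open_orthant = {p \<in> orthant m. \<forall>i<m. 0 < p i}"

lemma charts_around_iff: "(X, h) \<in> charts_around m C x \<longleftrightarrow>
    X = orthant m \<and> (\<exists>c\<in>I. h = ch c \<and> x \<in> ch c ` open_orthant)"
proof -
  have full: "J = {..<m}" if "J \<subseteq> {..<m}" "poly_dim (coord_face J) = m" for J
    using that card_subset_eq[of "{..<m}" J] finite_subset[OF that(1)] by (simp add: poly_dim_coord_face)
  have ri: "rel_interior (coord_face {..<m}) = open_orthant"
    by (auto simp: rel_interior_coord_face open_orthant_def orthant_coord_face)
  have dim: "poly_dim (coord_face {..<m}) = m" by (simp add: poly_dim_coord_face)
  show ?thesis
  proof
    assume "(X, h) \<in> charts_around m C x"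
    then have *: "(X, h) \<in> pcharts C" "poly_dim X = m" "x \<in> h ` rel_interior X"
      by (auto simp: charts_around_def)
    then obtain c J where cJ: "c \<in> I" "J \<subseteq> {..<m}" "X = coord_face J" "h = ch c" using chart_iff by blast
    then have "J = {..<m}" using full *(2) by blast
    then show "X = orthant m \<and> (\<exists>c\<in>I. h = ch c \<and> x \<in> ch c ` open_orthant)"
      using cJ *(3) ri by (auto simp: orthant_coord_face)
  next
    assume "X = orthant m \<and> (\<exists>c\<in>I. h = ch c \<and> x \<in> ch c ` open_orthant)"
    then obtain c where c: "X = coord_face {..<m}" "c \<in> I" "h = ch c" "x \<in> ch c ` open_orthant"
      by (auto simp: orthant_coord_face)
    then show "(X, h) \<in> charts_around m C x"
      using chart_iff ri dim by (auto simp: charts_around_def)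
  qed
qed

lemma top_interior_iff: "x \<in> top_interior m C \<longleftrightarrow> (\<exists>c\<in>I. x \<in> ch c ` open_orthant)"
proof -
  have "x \<in> top_interior m C \<longleftrightarrow> (\<exists>X h. (X, h) \<in> charts_around m C x)"
    by (auto simp: top_interior_def)
  then show ?thesis unfolding charts_around_iff by blast
qed

text \<open>Resolves the \<open>SOME\<close> in \<open>index_at\<close> and
  \<open>weight_at\<close>: the selected chart is that of a full cone, though possibly of another
  class with the same cell.\<close>

lemma some_chart_around:
  assumes "x \<in> top_interior m C"
  shows "\<exists>c\<in>I. x \<in> ch c ` open_orthant \<and> (SOME \<gamma>. \<gamma> \<in> charts_around m C x) = (orthant m, ch c)"
proof -
  have "\<exists>\<gamma>. \<gamma> \<in> charts_around m C x" using assms by (auto simp: top_interior_def)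
  then have "(SOME \<gamma>. \<gamma> \<in> charts_around m C x) \<in> charts_around m C x" by (rule someI_ex)
  moreover obtain X h where Xh: "(SOME \<gamma>. \<gamma> \<in> charts_around m C x) = (X, h)" by fastforce
  ultimately show ?thesis using charts_around_iff by auto
qed

end

lemma lattice_index_self:
  assumes "\<And>u v. u \<in> \<Lambda> \<Longrightarrow> v \<in> \<Lambda> \<Longrightarrow> u + v \<in> \<Lambda>" "\<And>u. u \<in> \<Lambda> \<Longrightarrow> - u \<in> \<Lambda>" "0 \<in> \<Lambda>"
  shows "lattice_index \<Lambda> \<Lambda> = 1"
proof -
  have "(\<lambda>v. u + v) ` \<Lambda> = \<Lambda>" if u: "u \<in> \<Lambda>" for u
  proof (intro subset_antisym subsetI)
    fix v assume v: "v \<in> \<Lambda>"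
    have "v = u + (- u + v)" by simp
    then show "v \<in> (\<lambda>v. u + v) ` \<Lambda>" using assms(1)[OF assms(2)[OF u] v] by blast
  qed (use assms(1) u in auto)
  then have "(\<lambda>u. (\<lambda>v. u + v) ` \<Lambda>) ` \<Lambda> = {\<Lambda>}"
    using assms(3) by auto
  then show ?thesis by (simp add: lattice_index_def)
qed

text \<open>The charts of the target are those of the source followed by \<open>f\<close>, so
  \<open>f\<close> is the identity in matching charts; what differs is the gluing, expressed by
  \<open>K\<close> and \<open>K'\<close>.\<close>

locale cone_morphism = A: cone_complex m C I ch K + B: cone_complex m C' I "\<lambda>c. f \<circ> ch c" K'
  for m :: nat and C :: "'a pcomplex" and I :: "'i set" and ch :: "'i \<Rightarrow> (nat \<Rightarrow> real) \<Rightarrow> 'a"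
    and K :: "'i \<Rightarrow> nat \<Rightarrow> 'k" and C' :: "'b pcomplex" and f :: "'a \<Rightarrow> 'b" and K' :: "'i \<Rightarrow> nat \<Rightarrow> 'l" +
  assumes f_cont: "continuous_map (pspace C) (pspace C') f"
begin

theorem pc_morphism: "pc_morphism C C' f"
  unfolding pc_morphism_def
proof (intro conjI ballI)
  show "continuous_map (pspace C) (pspace C') f" by (rule f_cont)
  fix \<gamma> assume "\<gamma> \<in> pcharts C"
  moreover obtain X h where \<gamma>: "\<gamma> = (X, h)" by fastforce
  ultimately obtain c J where cJ: "c \<in> I" "J \<subseteq> {..<m}" "X = coord_face J" "h = ch c"
    using A.chart_iff by blast
  have chart: "(X, f \<circ> ch c) \<in> pcharts C'" using B.chart_iff cJ by blast
  have "inj_on (f \<circ> ch c) X"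
    using B.ch_inj[OF cJ(1)] A.face_orthant[OF cJ(2)] cJ(3) by (meson inj_on_subset subsetI)
  then have "in_charts (X, h) (X, f \<circ> ch c) f x = x" if "x \<in> X" for x
    using inv_into_f_f[of "f \<circ> ch c" X x] that by (simp add: in_charts_def cJ(4))
  then have "linear_part X (in_charts (X, h) (X, f \<circ> ch c) f) (\<lambda>x. x)"
    by (auto simp: linear_part_def linear_ident)
  then show "case \<gamma> of (X, c) \<Rightarrow> \<exists>(X', c')\<in>pcharts C'. f ` c ` X \<subseteq> c' ` X' \<and>
        (\<exists>L. linear_part X (in_charts (X, c) (X', c') f) L \<and> L ` direction_lattice X \<subseteq> direction_lattice X')"
    unfolding \<gamma> case_prod_conv using chart cJ(4)
    by (intro bexI[of _ "(X, f \<circ> ch c)"]) (auto intro!: exI[of _ "\<lambda>x. x"])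
qed

theorem index_one:
  assumes "x \<in> top_interior m C"
  shows "index_at m C C' f x = 1"
proof -
  obtain c where c: "c \<in> I" "(SOME \<gamma>. \<gamma> \<in> charts_around m C x) = (orthant m, ch c)"
    using A.some_chart_around[OF assms] by blast
  let ?P = "\<lambda>\<gamma>'. \<gamma>' \<in> pcharts C' \<and> f ` ch c ` orthant m \<subseteq> snd \<gamma>' ` fst \<gamma>'"
  have "(coord_face {..<m}, f \<circ> ch c) \<in> pcharts C'" using B.chart_iff c(1) by blast
  then have "?P (orthant m, f \<circ> ch c)" by (auto simp: orthant_coord_face)
  \<comment> \<open>The selected target chart is any one whose cell contains the image of the cone,
    possibly of another class. It remains to see that it is a full cone with the same keys.\<close>
  then have some: "?P (SOME \<gamma>'. ?P \<gamma>')" by (rule someI)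
  obtain X' h' where X': "(SOME \<gamma>'. ?P \<gamma>') = (X', h')" by fastforce
  obtain c' J' where c': "c' \<in> I" "J' \<subseteq> {..<m}" "X' = coord_face J'" "h' = f \<circ> ch c'"
    using some B.chart_iff unfolding X' by auto
  have "(f \<circ> ch c) ` coord_face {..<m} \<subseteq> (f \<circ> ch c') ` coord_face J'"
    using some unfolding X' c'(3,4) by (simp add: orthant_coord_face image_comp)
  then have sub: "K' c ` {..<m} \<subseteq> K' c' ` J'"
    using B.image_subset_iff[OF c(1) c'(1) order_refl c'(2)] by blast
  have finJ: "finite J'" using c'(2) finite_subset by blast
  \<comment> \<open>The \<open>m\<close> distinct keys of the image all occur in \<open>J'\<close>,
    which leaves no room for a smaller face.\<close>
  have "m = card (K' c ` {..<m})" using card_image[OF B.K_inj[OF c(1)]] by simp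
  also have "\<dots> \<le> card (K' c' ` J')" using finJ sub by (intro card_mono) auto
  also have "\<dots> \<le> card J'" using finJ by (rule card_image_le)
  finally have J': "J' = {..<m}"
    using c'(2) card_seteq[of "{..<m}" J'] by simp
  have "card (K' c ` {..<m}) = card (K' c' ` {..<m})"
    using card_image[OF B.K_inj[OF c(1)]] card_image[OF B.K_inj[OF c'(1)]] by simp
  then have K: "K' c ` {..<m} = K' c' ` {..<m}"
    using sub unfolding J' by (intro card_subset_eq) auto
  obtain \<tau> where \<tau>: "bij_betw \<tau> {..<m} {..<m}"
      "\<And>p. p \<in> coord_face {..<m} \<Longrightarrow> reindex \<tau> {..<m} p = B.push c c' p"
    using B.reindex_push[OF c(1) c'(1) order_refl order_refl K] by blast
  let ?g = "in_charts (orthant m, ch c) (X', h') f" and ?R = "reindex \<tau> {..<m}"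
  have g: "?g p = ?R p" if p: "p \<in> orthant m" for p
  proof -
    have p': "p \<in> coord_face {..<m}" using p by (simp add: orthant_coord_face)
    note push = B.push[OF c(1) c'(1) order_refl order_refl p', unfolded K, OF order_refl]
    have "inv_into X' h' (h' (B.push c c' p)) = B.push c c' p"
      unfolding c'(3,4) J' using B.ch_inj[OF c'(1)] push(1)
      by (intro inv_into_f_f) (simp_all add: orthant_coord_face)
    then show ?thesis using push(2) \<tau>(2)[OF p'] by (simp add: in_charts_def c'(4))
  qed
  have lin: "linear_part (orthant m) ?g ?R"
    unfolding linear_part_def
  proof (intro conjI ballI)
    fix x y assume "x \<in> orthant m" "y \<in> orthant m"
    then show "?g x - ?g y = ?R (x - y)" using g linear_diff[OF linear_reindex] by metis
  qed (rule linear_reindex)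
  \<comment> \<open>The linear part selected by \<open>SOME\<close> is determined on the direction
    space only. There it agrees with the coordinate permutation, as the unit vectors are differences
    of points of the orthant.\<close>
  define L where "L = (SOME L. linear_part (orthant m) ?g L)"
  have L: "linear_part (orthant m) ?g L" unfolding L_def by (rule someI[of "linear_part (orthant m) ?g", OF lin])
  then have linL: "linear L" by (simp add: linear_part_def)
  have "L x = ?R x" if x: "x \<in> coord_space {..<m}" for x
  proof -
    have "L (unit_seq i) = ?R (unit_seq i)" if "i < m" for i
    proof -
      have u: "unit_seq i \<in> orthant m" "0 \<in> orthant m"
        unfolding orthant_coord_face using unit_seq_face that by auto
      have "L (unit_seq i - 0) = ?g (unit_seq i) - ?g 0" using L u by (metis linear_part_def)
      then show ?thesis using g u by simp
    qed
    then have "\<And>u. u \<in> unit_seq ` {..<m} \<Longrightarrow> L u = ?R u" by blast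
    moreover have "x \<in> span (unit_seq ` {..<m})" using x span_unit_seq by simp
    ultimately show ?thesis using linear_eq_on_span[OF linL linear_reindex] by blast
  qed
  moreover have dl: "direction_lattice (orthant m) = coord_space {..<m} \<inter> int_points"
    by (simp add: direction_lattice_def orthant_coord_face direction_space_coord_face)
  ultimately have "L ` direction_lattice (orthant m) = ?R ` (coord_space {..<m} \<inter> int_points)"
    by (intro image_cong) auto
  then have Ldl: "L ` direction_lattice (orthant m) = coord_space {..<m} \<inter> int_points"
    using reindex_image(3)[OF \<tau>(1)] by simp
  have X'o: "X' = orthant m" using c'(3) J' by (simp add: orthant_coord_face)
  have "poly_dim X' = m" unfolding c'(3) J' by (simp add: poly_dim_coord_face)
  then have "index_at m C C' f x = lattice_index (L ` direction_lattice (orthant m)) (direction_lattice X')"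
    using assms unfolding index_at_def c(2) case_prod_conv Let_def X' L_def by simp
  also have "\<dots> = lattice_index (coord_space {..<m} \<inter> int_points) (coord_space {..<m} \<inter> int_points)"
    unfolding Ldl X'o unfolding dl ..
  also have "\<dots> = 1"
    by (rule lattice_index_self) (auto simp: coord_space_def int_points_def)
  finally show ?thesis .
qed

end

section \<open>Summing the weights over all colourings of a tree\<close>

section \<open>Traces of products of class sums along trees\<close>

text \<open>\<open>vertex_mult\<close> for an arbitrary finite set of edges: the vertices produced
  by merging have any number of edges.\<close>

definition class_trace :: "nat \<Rightarrow> ('e \<Rightarrow> nat multiset) \<Rightarrow> 'e set \<Rightarrow> real" where
  "class_trace d f A = galg_tr (sym_group d) (galg_prod (sym_group d)
     (map (\<lambda>e. class_sum d (f e)) (SOME es. distinct es \<and> set es = A)))"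

lemma class_trace_list:
  assumes "distinct es" "set es = A"
  shows "class_trace d f A = galg_tr (sym_group d) (galg_prod (sym_group d) (map (\<lambda>e. class_sum d (f e)) es))"
proof -
  interpret group "sym_group d" by (rule sym_group_is_group)
  let ?es = "SOME es. distinct es \<and> set es = A"
  have "distinct ?es \<and> set ?es = A" by (rule someI[of _ es]) (use assms in blast)
  then have "mset ?es = mset es" using assms set_eq_iff_mset_eq_distinct by metis
  then have "mset (map (\<lambda>e. class_sum d (f e)) ?es) = mset (map (\<lambda>e. class_sum d (f e)) es)" by simp
  moreover have "\<forall>a\<in>set (map (\<lambda>e. class_sum d (f e)) ?es). class_fun a"
    by (auto simp: class_fun_class_sum)
  ultimately show ?thesis
    unfolding class_trace_def by (rule arg_cong[OF galg_prod_perm])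
qed

lemma class_trace_cong:
  assumes "finite A" "\<And>e. e \<in> A \<Longrightarrow> f e = g e"
  shows "class_trace d f A = class_trace d g A"
proof -
  obtain es where es: "distinct es" "set es = A" using finite_distinct_list[OF assms(1)] by blast
  then have "map (\<lambda>e. class_sum d (f e)) es = map (\<lambda>e. class_sum d (g e)) es" using assms(2) by auto
  then show ?thesis unfolding class_trace_list[OF es] by (simp only:)
qed

lemma class_trace_image:
  assumes "finite A" "inj_on h A"
  shows "class_trace d f (h ` A) = class_trace d (\<lambda>e. f (h e)) A"
proof -
  obtain es where es: "distinct es" "set es = A" using finite_distinct_list[OF assms(1)] by blast
  then have "distinct (map h es)" "set (map h es) = h ` A" using assms(2) by (auto simp: distinct_map)
  then show ?thesis
    unfolding class_trace_list[OF es] by (simp add: class_trace_list comp_def)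
qed

text \<open>\<open>class_sum_gluing\<close> at the edge \<open>e\<close>: \<nu> occurs once at each
  end of \<open>e\<close>, and summing over it joins the remaining edges \<open>A\<close> and
  \<open>B\<close> at one vertex.\<close>

lemma class_trace_glue:
  assumes "finite A" "finite B" "A \<inter> B = {}" "e \<notin> A" "e \<notin> B"
  shows "(\<Sum>\<nu> | integer_partition d \<nu>. 1 / real (card (conj_class d \<nu>)) *
      (class_trace d (f(e := \<nu>)) (insert e A) * class_trace d (f(e := \<nu>)) (insert e B)))
    = class_trace d f (A \<union> B)"
proof -
  interpret group "sym_group d" by (rule sym_group_is_group)
  obtain as where as: "distinct as" "set as = A" using finite_distinct_list[OF assms(1)] by blast
  obtain bs where bs: "distinct bs" "set bs = B" using finite_distinct_list[OF assms(2)] by blast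
  let ?P = "\<lambda>es. galg_prod (sym_group d) (map (\<lambda>e. class_sum d (f e)) es)"
  have tr: "class_trace d (f(e := \<nu>)) (insert e C) =
      galg_tr (sym_group d) (galg_mult (sym_group d) (class_sum d \<nu>) (?P cs))"
    if "distinct cs" "set cs = C" "e \<notin> C" for \<nu> C cs
  proof -
    have eq: "map (\<lambda>x. class_sum d ((f(e := \<nu>)) x)) cs = map (\<lambda>x. class_sum d (f x)) cs" using that by auto
    have "class_trace d (f(e := \<nu>)) (insert e C) = galg_tr (sym_group d)
        (galg_prod (sym_group d) (map (\<lambda>x. class_sum d ((f(e := \<nu>)) x)) (e # cs)))"
      by (rule class_trace_list) (use that in auto)
    then show ?thesis unfolding list.map(2) eq galg_prod_Cons by simp
  qed
  have cls: "class_fun (?P es)" for es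
    by (rule class_fun_prod) (auto simp: class_fun_class_sum)
  have "class_trace d f (A \<union> B) = galg_tr (sym_group d) (?P (as @ bs))"
    by (rule class_trace_list) (use as bs assms(3) in auto)
  also have "?P (as @ bs) = galg_mult (sym_group d) (?P as) (?P bs)"
    unfolding map_append by (rule galg_prod_append[OF finite_sym_group]) (auto simp: class_fun_class_sum)
  also have "galg_tr (sym_group d) (galg_mult (sym_group d) (?P as) (?P bs)) =
    (\<Sum>\<nu> | integer_partition d \<nu>. 1 / real (card (conj_class d \<nu>)) *
      (galg_tr (sym_group d) (galg_mult (sym_group d) (class_sum d \<nu>) (?P as)) *
       galg_tr (sym_group d) (galg_mult (sym_group d) (class_sum d \<nu>) (?P bs))))"
    by (rule class_sum_gluing[OF cls cls, symmetric])
  finally show ?thesis using tr[OF as assms(4)] tr[OF bs assms(5)] by simp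
qed

lemma vertex_mult_trace: "vertex_mult n d \<sigma> T v = class_trace d (edge_partition n \<sigma> T) (edges_at (gr T) v)"
  by (simp add: vertex_mult_def class_trace_def Let_def)

lemma sum_PiE_insert:
  assumes "i \<notin> J"
  shows "(\<Sum>\<nu>\<in>PiE (insert i J) (\<lambda>_. P). F \<nu>) = (\<Sum>x\<in>P. \<Sum>\<nu>\<in>PiE J (\<lambda>_. P). F (\<nu>(i := x)))"
proof -
  have "(\<Sum>\<nu>\<in>PiE (insert i J) (\<lambda>_. P). F \<nu>) = (\<Sum>(x, \<nu>)\<in>P \<times> PiE J (\<lambda>_. P). F (\<nu>(i := x)))"
    unfolding PiE_insert_eq using inj_combinator[OF assms, of "\<lambda>_. P"]
    by (simp add: sum.reindex case_prod_unfold)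
  then show ?thesis by (simp add: sum.cartesian_product)
qed

context trivalent_tree
begin

abbreviation "internal \<equiv> V - leaves (gr T)"

lemma leaves_labels: "leaves (gr T) = leaf_of T ` {..<n}"
  by (rule leaves_eq[OF refl refl])

lemma lower_inj:
  assumes "e \<in> E" "e' \<in> E" "lower e = lower e'"
  shows "e = e'"
proof (rule inj_onD[OF cluster_inj _ assms(1,2)])
  have "e' \<in> ancestors (lower e)" "e \<in> ancestors (lower e')"
    using lower_ancestor[OF assms(1)] lower_ancestor[OF assms(2)] assms(3) by simp_all
  then show "cluster e = cluster e'"
    using ancestor_lower_iff[OF assms(1,2)] ancestor_lower_iff[OF assms(2,1)] by blast
qed

lemma lower_mem: "e \<in> E \<Longrightarrow> lower e \<in> e" and upper_mem: "e \<in> E \<Longrightarrow> upper e \<in> e"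
proof -
  assume "e \<in> E"
  from ends(1)[OF this] show "lower e \<in> e" "upper e \<in> e" by (metis insertCI)+
qed

lemma leaf_edge_eq: "i < n \<Longrightarrow> e \<in> E \<Longrightarrow> leaf_of T i \<in> e \<Longrightarrow> e = ulab T i"
  using leaf_edge_unique[of "leaf_of T i" e "ulab T i"] leaf_of ulab_E by blast

lemma edge_cases: "e \<in> E \<Longrightarrow> e \<in> unbounded_edges (gr T) \<or> e \<in> bounded_edges (gr T)"
  by (simp add: bounded_edges_def)

lemma bounded_internal: "e \<in> E \<Longrightarrow> e \<in> bounded_edges (gr T) \<longleftrightarrow> e \<subseteq> internal"
  using E_sub by (auto simp: bounded_edges_def unbounded_edges_def)

lemma edge_partition_ulab: "i < n \<Longrightarrow> edge_partition n \<sigma> (T\<lparr>part := \<nu>\<rparr>) (ulab T i) = \<sigma> ! i"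
  using facts(4) bij_betw_inv_into_left[OF facts(4), of i] by (auto simp: edge_partition_def bij_betw_def)

lemma edge_partition_blab:
  assumes "i < n - 3"
  shows "edge_partition n \<sigma> (T\<lparr>part := \<nu>\<rparr>) (blab T i) = \<nu> i"
proof -
  have "blab T i \<notin> unbounded_edges (gr T)"
    using blab_bounded[OF assms] by (simp add: bounded_edges_def)
  then show ?thesis
    using bij_betw_inv_into_left[OF facts(5), of i] assms by (simp add: edge_partition_def)
qed

lemma unbounded_obtain:
  assumes "e \<in> unbounded_edges (gr T)"
  obtains i where "i < n" "e = ulab T i"
proof -
  have "e \<in> ulab T ` {..<n}" using assms facts(4) by (simp add: bij_betw_def)
  then show ?thesis using that by blast
qed

lemma bounded_obtain:
  assumes "e \<in> bounded_edges (gr T)"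
  obtains i where "i < n - 3" "e = blab T i"
proof -
  have "e \<in> blab T ` {..<n - 3}" using assms facts(5) by (simp add: bij_betw_def)
  then show ?thesis using that by blast
qed

definition inner :: "nat set \<Rightarrow> nat set" where
  "inner W = {i. i < n - 3 \<and> blab T i \<subseteq> W}"

definition rim :: "nat set \<Rightarrow> nat set set" where
  "rim W = {e \<in> E. e \<inter> W \<noteq> {} \<and> \<not> e \<subseteq> W}"

text \<open>With the neighbour of the root in \<open>W\<close>, this says that the internal vertices
  in \<open>W\<close> form a subtree reaching up to that neighbour. Only an internal parent is
  demanded, because the root itself is a leaf.\<close>

definition upward_closed :: "nat set \<Rightarrow> bool" where
  "upward_closed W \<longleftrightarrow> (\<forall>e\<in>E. lower e \<in> W \<longrightarrow> upper e \<in> internal \<longrightarrow> upper e \<in> W)"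

lemma root_edge: "leaf_of T 0 \<in> ulab T 0" "ulab T 0 \<in> E" "upper (ulab T 0) = leaf_of T 0"
proof -
  show r: "leaf_of T 0 \<in> ulab T 0" "ulab T 0 \<in> E" using leaf_of[of 0] ulab_E[of 0] n3 by simp_all
  have "lower (ulab T 0) \<noteq> leaf_of T 0" using ends(6)[OF r(2)] by auto
  then show "upper (ulab T 0) = leaf_of T 0" using mem_ends[OF r(2,1)] by metis
qed

lemma root_neighbour_internal: "lower (ulab T 0) \<in> internal"
proof -
  have "lower (ulab T 0) \<in> ulab T 0" by (rule lower_mem[OF root_edge(2)])
  then show ?thesis
    using one_leaf[OF root_edge(2) root_edge(1)] leaf_of(1)[of 0] n3 ends(4)[OF root_edge(2)] ends(6)[OF root_edge(2)]
    by auto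
qed

text \<open>A leaf other than the root is the lower end of its only edge, so it is the parent of no
  vertex; and the root has a single child.\<close>

lemma internal_parent:
  assumes "v \<in> internal" "v \<noteq> lower (ulab T 0)"
  shows "\<exists>e\<in>E. lower e = v \<and> upper e \<in> internal"
proof -
  have "v \<noteq> leaf_of T 0" using assms(1) leaf_of(1)[of 0] n3 by auto
  then obtain e where e: "e \<in> E" "lower e = v" using nonroot_lower[of v] assms(1) by auto
  have up: "upper e \<in> e" by (rule upper_mem[OF e(1)])
  have "upper e \<notin> leaves (gr T)"
  proof
    assume "upper e \<in> leaves (gr T)"
    then obtain i where i: "i < n" "upper e = leaf_of T i" unfolding leaves_labels by blast
    then have eq: "e = ulab T i" using leaf_edge_eq e(1) up by simp
    show False
    proof (cases "i = 0")
      case True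
      then show False using eq e(2) assms(2) by simp
    next
      case False
      then have "leaf_of T i \<noteq> leaf_of T 0" using inj_onD[OF label_inj, of i 0] i n3 by auto
      then obtain e' where e': "e' \<in> E" "lower e' = leaf_of T i" using nonroot_lower label_in i by metis
      then have "leaf_of T i \<in> e'" using lower_mem[OF e'(1)] by simp
      then have "e' = e" using leaf_edge_eq[OF i(1) e'(1)] eq by simp
      then have "lower e = upper e" using e'(2) i(2) by simp
      then show False using ends(2)[OF e(1)] by simp
    qed
  qed
  then show ?thesis using e ends(3)[OF e(1)] by blast
qed

lemma finite_ancestors: "finite (ancestors v)"
  using ancestors_sub finite_E finite_subset by blast

text \<open>\<open>W\<close> grows away from the root: the parent edge of a new vertex is the only edge between it
  and the old vertices, so the sum over its colour can be carried out.\<close>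

lemma growth:
  assumes "W \<subseteq> internal" "lower (ulab T 0) \<in> W" "upward_closed W"
  shows "(\<Sum>\<nu>\<in>PiE (inner W) (\<lambda>_. {\<mu>. integer_partition d \<mu>}).
      (\<Prod>i\<in>inner W. 1 / real (card (conj_class d (\<nu> i)))) *
      (\<Prod>v\<in>W. class_trace d (edge_partition n \<sigma> (T\<lparr>part := \<lambda>i. if i \<in> inner W then \<nu> i else \<kappa> i\<rparr>)) (edges_at (gr T) v)))
    = class_trace d (edge_partition n \<sigma> (T\<lparr>part := \<kappa>\<rparr>)) (rim W)"
  using assms
proof (induction "card W" arbitrary: W \<kappa> rule: less_induct)
  case less
  let ?v0 = "lower (ulab T 0)" and ?P = "{\<mu>. integer_partition d \<mu>}"
  let ?ep = "\<lambda>\<kappa>. edge_partition n \<sigma> (T\<lparr>part := \<kappa>\<rparr>)"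
  have finW: "finite W" using less.prems(1) finite_V by (meson finite_Diff finite_subset)
  show ?case
  proof (cases "W = {?v0}")
    \<comment> \<open>A single vertex: no edge has both ends in it, and its rim consists of the
      edges at it.\<close>
    case True
    have "inner W = {}"
    proof -
      have "\<not> blab T i \<subseteq> {?v0}" if "i < n - 3" for i
        using ends(1,2)[OF bounded_E[OF blab_bounded[OF that]]] by (metis insert_subset singletonD)
      then show ?thesis by (auto simp: inner_def True)
    qed
    moreover have "rim W = edges_at (gr T) ?v0"
    proof -
      have "\<not> e \<subseteq> {?v0}" if "e \<in> E" for e
        using ends(1,2)[OF that] by (metis insert_subset singletonD)
      then show ?thesis by (auto simp: rim_def edges_at_def True)
    qed
    ultimately show ?thesis by (simp add: True)
  next
    case False
    let ?U = "W - {?v0}"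
    have U: "finite ?U" "?U \<noteq> {}" using finW False less.prems(2) by auto
    \<comment> \<open>Remove a vertex \<open>v\<close> of maximal depth. None of its children lies
      in \<open>W\<close>, so its parent edge \<open>e0\<close> is the only edge from
      \<open>v\<close> into the rest, and \<open>W - {v}\<close> is again upward closed.\<close>
    let ?D = "(\<lambda>w. card (ancestors w)) ` ?U"
    have D: "finite ?D" "?D \<noteq> {}" using U by blast+
    obtain v where v1: "v \<in> ?U" "Max ?D = card (ancestors v)" using Max_in[OF D] by blast
    have "\<forall>w\<in>?U. card (ancestors w) \<le> Max ?D" using Max_ge[OF D(1)] by blast
    then have v: "v \<in> ?U" "\<forall>w\<in>?U. card (ancestors w) \<le> card (ancestors v)"
      using v1 by simp_all
    then have vW: "v \<in> W" "v \<noteq> ?v0" "v \<in> internal" using less.prems(1) by auto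
    obtain e0 where e0: "e0 \<in> E" "lower e0 = v" "upper e0 \<in> internal" using internal_parent vW by blast
    have e0': "v \<in> e0" "upper e0 \<in> e0" "\<And>x. x \<in> e0 \<Longrightarrow> x = upper e0 \<or> x = v"
      using lower_mem[OF e0(1)] upper_mem[OF e0(1)] mem_ends[OF e0(1)] e0(2) by simp_all
    have uW: "upper e0 \<in> W" using less.prems(3) e0 vW(1) by (auto simp: upward_closed_def)
    have uv: "upper e0 \<noteq> v" using ends(2)[OF e0(1)] e0(2) by simp
    have child: "lower f \<notin> W" if f: "f \<in> E" "upper f = v" for f
    proof
      assume fW: "lower f \<in> W"
      have anc: "ancestors (lower f) = insert f (ancestors v)" "f \<notin> ancestors v"
        using ancestors_lower[OF f(1)] upper_ancestor[OF f(1)] f(2) by simp_all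
      then have "card (ancestors (lower f)) = Suc (card (ancestors v))" using finite_ancestors by simp
      moreover have "lower f \<noteq> ?v0"
      proof
        assume "lower f = ?v0"
        then have "f = ulab T 0" using lower_inj f(1) root_edge(2) by blast
        then have "v = leaf_of T 0" using f(2) root_edge(3) by simp
        then show False using vW(3) leaf_of(1)[of 0] n3 by simp
      qed
      ultimately show False using v(2) fW by force
    qed
    have other: "e = e0" if e: "e \<in> E" "v \<in> e" "e \<subseteq> W" for e
    proof -
      have "lower e \<in> W" using lower_mem[OF e(1)] e(3) by blast
      then have "upper e \<noteq> v" using child[OF e(1)] by blast
      then have "lower e = lower e0" using mem_ends[OF e(1,2)] e0(2) by metis
      then show ?thesis by (rule lower_inj[OF e(1) e0(1)])
    qed
    let ?W = "W - {v}"
    have e0W: "e0 \<subseteq> W" using e0'(3) uW vW(1) by blast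
    have "e0 \<in> bounded_edges (gr T)" using bounded_internal[OF e0(1)] e0W less.prems(1) by blast
    then obtain i0 where i0: "i0 < n - 3" "e0 = blab T i0" by (rule bounded_obtain)
    have i0J: "i0 \<notin> inner ?W" using e0'(1) i0 by (auto simp: inner_def)
    have J: "inner W = insert i0 (inner ?W)"
    proof (intro subset_antisym subsetI)
      fix i assume i: "i \<in> inner W"
      then have i': "i < n - 3" "blab T i \<subseteq> W" by (auto simp: inner_def)
      show "i \<in> insert i0 (inner ?W)"
      proof (cases "v \<in> blab T i")
        case True
        then have "blab T i = e0" using other bounded_E[OF blab_bounded[OF i'(1)]] i'(2) by blast
        then have "i = i0" using facts(5) i0 i'(1) by (auto simp: bij_betw_def inj_on_def)
        then show ?thesis by simp
      next
        case False
        then show ?thesis using i' by (auto simp: inner_def)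
      qed
    next
      fix i assume "i \<in> insert i0 (inner ?W)"
      then show "i \<in> inner W" using i0 e0W by (auto simp: inner_def)
    qed
    \<comment> \<open>The edges other than \<open>e0\<close> on its two sides: those at
      \<open>v\<close>, and those leaving the old part. Together they form the rim of
      \<open>W\<close>.\<close>
    let ?A = "edges_at (gr T) v - {e0}" and ?B = "rim ?W - {e0}"
    have A: "edges_at (gr T) v = insert e0 ?A" using e0(1) e0'(1) by (auto simp: edges_at_def)
    have B: "rim ?W = insert e0 ?B"
    proof -
      have "e0 \<inter> ?W \<noteq> {}" "\<not> e0 \<subseteq> ?W" using e0'(1,2) uW uv by blast+
      then show ?thesis using e0(1) by (auto simp: rim_def)
    qed
    have vB: "v \<notin> e" if "e \<in> ?B" for e
    proof
      assume ve: "v \<in> e"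
      have e: "e \<in> E" "e \<inter> ?W \<noteq> {}" "e \<noteq> e0" using that by (auto simp: rim_def)
      obtain a b where ab: "e = {a, b}" using ends_in[OF e(1)] by blast
      have "e \<subseteq> W" using ab ve e(2) vW(1) by auto
      then show False using other[OF e(1) ve] e(3) by blast
    qed
    have fin: "finite ?A" "finite ?B" using finite_E by (auto simp: edges_at_def rim_def)
    have dis: "?A \<inter> ?B = {}" using vB by (auto simp: edges_at_def)
    have AB: "rim W = ?A \<union> ?B"
    proof (intro subset_antisym subsetI)
      fix e assume "e \<in> rim W"
      then have e: "e \<in> E" "e \<inter> W \<noteq> {}" "\<not> e \<subseteq> W" by (auto simp: rim_def)
      then have "e \<noteq> e0" using e0W by blast
      then show "e \<in> ?A \<union> ?B" using e by (auto simp: rim_def edges_at_def)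
    next
      fix e assume "e \<in> ?A \<union> ?B"
      then show "e \<in> rim W"
      proof
        assume e: "e \<in> ?A"
        then have "\<not> e \<subseteq> W" using other by (auto simp: edges_at_def)
        then show ?thesis using e vW(1) by (auto simp: rim_def edges_at_def)
      next
        assume e: "e \<in> ?B"
        then show ?thesis using vB[OF e] by (auto simp: rim_def)
      qed
    qed
    have ep: "?ep (\<kappa>(i0 := x)) e = ((?ep \<kappa>)(e0 := x)) e" if "e \<in> E" for x e
    proof (cases "e \<in> unbounded_edges (gr T)")
      case True
      then obtain i where i: "i < n" "e = ulab T i" by (rule unbounded_obtain)
      moreover have "e \<noteq> e0" using True \<open>e0 \<in> bounded_edges (gr T)\<close> by (auto simp: bounded_edges_def)
      ultimately show ?thesis using edge_partition_ulab[OF i(1)] by simp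
    next
      case False
      then have "e \<in> bounded_edges (gr T)" using that edge_cases by blast
      then obtain i where i: "i < n - 3" "e = blab T i" by (rule bounded_obtain)
      have "e = e0 \<longleftrightarrow> i = i0" using facts(5) i i0 by (auto simp: bij_betw_def inj_on_def)
      then show ?thesis using edge_partition_blab[OF i(1)] i by simp
    qed
    \<comment> \<open>The colour \<open>x\<close> of \<open>e0\<close> is an inner colour of
      \<open>W\<close> but an outer one of \<open>W - {v}\<close>. It moves from \<nu> to \<kappa>,
      which is why the induction is over arbitrary \<kappa>.\<close>
    have ov: "(\<lambda>i. if i \<in> inner W then (\<nu>(i0 := x)) i else \<kappa> i) =
        (\<lambda>i. if i \<in> inner ?W then \<nu> i else (\<kappa>(i0 := x)) i)" for \<nu> x
      using i0J by (auto simp: J)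
    have at_v: "class_trace d (?ep (\<lambda>i. if i \<in> inner ?W then \<nu> i else (\<kappa>(i0 := x)) i)) (edges_at (gr T) v) =
        class_trace d ((?ep \<kappa>)(e0 := x)) (insert e0 ?A)" for \<nu> x
      unfolding A[symmetric]
    proof (rule class_trace_cong)
      show "finite (edges_at (gr T) v)" using finite_E by (simp add: edges_at_def)
      fix e assume e: "e \<in> edges_at (gr T) v"
      then have eE: "e \<in> E" "v \<in> e" by (auto simp: edges_at_def)
      have "?ep (\<lambda>i. if i \<in> inner ?W then \<nu> i else (\<kappa>(i0 := x)) i) e = ?ep (\<kappa>(i0 := x)) e"
      proof (cases "e \<in> unbounded_edges (gr T)")
        case True
        then obtain i where i: "i < n" "e = ulab T i" by (rule unbounded_obtain)
        then show ?thesis using edge_partition_ulab[OF i(1)] by simp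
      next
        case False
        then have "e \<in> bounded_edges (gr T)" using eE edge_cases by blast
        then obtain i where i: "i < n - 3" "e = blab T i" by (rule bounded_obtain)
        then have "i \<notin> inner ?W" using eE by (auto simp: inner_def)
        then show ?thesis using edge_partition_blab[OF i(1)] i(2) by simp
      qed
      then show "?ep (\<lambda>i. if i \<in> inner ?W then \<nu> i else (\<kappa>(i0 := x)) i) e = ((?ep \<kappa>)(e0 := x)) e"
        using ep[OF eE(1)] by simp
    qed
    have IH: "(\<Sum>\<nu>\<in>PiE (inner ?W) (\<lambda>_. ?P).
        (\<Prod>i\<in>inner ?W. 1 / real (card (conj_class d (\<nu> i)))) *
        (\<Prod>w\<in>?W. class_trace d (?ep (\<lambda>i. if i \<in> inner ?W then \<nu> i else (\<kappa>(i0 := x)) i)) (edges_at (gr T) w)))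
      = class_trace d ((?ep \<kappa>)(e0 := x)) (insert e0 ?B)" for x
    proof -
      have "upward_closed ?W"
        unfolding upward_closed_def
      proof (intro ballI impI)
        fix e assume e: "e \<in> E" "lower e \<in> ?W" "upper e \<in> internal"
        then have "upper e \<in> W" using less.prems(3) by (auto simp: upward_closed_def)
        moreover have "upper e \<noteq> v" using child[OF e(1)] e(2) by auto
        ultimately show "upper e \<in> ?W" by blast
      qed
      moreover have "card ?W < card W" using finW vW(1) by (intro psubset_card_mono) auto
      moreover have "?W \<subseteq> internal" "?v0 \<in> ?W" using less.prems vW(2) by auto
      ultimately have "(\<Sum>\<nu>\<in>PiE (inner ?W) (\<lambda>_. ?P).
          (\<Prod>i\<in>inner ?W. 1 / real (card (conj_class d (\<nu> i)))) *
          (\<Prod>w\<in>?W. class_trace d (?ep (\<lambda>i. if i \<in> inner ?W then \<nu> i else (\<kappa>(i0 := x)) i)) (edges_at (gr T) w)))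
        = class_trace d (?ep (\<kappa>(i0 := x))) (rim ?W)"
        using less.hyps[of ?W "\<kappa>(i0 := x)"] by blast
      also have "\<dots> = class_trace d ((?ep \<kappa>)(e0 := x)) (insert e0 ?B)"
        unfolding B[symmetric]
        by (rule class_trace_cong) (use finite_E ep in \<open>auto simp: rim_def\<close>)
      finally show ?thesis .
    qed
    have finJ: "finite (inner ?W)" by (simp add: inner_def)
    have term_eq: "(\<Prod>i\<in>inner W. 1 / real (card (conj_class d ((\<nu>(i0 := x)) i)))) *
        (\<Prod>w\<in>W. class_trace d (?ep (\<lambda>i. if i \<in> inner W then (\<nu>(i0 := x)) i else \<kappa> i)) (edges_at (gr T) w)) =
      1 / real (card (conj_class d x)) * class_trace d ((?ep \<kappa>)(e0 := x)) (insert e0 ?A) *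
      ((\<Prod>i\<in>inner ?W. 1 / real (card (conj_class d (\<nu> i)))) *
        (\<Prod>w\<in>?W. class_trace d (?ep (\<lambda>i. if i \<in> inner ?W then \<nu> i else (\<kappa>(i0 := x)) i)) (edges_at (gr T) w)))"
      for \<nu> x
    proof -
      have "(\<Prod>i\<in>inner W. 1 / real (card (conj_class d ((\<nu>(i0 := x)) i)))) =
          1 / real (card (conj_class d x)) * (\<Prod>i\<in>inner ?W. 1 / real (card (conj_class d ((\<nu>(i0 := x)) i))))"
        unfolding J prod.insert[OF finJ i0J] by simp
      also have "(\<Prod>i\<in>inner ?W. 1 / real (card (conj_class d ((\<nu>(i0 := x)) i)))) =
          (\<Prod>i\<in>inner ?W. 1 / real (card (conj_class d (\<nu> i))))"
        by (rule prod.cong) (use i0J in auto)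
      finally have prod1: "(\<Prod>i\<in>inner W. 1 / real (card (conj_class d ((\<nu>(i0 := x)) i)))) =
          1 / real (card (conj_class d x)) * (\<Prod>i\<in>inner ?W. 1 / real (card (conj_class d (\<nu> i))))" .
      show ?thesis
        unfolding prod1 ov prod.remove[OF finW vW(1)] at_v by (simp only: mult_ac)
    qed
    have notin: "e0 \<notin> ?A" "e0 \<notin> ?B" by simp_all
    \<comment> \<open>The sum splits into one over \<open>x\<close> and one over the colours inside
      \<open>W - {v}\<close>. The latter is the induction hypothesis, the former is
      \<open>class_trace_glue\<close>.\<close>
    show ?thesis
      unfolding J sum_PiE_insert[OF i0J] unfolding J[symmetric] term_eq sum_distrib_left[symmetric] IH AB
      using class_trace_glue[OF fin dis notin, of d "?ep \<kappa>"] by (simp only: mult.assoc)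
  qed
qed

text \<open>This is \<open>growth\<close> for the set of all internal vertices: its inner edges are
  the bounded edges, and its rim is the set of unbounded ones, which carry \<sigma>.\<close>

theorem cone_weight_sum:
  assumes \<sigma>: "length \<sigma> = n"
  shows "(\<Sum>\<nu>\<in>PiE {..<n - 3} (\<lambda>_. {\<mu>. integer_partition d \<mu>}). cone_weight n d \<sigma> (T\<lparr>part := \<nu>\<rparr>))
    = 1 / fact d * galg_tr (sym_group d) (galg_prod (sym_group d) (map (class_sum d) \<sigma>))"
proof -
  let ?P = "{\<mu>. integer_partition d \<mu>}"
  have J: "inner internal = {..<n - 3}"
    using blab_bounded bounded_internal bounded_E by (auto simp: inner_def)
  have R: "rim internal = unbounded_edges (gr T)"
  proof (intro subset_antisym subsetI)
    fix e assume "e \<in> rim internal"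
    then have e: "e \<in> E" "\<not> e \<subseteq> internal" by (auto simp: rim_def)
    then show "e \<in> unbounded_edges (gr T)" using bounded_internal edge_cases by blast
  next
    fix e assume "e \<in> unbounded_edges (gr T)"
    then have e: "e \<in> E" "e \<inter> leaves (gr T) \<noteq> {}" by (auto simp: unbounded_edges_def)
    obtain a b where ab: "a \<in> V" "b \<in> V" "a \<noteq> b" "e = {a, b}" using ends_in[OF e(1)] by blast
    \<comment> \<open>An unbounded edge has only one leaf, so it also meets the internal vertices
      and belongs to their rim.\<close>
    have "\<not> (a \<in> leaves (gr T) \<and> b \<in> leaves (gr T))" using one_leaf[OF e(1), of a b] ab by blast
    then show "e \<in> rim internal" using e ab by (auto simp: rim_def)
  qed
  have "(\<Sum>\<nu>\<in>PiE {..<n - 3} (\<lambda>_. ?P). cone_weight n d \<sigma> (T\<lparr>part := \<nu>\<rparr>)) =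
    1 / fact d * (\<Sum>\<nu>\<in>PiE (inner internal) (\<lambda>_. ?P).
      (\<Prod>i\<in>inner internal. 1 / real (card (conj_class d (\<nu> i)))) *
      (\<Prod>v\<in>internal. class_trace d (edge_partition n \<sigma> (T\<lparr>part := \<lambda>i. if i \<in> inner internal then \<nu> i else {#}\<rparr>)) (edges_at (gr T) v)))"
    unfolding J sum_distrib_left
  proof (rule sum.cong)
    fix \<nu> assume "\<nu> \<in> PiE {..<n - 3} (\<lambda>_. ?P)"
    have ep: "edge_partition n \<sigma> (T\<lparr>part := \<nu>\<rparr>) e =
        edge_partition n \<sigma> (T\<lparr>part := \<lambda>i. if i \<in> {..<n - 3} then \<nu> i else {#}\<rparr>) e" if "e \<in> E" for e
    proof (cases "e \<in> unbounded_edges (gr T)")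
      case True
      then obtain i where i: "i < n" "e = ulab T i" by (rule unbounded_obtain)
      then show ?thesis using edge_partition_ulab[OF i(1)] by simp
    next
      case False
      then have "e \<in> bounded_edges (gr T)" using that edge_cases by blast
      then obtain i where i: "i < n - 3" "e = blab T i" by (rule bounded_obtain)
      then show ?thesis using edge_partition_blab[OF i(1)] by simp
    qed
    have "class_trace d (edge_partition n \<sigma> (T\<lparr>part := \<nu>\<rparr>)) (edges_at (gr T) v) =
      class_trace d (edge_partition n \<sigma> (T\<lparr>part := \<lambda>i. if i \<in> {..<n - 3} then \<nu> i else {#}\<rparr>)) (edges_at (gr T) v)" for v
      by (rule class_trace_cong) (use finite_E ep in \<open>auto simp: edges_at_def\<close>)
    then show "cone_weight n d \<sigma> (T\<lparr>part := \<nu>\<rparr>) = 1 / fact d *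
      ((\<Prod>i\<in>{..<n - 3}. 1 / real (card (conj_class d (\<nu> i)))) *
      (\<Prod>v\<in>internal. class_trace d (edge_partition n \<sigma> (T\<lparr>part := \<lambda>i. if i \<in> {..<n - 3} then \<nu> i else {#}\<rparr>)) (edges_at (gr T) v)))"
      by (simp add: cone_weight_def vertex_mult_trace)
  qed simp
  also have "\<dots> = 1 / fact d * class_trace d (edge_partition n \<sigma> (T\<lparr>part := \<lambda>_. {#}\<rparr>)) (rim internal)"
    using growth[of internal d \<sigma> "\<lambda>_. {#}"] root_neighbour_internal by (simp add: upward_closed_def)
  also have "class_trace d (edge_partition n \<sigma> (T\<lparr>part := \<lambda>_. {#}\<rparr>)) (rim internal) =
      galg_tr (sym_group d) (galg_prod (sym_group d) (map (\<lambda>e. class_sum d (edge_partition n \<sigma> (T\<lparr>part := \<lambda>_. {#}\<rparr>) e)) (map (ulab T) [0..<n])))"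
    unfolding R by (rule class_trace_list) (use facts(4) in \<open>auto simp: distinct_map bij_betw_def atLeast0LessThan\<close>)
  also have "map (\<lambda>e. class_sum d (edge_partition n \<sigma> (T\<lparr>part := \<lambda>_. {#}\<rparr>) e)) (map (ulab T) [0..<n]) = map (class_sum d) \<sigma>"
    by (rule nth_equalityI) (use \<sigma> edge_partition_ulab in auto)
  finally show ?thesis .
qed

end

section \<open>Independence of the numbering of the bounded edges\<close>

text \<open>Both trees have \<open>n - 3\<close> distinct keys, so matching all keys of one exhausts
  those of the other. Equal cluster families give an isomorphism; it may permute the numbering of
  the bounded edges but respects their partitions.\<close>

lemma same_keys_iso:
  assumes T: "trivalent_tree n T" and T': "trivalent_tree n T'"
    and keys: "\<And>i. i < n - 3 \<Longrightarrow> \<exists>j<n - 3. trivalent_tree.key n T' j = trivalent_tree.key n T i \<and> part T' j = part T i"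
  shows "\<exists>F. graph_iso (gr T) (gr T') F \<and>
    (\<forall>e\<in>edges (gr T). edge_partition n \<sigma> T' (F ` e) = edge_partition n \<sigma> T e)"
proof -
  interpret A: trivalent_tree n T by fact
  interpret B: trivalent_tree n T' by fact
  have ck: "labelled_tree.cluster (edges (gr X)) (leaf_of X) n ` edges (gr X) =
      trivalent_tree.key n X ` {..<n - 3} \<union> labelled_tree.cluster (edges (gr X)) (leaf_of X) n ` ulab X ` {..<n}"
    if "trivalent_tree n X" for X
  proof -
    interpret X: trivalent_tree n X by fact
    have "edges (gr X) = blab X ` {..<n - 3} \<union> ulab X ` {..<n}"
      using X.facts(4,5) by (auto simp: bij_betw_def bounded_edges_def unbounded_edges_def)
    then show ?thesis by (simp add: image_Un image_image X.key_def)
  qed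
  have ul: "labelled_tree.cluster (edges (gr X)) (leaf_of X) n (ulab X i) = (if i = 0 then {1..<n} else {i})"
    if "trivalent_tree n X" "i < n" for X i
  proof -
    interpret X: trivalent_tree n X by fact
    show ?thesis using X.cluster_label_edge[OF that(2) X.ulab_E X.leaf_of(2)] that(2) by simp
  qed
  have "A.key ` {..<n - 3} \<subseteq> B.key ` {..<n - 3}"
    using keys by (metis (no_types, lifting) image_eqI image_subsetI lessThan_iff)
  then have "A.key ` {..<n - 3} = B.key ` {..<n - 3}"
    by (rule card_subset_eq[rotated]) (simp_all add: card_image A.key_inj B.key_inj)
  then have "A.cluster ` A.E = B.cluster ` B.E"
    unfolding ck[OF T] ck[OF T'] using ul[OF T] ul[OF T'] by (simp add: image_image)
  then obtain F where F: "bij_betw F A.V B.V" "bij_betw ((`) F) A.E B.E"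
      "\<And>e. e \<in> A.E \<Longrightarrow> B.cluster (F ` e) = A.cluster e"
    using labelled_tree_iso[OF A.labelled_tree_axioms B.labelled_tree_axioms] by blast
  have FE: "F ` e \<in> B.E" if "e \<in> A.E" for e using F(2) that by (auto simp: bij_betw_def)
  have "edge_partition n \<sigma> T' (F ` e) = edge_partition n \<sigma> T e" if e: "e \<in> A.E" for e
  proof (cases "e \<in> unbounded_edges (gr T)")
    case True
    then obtain i where i: "i < n" "e = ulab T i" by (rule A.unbounded_obtain)
    have "F ` e = ulab T' i"
      by (rule inj_onD[OF B.cluster_inj])
        (use F(3)[OF e] ul[OF T i(1)] ul[OF T' i(1)] i(2) FE[OF e] B.ulab_E[OF i(1)] in auto)
    then show ?thesis
      using A.edge_partition_ulab[OF i(1), of \<sigma> "part T"] B.edge_partition_ulab[OF i(1), of \<sigma> "part T'"] i(2) by simp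
  next
    case False
    then have "e \<in> bounded_edges (gr T)" using e A.edge_cases by blast
    then obtain i where i: "i < n - 3" "e = blab T i" by (rule A.bounded_obtain)
    then obtain j where j: "j < n - 3" "B.key j = A.key i" "part T' j = part T i" using keys by blast
    have "F ` e = blab T' j"
      by (rule inj_onD[OF B.cluster_inj])
        (use F(3)[OF e] j(2) i(2) FE[OF e] B.bounded_E[OF B.blab_bounded[OF j(1)]] in \<open>auto simp: A.key_def B.key_def\<close>)
    then show ?thesis
      using A.edge_partition_blab[OF i(1), of \<sigma> "part T"] B.edge_partition_blab[OF j(1), of \<sigma> "part T'"] i(2) j(3) by simp
  qed
  then show ?thesis using F by (auto simp: graph_iso_def)
qed

text \<open>\<open>H_weight\<close> picks some class with the given cell; the first part shows that
  the pick does not affect the weight. The second part carries acceptability over when colours are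
  copied to another tree.\<close>

lemma same_keys:
  assumes T: "trivalent_tree n T" and T': "trivalent_tree n T'"
    and keys: "\<And>i. i < n - 3 \<Longrightarrow> \<exists>j<n - 3. trivalent_tree.key n T' j = trivalent_tree.key n T i \<and> part T' j = part T i"
  shows "cone_weight n d \<sigma> T' = cone_weight n d \<sigma> T"
    "(\<forall>v\<in>verts (gr T') - leaves (gr T'). vertex_mult n d \<sigma> T' v \<noteq> 0) \<longleftrightarrow>
     (\<forall>v\<in>verts (gr T) - leaves (gr T). vertex_mult n d \<sigma> T v \<noteq> 0)"
proof -
  interpret A: trivalent_tree n T by fact
  interpret B: trivalent_tree n T' by fact
  obtain F where F: "graph_iso (gr T) (gr T') F"
      "\<And>e. e \<in> A.E \<Longrightarrow> edge_partition n \<sigma> T' (F ` e) = edge_partition n \<sigma> T e"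
    using same_keys_iso[OF T T' keys] by blast
  have vm: "vertex_mult n d \<sigma> T' (F v) = vertex_mult n d \<sigma> T v" if v: "v \<in> A.V" for v
  proof -
    have sub: "edges_at (gr T) v \<subseteq> A.E" by (auto simp: edges_at_def)
    have fin: "finite (edges_at (gr T) v)" using sub A.finite_E finite_subset by blast
    have inj: "inj_on ((`) F) (edges_at (gr T) v)"
      using F(1) sub by (auto simp: graph_iso_def bij_betw_def intro: inj_on_subset)
    have "class_trace d (\<lambda>e. edge_partition n \<sigma> T' (F ` e)) (edges_at (gr T) v) =
        class_trace d (edge_partition n \<sigma> T) (edges_at (gr T) v)"
      by (rule class_trace_cong[OF fin]) (use F(2) sub in auto)
    then show ?thesis
      unfolding vertex_mult_trace graph_iso_edges_at(1)[OF F(1) A.E_sub v] class_trace_image[OF fin inj] .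
  qed
  have bij: "bij_betw F A.internal B.internal"
  proof -
    have inj: "inj_on F A.V" and im: "F ` A.V = B.V" using F(1) by (auto simp: graph_iso_def bij_betw_def)
    have "F ` A.internal = B.internal"
      using inj_on_image_set_diff[OF inj, of A.V "leaves (gr T)"] graph_iso_leaves[OF F(1) A.E_sub] im A.leaf_V by auto
    moreover have "inj_on F A.internal" by (rule inj_on_subset[OF inj]) blast
    ultimately show ?thesis by (simp only: bij_betw_def simp_thms)
  qed
  show "(\<forall>v\<in>B.internal. vertex_mult n d \<sigma> T' v \<noteq> 0) \<longleftrightarrow> (\<forall>v\<in>A.internal. vertex_mult n d \<sigma> T v \<noteq> 0)"
  proof -
    have im: "B.internal = F ` A.internal" using bij by (simp add: bij_betw_def)
    show ?thesis unfolding im using vm by simp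
  qed
  have "(\<Prod>v\<in>B.internal. vertex_mult n d \<sigma> T' v) = (\<Prod>v\<in>A.internal. vertex_mult n d \<sigma> T' (F v))"
    by (rule prod.reindex_bij_betw[OF bij, symmetric])
  also have "\<dots> = (\<Prod>v\<in>A.internal. vertex_mult n d \<sigma> T v)"
    by (rule prod.cong) (use vm in auto)
  finally have 1: "(\<Prod>v\<in>B.internal. vertex_mult n d \<sigma> T' v) = (\<Prod>v\<in>A.internal. vertex_mult n d \<sigma> T v)" .
  have "\<forall>i\<in>{..<n - 3}. \<exists>j. j < n - 3 \<and> B.key j = A.key i \<and> part T' j = part T i"
    using keys by simp
  \<comment> \<open>\<pi> translates between the two numberings of the bounded edges and reindexes
    the product of class sizes.\<close>
  then obtain \<pi> where "\<forall>i\<in>{..<n - 3}. \<pi> i < n - 3 \<and> B.key (\<pi> i) = A.key i \<and> part T' (\<pi> i) = part T i"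
    using bchoice by meson
  then have \<pi>: "\<pi> i < n - 3 \<and> B.key (\<pi> i) = A.key i \<and> part T' (\<pi> i) = part T i" if "i < n - 3" for i
    using that by blast
  have "inj_on \<pi> {..<n - 3}"
  proof (rule inj_onI)
    fix i j assume ij: "i \<in> {..<n - 3}" "j \<in> {..<n - 3}" "\<pi> i = \<pi> j"
    then have "A.key i = A.key j" using \<pi>[of i] \<pi>[of j] by simp
    then show "i = j" using inj_onD[OF A.key_inj] ij by blast
  qed
  moreover have "\<pi> ` {..<n - 3} \<subseteq> {..<n - 3}" using \<pi> by auto
  ultimately have bij\<pi>: "bij_betw \<pi> {..<n - 3} {..<n - 3}"
    unfolding bij_betw_def using endo_inj_surj[of "{..<n - 3}" \<pi>] by blast
  have "(\<Prod>i<n - 3. 1 / real (card (conj_class d (part T' i)))) = (\<Prod>i<n - 3. 1 / real (card (conj_class d (part T' (\<pi> i)))))"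
    by (rule prod.reindex_bij_betw[OF bij\<pi>, symmetric])
  also have "\<dots> = (\<Prod>i<n - 3. 1 / real (card (conj_class d (part T i))))"
    by (rule prod.cong) (use \<pi> in auto)
  finally show "cone_weight n d \<sigma> T' = cone_weight n d \<sigma> T"
    unfolding cone_weight_def 1 by simp
qed

section \<open>A tree for the case without top cells, and topological preparations\<close>

section \<open>Existence of labelled trivalent trees\<close>

text \<open>Indices are read cyclically, so that the closing edge is treated like the
  others.\<close>

lemma circuit_adjacent:
  assumes "is_circuit G xs" "k < length xs"
  shows "{xs ! k, xs ! (Suc k mod length xs)} \<in> edges G"
proof (cases "Suc k < length xs")
  case True
  then show ?thesis
    using assms by (auto simp: is_circuit_def successively_conv_nth)
next
  case False
  then have l: "Suc k = length xs" "xs \<noteq> []" using assms(2) by auto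
  then have "length xs - 1 = k" by simp
  then have "xs ! k = last xs" using last_conv_nth[OF l(2)] by simp
  moreover have "xs ! (Suc k mod length xs) = hd xs" using l by (simp add: hd_conv_nth)
  ultimately show ?thesis using assms(1) by (simp add: is_circuit_def)
qed

text \<open>Parents are smaller than their children, so every vertex descends to 0. In a circuit,
  the largest vertex would have two different neighbours that are both its parent.\<close>

lemma parent_graph_tree:
  fixes N :: nat
  assumes N: "0 < N" and par: "\<And>v. 0 < v \<Longrightarrow> v < N \<Longrightarrow> par v < v"
    and G: "verts G = {..<N}" "edges G = (\<lambda>v. {v, par v}) ` {0<..<N}"
  shows "is_tree G"
  unfolding is_tree_def
proof (intro conjI notI)
  show wf: "wf_graph G"
    unfolding wf_graph_def G
  proof (intro conjI ballI)
    fix e assume "e \<in> (\<lambda>v. {v, par v}) ` {0<..<N}"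
    then obtain v where v: "0 < v" "v < N" "e = {v, par v}" by auto
    then have "v \<in> {..<N}" "par v \<in> {..<N}" "v \<noteq> par v" using par[of v] by auto
    then show "\<exists>u\<in>{..<N}. \<exists>v\<in>{..<N}. u \<noteq> v \<and> e = {u, v}" using v(3) by blast
  qed simp
  have conn0: "(v, 0) \<in> conn (edges G)" if "v < N" for v
    using that
  proof (induction v rule: less_induct)
    case (less v)
    show ?case
    proof (cases "v = 0")
      case False
      then have "{v, par v} \<in> edges G" using less.prems unfolding G by auto
      then have "(v, par v) \<in> conn (edges G)" by (rule conn_edge)
      moreover have "(par v, 0) \<in> conn (edges G)"
        using less.IH[of "par v"] par[of v] False less.prems by simp
      ultimately show ?thesis by (rule conn_trans)
    qed simp
  qed
  have sub: "edges G \<subseteq> Pow (verts G)" using wf by (auto simp: wf_graph_def)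
  show "connected_graph G"
    unfolding connected_graph_def
  proof (intro conjI ballI)
    show "verts G \<noteq> {}" using N G by auto
    fix u v assume uv: "u \<in> verts G" "v \<in> verts G"
    then have "(u, 0) \<in> conn (edges G)" "(v, 0) \<in> conn (edges G)" using conn0 G by auto
    then have "(u, v) \<in> conn (edges G)" by (rule conn_trans[OF _ conn_sym])
    then show "\<exists>xs. is_path G u xs v" by (rule conn_is_path[OF _ uv(1) sub])
  qed
  assume "\<exists>xs. is_circuit G xs"
  then obtain xs where xs: "is_circuit G xs" by blast
  let ?l = "length xs"
  have l: "3 \<le> ?l" "distinct xs" using xs by (auto simp: is_circuit_def)
  then have ne: "set xs \<noteq> {}" by auto
  define M where "M = Max (set xs)"
  have M: "M \<in> set xs" "\<And>w. w \<in> set xs \<Longrightarrow> w \<le> M" using ne by (simp_all add: M_def)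
  then obtain k where k: "k < ?l" "xs ! k = M" by (metis in_set_conv_nth)
  have nb: "w = par M" if w: "w \<in> set xs" "w \<noteq> M" "{M, w} \<in> edges G" for w
  proof -
    have lt: "w < M" using w(2) M(2)[OF w(1)] by simp
    obtain v where v: "v \<in> {0<..<N}" "{M, w} = {v, par v}" using w(3) unfolding G by blast
    then have "par v < v" using par by simp
    then show ?thesis using v(2) lt by (auto simp: doubleton_eq_iff)
  qed
  define i where "i = Suc k mod ?l"
  define j where "j = (if k = 0 then ?l - 1 else k - 1)"
  have ij: "i < ?l" "j < ?l" "i \<noteq> k" "j \<noteq> k" "i \<noteq> j" "Suc j mod ?l = k"
    using k(1) l(1) by (auto simp: i_def j_def mod_Suc split: if_splits)
  have "{xs ! k, xs ! i} \<in> edges G" using circuit_adjacent[OF xs k(1)] by (simp add: i_def)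
  moreover have "{xs ! k, xs ! j} \<in> edges G" using circuit_adjacent[OF xs ij(2)] ij(6) by (simp add: insert_commute)
  moreover have "xs ! i \<noteq> xs ! k" "xs ! j \<noteq> xs ! k" using ij k(1) l(2) by (simp_all add: nth_eq_iff_index_eq)
  ultimately have "xs ! i = xs ! j"
    using nb[of "xs ! i"] nb[of "xs ! j"] ij k(2) by simp
  then show False using ij l(2) by (simp add: nth_eq_iff_index_eq)
qed

text \<open>A caterpillar: the odd numbers below \<open>2 n - 3\<close> are the internal vertices.\<close>

definition cat_parent :: "nat \<Rightarrow> nat" where
  "cat_parent v = (if v = 1 then 0 else if odd v then v - 2 else v - 1)"

definition caterpillar :: "nat \<Rightarrow> nat ugraph" where
  "caterpillar n = \<lparr>verts = {..<2 * n - 2}, edges = (\<lambda>v. {v, cat_parent v}) ` {0<..<2 * n - 2}\<rparr>"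

lemma cat_parent_less: "0 < v \<Longrightarrow> cat_parent v < v"
  by (auto simp: cat_parent_def)

lemma cat_edge_inj: "inj_on (\<lambda>v. {v, cat_parent v}) {0<..<N}"
proof (rule inj_onI)
  fix v w assume "v \<in> {0<..<N}" "w \<in> {0<..<N}" "{v, cat_parent v} = {w, cat_parent w}"
  then show "v = w"
    using cat_parent_less[of v] cat_parent_less[of w] by (auto simp: doubleton_eq_iff)
qed

text \<open>The spine starts at the leaf 0; each odd \<open>v\<close> carries the leaf
  \<open>v + 1\<close> and is followed on the spine by \<open>v + 2\<close>. Cutting the vertex
  range after \<open>2 * n - 3\<close> makes that last odd number a leaf.\<close>

lemma cat_children:
  assumes "0 < c"
  shows "cat_parent c = v \<longleftrightarrow> (v = 0 \<and> c = 1) \<or> (odd v \<and> (c = v + 1 \<or> c = v + 2))"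
  using assms unfolding cat_parent_def by (cases "c = 1"; cases "odd c"; simp only: if_True if_False simp_thms; presburger)

lemma cat_edges_at:
  assumes "n \<ge> 3" "v < 2 * n - 2"
  shows "edges_at (caterpillar n) v = (\<lambda>v. {v, cat_parent v}) `
    (if v = 0 then {1} else if even v \<or> v = 2 * n - 3 then {v} else {v, v + 1, v + 2})"
proof -
  have "edges_at (caterpillar n) v = (\<lambda>v. {v, cat_parent v}) ` {c \<in> {0<..<2 * n - 2}. v = c \<or> cat_parent c = v}"
    by (auto simp: edges_at_def caterpillar_def)
  also have "{c \<in> {0<..<2 * n - 2}. v = c \<or> cat_parent c = v} =
      (if v = 0 then {1} else if even v \<or> v = 2 * n - 3 then {v} else {v, v + 1, v + 2})"
  proof (rule Set.set_eqI)
    fix c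
    have "c \<in> {c \<in> {0<..<2 * n - 2}. v = c \<or> cat_parent c = v} \<longleftrightarrow>
        0 < c \<and> c < 2 * n - 2 \<and> (v = c \<or> (v = 0 \<and> c = 1) \<or> (odd v \<and> (c = v + 1 \<or> c = v + 2)))"
      using cat_children[of c v] by auto
    also have "\<dots> \<longleftrightarrow> c \<in> (if v = 0 then {1} else if even v \<or> v = 2 * n - 3 then {v} else {v, v + 1, v + 2})"
    proof (cases "v = 0")
      case False
      show ?thesis
      proof (cases "even v \<or> v = 2 * n - 3")
        case True
        then show ?thesis using False assms by auto
      next
        case F2: False
        then have "v + 2 < 2 * n - 2" using assms by presburger
        then show ?thesis using F2 False by auto
      qed
    qed (use assms in auto)
    finally show "c \<in> {c \<in> {0<..<2 * n - 2}. v = c \<or> cat_parent c = v} \<longleftrightarrow>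
        c \<in> (if v = 0 then {1} else if even v \<or> v = 2 * n - 3 then {v} else {v, v + 1, v + 2})" .
  qed
  finally show ?thesis .
qed

lemma cat_degree:
  assumes "n \<ge> 3" "v < 2 * n - 2"
  shows "card (edges_at (caterpillar n) v) = (if even v \<or> v = 2 * n - 3 then 1 else 3)"
proof -
  have inj: "inj_on (\<lambda>v. {v, cat_parent v}) A" if "A \<subseteq> {0<..}" for A
  proof (rule inj_onI)
    fix v w assume vw: "v \<in> A" "w \<in> A" "{v, cat_parent v} = {w, cat_parent w}"
    then have "v \<in> {0<..<Suc (v + w)}" "w \<in> {0<..<Suc (v + w)}" using that by auto
    then show "v = w" using inj_onD[OF cat_edge_inj vw(3)] by blast
  qed
  show ?thesis
    unfolding cat_edges_at[OF assms] by (subst card_image[OF inj]) (auto simp: card_insert_if)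
qed

text \<open>Serves the case in which the complex has no top cell: some tree is then needed on which
  to sum the weights. Once edges and leaves of the caterpillar are counted, arbitrary bijections
  provide the labels.\<close>

lemma exists_labelled_trivalent_tree:
  assumes n: "n \<ge> 3"
  shows "\<exists>T. labelled_trivalent_tree n T"
proof -
  let ?G = "caterpillar n" and ?e = "\<lambda>v. {v, cat_parent v}"
  have tree: "is_tree ?G"
    by (rule parent_graph_tree[of "2 * n - 2" cat_parent]) (use n cat_parent_less in \<open>auto simp: caterpillar_def\<close>)
  have tri: "trivalent ?G"
    unfolding trivalent_def using cat_degree[OF n] by (auto simp: caterpillar_def)
  have lv: "leaves ?G = {v. v < 2 * n - 2 \<and> (even v \<or> v = 2 * n - 3)}"
  proof -
    have "v < 2 * n - 2 \<and> card (edges_at ?G v) = 1 \<longleftrightarrow> v < 2 * n - 2 \<and> (even v \<or> v = 2 * n - 3)" for v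
    proof (cases "v < 2 * n - 2")
      case True
      then show ?thesis using cat_degree[OF n True] by simp
    qed simp
    then show ?thesis by (simp add: leaves_def caterpillar_def)
  qed
  have lv': "leaves ?G = insert (2 * n - 3) ((\<lambda>k. 2 * k) ` {..<n - 1})"
  proof -
    have "v < 2 * n - 2 \<and> (even v \<or> v = 2 * n - 3) \<longleftrightarrow> v = 2 * n - 3 \<or> (\<exists>k<n - 1. v = 2 * k)" for v
      using n by presburger
    then show ?thesis unfolding lv by auto
  qed
  have "2 * n - 3 \<noteq> 2 * k" for k using n by presburger
  then have "2 * n - 3 \<notin> (\<lambda>k. 2 * k) ` {..<n - 1}" by blast
  moreover have "card ((\<lambda>k::nat. 2 * k) ` {..<n - 1}) = n - 1" by (subst card_image) (auto simp: inj_on_def)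
  ultimately have card_leaves: "card (leaves ?G) = n" unfolding lv' using n by simp
  \<comment> \<open>Edges are indexed by their child. An edge is bounded when child and parent are
    both internal, that is, \<open>2 * k + 3\<close> over \<open>2 * k + 1\<close>.\<close>
  have bd: "bounded_edges ?G = ?e ` (\<lambda>k. 2 * k + 3) ` {..<n - 3}"
  proof -
    have "bounded_edges ?G = ?e ` {v \<in> {0<..<2 * n - 2}. v \<notin> leaves ?G \<and> cat_parent v \<notin> leaves ?G}"
      by (auto simp: bounded_edges_def unbounded_edges_def caterpillar_def)
    also have "{v \<in> {0<..<2 * n - 2}. v \<notin> leaves ?G \<and> cat_parent v \<notin> leaves ?G} = (\<lambda>k. 2 * k + 3) ` {..<n - 3}"
    proof (intro subset_antisym subsetI)
      fix v assume v: "v \<in> {v \<in> {0<..<2 * n - 2}. v \<notin> leaves ?G \<and> cat_parent v \<notin> leaves ?G}"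
      then have "odd v" "v \<noteq> 2 * n - 3" "v < 2 * n - 2" "cat_parent v \<noteq> 0"
        using n by (auto simp: lv intro: odd_pos)
      then have "v \<noteq> 1" by (auto simp: cat_parent_def)
      then have "\<exists>k. v = 2 * k + 3" using \<open>odd v\<close> by presburger
      then obtain k where "v = 2 * k + 3" by blast
      moreover have "k < n - 3" using calculation \<open>v \<noteq> 2 * n - 3\<close> \<open>v < 2 * n - 2\<close> by linarith
      ultimately show "v \<in> (\<lambda>k. 2 * k + 3) ` {..<n - 3}" by blast
    next
      fix v assume "v \<in> (\<lambda>k. 2 * k + 3) ` {..<n - 3}"
      then obtain k where k: "k < n - 3" "v = 2 * k + 3" by auto
      then have "cat_parent v = 2 * k + 1" by (simp add: cat_parent_def)
      then show "v \<in> {v \<in> {0<..<2 * n - 2}. v \<notin> leaves ?G \<and> cat_parent v \<notin> leaves ?G}"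
        using k n by (auto simp: lv)
    qed
    finally show ?thesis .
  qed
  have sub: "(\<lambda>k. 2 * k + 3) ` {..<n - 3} \<subseteq> {0<..<2 * n - 2}" by auto
  have "card (bounded_edges ?G) = card ((\<lambda>k::nat. 2 * k + 3) ` {..<n - 3})"
    unfolding bd by (rule card_image) (rule inj_on_subset[OF cat_edge_inj sub])
  also have "\<dots> = n - 3" by (subst card_image) (auto simp: inj_on_def)
  finally have card_b: "card (bounded_edges ?G) = n - 3" .
  have card_E: "card (edges ?G) = 2 * n - 3"
    using card_image[OF cat_edge_inj[of "2 * n - 2"]] n by (simp add: caterpillar_def)
  have fin: "finite (edges ?G)" by (simp add: caterpillar_def)
  have un: "unbounded_edges ?G = edges ?G - bounded_edges ?G" "bounded_edges ?G \<subseteq> edges ?G"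
    by (auto simp: bounded_edges_def unbounded_edges_def)
  have "card (unbounded_edges ?G) = n"
    unfolding un(1) using card_Diff_subset[OF finite_subset[OF un(2) fin] un(2)] card_b card_E n by simp
  moreover have "finite (unbounded_edges ?G)" "finite (bounded_edges ?G)"
    using fin un finite_subset by auto
  ultimately obtain ul bl where "bij_betw ul {..<n} (unbounded_edges ?G)" "bij_betw bl {..<n - 3} (bounded_edges ?G)"
    using finite_same_card_bij[of "{..<n}" "unbounded_edges ?G"] finite_same_card_bij[of "{..<n - 3}" "bounded_edges ?G"] card_b
    by auto
  then have "labelled_trivalent_tree n \<lparr>gr = ?G, ulab = ul, blab = bl, part = \<lambda>_. {#}\<rparr>"
    using tree tri card_leaves by (simp add: labelled_trivalent_tree_def)
  then show ?thesis by blast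
qed

section \<open>Quotients and sums of topologies\<close>

lemma continuous_map_from_sum:
  assumes "\<And>i. i \<in> I \<Longrightarrow> continuous_map (X i) Z (\<lambda>x. f (i, x))"
  shows "continuous_map (sum_topology X I) Z f"
proof -
  have "f a \<in> topspace Z" if a: "a \<in> topspace (sum_topology X I)" for a
  proof -
    obtain i x where ix: "a = (i, x)" "i \<in> I" "x \<in> topspace (X i)" using a by auto
    show ?thesis using continuous_map_funspace[OF assms[OF ix(2)]] ix(1,3) by auto
  qed
  moreover have "openin (sum_topology X I) {a \<in> topspace (sum_topology X I). f a \<in> U}" if "openin Z U" for U
    unfolding openin_sum_topology
  proof (intro conjI ballI)
    fix i assume i: "i \<in> I"
    have "{x. (i, x) \<in> {a \<in> topspace (sum_topology X I). f a \<in> U}} = {x \<in> topspace (X i). f (i, x) \<in> U}"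
      using i by auto
    then show "openin (X i) {x. (i, x) \<in> {a \<in> topspace (sum_topology X I). f a \<in> U}}"
      using openin_continuous_map_preimage[OF assms[OF i] that] by simp
  qed auto
  ultimately show ?thesis by (auto simp: continuous_map_def)
qed

context
  fixes T :: "'a topology" and R :: "('a \<times> 'a) set"
  assumes eq: "equiv (topspace T) R"
begin

lemma openin_quotient_topology:
  "openin (quotient_topology T R) U \<longleftrightarrow> U \<subseteq> topspace T // R \<and> openin T (\<Union> U)"
  unfolding quotient_topology_def topology_inverse'[OF istopology_quotient[OF eq]] ..

lemma topspace_quotient_topology: "topspace (quotient_topology T R) = topspace T // R"
proof (intro subset_antisym)
  show "topspace (quotient_topology T R) \<subseteq> topspace T // R"
    using openin_quotient_topology[of "topspace (quotient_topology T R)"] by simp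
  have "openin (quotient_topology T R) (topspace T // R)"
    unfolding openin_quotient_topology Union_quotient[OF eq] by simp
  then show "topspace T // R \<subseteq> topspace (quotient_topology T R)" by (rule openin_subset)
qed

lemma continuous_map_quotient_projection: "continuous_map T (quotient_topology T R) (\<lambda>x. R `` {x})"
  unfolding continuous_map_def
proof (intro conjI allI impI)
  show "(\<lambda>x. R `` {x}) \<in> topspace T \<rightarrow> topspace (quotient_topology T R)"
    by (auto simp: topspace_quotient_topology quotientI)
  fix U assume "openin (quotient_topology T R) U"
  then have U: "U \<subseteq> topspace T // R" "openin T (\<Union> U)" unfolding openin_quotient_topology by simp_all
  have "{x \<in> topspace T. R `` {x} \<in> U} = \<Union> U"
  proof (intro subset_antisym subsetI)
    fix x assume "x \<in> {x \<in> topspace T. R `` {x} \<in> U}"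
    then show "x \<in> \<Union> U" using equiv_class_self[OF eq] by blast
  next
    fix x assume "x \<in> \<Union> U"
    then obtain h where h: "h \<in> U" "x \<in> h" by blast
    then obtain y where y: "h = R `` {y}" using U(1) by (meson quotientE subsetD)
    then have "h = R `` {x}" using h(2) equiv_class_eq[OF eq] by blast
    moreover have "x \<in> topspace T" using h U(2) openin_subset by blast
    ultimately show "x \<in> {x \<in> topspace T. R `` {x} \<in> U}" using h(1) by simp
  qed
  then show "openin T {x \<in> topspace T. R `` {x} \<in> U}" using U(2) by simp
qed

lemma continuous_map_quotient_lift:
  assumes "continuous_map T Z (\<lambda>x. g (R `` {x}))"
  shows "continuous_map (quotient_topology T R) Z g"
  unfolding continuous_map_def topspace_quotient_topology
proof (intro conjI allI impI)
  show "g \<in> topspace T // R \<rightarrow> topspace Z"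
  proof
    fix h assume "h \<in> topspace T // R"
    then obtain x where "x \<in> topspace T" "h = R `` {x}" by (rule quotientE)
    then show "g h \<in> topspace Z" using assms by (auto simp: continuous_map_def)
  qed
  fix U assume U: "openin Z U"
  have "\<Union> {h \<in> topspace T // R. g h \<in> U} = {x \<in> topspace T. g (R `` {x}) \<in> U}"
  proof (intro subset_antisym subsetI)
    fix x assume "x \<in> \<Union> {h \<in> topspace T // R. g h \<in> U}"
    then obtain h where h: "h \<in> topspace T // R" "g h \<in> U" "x \<in> h" by blast
    then obtain y where y: "y \<in> topspace T" "h = R `` {y}" by (meson quotientE)
    then have "h = R `` {x}" using h(3) equiv_class_eq[OF eq] by blast
    moreover have "x \<in> topspace T" using h(1,3) Union_quotient[OF eq] by blast
    ultimately show "x \<in> {x \<in> topspace T. g (R `` {x}) \<in> U}" using h(2) by simp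
  next
    fix x assume x: "x \<in> {x \<in> topspace T. g (R `` {x}) \<in> U}"
    then have "R `` {x} \<in> topspace T // R" "x \<in> R `` {x}"
      using equiv_class_self[OF eq] by (auto intro: quotientI)
    then show "x \<in> \<Union> {h \<in> topspace T // R. g h \<in> U}" using x by blast
  qed
  then show "openin (quotient_topology T R) {h \<in> topspace T // R. g h \<in> U}"
    unfolding openin_quotient_topology using openin_continuous_map_preimage[OF assms U] by auto
qed

end

lemma Euclidean_orthant: "subtopology (Euclidean_space m) (orthant m) = top_of_set (orthant m)"
proof -
  have "orthant m \<subseteq> {x. \<forall>i\<ge>m. x i = 0}" by (auto simp: orthant_def topspace_Euclidean_space)
  then show ?thesis
    by (simp add: Euclidean_space_def euclidean_product_topology subtopology_subtopology Int_absorb1)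
qed

text \<open>The continuous left inverse \<open>g\<close> exhibits the image of a closed set as a
  preimage under \<open>g\<close>, intersected with the closed image of \<open>Q\<close>.\<close>

lemma closed_map_embedding_of_closed:
  assumes g: "continuous_map Y euclidean g" "\<And>x. x \<in> Q \<Longrightarrow> g (f x) = x"
    and Q: "closed Q" "closedin Y (f ` Q)"
  shows "closed_map (top_of_set Q) Y f"
  unfolding closed_map_def
proof (intro allI impI)
  fix Z assume "closedin (top_of_set Q) Z"
  then have Z: "Z \<subseteq> Q" "closed Z" using closedin_closed_eq[OF Q(1)] by auto
  have "f ` Z = f ` Q \<inter> {y \<in> topspace Y. g y \<in> Z}"
  proof (intro subset_antisym subsetI)
    fix y assume "y \<in> f ` Z"
    then show "y \<in> f ` Q \<inter> {y \<in> topspace Y. g y \<in> Z}"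
      using Z(1) g(2) closedin_subset[OF Q(2)] by auto
  next
    fix y assume "y \<in> f ` Q \<inter> {y \<in> topspace Y. g y \<in> Z}"
    then show "y \<in> f ` Z" using g(2) by auto
  qed
  moreover have "closedin Y {y \<in> topspace Y. g y \<in> Z}"
    using closedin_continuous_map_preimage[OF g(1)] Z(2) by simp
  ultimately show "closedin Y (f ` Z)" using Q(2) by auto
qed

lemma continuous_map_into_sequences:
  assumes "\<And>i. continuous_map Y euclideanreal (\<lambda>y. g y i)"
  shows "continuous_map Y euclidean (g :: 'a \<Rightarrow> nat \<Rightarrow> real)"
  unfolding euclidean_product_topology[symmetric] continuous_map_componentwise_UNIV using assms by blast

lemma len_sum:
  assumes "inj_on K {..<m}" "finite S" "K ` {..<m} \<subseteq> S"
  shows "(\<Sum>i<m. p i * g (K i)) = (\<Sum>k\<in>S. len m K p k * g k)"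
proof -
  have "(\<Sum>k\<in>S. len m K p k * g k) = (\<Sum>k\<in>K ` {..<m}. len m K p k * g k)"
    by (rule sum.mono_neutral_right) (use assms(2,3) in \<open>auto intro: len_outside\<close>)
  also have "\<dots> = (\<Sum>i<m. len m K p (K i) * g (K i))" by (simp add: sum.reindex[OF assms(1)])
  also have "\<dots> = (\<Sum>i<m. p i * g (K i))" by (rule sum.cong) (use len_key[OF assms(1)] in auto)
  finally show ?thesis by simp
qed

text \<open>Both sums equal one over keys, in which only the length function enters. This is how
  double ratios descend to glued points.\<close>

lemma len_sum_eq:
  assumes "inj_on K {..<m}" "inj_on K' {..<m}" "\<And>k. len m K p k = len m K' p' k"
  shows "(\<Sum>i<m. p i * g (K i)) = (\<Sum>i<m. p' i * g (K' i))"
proof -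
  let ?S = "K ` {..<m} \<union> K' ` {..<m}"
  have "(\<Sum>i<m. p i * g (K i)) = (\<Sum>k\<in>?S. len m K p k * g k)"
    by (rule len_sum[OF assms(1)]) auto
  also have "\<dots> = (\<Sum>k\<in>?S. len m K' p' k * g k)" unfolding assms(3) ..
  also have "\<dots> = (\<Sum>i<m. p' i * g (K' i))"
    by (rule len_sum[OF assms(2), symmetric]) auto
  finally show ?thesis .
qed

lemma continuous_on_coordinate: "continuous_on A (\<lambda>p :: nat \<Rightarrow> real. p i)"
  by (rule continuous_on_subset[OF continuous_on_product_coordinates subset_UNIV])

lemma continuous_on_len: "continuous_on A (\<lambda>p. len m K p k)"
  unfolding len_def by (intro continuous_on_sum continuous_on_coordinate)

lemma continuous_on_drsum: "continuous_on A (\<lambda>p. drsum m K p q)"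
  unfolding drsum_def
  by (intro continuous_on_sum continuous_on_mult continuous_on_const continuous_on_coordinate)

section \<open>The two complexes, the fibres of the double ratio map and its degree\<close>

section \<open>The complexes as glued orthants\<close>

lemma ltree_iso_keys:
  assumes T: "trivalent_tree n T" and T': "trivalent_tree n T'" and iso: "ltree_iso n T T'" and i: "i < n - 3"
  shows "trivalent_tree.key n T' i = trivalent_tree.key n T i" "part T' i = part T i"
proof -
  interpret A: trivalent_tree n T by fact
  interpret B: trivalent_tree n T' by fact
  obtain F where F: "graph_iso (gr T) (gr T') F" "\<And>i. i < n \<Longrightarrow> F ` ulab T i = ulab T' i"
      "\<And>i. i < n - 3 \<Longrightarrow> F ` blab T i = blab T' i \<and> part T i = part T' i"
    using iso by (auto simp: ltree_iso_def)
  have leaf: "F (leaf_of T j) = leaf_of T' j" if j: "j < n" for j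
  proof -
    have "F (leaf_of T j) \<in> leaves (gr T')"
      using graph_iso_leaf_iff[OF F(1) A.E_sub A.label_in[OF j]] A.leaf_of(1)[OF j] by blast
    moreover have "F (leaf_of T j) \<in> ulab T' j" using A.leaf_of(2)[OF j] F(2)[OF j] by blast
    ultimately show ?thesis using B.one_leaf[OF B.ulab_E[OF j]] B.leaf_of[OF j] by blast
  qed
  have "B.cluster (F ` blab T i) = A.cluster (blab T i)"
    by (rule cluster_iso[OF A.labelled_tree_axioms B.labelled_tree_axioms F(1) leaf A.bounded_E[OF A.blab_bounded[OF i]]])
  then show "B.key i = A.key i" "part T' i = part T i"
    using F(3)[OF i] by (simp_all add: A.key_def B.key_def)
qed

locale hurwitz =
  fixes n d :: nat and \<sigma> :: "nat multiset list"
  assumes n3: "n \<ge> 3"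
begin

abbreviation "m \<equiv> n - 3"
abbreviation "AC \<equiv> acceptable_classes n d \<sigma>"
abbreviation "D \<equiv> D_space n d \<sigma>"
abbreviation "R \<equiv> gluing n d \<sigma>"
abbreviation "pt \<equiv> H_point n d \<sigma>"

abbreviation class_key :: "ltree set \<Rightarrow> nat \<Rightarrow> nat set" where
  "class_key c \<equiv> trivalent_tree.key n (class_rep c)"

text \<open>The key for \<open>H_complex\<close>; \<open>class_key\<close> is the one for
  \<open>M_complex\<close>, and \<phi> is the passage from the first to the second.\<close>

definition full_key :: "ltree set \<Rightarrow> nat \<Rightarrow> nat set \<times> nat multiset" where
  "full_key c i = (class_key c i, part (class_rep c) i)"

definition tree_class :: "ltree \<Rightarrow> ltree set" where
  "tree_class T = {(T, T'). acceptable n d \<sigma> T \<and> acceptable n d \<sigma> T' \<and> ltree_iso n T T'} `` {T}"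

lemma ltree_iso_refl: "ltree_iso n T T"
  unfolding ltree_iso_def graph_iso_def by (intro exI[of _ id]) auto

lemma trivalent_tree_acceptable: "acceptable n d \<sigma> T \<Longrightarrow> trivalent_tree n T"
  by (rule trivalent_tree.intro) (auto simp: n3 acceptable_def)

lemma tree_class:
  assumes "acceptable n d \<sigma> T"
  shows "tree_class T \<in> AC" "acceptable n d \<sigma> (class_rep (tree_class T))" "ltree_iso n T (class_rep (tree_class T))"
proof -
  show "tree_class T \<in> AC"
    unfolding tree_class_def acceptable_classes_def by (rule quotientI) (use assms in simp)
  have "T \<in> tree_class T" using assms ltree_iso_refl by (simp add: tree_class_def)
  then have "class_rep (tree_class T) \<in> tree_class T" unfolding class_rep_def by (rule someI)
  then show "acceptable n d \<sigma> (class_rep (tree_class T))" "ltree_iso n T (class_rep (tree_class T))"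
    by (auto simp: tree_class_def)
qed

lemma rep_acceptable: "c \<in> AC \<Longrightarrow> acceptable n d \<sigma> (class_rep c)"
proof -
  assume "c \<in> AC"
  then obtain T where "acceptable n d \<sigma> T" "c = tree_class T"
    unfolding acceptable_classes_def tree_class_def by (auto elim!: quotientE)
  then show ?thesis using tree_class(2) by blast
qed

lemma rep_tree: "c \<in> AC \<Longrightarrow> trivalent_tree n (class_rep c)"
  using rep_acceptable trivalent_tree_acceptable by blast

lemma class_key_inj: "c \<in> AC \<Longrightarrow> inj_on (class_key c) {..<m}"
  by (rule trivalent_tree.key_inj[OF rep_tree])

lemma full_key_inj: "c \<in> AC \<Longrightarrow> inj_on (full_key c) {..<m}"
  using class_key_inj[of c] by (auto simp: inj_on_def full_key_def)

lemma tree_keys_class: "c \<in> AC \<Longrightarrow> tree_keys n m (class_key c)"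
proof -
  assume c: "c \<in> AC"
  interpret trivalent_tree n "class_rep c" by (rule rep_tree[OF c])
  show ?thesis
    unfolding tree_keys_def proper_cluster_def nested_or_disjoint_def
    using key_inj key_proper key_laminar by blast
qed

lemma tree_class_keys:
  assumes "acceptable n d \<sigma> T" "i < m"
  shows "full_key (tree_class T) i = (trivalent_tree.key n T i, part T i)"
  using ltree_iso_keys[OF trivalent_tree_acceptable[OF assms(1)]
      trivalent_tree_acceptable[OF tree_class(2)[OF assms(1)]] tree_class(3)[OF assms(1)] assms(2)]
  by (simp add: full_key_def)

lemma topspace_D: "topspace D = Sigma AC (\<lambda>_. orthant m)"
proof -
  have "topspace (top_of_set (orthant m)) = orthant m" by simp
  then show ?thesis by (simp add: D_space_def Euclidean_orthant comp_def)
qed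

lemma view:
  assumes "c \<in> AC" "p \<in> orthant m"
  shows "\<exists>L b. metric_view (dtree n (c, p)) L n b p (class_key c)"
proof -
  interpret metric_trivalent_tree n "class_rep c" p
    by (intro metric_trivalent_tree.intro rep_tree[OF assms(1)] metric_trivalent_tree_axioms.intro)
      (use assms(2) in \<open>auto simp: orthant_def\<close>)
  show ?thesis using metric_view by (auto simp: dtree_def)
qed

lemma gluing_sub: "(a, b) \<in> R \<Longrightarrow> a \<in> topspace D \<and> b \<in> topspace D"
  by (simp add: gluing_def)

text \<open>Translates gluing by isometries into equality of length functions on coloured clusters,
  which makes the equivalence relation and the \<open>glue\<close> axiom immediate. The two
  directions are \<open>metric_view_iso_imp\<close> and
  \<open>metric_view_iso_exists\<close>.\<close>

lemma gluing_iff: "((c, p), (c', p')) \<in> R \<longleftrightarrow> c \<in> AC \<and> c' \<in> AC \<and> p \<in> orthant m \<and> p' \<in> orthant m \<and>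
    (\<forall>k. len m (full_key c) p k = len m (full_key c') p' k)"
proof (cases "c \<in> AC \<and> c' \<in> AC \<and> p \<in> orthant m \<and> p' \<in> orthant m")
  case True
  then obtain L b L' b' where v: "metric_view (dtree n (c, p)) L n b p (class_key c)"
      "metric_view (dtree n (c', p')) L' n b' p' (class_key c')" using view by metis
  have fk: "full_key x = (\<lambda>i. (class_key x i, part (class_rep x) i))" for x
    by (rule ext) (simp add: full_key_def)
  have "((c, p), (c', p')) \<in> R \<longleftrightarrow> (\<exists>F. metric_iso (dtree n (c, p)) (dtree n (c', p')) F \<and>
        (\<forall>i<n. F ` mulab (dtree n (c, p)) i = mulab (dtree n (c', p')) i) \<and>
        (\<forall>i j e e'. mblab (dtree n (c, p)) i = Some e \<and> mblab (dtree n (c', p')) j = Some e' \<and> F ` e = e' \<longrightarrow>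
           part (class_rep c) i = part (class_rep c') j))"
    using True by (simp add: gluing_def topspace_D)
  also have "\<dots> \<longleftrightarrow> (\<forall>k. len m (full_key c) p k = len m (full_key c') p' k)"
  proof
    assume "\<exists>F. metric_iso (dtree n (c, p)) (dtree n (c', p')) F \<and>
        (\<forall>i<n. F ` mulab (dtree n (c, p)) i = mulab (dtree n (c', p')) i) \<and>
        (\<forall>i j e e'. mblab (dtree n (c, p)) i = Some e \<and> mblab (dtree n (c', p')) j = Some e' \<and> F ` e = e' \<longrightarrow>
           part (class_rep c) i = part (class_rep c') j)"
    then obtain F where "metric_iso (dtree n (c, p)) (dtree n (c', p')) F"
        "\<And>i. i < n \<Longrightarrow> F ` mulab (dtree n (c, p)) i = mulab (dtree n (c', p')) i"
        "\<And>i j e e'. mblab (dtree n (c, p)) i = Some e \<Longrightarrow> mblab (dtree n (c', p')) j = Some e' \<Longrightarrow> F ` e = e' \<Longrightarrow>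
           part (class_rep c) i = part (class_rep c') j" by metis
    then show "\<forall>k. len m (full_key c) p k = len m (full_key c') p' k"
      unfolding fk by (intro allI metric_view_iso_imp[OF v])
  next
    assume "\<forall>k. len m (full_key c) p k = len m (full_key c') p' k"
    then have "len m (\<lambda>i. (class_key c i, part (class_rep c) i)) p k = len m (\<lambda>i. (class_key c' i, part (class_rep c') i)) p' k" for k
      unfolding fk by blast
    then show "\<exists>F. metric_iso (dtree n (c, p)) (dtree n (c', p')) F \<and>
        (\<forall>i<n. F ` mulab (dtree n (c, p)) i = mulab (dtree n (c', p')) i) \<and>
        (\<forall>i j e e'. mblab (dtree n (c, p)) i = Some e \<and> mblab (dtree n (c', p')) j = Some e' \<and> F ` e = e' \<longrightarrow>
           part (class_rep c) i = part (class_rep c') j)"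
      by (rule metric_view_iso_exists[OF v])
  qed
  finally show ?thesis by (simp only: True simp_thms)
next
  case False
  then show ?thesis using gluing_sub[of "(c, p)" "(c', p')"] unfolding topspace_D by auto
qed

lemma equiv_gluing: "equiv (topspace D) R"
proof (rule equivI)
  show "R \<subseteq> topspace D \<times> topspace D" using gluing_sub by auto
  show "refl_on (topspace D) R"
    unfolding refl_on_def by (auto simp: topspace_D gluing_iff)
  show "sym R" unfolding sym_def by (auto simp: gluing_iff)
  show "trans R" unfolding trans_def by (auto simp: gluing_iff)
qed

lemma pt_eq_iff:
  assumes "c \<in> AC" "c' \<in> AC" "p \<in> orthant m" "p' \<in> orthant m"
  shows "pt c p = pt c' p' \<longleftrightarrow> (\<forall>k. len m (full_key c) p k = len m (full_key c') p' k)"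
proof -
  have "(c, p) \<in> topspace D" "(c', p') \<in> topspace D" using assms by (auto simp: topspace_D)
  then have "pt c p = pt c' p' \<longleftrightarrow> ((c, p), (c', p')) \<in> R"
    unfolding H_point_def by (rule eq_equiv_class_iff[OF equiv_gluing])
  then show ?thesis using assms gluing_iff by blast
qed

abbreviation "H \<equiv> H_complex n d \<sigma>"

lemma topspace_H: "topspace (pspace H) = (\<Union>c\<in>AC. pt c ` orthant m)"
proof -
  have "topspace (pspace H) = topspace D // R"
    by (simp add: H_complex_def topspace_quotient_topology[OF equiv_gluing])
  also have "\<dots> = (\<Union>c\<in>AC. pt c ` orthant m)"
    by (auto simp: quotient_def topspace_D H_point_def)
  finally show ?thesis .
qed

lemma continuous_from_H:
  assumes "\<And>c. c \<in> AC \<Longrightarrow> continuous_map (top_of_set (orthant m)) Z (\<lambda>p. g (pt c p))"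
  shows "continuous_map (pspace H) Z g"
proof -
  have "continuous_map D Z (\<lambda>x. g (R `` {x}))"
    unfolding D_space_def
  proof (rule continuous_map_from_sum)
    fix c assume "c \<in> AC"
    then show "continuous_map (subtopology (Euclidean_space m) (orthant m)) Z (\<lambda>p. g (R `` {(c, p)}))"
      using assms unfolding Euclidean_orthant H_point_def by blast
  qed
  then show ?thesis
    using continuous_map_quotient_lift[OF equiv_gluing] by (simp add: H_complex_def)
qed

lemma continuous_pt:
  assumes "c \<in> AC"
  shows "continuous_map (top_of_set (orthant m)) (pspace H) (pt c)"
proof -
  have "continuous_map (top_of_set (orthant m)) D (\<lambda>p. (c, p))"
    using continuous_map_component_injection[OF assms, of "\<lambda>_. top_of_set (orthant m)"]
    by (simp add: D_space_def Euclidean_orthant)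
  then have "continuous_map (top_of_set (orthant m)) (quotient_topology D R) ((\<lambda>x. R `` {x}) \<circ> (\<lambda>p. (c, p)))"
    using continuous_map_quotient_projection[OF equiv_gluing] by (rule continuous_map_compose)
  moreover have "(\<lambda>x. R `` {x}) \<circ> (\<lambda>p. (c, p)) = pt c" by (rule ext) (simp add: H_point_def)
  ultimately show ?thesis by (simp add: H_complex_def)
qed

text \<open>Single values of the length function as functions on the quotient; the choice of
  representative is harmless by \<open>pt_eq_iff\<close>. They serve as continuous coordinates on
  the whole complex.\<close>

definition length_at :: "nat set \<times> nat multiset \<Rightarrow> dpoint set \<Rightarrow> real" where
  "length_at k h = (case SOME a. a \<in> h of (c, p) \<Rightarrow> len m (full_key c) p k)"

lemma some_rep:
  assumes "c \<in> AC" "p \<in> orthant m"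
  obtains c' p' where "(SOME a. a \<in> pt c p) = (c', p')" "c' \<in> AC" "p' \<in> orthant m" "pt c' p' = pt c p"
proof -
  have "(c, p) \<in> pt c p"
    unfolding H_point_def using equiv_class_self[OF equiv_gluing] assms by (simp add: topspace_D)
  then have "(SOME a. a \<in> pt c p) \<in> pt c p" by (rule someI)
  moreover obtain c' p' where cp: "(SOME a. a \<in> pt c p) = (c', p')" by fastforce
  ultimately have "((c, p), (c', p')) \<in> R" by (simp add: H_point_def)
  then show ?thesis using that[OF cp] pt_eq_iff by (metis gluing_iff)
qed

lemma length_at_pt:
  assumes "c \<in> AC" "p \<in> orthant m"
  shows "length_at k (pt c p) = len m (full_key c) p k"
proof -
  obtain c' p' where s: "(SOME a. a \<in> pt c p) = (c', p')" "c' \<in> AC" "p' \<in> orthant m" "pt c' p' = pt c p"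
    using some_rep[OF assms] .
  have "length_at k (pt c p) = len m (full_key c') p' k" by (simp add: length_at_def s(1))
  also have "\<dots> = len m (full_key c) p k"
    using pt_eq_iff[OF s(2) assms(1) s(3) assms(2)] s(4) by blast
  finally show ?thesis .
qed

lemma continuous_length_at: "continuous_map (pspace H) euclideanreal (length_at k)"
proof (rule continuous_from_H)
  fix c assume c: "c \<in> AC"
  have "continuous_map (top_of_set (orthant m)) euclideanreal (\<lambda>p. len m (full_key c) p k)"
    using continuous_on_len by simp
  then show "continuous_map (top_of_set (orthant m)) euclideanreal (\<lambda>p. length_at k (pt c p))"
    by (rule continuous_map_eq) (simp add: length_at_pt[OF c])
qed

lemma orthant_nonneg: "p \<in> orthant m \<Longrightarrow> i < m \<Longrightarrow> 0 \<le> p i"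
  by (simp add: orthant_def)

lemma closed_orthant: "closed (orthant m)"
  unfolding orthant_coord_face by (rule closed_coord_face)

text \<open>A point lies in the cell when all its length sits at keys of \<open>c\<close>. The cell
  is thus the common zero set of continuous functions, hence closed.\<close>

lemma cell_image:
  assumes c: "c \<in> AC"
  shows "pt c ` orthant m = {h \<in> topspace (pspace H). \<forall>k. k \<notin> full_key c ` {..<m} \<longrightarrow> length_at k h = 0}"
proof (intro subset_antisym subsetI)
  fix h assume "h \<in> pt c ` orthant m"
  then obtain p where p: "p \<in> orthant m" "h = pt c p" by blast
  then have "length_at k h = 0" if "k \<notin> full_key c ` {..<m}" for k
    using that length_at_pt[OF c p(1)] by (auto intro: len_outside)
  then show "h \<in> {h \<in> topspace (pspace H). \<forall>k. k \<notin> full_key c ` {..<m} \<longrightarrow> length_at k h = 0}"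
    using p c topspace_H by blast
next
  fix h assume h: "h \<in> {h \<in> topspace (pspace H). \<forall>k. k \<notin> full_key c ` {..<m} \<longrightarrow> length_at k h = 0}"
  then obtain c' p' where c': "c' \<in> AC" "p' \<in> orthant m" "h = pt c' p'" unfolding topspace_H by blast
  define p where "p i = (if i < m then len m (full_key c') p' (full_key c i) else 0)" for i
  have "0 \<le> len m (full_key c') p' k" for k
    unfolding len_def using orthant_nonneg[OF c'(2)] by (intro sum_nonneg) auto
  then have p: "p \<in> orthant m" by (auto simp: p_def orthant_def topspace_Euclidean_space)
  have "len m (full_key c) p k = len m (full_key c') p' k" for k
  proof (rule len_eqI[OF full_key_inj[OF c] full_key_inj[OF c'(1)]])
    show "\<exists>j<m. full_key c' j = full_key c i \<and> p' j = p i" if i: "i < m" "p i \<noteq> 0" for i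
    proof -
      have "len m (full_key c') p' (full_key c i) \<noteq> 0" using i by (simp add: p_def)
      then obtain j where j: "j < m" "full_key c' j = full_key c i"
        using len_nonzero by metis
      then show ?thesis
        using len_key[OF full_key_inj[OF c'(1)] j(1), of p'] i(1) by (auto simp: p_def)
    qed
    show "\<exists>i<m. full_key c i = full_key c' j \<and> p i = p' j" if j: "j < m" "p' j \<noteq> 0" for j
    proof -
      have len: "len m (full_key c') p' (full_key c' j) = p' j"
        by (rule len_key[OF full_key_inj[OF c'(1)] j(1)])
      then have "length_at (full_key c' j) h \<noteq> 0"
        using length_at_pt[OF c'(1,2)] c'(3) j(2) by simp
      then have "full_key c' j \<in> full_key c ` {..<m}" using h by blast
      then obtain i where i: "i < m" "full_key c i = full_key c' j" by auto
      then have "p i = p' j" using len by (simp add: p_def)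
      then show ?thesis using i by blast
    qed
  qed
  then have "h = pt c p" unfolding c'(3) using pt_eq_iff[OF c c'(1) p c'(2)] by simp
  then show "h \<in> pt c ` orthant m" using p by blast
qed

lemma closed_cell: "c \<in> AC \<Longrightarrow> closedin (pspace H) (pt c ` orthant m)"
proof -
  assume c: "c \<in> AC"
  let ?Z = "\<lambda>k. {h \<in> topspace (pspace H). length_at k h \<in> (if k \<in> full_key c ` {..<m} then UNIV else {0})}"
  have "length_at k h \<in> (if k \<in> full_key c ` {..<m} then UNIV else {0}) \<longleftrightarrow> (k \<notin> full_key c ` {..<m} \<longrightarrow> length_at k h = 0)" for k h
    by simp
  then have "pt c ` orthant m = (\<Inter>k. ?Z k)" unfolding cell_image[OF c] by auto
  moreover have "closedin (pspace H) (?Z k)" for k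
    by (rule closedin_continuous_map_preimage[OF continuous_length_at]) auto
  ultimately show ?thesis by (auto intro!: closedin_INT)
qed

sublocale HC: cone_complex m H AC pt full_key
proof
  show "pcharts H = {(Y, pt c) | Y c. c \<in> AC \<and> Y face_of orthant m \<and> Y \<noteq> {}}"
    by (simp add: H_complex_def)
  show "inj_on (full_key c) {..<m}" if "c \<in> AC" for c by (rule full_key_inj[OF that])
  show "pt c p = pt c' p' \<longleftrightarrow> (\<forall>k. len m (full_key c) p k = len m (full_key c') p' k)"
    if "c \<in> AC" "c' \<in> AC" "p \<in> orthant m" "p' \<in> orthant m" for c c' p p'
    by (rule pt_eq_iff[OF that])
  show "topspace (pspace H) = (\<Union>c\<in>AC. pt c ` orthant m)" by (rule topspace_H)
  show "continuous_map (top_of_set (orthant m)) (pspace H) (pt c)" if "c \<in> AC" for c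
    by (rule continuous_pt[OF that])
  show "closed_map (top_of_set (orthant m)) (pspace H) (pt c)" if c: "c \<in> AC" for c
  \<comment> \<open>The left inverse of a chart reads off the lengths at the keys of
    \<open>c\<close>.\<close>
  proof (rule closed_map_embedding_of_closed[where g = "\<lambda>h i. if i < m then length_at (full_key c i) h else 0"])
    show "continuous_map (pspace H) euclidean (\<lambda>h i. if i < m then length_at (full_key c i) h else 0)"
    proof (rule continuous_map_into_sequences)
      fix i
      show "continuous_map (pspace H) euclideanreal (\<lambda>h. if i < m then length_at (full_key c i) h else 0)"
        using continuous_length_at[of "full_key c i"] by (cases "i < m") auto
    qed
    show "(\<lambda>i. if i < m then length_at (full_key c i) (pt c p) else 0) = p" if p: "p \<in> orthant m" for p
    proof
      fix i
      show "(if i < m then length_at (full_key c i) (pt c p) else 0) = p i"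
        using length_at_pt[OF c p] len_key[OF full_key_inj[OF c], of i p] p
        by (auto simp: orthant_def topspace_Euclidean_space)
    qed
    show "closed (orthant m)" by (rule closed_orthant)
    show "closedin (pspace H) (pt c ` orthant m)" by (rule closed_cell[OF c])
  qed
qed

end

locale hurwitz_ratios = hurwitz +
  fixes reps :: "quad list"
  assumes reps: "quad_representatives n reps"
begin

abbreviation "\<phi> \<equiv> double_ratio_map n reps"
abbreviation "M \<equiv> M_complex n d \<sigma> reps"

lemma reps_quads: "k < length reps \<Longrightarrow> reps ! k \<in> quads n"
  using reps nth_mem by (fastforce simp: quad_representatives_def)

text \<open>\<open>double_ratio_map\<close> evaluates some representative of the point; the value is
  transferred to \<open>(c, p)\<close> by \<open>len_sum_eq\<close>, with a coefficient that sees
  only the cluster component of a key.\<close>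

lemma phi_pt:
  assumes c: "c \<in> AC" "p \<in> orthant m"
  shows "\<phi> (pt c p) = (\<lambda>k. if k < length reps then drsum m (class_key c) p (reps ! k) else 0)"
proof
  fix k
  obtain c' p' where s: "(SOME a. a \<in> pt c p) = (c', p')" "c' \<in> AC" "p' \<in> orthant m" "pt c' p' = pt c p"
    using some_rep[OF c] .
  show "\<phi> (pt c p) k = (if k < length reps then drsum m (class_key c) p (reps ! k) else 0)"
  proof (cases "k < length reps")
    case True
    obtain L b where v: "metric_view (dtree n (c', p')) L n b p' (class_key c')" using view[OF s(2,3)] by blast
    have "\<phi> (pt c p) k = double_ratio (dtree n (c', p')) (reps ! k)"
      using True s(1) by (simp add: double_ratio_map_def)
    also have "\<dots> = (\<Sum>i<m. p' i * quad_sign (class_key c' i) (reps ! k))"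
      by (rule metric_view.double_ratio_keys[OF v reps_quads[OF True]])
    also have "\<dots> = (\<Sum>i<m. p i * quad_sign (class_key c i) (reps ! k))"
    proof -
      have "len m (full_key c') p' k = len m (full_key c) p k" for k
        using pt_eq_iff[OF s(2) c(1) s(3) c(2)] s(4) by blast
      from len_sum_eq[OF full_key_inj[OF s(2)] full_key_inj[OF c(1)] this, of "\<lambda>x. quad_sign (fst x) (reps ! k)"]
      show ?thesis by (simp add: full_key_def)
    qed
    finally show ?thesis using True by (simp add: drsum_def)
  qed (simp add: double_ratio_map_def)
qed

lemma representative:
  assumes "q \<in> quads n"
  shows "\<exists>k<length reps. \<exists>s\<in>{1, -1}. \<forall>K p. drsum m K p q = s * drsum m K p (reps ! k)"
proof -
  obtain k where k: "k < length reps" "quad_swap\<^sup>*\<^sup>* (reps ! k) q"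
    using reps assms unfolding quad_representatives_def by blast
  obtain s where "s \<in> {1, -1}" "\<forall>m K p. drsum m K p q = s * drsum m K p (reps ! k)"
    using quad_swap_sign[OF k(2)] by blast
  then show ?thesis using k(1) by blast
qed

text \<open>\<open>drsum_determines\<close> asks for all quads; those outside \<open>reps\<close>
  are recovered up to sign by \<open>representative\<close>.\<close>

lemma phi_eq_iff:
  assumes c: "c \<in> AC" "c' \<in> AC" "p \<in> orthant m" "p' \<in> orthant m"
  shows "\<phi> (pt c p) = \<phi> (pt c' p') \<longleftrightarrow> (\<forall>k. len m (class_key c) p k = len m (class_key c') p' k)"
proof
  assume eq: "\<phi> (pt c p) = \<phi> (pt c' p')"
  have "drsum m (class_key c) p q = drsum m (class_key c') p' q" if q: "q \<in> quads n" for q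
  proof -
    obtain k s where k: "k < length reps" "\<And>K p. drsum m K p q = s * drsum m K p (reps ! k)"
      using representative[OF q] by blast
    have "drsum m (class_key c) p (reps ! k) = drsum m (class_key c') p' (reps ! k)"
      using fun_cong[OF eq, of k] phi_pt[OF c(1,3)] phi_pt[OF c(2,4)] k(1) by simp
    then show ?thesis using k(2) by simp
  qed
  then have "len m (class_key c) p k = len m (class_key c') p' k" for k
    by (intro drsum_determines[OF tree_keys_class[OF c(1)] tree_keys_class[OF c(2)]] orthant_nonneg[OF c(3)] orthant_nonneg[OF c(4)])
  then show "\<forall>k. len m (class_key c) p k = len m (class_key c') p' k" by blast
next
  assume "\<forall>k. len m (class_key c) p k = len m (class_key c') p' k"
  then have "drsum m (class_key c) p q = drsum m (class_key c') p' q" for q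
    unfolding drsum_def
    using len_sum_eq[OF class_key_inj[OF c(1)] class_key_inj[OF c(2)], of p p' "\<lambda>x. quad_sign x q"] by blast
  then show "\<phi> (pt c p) = \<phi> (pt c' p')"
    unfolding phi_pt[OF c(1,3)] phi_pt[OF c(2,4)] by (auto simp: fun_eq_iff)
qed

lemma phi_image_Euclidean: "\<phi> ` topspace (pspace H) \<subseteq> topspace (Euclidean_space (length reps))"
  by (auto simp: double_ratio_map_def topspace_Euclidean_space)

lemma topspace_M: "topspace (pspace M) = \<phi> ` topspace (pspace H)"
  using phi_image_Euclidean by (auto simp: M_complex_def)

lemma pspace_M: "pspace M = top_of_set (\<phi> ` topspace (pspace H))"
proof -
  have "\<phi> ` topspace (pspace H) \<subseteq> {x. \<forall>i\<ge>length reps. x i = 0}"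
    using phi_image_Euclidean by (simp add: topspace_Euclidean_space)
  then show ?thesis
    by (simp add: M_complex_def Euclidean_space_def euclidean_product_topology subtopology_subtopology Int_absorb1)
qed

lemma phi_pt_image: "c \<in> AC \<Longrightarrow> (\<phi> \<circ> pt c) ` orthant m \<subseteq> \<phi> ` topspace (pspace H)"
  unfolding topspace_H image_comp[symmetric] by (intro image_mono) blast

lemma continuous_phi_pt:
  assumes c: "c \<in> AC"
  shows "continuous_map (top_of_set (orthant m)) (pspace M) (\<phi> \<circ> pt c)"
proof -
  have "continuous_on (orthant m) (\<lambda>p k. if k < length reps then drsum m (class_key c) p (reps ! k) else 0)"
  proof (rule continuous_on_coordinatewise_then_product)
    fix k
    show "continuous_on (orthant m) (\<lambda>p. if k < length reps then drsum m (class_key c) p (reps ! k) else 0)"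
      using continuous_on_drsum by (cases "k < length reps") auto
  qed
  then have "continuous_on (orthant m) (\<phi> \<circ> pt c)"
    by (rule continuous_on_cong[THEN iffD1, rotated -1]) (simp_all add: phi_pt[OF c])
  then show ?thesis
    unfolding pspace_M continuous_map_in_subtopology using phi_pt_image[OF c] by auto
qed

lemma isolating_coordinate:
  assumes "c \<in> AC" "i < m"
  shows "\<exists>k s. \<forall>p\<in>orthant m. s * \<phi> (pt c p) k = p i"
proof -
  obtain q where q: "q \<in> quads n" "\<And>p. drsum m (class_key c) p q = p i"
    using isolating_key_quad[OF tree_keys_class[OF assms(1)] assms(2)] by blast
  obtain k s where "k < length reps" "\<And>K p. drsum m K p q = s * drsum m K p (reps ! k)"
    using representative[OF q(1)] by blast
  then have "\<forall>p\<in>orthant m. s * \<phi> (pt c p) k = p i" using q(2) phi_pt[OF assms(1)] by simp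
  then show ?thesis by blast
qed

sublocale MC: cone_complex m M AC "\<lambda>c. \<phi> \<circ> pt c" class_key
proof
  show "pcharts M = {(Y, \<phi> \<circ> pt c) | Y c. c \<in> AC \<and> Y face_of orthant m \<and> Y \<noteq> {}}"
  proof -
    let ?A = "{(Y, pt c) | Y c. c \<in> AC \<and> Y face_of orthant m \<and> Y \<noteq> {}}"
    have "pcharts M = (\<lambda>(X, h). (X, \<phi> \<circ> h)) ` ?A"
      by (simp add: M_complex_def HC.charts)
    also have "\<dots> = {(Y, \<phi> \<circ> pt c) | Y c. c \<in> AC \<and> Y face_of orthant m \<and> Y \<noteq> {}}" (is "?l = ?r")
    proof (intro subset_antisym subsetI)
      fix x assume "x \<in> ?r"
      then obtain Y c where x: "x = (Y, \<phi> \<circ> pt c)" "c \<in> AC" "Y face_of orthant m" "Y \<noteq> {}" by blast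
      then have "(Y, pt c) \<in> ?A" by blast
      then show "x \<in> ?l" by (rule rev_image_eqI) (simp add: x(1))
    qed auto
    finally show ?thesis .
  qed
  show "inj_on (class_key c) {..<m}" if "c \<in> AC" for c by (rule class_key_inj[OF that])
  show "(\<phi> \<circ> pt c) p = (\<phi> \<circ> pt c') p' \<longleftrightarrow> (\<forall>k. len m (class_key c) p k = len m (class_key c') p' k)"
    if "c \<in> AC" "c' \<in> AC" "p \<in> orthant m" "p' \<in> orthant m" for c c' p p'
    using phi_eq_iff[OF that] by simp
  show "topspace (pspace M) = (\<Union>c\<in>AC. (\<phi> \<circ> pt c) ` orthant m)"
    unfolding topspace_M topspace_H by auto
  show "continuous_map (top_of_set (orthant m)) (pspace M) (\<phi> \<circ> pt c)" if "c \<in> AC" for c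
    by (rule continuous_phi_pt[OF that])
  show "closed_map (top_of_set (orthant m)) (pspace M) (\<phi> \<circ> pt c)" if c: "c \<in> AC" for c
  proof -
    have ex: "\<forall>i\<in>{..<m}. \<exists>ks. \<forall>p\<in>orthant m. snd ks * \<phi> (pt c p) (fst ks) = p i"
      using isolating_coordinate[OF c] by auto
    from bchoice[OF ex] obtain ks where ks: "\<forall>i\<in>{..<m}. \<forall>p\<in>orthant m. snd (ks i) * \<phi> (pt c p) (fst (ks i)) = p i" ..
    \<comment> \<open>Recovers the coordinates of the cone from isolating double ratios:
      \<open>ks i\<close> holds a position in \<open>reps\<close> and a factor that corrects the
      sign.\<close>
    define g where "g y = (\<lambda>i. if i < m then snd (ks i) * y (fst (ks i)) else 0)" for y :: "nat \<Rightarrow> real"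
    have gc: "continuous_on A g" for A
      unfolding g_def
    proof (rule continuous_on_coordinatewise_then_product)
      fix i
      have "continuous_on A (\<lambda>y :: nat \<Rightarrow> real. snd (ks i) * y (fst (ks i)))"
        using continuous_on_mult_left[OF continuous_on_coordinate[of A "fst (ks i)"], of "snd (ks i)"] .
      then show "continuous_on A (\<lambda>y :: nat \<Rightarrow> real. if i < m then snd (ks i) * y (fst (ks i)) else 0)"
        by (cases "i < m") auto
    qed
    have gf: "g ((\<phi> \<circ> pt c) p) = p" if p: "p \<in> orthant m" for p
    proof
      fix i
      show "g ((\<phi> \<circ> pt c) p) i = p i"
      proof (cases "i < m")
        case True
        then have "snd (ks i) * \<phi> (pt c p) (fst (ks i)) = p i" using ks p by blast
        then show ?thesis using True by (simp only: g_def comp_def if_True)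
      next
        case False
        then show ?thesis using p by (simp add: g_def orthant_def topspace_Euclidean_space)
      qed
    qed
    \<comment> \<open>The linear formula for \<phi> on the cone, extended to all sequences. With
      \<open>g\<close> it describes the image by two closed conditions: \<open>y = A (g y)\<close>,
      and \<open>g y\<close> lies in the orthant.\<close>
    define A where "A p = (\<lambda>k. if k < length reps then drsum m (class_key c) p (reps ! k) else 0)" for p
    have AC: "continuous_on X A" for X
      unfolding A_def
    proof (rule continuous_on_coordinatewise_then_product)
      fix k
      show "continuous_on X (\<lambda>p. if k < length reps then drsum m (class_key c) p (reps ! k) else 0)"
        using continuous_on_drsum by (cases "k < length reps") auto
    qed
    have phiA: "\<phi> (pt c p) = A p" if "p \<in> orthant m" for p
      using phi_pt[OF c that] by (simp add: A_def)
    have "(\<phi> \<circ> pt c) ` orthant m = {y. y = A (g y)} \<inter> g -` orthant m"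
    proof (intro subset_antisym subsetI)
      fix y assume "y \<in> (\<phi> \<circ> pt c) ` orthant m"
      then obtain p where p: "p \<in> orthant m" "y = (\<phi> \<circ> pt c) p" by blast
      then have gy: "g y = p" using gf[OF p(1)] by (simp only:)
      have "y = A p" using p(2) phiA[OF p(1)] by (simp only: comp_apply)
      then show "y \<in> {y. y = A (g y)} \<inter> g -` orthant m"
        using p(1) unfolding Int_iff mem_Collect_eq vimage_eq gy by blast
    next
      fix y assume "y \<in> {y. y = A (g y)} \<inter> g -` orthant m"
      then have gy: "g y \<in> orthant m" and "y = A (g y)" by simp_all
      then have "y = (\<phi> \<circ> pt c) (g y)" using phiA[OF gy] by (simp only: comp_apply)
      then show "y \<in> (\<phi> \<circ> pt c) ` orthant m" using gy by (rule image_eqI)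
    qed
    moreover have "closed {y. y = A (g y)}"
    proof -
      have "{y. y = A (g y)} = (\<Inter>k. {y. y k = A (g y) k})" by (auto simp: fun_eq_iff)
      moreover have "continuous_on UNIV (\<lambda>y. A (g y))"
        using continuous_on_compose[OF gc AC] by (simp add: comp_def)
      then have "continuous_on UNIV (\<lambda>y. A (g y) k)" for k
        by (rule continuous_on_product_then_coordinatewise)
      then have "closed {y. y k = A (g y) k}" for k
        by (intro closed_Collect_eq continuous_on_product_coordinates)
      ultimately show ?thesis by (auto intro!: closed_INT)
    qed
    moreover have "closed (g -` orthant m)"
      using closed_vimage[OF closed_orthant gc] by simp
    ultimately have cl: "closed ((\<phi> \<circ> pt c) ` orthant m)" by auto
    from phi_pt_image[OF c] have "closedin (pspace M) ((\<phi> \<circ> pt c) ` orthant m)"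
      unfolding pspace_M using cl by (rule closed_subset)
    then show ?thesis
      by (intro closed_map_embedding_of_closed[where g = g] gf closed_orthant) (simp_all add: pspace_M gc)
  qed
qed

sublocale cone_morphism m H AC pt full_key M \<phi> class_key
proof
  show "continuous_map (pspace H) (pspace M) \<phi>"
    by (rule continuous_from_H) (use continuous_phi_pt in \<open>simp add: comp_def\<close>)
qed

end

section \<open>The degree\<close>

lemma galg_prod_Rats:
  assumes "\<And>a x. a \<in> set as \<Longrightarrow> a x \<in> \<rat>"
  shows "galg_prod G as x \<in> \<rat>"
  using assms
proof (induction as arbitrary: x)
  case Nil
  then show ?case by (simp add: galg_prod_def galg_one_def)
next
  case (Cons a as)
  have "a g * galg_prod G as h \<in> \<rat>" for g h
    using Cons by (intro Rats_mult) auto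
  then show ?case
    by (auto simp: galg_prod_def galg_mult_def intro!: Rats_sum)
qed

lemma cone_weight_Rats: "cone_weight n d \<sigma> T \<in> \<rat>"
proof -
  have "class_sum d \<mu> g \<in> \<rat>" for \<mu> g by (simp add: class_sum_def)
  then have "vertex_mult n d \<sigma> T v \<in> \<rat>" for v
    unfolding vertex_mult_def Let_def galg_tr_def by (intro galg_prod_Rats) auto
  moreover have "(fact d :: real) \<in> \<rat>"
    by (metis Rats_of_nat of_nat_fact)
  ultimately show ?thesis
    unfolding cone_weight_def by (intro Rats_mult Rats_prod Rats_divide Rats_1 Rats_of_nat) auto
qed

context hurwitz_ratios
begin

abbreviation "w \<equiv> H_weight n d \<sigma>"
abbreviation "colourings \<equiv> PiE {..<m} (\<lambda>_. {\<mu>. integer_partition d \<mu>})"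

lemma weighted_H: "weighted m H w"
  by (auto simp: weighted_def H_weight_def cone_weight_Rats)

text \<open>Allows the sum over the fibre to be extended by zeros to all colourings. An empty
  conjugacy class makes its class sum 0, and with it the multiplicity of an adjacent vertex, so
  nonzero multiplicities already force nonzero class sizes.\<close>

lemma acceptable_iff:
  assumes "trivalent_tree n T" "\<nu> \<in> colourings"
  shows "acceptable n d \<sigma> (T\<lparr>part := \<nu>\<rparr>) \<longleftrightarrow> cone_weight n d \<sigma> (T\<lparr>part := \<nu>\<rparr>) \<noteq> 0"
proof -
  interpret trivalent_tree n T by fact
  have fin: "finite internal" using finite_V by blast
  have lt': "labelled_trivalent_tree n (T\<lparr>part := \<nu>\<rparr>)" using lt by (simp add: labelled_trivalent_tree_def)
  have ip: "\<forall>i<m. integer_partition d (\<nu> i)" using assms(2) by auto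
  have acc: "acceptable n d \<sigma> (T\<lparr>part := \<nu>\<rparr>) \<longleftrightarrow> (\<forall>v\<in>internal. vertex_mult n d \<sigma> (T\<lparr>part := \<nu>\<rparr>) v \<noteq> 0)"
    using lt' ip by (simp add: acceptable_def)
  have "card (conj_class d (\<nu> i)) \<noteq> 0"
    if all: "\<forall>v\<in>internal. vertex_mult n d \<sigma> (T\<lparr>part := \<nu>\<rparr>) v \<noteq> 0" and i: "i < m" for i
  proof
    assume "card (conj_class d (\<nu> i)) = 0"
    then have empty: "conj_class d (\<nu> i) = {}"
      using finite_sym_group by (simp add: conj_class_def)
    let ?v = "lower (blab T i)"
    have e: "blab T i \<in> E" "blab T i \<in> bounded_edges (gr T)"
      using blab_bounded[OF i] bounded_E by blast+
    have v: "?v \<in> internal" using lower_mem[OF e(1)] bounded_internal[OF e(1)] e(2) by blast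
    have fine: "finite (edges_at (gr T) ?v)" using finite_E by (simp add: edges_at_def)
    obtain es where es: "distinct es" "set es = edges_at (gr T) ?v - {blab T i}"
      using finite_distinct_list[of "edges_at (gr T) ?v - {blab T i}"] fine by auto
    have ea: "blab T i \<in> edges_at (gr T) ?v" using e(1) lower_mem[OF e(1)] by (simp add: edges_at_def)
    have "class_sum d (edge_partition n \<sigma> (T\<lparr>part := \<nu>\<rparr>) (blab T i)) = (\<lambda>_. 0)"
      unfolding edge_partition_blab[OF i] by (rule ext) (simp add: class_sum_def empty)
    moreover have "vertex_mult n d \<sigma> (T\<lparr>part := \<nu>\<rparr>) ?v = galg_tr (sym_group d) (galg_prod (sym_group d)
        (map (\<lambda>e. class_sum d (edge_partition n \<sigma> (T\<lparr>part := \<nu>\<rparr>) e)) (blab T i # es)))"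
      unfolding vertex_mult_trace by (rule class_trace_list) (use es ea in auto)
    ultimately have "vertex_mult n d \<sigma> (T\<lparr>part := \<nu>\<rparr>) ?v = 0"
      by (simp add: galg_prod_def galg_mult_def galg_tr_def)
    then show False using all v by blast
  qed
  then show ?thesis
    unfolding acc cone_weight_def using fin by (auto simp: prod_zero_iff)
qed

text \<open>Two choices have to be traced: the chart around the point (\<open>c1\<close>) and the
  class whose cell defines the weight (\<open>c2\<close>). Since all lengths are positive, every
  coloured key of \<open>T\<close> occurs in both, so \<open>same_keys\<close> applies.\<close>

lemma weight_index_at:
  assumes T: "acceptable n d \<sigma> T" and p: "p \<in> HC.open_orthant"
  shows "weight_at m H w (pt (tree_class T) p) * real (index_at m H M \<phi> (pt (tree_class T) p)) = cone_weight n d \<sigma> T"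
proof -
  let ?c = "tree_class T" and ?h = "pt (tree_class T) p"
  have c: "?c \<in> AC" by (rule tree_class(1)[OF T])
  have po: "p \<in> orthant m" "\<And>i. i < m \<Longrightarrow> 0 < p i" using p by (auto simp: HC.open_orthant_def)
  have ti: "?h \<in> top_interior m H" using HC.top_interior_iff c p by blast
  obtain c1 where c1: "c1 \<in> AC" "?h \<in> pt c1 ` HC.open_orthant"
      "(SOME \<gamma>. \<gamma> \<in> charts_around m H ?h) = (orthant m, pt c1)"
    using HC.some_chart_around[OF ti] by blast
  define c2 where "c2 = (SOME c. c \<in> AC \<and> pt c1 ` orthant m = pt c ` orthant m)"
  have c2: "c2 \<in> AC" "pt c1 ` orthant m = pt c2 ` orthant m"
    unfolding c2_def using someI[of "\<lambda>c. c \<in> AC \<and> pt c1 ` orthant m = pt c ` orthant m" c1] c1(1) by blast+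
  have keys2: "full_key c1 ` {..<m} = full_key c2 ` {..<m}"
    using HC.image_eq_iff[OF c1(1) c2(1) order_refl order_refl] c2(2) by (simp add: orthant_coord_face)
  obtain p1 where p1: "p1 \<in> orthant m" "?h = pt c1 p1" using c1(2) by (auto simp: HC.open_orthant_def)
  have len: "len m (full_key ?c) p k = len m (full_key c1) p1 k" for k
    using pt_eq_iff[OF c c1(1) po(1) p1(1)] p1(2) by blast
  have sub: "full_key ?c i \<in> full_key c1 ` {..<m}" if i: "i < m" for i
  proof -
    have "p i \<noteq> 0" using po(2)[OF i] by simp
    then obtain j where "j < m" "full_key c1 j = full_key ?c i"
      using len_eqD[OF full_key_inj[OF c] full_key_inj[OF c1(1)] len i] by blast
    then show ?thesis by force
  qed
  have "\<exists>j<m. class_key c2 j = trivalent_tree.key n T i \<and> part (class_rep c2) j = part T i" if i: "i < m" for i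
  proof -
    obtain j where "j < m" "full_key c2 j = full_key ?c i" using sub[OF i] keys2 by force
    then show ?thesis using tree_class_keys[OF T i] by (auto simp: full_key_def)
  qed
  then have "cone_weight n d \<sigma> (class_rep c2) = cone_weight n d \<sigma> T"
    by (rule same_keys(1)[OF trivalent_tree_acceptable[OF T] rep_tree[OF c2(1)]])
  moreover have "weight_at m H w ?h = cone_weight n d \<sigma> (class_rep c2)"
    by (simp add: weight_at_def c1(3) H_weight_def c2_def)
  ultimately show ?thesis using index_one[OF ti] by simp
qed

text \<open>A point of the fibre has the lengths of \<open>p\<close> at the clusters of
  \<open>c\<close>, all positive, so its tree has exactly these clusters and can differ from
  \<open>class_rep c\<close> only in colours and numbering. Distinct colourings give distinct points
  because partitions are part of the key.\<close>

lemma fibre_colourings: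
  assumes c: "c \<in> AC" and p: "p \<in> HC.open_orthant"
  defines "N \<equiv> {\<nu> \<in> colourings. acceptable n d \<sigma> ((class_rep c)\<lparr>part := \<nu>\<rparr>)}"
  shows "bij_betw (\<lambda>\<nu>. pt (tree_class ((class_rep c)\<lparr>part := \<nu>\<rparr>)) p) N (fibre H \<phi> (\<phi> (pt c p)))"
proof -
  let ?T = "class_rep c"
  let ?U = "\<lambda>\<nu>. ?T\<lparr>part := \<nu>\<rparr>"
  let ?\<eta> = "\<lambda>\<nu>. pt (tree_class (?U \<nu>)) p"
  have T: "trivalent_tree n ?T" by (rule rep_tree[OF c])
  have po: "p \<in> orthant m" "\<And>i. i < m \<Longrightarrow> 0 < p i" using p by (auto simp: HC.open_orthant_def)
  have acc: "acceptable n d \<sigma> (?U \<nu>)" if "\<nu> \<in> N" for \<nu> using that by (simp add: N_def)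
  have key_U: "trivalent_tree.key n (?U \<nu>) = class_key c" if "acceptable n d \<sigma> (?U \<nu>)" for \<nu>
  proof (rule ext)
    fix i
    show "trivalent_tree.key n (?U \<nu>) i = class_key c i"
      using trivalent_tree.key_def[OF trivalent_tree_acceptable[OF that]] trivalent_tree.key_def[OF T]
      by (simp add: leaf_of_def[abs_def])
  qed
  have fk: "full_key (tree_class (?U \<nu>)) i = (class_key c i, \<nu> i)" if "acceptable n d \<sigma> (?U \<nu>)" "i < m" for \<nu> i
    using tree_class_keys[OF that] key_U[OF that(1)] by simp
  have ck: "class_key (tree_class (?U \<nu>)) i = class_key c i" if "acceptable n d \<sigma> (?U \<nu>)" "i < m" for \<nu> i
    using fk[OF that] by (simp add: full_key_def)
  have in_fibre: "?\<eta> \<nu> \<in> fibre H \<phi> (\<phi> (pt c p))" if \<nu>: "\<nu> \<in> N" for \<nu>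
  proof -
    have tc: "tree_class (?U \<nu>) \<in> AC" by (rule tree_class(1)[OF acc[OF \<nu>]])
    have "len m (class_key (tree_class (?U \<nu>))) p k = len m (class_key c) p k" for k
      unfolding len_def by (rule sum.cong) (use ck[OF acc[OF \<nu>]] in auto)
    then have "\<phi> (?\<eta> \<nu>) = \<phi> (pt c p)" using phi_eq_iff[OF tc c po(1) po(1)] by blast
    moreover have "?\<eta> \<nu> \<in> topspace (pspace H)" unfolding topspace_H using tc po(1) by blast
    ultimately show ?thesis by (simp add: fibre_def)
  qed
  have inj: "inj_on ?\<eta> N"
  proof (rule inj_onI)
    fix \<nu> \<nu>' assume \<nu>: "\<nu> \<in> N" "\<nu>' \<in> N" "?\<eta> \<nu> = ?\<eta> \<nu>'"
    have tc: "tree_class (?U \<nu>) \<in> AC" "tree_class (?U \<nu>') \<in> AC"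
      using tree_class(1) acc \<nu> by blast+
    have len: "len m (full_key (tree_class (?U \<nu>))) p k = len m (full_key (tree_class (?U \<nu>'))) p k" for k
      using pt_eq_iff[OF tc po(1) po(1)] \<nu>(3) by blast
    have "\<nu> i = \<nu>' i" if i: "i < m" for i
    proof -
      have "p i \<noteq> 0" using po(2)[OF i] by simp
      then obtain j where j: "j < m" "full_key (tree_class (?U \<nu>')) j = full_key (tree_class (?U \<nu>)) i"
        using len_eqD[OF full_key_inj[OF tc(1)] full_key_inj[OF tc(2)] len i] by blast
      then have "class_key c j = class_key c i" "\<nu>' j = \<nu> i"
        using fk[OF acc[OF \<nu>(2)] j(1)] fk[OF acc[OF \<nu>(1)] i] by simp_all
      then show ?thesis using inj_onD[OF class_key_inj[OF c], of j i] j(1) i by simp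
    qed
    then show "\<nu> = \<nu>'" using \<nu>(1,2) by (intro PiE_ext[of _ "{..<m}"]) (auto simp: N_def)
  qed
  have "h \<in> ?\<eta> ` N" if h: "h \<in> fibre H \<phi> (\<phi> (pt c p))" for h
  proof -
    obtain c' p' where c': "c' \<in> AC" "p' \<in> orthant m" "h = pt c' p'" and \<phi>h: "\<phi> h = \<phi> (pt c p)"
      using h unfolding fibre_def topspace_H by blast
    have len: "len m (class_key c) p k = len m (class_key c') p' k" for k
      using phi_eq_iff[OF c'(1) c c'(2) po(1)] \<phi>h c'(3) by metis
    note injs = class_key_inj[OF c] class_key_inj[OF c'(1)]
    have ex: "\<forall>i\<in>{..<m}. \<exists>j. j < m \<and> class_key c' j = class_key c i \<and> p' j = p i"
    proof
      fix i assume "i \<in> {..<m}"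
      then have "i < m" "p i \<noteq> 0" using po(2)[of i] by auto
      then show "\<exists>j. j < m \<and> class_key c' j = class_key c i \<and> p' j = p i"
        using len_eqD[OF injs len] by blast
    qed
    from bchoice[OF ex] obtain \<pi> where "\<forall>i\<in>{..<m}. \<pi> i < m \<and> class_key c' (\<pi> i) = class_key c i \<and> p' (\<pi> i) = p i" ..
    then have \<pi>: "\<pi> i < m" "class_key c' (\<pi> i) = class_key c i" "p' (\<pi> i) = p i" if "i < m" for i
      using that by simp_all
    \<comment> \<open>The colours of the tree of \<open>c'\<close>, pulled back along the matching
      \<pi> of clusters; the restriction puts the function into the extensional set
      \<open>colourings\<close>.\<close>
    define \<nu> where "\<nu> = (\<lambda>i\<in>{..<m}. part (class_rep c') (\<pi> i))"
    have "\<nu> \<in> colourings"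
      using rep_acceptable[OF c'(1)] \<pi>(1) by (auto simp: \<nu>_def acceptable_def)
    have U: "trivalent_tree n (?U \<nu>)"
      using T by (simp add: trivalent_tree_def labelled_trivalent_tree_def)
    have kU: "trivalent_tree.key n (?U \<nu>) i = class_key c i" for i
      using trivalent_tree.key_def[OF U] trivalent_tree.key_def[OF T] by (simp add: leaf_of_def[abs_def])
    have "\<exists>j<m. class_key c' j = trivalent_tree.key n (?U \<nu>) i \<and> part (class_rep c') j = part (?U \<nu>) i" if i: "i < m" for i
      using \<pi>[OF i] i kU by (auto simp: \<nu>_def)
    from same_keys(2)[OF U rep_tree[OF c'(1)] this, of d \<sigma>]
    have "acceptable n d \<sigma> (?U \<nu>)"
      using rep_acceptable[OF c'(1)] U \<open>\<nu> \<in> colourings\<close> by (auto simp: acceptable_def trivalent_tree_def)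
    then have \<nu>N: "\<nu> \<in> N" using \<open>\<nu> \<in> colourings\<close> by (simp add: N_def)
    have tc: "tree_class (?U \<nu>) \<in> AC" by (rule tree_class(1)[OF acc[OF \<nu>N]])
    have fk': "full_key c' (\<pi> i) = full_key (tree_class (?U \<nu>)) i" if i: "i < m" for i
      using fk[OF acc[OF \<nu>N] i] \<pi>[OF i] i by (simp add: full_key_def \<nu>_def)
    have "len m (full_key (tree_class (?U \<nu>))) p k = len m (full_key c') p' k" for k
    proof (rule len_eqI[OF full_key_inj[OF tc] full_key_inj[OF c'(1)]])
      show "\<exists>j<m. full_key c' j = full_key (tree_class (?U \<nu>)) i \<and> p' j = p i" if "i < m" "p i \<noteq> 0" for i
        using fk'[OF that(1)] \<pi>[OF that(1)] by blast
      show "\<exists>i<m. full_key (tree_class (?U \<nu>)) i = full_key c' j \<and> p i = p' j" if j: "j < m" "p' j \<noteq> 0" for j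
      proof -
        obtain i where i: "i < m" "class_key c i = class_key c' j"
          using len_eqD[OF injs(2,1) len[symmetric] j] by blast
        then have "\<pi> i = j" using inj_onD[OF injs(2), of "\<pi> i" j] \<pi>[OF i(1)] j(1) by simp
        then show ?thesis using fk'[OF i(1)] \<pi>(3)[OF i(1)] i(1) by auto
      qed
    qed
    then have "?\<eta> \<nu> = h" unfolding c'(3) using pt_eq_iff[OF tc c'(1) po(1) c'(2)] by simp
    then show ?thesis using \<nu>N by blast
  qed
  then show ?thesis using inj in_fibre by (auto simp: bij_betw_def)
qed

lemma finite_colourings: "finite colourings"
  using finite_integer_partitions by (intro finite_PiE) auto

theorem degree_value:
  assumes q: "q \<in> top_interior m M" and \<sigma>: "length \<sigma> = n"
  shows "finite (fibre H \<phi> q)"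
    "degree_at m H w M \<phi> q = 1 / fact d * galg_tr (sym_group d) (galg_prod (sym_group d) (map (class_sum d) \<sigma>))"
proof -
  obtain c p where c: "c \<in> AC" "p \<in> HC.open_orthant" "q = \<phi> (pt c p)"
    using q MC.top_interior_iff by (auto simp: HC.open_orthant_def MC.open_orthant_def)
  let ?U = "\<lambda>\<nu>. (class_rep c)\<lparr>part := \<nu>\<rparr>"
  let ?N = "{\<nu> \<in> colourings. acceptable n d \<sigma> (?U \<nu>)}"
  have T: "trivalent_tree n (class_rep c)" by (rule rep_tree[OF c(1)])
  note bij = fibre_colourings[OF c(1,2)]
  have finN: "finite ?N" using finite_colourings by simp
  show "finite (fibre H \<phi> q)" unfolding c(3) using bij_betw_finite[OF bij] finN by blast
  have "degree_at m H w M \<phi> q = (\<Sum>\<nu>\<in>?N. weight_at m H w (pt (tree_class (?U \<nu>)) p) *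
      real (index_at m H M \<phi> (pt (tree_class (?U \<nu>)) p)))"
    unfolding degree_at_def c(3) by (rule sum.reindex_bij_betw[OF bij, symmetric])
  also have "\<dots> = (\<Sum>\<nu>\<in>?N. cone_weight n d \<sigma> (?U \<nu>))"
    by (rule sum.cong) (use weight_index_at[OF _ c(2)] in auto)
  \<comment> \<open>Colourings that are not acceptable have weight 0.\<close>
  also have "\<dots> = (\<Sum>\<nu>\<in>colourings. cone_weight n d \<sigma> (?U \<nu>))"
    by (rule sum.mono_neutral_left) (use finite_colourings acceptable_iff[OF T] in auto)
  also have "\<dots> = 1 / fact d * galg_tr (sym_group d) (galg_prod (sym_group d) (map (class_sum d) \<sigma>))"
    by (rule trivalent_tree.cone_weight_sum[OF T \<sigma>])
  finally show "degree_at m H w M \<phi> q = 1 / fact d * galg_tr (sym_group d) (galg_prod (sym_group d) (map (class_sum d) \<sigma>))" .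
qed

text \<open>With no top cell the degree is 0 by convention, so the trace has to vanish. Otherwise
  \<open>cone_weight_sum\<close> on any one labelled trivalent tree would yield a colouring of
  nonzero weight, and its class would give a top cell.\<close>

lemma no_acceptable:
  assumes "top_interior m M = {}" and \<sigma>: "length \<sigma> = n"
  shows "galg_tr (sym_group d) (galg_prod (sym_group d) (map (class_sum d) \<sigma>)) = 0"
proof (rule ccontr)
  assume ne: "galg_tr (sym_group d) (galg_prod (sym_group d) (map (class_sum d) \<sigma>)) \<noteq> 0"
  obtain T where "labelled_trivalent_tree n T" using exists_labelled_trivalent_tree[OF n3] by blast
  then have T: "trivalent_tree n T" using n3 by (simp add: trivalent_tree_def)
  have "(\<Sum>\<nu>\<in>colourings. cone_weight n d \<sigma> (T\<lparr>part := \<nu>\<rparr>)) \<noteq> 0"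
    unfolding trivalent_tree.cone_weight_sum[OF T \<sigma>] using ne by simp
  then obtain \<nu> where "\<nu> \<in> colourings" "cone_weight n d \<sigma> (T\<lparr>part := \<nu>\<rparr>) \<noteq> 0"
    by (metis (no_types, lifting) sum.neutral)
  then have "acceptable n d \<sigma> (T\<lparr>part := \<nu>\<rparr>)" using acceptable_iff[OF T] by blast
  then have c: "tree_class (T\<lparr>part := \<nu>\<rparr>) \<in> AC" by (rule tree_class(1))
  have "(\<lambda>i. if i < m then 1 else 0) \<in> MC.open_orthant"
    by (auto simp: MC.open_orthant_def orthant_def topspace_Euclidean_space)
  then have "(\<phi> \<circ> pt (tree_class (T\<lparr>part := \<nu>\<rparr>))) (\<lambda>i. if i < m then 1 else 0) \<in> top_interior m M"
    using MC.top_interior_iff c by blast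
  then show False using assms(1) by blast
qed

end

theorem theorem3p30:
  fixes n d :: nat and \<sigma> :: "nat multiset list" and reps :: "quad list"
  assumes "n \<ge> 3" and "d \<ge> 1"
    and "length \<sigma> = n" and "\<forall>\<mu> \<in> set \<sigma>. integer_partition d \<mu>"
    and "quad_representatives n reps"
  shows "polyhedral_complex (H_complex n d \<sigma>) \<and>
         has_dimension (H_complex n d \<sigma>) (n - 3) \<and>
         weighted (n - 3) (H_complex n d \<sigma>) (H_weight n d \<sigma>) \<and>
         polyhedral_complex (M_complex n d \<sigma> reps) \<and>
         has_dimension (M_complex n d \<sigma> reps) (n - 3) \<and>
         pc_morphism (H_complex n d \<sigma>) (M_complex n d \<sigma> reps) (double_ratio_map n reps) \<and>
         degree_well_defined (n - 3) (H_complex n d \<sigma>) (H_weight n d \<sigma>)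
           (M_complex n d \<sigma> reps) (double_ratio_map n reps) \<and>
         morphism_degree (n - 3) (H_complex n d \<sigma>) (H_weight n d \<sigma>)
           (M_complex n d \<sigma> reps) (double_ratio_map n reps)
         = 1 / fact d * galg_tr (sym_group d) (galg_prod (sym_group d) (map (class_sum d) \<sigma>))"
proof -
  interpret hurwitz_ratios n d \<sigma> reps
    using assms(1,5) by unfold_locales
  let ?t = "1 / fact d * galg_tr (sym_group d) (galg_prod (sym_group d) (map (class_sum d) \<sigma>))"
  have "degree_well_defined m H w M \<phi>"
    using degree_value[OF _ assms(3)] by (simp add: degree_well_defined_def)
  moreover have "morphism_degree m H w M \<phi> = ?t"
  proof (cases "top_interior m M = {}")
    case True
    then show ?thesis using no_acceptable[OF True assms(3)] by (simp add: morphism_degree_def)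
  next
    case False
    then have "(SOME q. q \<in> top_interior m M) \<in> top_interior m M" by (simp add: some_in_eq)
    then show ?thesis using degree_value(2)[OF _ assms(3)] False by (simp add: morphism_degree_def)
  qed
  ultimately show ?thesis
    using HC.polyhedral_complex HC.has_dimension weighted_H MC.polyhedral_complex MC.has_dimension pc_morphism
    by blast
qed

end
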